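(* Let $\mu>\rho-1$ and let $\nu$ be a probability measure on $\Pi_q$ with finite second moment $\int_{\Pi_q}\|r\|^2\,d\nu(r)<\infty$. Then $\sigma^2:=\frac1{2\mu}\int_{\Pi_q}r^2\,d\nu(r)\in\Pi_q$ exists (entrywise integral), and the probability measures $T_{n^{-1/2}I}(\nu^{(n)})=(T_{n^{-1/2}I}(\nu))^{(n)}$ converge weakly to the squared Wishart distribution $W(\sigma^2)$ as $n\to\infty$.
   Context: Let $\mathbb F\in\{\mathbb R,\mathbb C,\mathbb H\}$ with real dimension $d\in\{1,2,4\}$, $q\in\mathbb N$, $M_q$ the $q\times q$ matrices over $\mathbb F$, $x^*=\bar x^t$, $H_q$ the Hermitian matrices with norm $\|x\|=(\mathrm{Re}\,\mathrm{tr}(x^*x))^{1/2}$, $\Pi_q$ the positive semidefinite ones, $\Omega_q$ its interior, $\sqrt r$ the positive semidefinite square root, $\Delta$ the determinant function of the cone $\Omega_q$, $\Gamma_{\Omega_q}$ its Gamma function. $\rho=d(q-\frac12)+1$, $n_0=q+\frac d2q(q-1)$. For $\mu>\rho-1$, $D=\{v\in M_q:v^*v<I\}$, $\kappa_\mu=\int_D\Delta(I-v^*v)^{\mu-\rho}dv$, and $X_{q,\mu}=(\Pi_q,*_\mu)$ is $\Pi_q$ with the convolution obtained by bilinear weakly continuous extension of $(\delta_r*_\mu\delta_s)(f)=\kappa_\mu^{-1}\int_D f\big(\sqrt{r^2+s^2+svr+rv^*s}\big)\Delta(I-vv^* )^{\mu-\rho}dv$; $\nu^{(n)}$ is the $n$-fold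 $*_\mu$-convolution power. Haar measure $\omega_\mu(f)=\frac{\pi^{q\mu}}{\Gamma_{\Omega_q}(\mu)}\int_{\Omega_q}f(\sqrt r)\Delta(r)^{\mu-n_0/q}dr$. For $a\in M_q$, $T_a(r)=\sqrt{ar^2a^*}$, acting on measures by image measures (so $T_{cI}(r)=cr$ for $c>0$). Standard squared Wishart distribution $dW(r)=(2\pi)^{-q\mu}e^{-\mathrm{tr}(r^2)/2}d\omega_\mu(r)$; $W(s^2):=T_s(W)$ for $s\in\Pi_q$. *)

theory Defs
  imports "HOL-Probability.Probability" "HOL-Library.Countable_Set"
begin

section \<open>Scalars: R, C, H embedded in real^4 (basis 1, i, j, k at components 0,1,2,3)\<close>

type_synonym scal = "real^4"
type_synonym 'q mat = "real^4^'q^'q"   (* x $ i $ j = entry (i,j) *)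

definition comps :: "nat \<Rightarrow> 4 set" where
  "comps d = (if d = 1 then {0} else if d = 2 then {0, 1} else UNIV)"

definition qmul :: "scal \<Rightarrow> scal \<Rightarrow> scal" where
  "qmul a b = (\<chi> k.
     if k = 0 then a$0*b$0 - a$1*b$1 - a$2*b$2 - a$3*b$3
     else if k = 1 then a$0*b$1 + a$1*b$0 + a$2*b$3 - a$3*b$2
     else if k = 2 then a$0*b$2 - a$1*b$3 + a$2*b$0 + a$3*b$1
     else a$0*b$3 + a$1*b$2 - a$2*b$1 + a$3*b$0)"

definition qconj :: "scal \<Rightarrow> scal" where
  "qconj a = (\<chi> k. if k = 0 then a$0 else - a$k)"

definition qone :: scal where
  "qone = (\<chi> k. if k = 0 then 1 else 0)"

definition In_M :: "nat \<Rightarrow> 'q::finite mat \<Rightarrow> bool" where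
  "In_M d x \<longleftrightarrow> (\<forall>i j k. k \<notin> comps d \<longrightarrow> x$i$j$k = 0)"

definition mmul :: "'q::finite mat \<Rightarrow> 'q mat \<Rightarrow> 'q mat" where
  "mmul x y = (\<chi> i j. \<Sum>l\<in>UNIV. qmul (x$i$l) (y$l$j))"

definition madj :: "'q::finite mat \<Rightarrow> 'q mat" where
  "madj x = (\<chi> i j. qconj (x$j$i))"

definition mid :: "'q::finite mat" where
  "mid = (\<chi> i j. if i = j then qone else 0)"

definition rdiag :: "('q::finite \<Rightarrow> real) \<Rightarrow> 'q mat" where
  "rdiag l = (\<chi> i j. if i = j then l i *\<^sub>R qone else 0)"

definition retr :: "'q::finite mat \<Rightarrow> real" where
  "retr x = (\<Sum>i\<in>UNIV. x$i$i$0)"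

definition Herm :: "nat \<Rightarrow> 'q::finite mat set" where
  "Herm d = {x. In_M d x \<and> madj x = x}"

definition PiQ :: "nat \<Rightarrow> 'q::finite mat set" where
  "PiQ d = {x. x \<in> Herm d \<and>
     (\<forall>v::real^4^'q. (\<forall>i k. k \<notin> comps d \<longrightarrow> v$i$k = 0) \<longrightarrow>
        0 \<le> (\<Sum>i\<in>UNIV. \<Sum>j\<in>UNIV. qmul (qmul (qconj (v$i)) (x$i$j)) (v$j)) $ 0)}"

definition OmegaQ :: "nat \<Rightarrow> 'q::finite mat set" where
  "OmegaQ d = {x \<in> PiQ d. \<exists>e>0. \<forall>y\<in>Herm d. dist y x < e \<longrightarrow> y \<in> PiQ d}"

definition unitary :: "nat \<Rightarrow> 'q::finite mat \<Rightarrow> bool" where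
  "unitary d u \<longleftrightarrow> In_M d u \<and> mmul (madj u) u = mid"

text \<open>Determinant of the cone: product of the (real) eigenvalues of a Hermitian matrix.\<close>
definition Delta :: "nat \<Rightarrow> 'q::finite mat \<Rightarrow> real" where
  "Delta d x = (THE p. \<exists>u l. unitary d u \<and> x = mmul u (mmul (rdiag l) (madj u))
                           \<and> p = (\<Prod>i\<in>UNIV. l i))"

definition msqrt :: "nat \<Rightarrow> 'q::finite mat \<Rightarrow> 'q mat" where
  "msqrt d r = (THE s. s \<in> PiQ d \<and> mmul s s = r)"

definition lebM :: "nat \<Rightarrow> 'q::finite mat measure" where
  "lebM d = distr (PiM {(i,j,k). k \<in> comps d} (\<lambda>_. lborel)) borel
     (\<lambda>f. \<chi> i j k. if k \<in> comps d then f (i,j,k) else 0)"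

definition qord :: "'q::finite \<Rightarrow> nat" where
  "qord = to_nat_on UNIV"

definition lebH :: "nat \<Rightarrow> 'q::finite mat measure" where
  "lebH d = distr (PiM {(i,j,k). (i = j \<and> k = 0) \<or> (qord i < qord j \<and> k \<in> comps d)} (\<lambda>_. lborel))
     borel
     (\<lambda>f. \<chi> i j. if i = j then (\<chi> k. if k = 0 then f (i,i,0) else 0)
                 else if qord i < qord j then (\<chi> k. if k \<in> comps d then f (i,j,k) else 0)
                 else qconj (\<chi> k. if k \<in> comps d then f (j,i,k) else 0))"

definition rho :: "nat \<Rightarrow> 'q::finite itself \<Rightarrow> real" where
  "rho d _ = real d * (real CARD('q) - 1/2) + 1"

definition n0 :: "nat \<Rightarrow> 'q::finite itself \<Rightarrow> real" where
  "n0 d _ = real CARD('q) + real d / 2 * real CARD('q) * (real CARD('q) - 1)"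

definition Dset :: "nat \<Rightarrow> 'q::finite mat set" where
  "Dset d = {v. In_M d v \<and> mid - mmul (madj v) v \<in> OmegaQ d}"

definition kappa :: "nat \<Rightarrow> real \<Rightarrow> 'q::finite itself \<Rightarrow> real" where
  "kappa d \<mu> Q = (LINT v:(Dset d :: 'q mat set)|lebM d.
                    Delta d (mid - mmul (madj v) v) powr (\<mu> - rho d Q))"

definition GammaOmega :: "nat \<Rightarrow> real \<Rightarrow> 'q::finite itself \<Rightarrow> real" where
  "GammaOmega d \<mu> Q = (LINT x:(OmegaQ d :: 'q mat set)|lebH d.
                    exp (- retr x) * Delta d x powr (\<mu> - n0 d Q / real CARD('q)))"

definition PiS :: "nat \<Rightarrow> 'q::finite mat measure" where
  "PiS d = restrict_space borel (PiQ d)"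

definition pconv :: "nat \<Rightarrow> real \<Rightarrow> 'q::finite mat \<Rightarrow> 'q mat \<Rightarrow> 'q mat measure" where
  "pconv d \<mu> r s = distr
     (density (lebM d) (\<lambda>v. ennreal (indicator (Dset d) v *
         Delta d (mid - mmul v (madj v)) powr (\<mu> - rho d TYPE('q)) / kappa d \<mu> TYPE('q))))
     (PiS d)
     (\<lambda>v. msqrt d (mmul r r + mmul s s + mmul s (mmul v r) + mmul r (mmul (madj v) s)))"

definition mconv :: "nat \<Rightarrow> real \<Rightarrow> 'q::finite mat measure \<Rightarrow> 'q mat measure \<Rightarrow> 'q mat measure" where
  "mconv d \<mu> \<nu>1 \<nu>2 = \<nu>1 \<bind> (\<lambda>r. \<nu>2 \<bind> (\<lambda>s. pconv d \<mu> r s))"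

fun convpow :: "nat \<Rightarrow> real \<Rightarrow> 'q::finite mat measure \<Rightarrow> nat \<Rightarrow> 'q mat measure" where
  "convpow d \<mu> \<nu> 0 = return (PiS d) 0"
| "convpow d \<mu> \<nu> (Suc n) = mconv d \<mu> (convpow d \<mu> \<nu> n) \<nu>"

definition Tmap :: "nat \<Rightarrow> 'q::finite mat \<Rightarrow> 'q mat \<Rightarrow> 'q mat" where
  "Tmap d a r = msqrt d (mmul a (mmul (mmul r r) (madj a)))"

definition Tmeas :: "nat \<Rightarrow> 'q::finite mat \<Rightarrow> 'q mat measure \<Rightarrow> 'q mat measure" where
  "Tmeas d a \<nu> = distr \<nu> (PiS d) (Tmap d a)"

definition haar :: "nat \<Rightarrow> real \<Rightarrow> 'q::finite mat measure" where
  "haar d \<mu> = distr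
     (density (lebH d) (\<lambda>r. ennreal (indicator (OmegaQ d) r *
        (pi powr (real CARD('q) * \<mu>) / GammaOmega d \<mu> TYPE('q)) *
        Delta d r powr (\<mu> - n0 d TYPE('q) / real CARD('q)))))
     (PiS d) (msqrt d)"

definition wishart :: "nat \<Rightarrow> real \<Rightarrow> 'q::finite mat measure" where
  "wishart d \<mu> = density (haar d \<mu>)
     (\<lambda>r. ennreal ((2 * pi) powr (- real CARD('q) * \<mu>) * exp (- retr (mmul r r) / 2)))"

definition wishart_sq :: "nat \<Rightarrow> real \<Rightarrow> 'q::finite mat \<Rightarrow> 'q mat measure" where
  "wishart_sq d \<mu> s2 = Tmeas d (msqrt d s2) (wishart d \<mu>)"

definition weak_conv_Pi :: "nat \<Rightarrow> (nat \<Rightarrow> 'q::finite mat measure) \<Rightarrow> 'q mat measure \<Rightarrow> bool" where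
  "weak_conv_Pi d Ms M \<longleftrightarrow>
     (\<forall>f :: 'q mat \<Rightarrow> real. continuous_on (PiQ d) f \<and> bounded (f ` PiQ d) \<longrightarrow>
        (\<lambda>n. integral\<^sup>L (Ms n) f) \<longlonglongrightarrow> integral\<^sup>L M f)"

end

theory Submission
  imports Defs
begin

text \<open>
Laplace transforms \<open>\<integral> exp (- tr (a r\<^sup>2)) dP(r)\<close>, \<open>a\<close> positive semidefinite, determine weak convergence of tight
sequences on the cone, because finite linear combinations of the functions \<open>exp (- tr (a r\<^sup>2))\<close> form a
point-separating algebra (Stone--Weierstrass). The second moments of the rescaled convolution powers are
constant in \<open>n\<close>, which gives tightness.

The Laplace transforms are computed by a Lindeberg argument. After diagonalising \<open>a\<^sup>1\<^sup>/\<^sup>2 \<sigma>\<^sup>2 a\<^sup>1\<^sup>/\<^sup>2\<close> with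
eigenvalues \<open>l\<^sub>i\<close>, consider the heat flow \<open>h\<^sub>t(r) = \<Prod>\<^sub>i (1 + 2 t l\<^sub>i)\<^sup>-\<^sup>\<mu> exp (- tr (a\<^sub>t r\<^sup>2))\<close> started at
\<open>exp (- tr (a r\<^sup>2))\<close>. One convolution with \<open>\<nu>\<close> scaled by \<open>n\<^sup>-\<^sup>1\<^sup>/\<^sup>2\<close> moves \<open>h\<^sub>t\<close> to \<open>h\<^sub>t\<^sub>+\<^sub>1\<^sub>/\<^sub>n\<close> up to \<open>o(1/n)\<close>; this only
uses that the matrix ball law has mean zero and covariance \<open>1/(2\<mu>)\<close> times the identity, which follows by
integrating out one column of \<open>v\<close> at a time. Hence the \<open>n\<close>-fold convolution power has Laplace transform
tending to \<open>h\<^sub>1(0) = \<Delta>(1 + 2 a\<^sup>1\<^sup>/\<^sup>2 \<sigma>\<^sup>2 a\<^sup>1\<^sup>/\<^sup>2)\<^sup>-\<^sup>\<mu>\<close>. The squared Wishart law has the same transform by the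
transformation behaviour of the Lebesgue measure on Hermitian matrices under \<open>x \<mapsto> g x g\<^sup>*\<close>.
\<close>

section \<open>Scalars\<close>

lemma four_eq_zero: "(4::4) = 0" by simp

lemma sum_UNIV_4: "sum f (UNIV::4 set) = f 0 + f 1 + f 2 + f 3"
  by (simp add: sum_4 four_eq_zero ac_simps)

lemma all_4_iff: "(\<forall>i::4. P i) \<longleftrightarrow> P 0 \<and> P 1 \<and> P 2 \<and> P 3"
  unfolding forall_4 four_eq_zero by auto

lemma scal_eq_iff: "(a::scal) = b \<longleftrightarrow> a$0 = b$0 \<and> a$1 = b$1 \<and> a$2 = b$2 \<and> a$3 = b$3"
  by (simp add: vec_eq_iff all_4_iff)

lemma qmul_nth [simp]:
  "qmul a b $ 0 = a$0*b$0 - a$1*b$1 - a$2*b$2 - a$3*b$3"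
  "qmul a b $ 1 = a$0*b$1 + a$1*b$0 + a$2*b$3 - a$3*b$2"
  "qmul a b $ 2 = a$0*b$2 - a$1*b$3 + a$2*b$0 + a$3*b$1"
  "qmul a b $ 3 = a$0*b$3 + a$1*b$2 - a$2*b$1 + a$3*b$0"
  by (simp_all add: qmul_def)

lemma qconj_nth [simp]: "qconj a $ k = (if k = 0 then a$0 else - a$k)"
  by (simp add: qconj_def)

lemma qone_nth [simp]: "qone $ k = (if k = 0 then 1 else 0)"
  by (simp add: qone_def)

lemma qone_eq_axis: "qone = axis 0 1"
  by (simp add: vec_eq_iff axis_def)

lemma qmul_assoc: "qmul (qmul a b) c = qmul a (qmul b c)"
  by (simp add: scal_eq_iff algebra_simps)

lemma qmul_qone [simp]: "qmul qone a = a" "qmul a qone = a"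
  by (simp_all add: scal_eq_iff)

lemma qmul_zero [simp]: "qmul 0 c = 0" "qmul a 0 = 0"
  by (simp_all add: scal_eq_iff)

lemma qmul_linear [simp]:
  "qmul (a + b) c = qmul a c + qmul b c" "qmul a (b + c) = qmul a b + qmul a c"
  "qmul (a - b) c = qmul a c - qmul b c" "qmul a (b - c) = qmul a b - qmul a c"
  "qmul (t *\<^sub>R a) c = t *\<^sub>R qmul a c" "qmul a (t *\<^sub>R c) = t *\<^sub>R qmul a c"
  "qmul (- a) c = - qmul a c" "qmul a (- c) = - qmul a c"
  by (simp_all add: scal_eq_iff algebra_simps)

lemma qmul_sum_left: "qmul (sum f A) c = (\<Sum>i\<in>A. qmul (f i) c)"
  by (induction A rule: infinite_finite_induct) simp_all

lemma qmul_sum_right: "qmul c (sum f A) = (\<Sum>i\<in>A. qmul c (f i))"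
  by (induction A rule: infinite_finite_induct) simp_all

lemma qconj_simps [simp]:
  "qconj (qmul a b) = qmul (qconj b) (qconj a)" "qconj (qconj a) = a"
  "qconj (a + b) = qconj a + qconj b" "qconj (a - b) = qconj a - qconj b"
  "qconj (t *\<^sub>R a) = t *\<^sub>R qconj a" "qconj 0 = 0" "qconj (- a) = - qconj a" "qconj qone = qone"
  by (simp_all add: scal_eq_iff algebra_simps)

lemma qconj_sum: "qconj (sum f A) = (\<Sum>i\<in>A. qconj (f i))"
  by (induction A rule: infinite_finite_induct) simp_all

lemma inner_scal: "(a::scal) \<bullet> b = a$0*b$0 + a$1*b$1 + a$2*b$2 + a$3*b$3"
  by (simp add: inner_vec_def sum_UNIV_4)

lemma inner_qone: "qone \<bullet> a = a$0"
  by (simp add: inner_scal)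

lemma inner_qconj [simp]: "qconj a \<bullet> qconj b = a \<bullet> b"
  by (simp add: inner_scal)

lemma norm_qconj [simp]: "norm (qconj a) = norm a"
  by (simp add: norm_eq_sqrt_inner)

lemma inner_qmul_left: "qmul a b \<bullet> c = b \<bullet> qmul (qconj a) c"
  by (simp add: inner_scal algebra_simps)

lemma inner_qmul_right: "qmul a b \<bullet> c = a \<bullet> qmul c (qconj b)"
  by (simp add: inner_scal algebra_simps)

lemma qmul_qconj_self: "qmul (qconj a) a = (norm a)\<^sup>2 *\<^sub>R qone"
  unfolding power2_norm_eq_inner by (simp add: scal_eq_iff inner_scal algebra_simps)

lemma norm_qmul: "norm (qmul a b) = norm a * norm b"
proof -
  have "(norm (qmul a b))\<^sup>2 = b \<bullet> qmul (qmul (qconj a) a) b"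
    by (simp add: power2_norm_eq_inner inner_qmul_left qmul_assoc)
  also have "\<dots> = (norm a * norm b)\<^sup>2"
    by (simp add: qmul_qconj_self power_mult_distrib power2_norm_eq_inner)
  finally show ?thesis by (simp add: power2_eq_iff_nonneg)
qed

section \<open>Matrices\<close>

lemma mat_eq_iff: "(x::'q::finite mat) = y \<longleftrightarrow> (\<forall>i j. x$i$j = y$i$j)"
  by (auto simp: vec_eq_iff)

lemma mmul_nth: "mmul x y $ i $ j = (\<Sum>l\<in>UNIV. qmul (x$i$l) (y$l$j))"
  by (simp add: mmul_def)

lemma madj_nth [simp]: "madj x $ i $ j = qconj (x$j$i)"
  by (simp add: madj_def)

lemma mid_nth: "mid $ i $ j = (if i = j then qone else 0)"
  by (simp add: mid_def)

lemma rdiag_nth: "rdiag l $ i $ j = (if i = j then l i *\<^sub>R qone else 0)"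
  by (simp add: rdiag_def)

lemma mmul_assoc: "mmul (mmul x y) z = mmul x (mmul y z)"
proof -
  have "(\<Sum>l\<in>UNIV. \<Sum>m\<in>UNIV. qmul (qmul (x$i$m) (y$m$l)) (z$l$j)) =
        (\<Sum>m\<in>UNIV. \<Sum>l\<in>UNIV. qmul (x$i$m) (qmul (y$m$l) (z$l$j)))" for i j
    by (subst sum.swap) (simp add: qmul_assoc)
  then show ?thesis
    by (simp add: mat_eq_iff mmul_nth qmul_sum_left qmul_sum_right)
qed

lemma mmul_zero [simp]: "mmul 0 c = 0" "mmul a 0 = 0"
  by (simp_all add: mat_eq_iff mmul_nth)

lemma mmul_linear [simp]:
  "mmul (a + b) c = mmul a c + mmul b c" "mmul a (b + c) = mmul a b + mmul a c"
  "mmul (a - b) c = mmul a c - mmul b c" "mmul a (b - c) = mmul a b - mmul a c"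
  "mmul (t *\<^sub>R a) c = t *\<^sub>R mmul a c" "mmul a (t *\<^sub>R c) = t *\<^sub>R mmul a c"
  "mmul (- a) c = - mmul a c" "mmul a (- c) = - mmul a c"
  by (simp_all add: mat_eq_iff mmul_nth sum.distrib sum_subtractf scaleR_sum_right sum_negf)

lemma mmul_mid [simp]: "mmul mid x = x" "mmul x mid = x"
  by (simp_all add: mat_eq_iff mmul_nth mid_nth if_distrib[of "qmul _"] if_distrib[of "\<lambda>f. qmul f _"]
      cong: if_cong)

lemma linear_mmul_right: "linear (mmul x)"
  by (simp add: linear_iff)

lemma bounded_bilinear_mmul: "bounded_bilinear (mmul :: 'q::finite mat \<Rightarrow> _)"
  by (intro bilinear_conv_bounded_bilinear[THEN iffD1]) (simp add: bilinear_def linear_iff)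

lemmas continuous_on_mmul [continuous_intros] = bounded_bilinear.continuous_on[OF bounded_bilinear_mmul]

lemma madj_mmul [simp]: "madj (mmul a b) = mmul (madj b) (madj a)"
  by (simp add: mat_eq_iff mmul_nth qconj_sum)

lemma madj_madj [simp]: "madj (madj a) = a"
  by (simp add: mat_eq_iff)

lemma madj_mid [simp]: "madj mid = mid"
  by (simp add: mat_eq_iff mid_nth)

lemma madj_rdiag [simp]: "madj (rdiag l) = rdiag l"
  by (auto simp: mat_eq_iff rdiag_nth)

lemma madj_linear [simp]:
  "madj 0 = 0" "madj (a + b) = madj a + madj b" "madj (a - b) = madj a - madj b"
  "madj (t *\<^sub>R a) = t *\<^sub>R madj a" "madj (- a) = - madj a"
  by (simp_all add: mat_eq_iff)

lemma linear_madj: "linear madj" by (simp add: linear_iff)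

lemmas bounded_linear_madj = linear_madj[THEN linear_conv_bounded_linear[THEN iffD1]]
lemmas continuous_on_madj [continuous_intros] = bounded_linear.continuous_on[OF bounded_linear_madj]

lemma inner_mat: "(x::'q::finite mat) \<bullet> y = (\<Sum>i\<in>UNIV. \<Sum>j\<in>UNIV. x$i$j \<bullet> y$i$j)"
  by (simp add: inner_vec_def)

lemma inner_mmul_left: "mmul a b \<bullet> c = b \<bullet> mmul (madj a) c"
proof -
  have "mmul a b \<bullet> c = (\<Sum>i\<in>UNIV. \<Sum>j\<in>UNIV. \<Sum>l\<in>UNIV. qmul (a$i$l) (b$l$j) \<bullet> c$i$j)"
    by (simp add: inner_mat mmul_nth inner_sum_left)
  also have "\<dots> = (\<Sum>i\<in>UNIV. \<Sum>l\<in>UNIV. \<Sum>j\<in>UNIV. qmul (a$i$l) (b$l$j) \<bullet> c$i$j)"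
    by (intro sum.cong refl sum.swap)
  also have "\<dots> = (\<Sum>l\<in>UNIV. \<Sum>i\<in>UNIV. \<Sum>j\<in>UNIV. qmul (a$i$l) (b$l$j) \<bullet> c$i$j)"
    by (rule sum.swap)
  also have "\<dots> = (\<Sum>l\<in>UNIV. \<Sum>j\<in>UNIV. \<Sum>i\<in>UNIV. qmul (a$i$l) (b$l$j) \<bullet> c$i$j)"
    by (intro sum.cong refl sum.swap)
  also have "\<dots> = b \<bullet> mmul (madj a) c"
    by (simp add: inner_mat mmul_nth inner_sum_right inner_qmul_left)
  finally show ?thesis .
qed

lemma inner_madj [simp]: "madj a \<bullet> madj b = a \<bullet> b"
  unfolding inner_mat madj_nth inner_qconj by (rule sum.swap)

lemma inner_madj_left: "madj a \<bullet> b = a \<bullet> madj b"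
  using inner_madj[of a "madj b"] by simp

lemma inner_mmul_right: "mmul a b \<bullet> c = a \<bullet> mmul c (madj b)"
  using inner_mmul_left[of "madj b" "madj a" "madj c"] by (metis inner_madj madj_mmul madj_madj)

lemma norm_madj [simp]: "norm (madj a) = norm a"
  by (simp add: norm_eq_sqrt_inner)

lemma norm_mat_sq: "(norm (x::'q::finite mat))\<^sup>2 = (\<Sum>i\<in>UNIV. \<Sum>j\<in>UNIV. (norm (x$i$j))\<^sup>2)"
  by (simp add: power2_norm_eq_inner inner_mat)

lemma norm_mmul_nth_sq:
  "(norm (mmul a b $ i $ j))\<^sup>2 \<le> (\<Sum>l\<in>UNIV. (norm (a$i$l))\<^sup>2) * (\<Sum>l\<in>UNIV. (norm (b$l$j))\<^sup>2)"
proof -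
  have "norm (mmul a b $ i $ j) \<le> (\<Sum>l\<in>UNIV. norm (a$i$l) * norm (b$l$j))"
    unfolding mmul_nth by (rule order_trans[OF norm_sum]) (simp add: norm_qmul)
  then have "(norm (mmul a b $ i $ j))\<^sup>2 \<le> (\<Sum>l\<in>UNIV. norm (a$i$l) * norm (b$l$j))\<^sup>2"
    by (simp add: power_mono)
  also have "\<dots> \<le> (\<Sum>l\<in>UNIV. (norm (a$i$l))\<^sup>2) * (\<Sum>l\<in>UNIV. (norm (b$l$j))\<^sup>2)"
    by (rule Cauchy_Schwarz_ineq_sum)
  finally show ?thesis .
qed

lemma norm_mmul: "norm (mmul a b) \<le> norm a * norm (b :: 'q::finite mat)"
proof -
  have "(norm (mmul a b))\<^sup>2 \<le>
      (\<Sum>i\<in>UNIV. \<Sum>j\<in>UNIV. (\<Sum>l\<in>UNIV. (norm (a$i$l))\<^sup>2) * (\<Sum>l\<in>UNIV. (norm (b$l$j))\<^sup>2))"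
    unfolding norm_mat_sq by (intro sum_mono norm_mmul_nth_sq)
  also have "\<dots> = (\<Sum>i\<in>UNIV. \<Sum>l\<in>UNIV. (norm (a$i$l))\<^sup>2) * (\<Sum>j\<in>UNIV. \<Sum>l\<in>UNIV. (norm (b$l$j))\<^sup>2)"
    by (rule sum_product[symmetric])
  also have "(\<Sum>j\<in>UNIV. \<Sum>l\<in>UNIV. (norm (b$l$j))\<^sup>2) = (norm b)\<^sup>2"
    unfolding norm_mat_sq by (rule sum.swap)
  also have "(\<Sum>i\<in>UNIV. \<Sum>l\<in>UNIV. (norm (a$i$l))\<^sup>2) = (norm a)\<^sup>2"
    by (rule norm_mat_sq[symmetric])
  finally have "(norm (mmul a b))\<^sup>2 \<le> (norm a * norm b)\<^sup>2" by (simp only: power_mult_distrib)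
  then show ?thesis by (rule power2_le_imp_le) simp
qed

lemma abs_inner_mmul_le: "\<bar>m \<bullet> mmul x m\<bar> \<le> norm x * (norm (m :: 'q::finite mat))\<^sup>2"
proof -
  have "\<bar>m \<bullet> mmul x m\<bar> \<le> norm m * norm (mmul x m)" by (rule Cauchy_Schwarz_ineq2)
  also have "\<dots> \<le> norm m * (norm x * norm m)" by (intro mult_left_mono norm_mmul) simp
  finally show ?thesis by (simp add: power2_eq_square ac_simps)
qed

lemma inner_rdiag: "rdiag g \<bullet> x = (\<Sum>i\<in>UNIV. g i * x$i$i$0)"
proof -
  have "(\<Sum>j\<in>UNIV. rdiag g $ i $ j \<bullet> x$i$j) = g i * x$i$i$0" for i
    by (subst sum.remove[of _ i]) (auto simp: rdiag_nth inner_qone)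
  then show ?thesis by (simp add: inner_mat)
qed

lemma rdiag_one: "rdiag (\<lambda>i. 1) = mid"
  by (simp add: mat_eq_iff rdiag_nth mid_nth)

lemma rdiag_linear:
  "rdiag (\<lambda>i. l i + m i) = rdiag l + rdiag m" "rdiag (\<lambda>i. l i - m i) = rdiag l - rdiag m"
  "rdiag (\<lambda>i. t * l i) = t *\<^sub>R rdiag l"
  by (auto simp: mat_eq_iff rdiag_nth algebra_simps)

lemma rdiag_mmul_nth: "mmul (rdiag l) x $ i $ j = l i *\<^sub>R (x$i$j)"
  by (simp add: mmul_nth rdiag_nth if_distrib[of "\<lambda>f. qmul f _"] cong: if_cong)

lemma mmul_rdiag_nth: "mmul x (rdiag l) $ i $ j = l j *\<^sub>R (x$i$j)"
  by (simp add: mmul_nth rdiag_nth if_distrib[of "\<lambda>f. qmul _ f"] cong: if_cong)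

lemma rdiag_mmul: "mmul (rdiag l) (rdiag m) = rdiag (\<lambda>i. l i * m i)"
  by (auto simp: mat_eq_iff rdiag_mmul_nth rdiag_nth)

lemma inner_mmul_rdiag: "m \<bullet> mmul (rdiag l) m = (\<Sum>i\<in>UNIV. l i * (\<Sum>j\<in>UNIV. (norm (m$i$j))\<^sup>2))"
  by (simp add: inner_mat rdiag_mmul_nth power2_norm_eq_inner sum_distrib_left)

lemma retr_eq_inner: "retr x = mid \<bullet> x"
  unfolding rdiag_one[symmetric] inner_rdiag by (simp add: retr_def)

lemma retr_rdiag: "retr (rdiag l) = (\<Sum>i\<in>UNIV. l i)"
  by (simp add: retr_def rdiag_nth)

lemma inner_eq_retr: "a \<bullet> b = retr (mmul (madj a) b)"
  using inner_mmul_left[of a mid b] by (simp add: retr_eq_inner)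

lemma retr_mmul_commute: "retr (mmul a b) = retr (mmul b a)"
proof -
  have "retr (mmul a b) = madj a \<bullet> b" by (simp add: inner_eq_retr)
  also have "\<dots> = madj b \<bullet> a" by (metis inner_commute inner_madj_left)
  finally show ?thesis by (simp add: inner_eq_retr)
qed

lemma inner_conj: "m \<bullet> mmul (mmul g (mmul x (madj g))) m = mmul (madj g) m \<bullet> mmul x (mmul (madj g) m)"
  by (simp add: mmul_assoc inner_mmul_left)

lemma inner_mmul_conj: "a \<bullet> mmul g (mmul x (madj g)) = mmul (madj g) (mmul a g) \<bullet> x"
  by (simp add: inner_mmul_left[of "madj g"] inner_mmul_right[of a] mmul_assoc)

lemma linear_conj: "linear (\<lambda>x. mmul g (mmul x (madj g)))"
  by (simp add: linear_iff)

section \<open>Sylvester's determinant identity\<close>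

lemma continuous_on_det [continuous_intros]:
  fixes f :: "'a::topological_space \<Rightarrow> real^'n^'n"
  shows "continuous_on S f \<Longrightarrow> continuous_on S (\<lambda>x. det (f x))"
  unfolding det_def by (intro continuous_intros)

lemma matrix_add_rdistrib: "(A + B) ** C = A ** C + B ** (C :: real^'n^'m)"
  by (simp add: matrix_matrix_mult_def vec_eq_iff sum.distrib distrib_right)

lemma finite_singular_shifts:
  fixes A :: "real^'n^'n"
  shows "finite {t. det (A + t *\<^sub>R mat 1) = 0}"
proof -
  have "real_polynomial_function (\<lambda>t. A $ i $ j + t * (mat 1 :: real^'n^'n) $ i $ j)" for i j
    by (intro real_polynomial_function.intros(3) real_polynomial_function.intros(2)
        real_polynomial_function.intros(1) bounded_linear_mult_left)
  then have "real_polynomial_function (\<lambda>t. det (A + t *\<^sub>R mat 1))"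
    unfolding det_def vector_add_component vector_scaleR_component real_scaleR_def
    by (intro real_polynomial_function_sum real_polynomial_function_prod
        real_polynomial_function.intros(2,4)
        finite_permutations finite)
  then obtain c and n where c: "\<And>t. det (A + t *\<^sub>R mat 1) = (\<Sum>i\<le>n::nat. c i * t ^ i)"
    unfolding real_polynomial_function_iff_sum by metis
  obtain B where B: "\<And>x. norm (A *v x) \<le> norm x * B"
    using bounded_linear.bounded[OF matrix_vector_mul_bounded_linear[of A]] by blast
  have "x = 0" if "(A + (\<bar>B\<bar> + 1) *\<^sub>R mat 1) *v x = 0" for x
  proof -
    have "A *v x = - ((\<bar>B\<bar> + 1) *\<^sub>R x)"
      using that by (simp add: matrix_vector_mult_add_rdistrib scaleR_matrix_vector_assoc[symmetric]
          eq_neg_iff_add_eq_0)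
    then have "norm x * (\<bar>B\<bar> + 1) \<le> norm x * B" using B[of x] by (simp add: mult.commute)
    moreover have "\<not> \<bar>B\<bar> + 1 \<le> B" by linarith
    ultimately show ?thesis by (auto simp: mult_le_cancel_left)
  qed
  then have "det (A + (\<bar>B\<bar> + 1) *\<^sub>R mat 1) \<noteq> 0"
    unfolding invertible_det_nz[symmetric] invertible_left_inverse matrix_left_invertible_ker by blast
  then show ?thesis unfolding c polyfun_finite_roots
    by (metis (mono_tags, lifting) atMost_iff mult_zero_left sum.neutral)
qed

lemma det_one_plus_matrix_mult_commute:
  fixes A B :: "real^'n^'n"
  shows "det (mat 1 + A ** B) = det (mat 1 + B ** A)"
proof -
  define shift where "shift t = A + t *\<^sub>R mat 1" for t :: real
  define S where "S = {t. det (shift t) = 0}"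
  let ?diff = "\<lambda>t. det (mat 1 + shift t ** B) - det (mat 1 + B ** shift t)"
  have "?diff t = 0" if "t \<in> - S" for t
  proof -
    have "(mat 1 + shift t ** B) ** shift t = shift t ** (mat 1 + B ** shift t)"
      by (simp add: matrix_add_ldistrib matrix_add_rdistrib matrix_mul_assoc)
    then have "det (mat 1 + shift t ** B) * det (shift t) = det (shift t) * det (mat 1 + B ** shift t)"
      by (simp only: det_mul[symmetric])
    then show ?thesis using that by (simp add: S_def)
  qed
  moreover have "continuous_on (closure (- S)) ?diff"
    unfolding shift_def matrix_matrix_mult_def by (intro continuous_intros)
  moreover have "closure (- S) = UNIV"
    using finite_singular_shifts[of A]
    by (simp add: S_def shift_def closure_complement empty_interior_finite)
  ultimately have "?diff 0 = 0" by (metis (no_types, lifting) UNIV_I continuous_constant_on_closure)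
  then show ?thesis by (simp add: shift_def)
qed

section \<open>Real matrices of left multiplication\<close>

definition left_mult :: "'q::finite mat \<Rightarrow> real^('q \<times> 4)^('q \<times> 4)" where
  "left_mult x = (\<chi> p r. qmul (x $ fst p $ fst r) (axis (snd r) 1) $ snd p)"

lemma qmul_nth_expand: "qmul a b $ k = (\<Sum>m\<in>UNIV. qmul a (axis m 1) $ k * b $ m)"
proof -
  have "b = (\<Sum>m\<in>UNIV. (b$m) *\<^sub>R axis m 1)"
    using basis_expansion[of b] by (simp add: scalar_mult_eq_scaleR)
  then have "qmul a b = (\<Sum>m\<in>UNIV. (b$m) *\<^sub>R qmul a (axis m 1))"
    using qmul_sum_right[of a "\<lambda>m. (b$m) *\<^sub>R axis m 1" UNIV] by (simp only: qmul_linear)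
  then show ?thesis by (simp add: sum_component mult.commute)
qed

lemma left_mult_mmul: "left_mult (mmul x y) = left_mult x ** left_mult y"
proof -
  have "qmul (mmul x y $ i $ j) (axis m 1) $ k =
     (\<Sum>r\<in>UNIV. qmul (x$i$fst r) (axis (snd r) 1) $ k * qmul (y$fst r$j) (axis m 1) $ snd r)" for i j k m
  proof -
    have "qmul (mmul x y $ i $ j) (axis m 1) $ k =
        (\<Sum>l\<in>UNIV. qmul (x$i$l) (qmul (y$l$j) (axis m 1)) $ k)"
      by (simp add: mmul_nth qmul_sum_left qmul_assoc)
    also have "\<dots> = (\<Sum>l\<in>UNIV. \<Sum>n\<in>UNIV. qmul (x$i$l) (axis n 1) $ k * qmul (y$l$j) (axis m 1) $ n)"
      by (intro sum.cong refl qmul_nth_expand)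
    also have "\<dots> = (\<Sum>r\<in>UNIV \<times> UNIV.
        qmul (x$i$fst r) (axis (snd r) 1) $ k * qmul (y$fst r$j) (axis m 1) $ snd r)"
      by (simp add: sum.cartesian_product case_prod_beta)
    finally show ?thesis by simp
  qed
  then show ?thesis
    by (simp add: left_mult_def matrix_matrix_mult_def vec_eq_iff)
qed

lemma linear_left_mult: "linear left_mult"
  by (simp add: linear_iff left_mult_def vec_eq_iff)

lemma left_mult_add: "left_mult (x + y) = left_mult x + left_mult y"
  by (rule linear_add[OF linear_left_mult])

lemma continuous_on_left_mult: "continuous_on A left_mult"
  by (intro linear_continuous_on linear_conv_bounded_linear[THEN iffD1] linear_left_mult)

lemma left_mult_rdiag: "left_mult (rdiag l) = (\<chi> p r. if p = r then l (fst p) else 0)"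
  by (auto simp: left_mult_def vec_eq_iff rdiag_nth axis_def)

lemma left_mult_mid: "left_mult mid = mat 1"
  unfolding rdiag_one[symmetric] left_mult_rdiag by (simp add: mat_def vec_eq_iff)

lemma det_left_mult_mmul: "det (left_mult (mmul x y)) = det (left_mult x) * det (left_mult y)"
  by (simp add: left_mult_mmul det_mul)

lemma det_left_mult_rdiag:
  fixes l :: "'q::finite \<Rightarrow> real"
  shows "det (left_mult (rdiag l)) = (\<Prod>i\<in>UNIV. l i) ^ 4"
proof -
  have "det (left_mult (rdiag l)) = (\<Prod>p\<in>(UNIV::('q \<times> 4) set). l (fst p))"
    by (subst det_diagonal) (auto simp: left_mult_rdiag intro!: prod.cong)
  also have "\<dots> = (\<Prod>i\<in>UNIV. \<Prod>k\<in>(UNIV::4 set). l i)"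
    by (simp add: prod.cartesian_product case_prod_beta del: prod_constant)
  also have "\<dots> = (\<Prod>i\<in>UNIV. l i) ^ 4" by (simp add: prod_power_distrib)
  finally show ?thesis .
qed

lemma det_left_mult_one_plus_commute:
  "det (left_mult (mid + mmul x y)) = det (left_mult (mid + mmul y x))"
  by (simp add: left_mult_add left_mult_mid left_mult_mmul det_one_plus_matrix_mult_commute)

lemma inj_left_mult: "inj left_mult"
proof (rule injI)
  fix x y :: "'q::finite mat" assume "left_mult x = left_mult y"
  then have "left_mult x $ (i,k) $ (j,0) = left_mult y $ (i,k) $ (j,0)" for i j k by simp
  then show "x = y" by (simp add: left_mult_def qone_eq_axis[symmetric] vec_eq_iff)
qed

lemma mmul_left_right_inverse: "mmul x y = mid \<Longrightarrow> mmul y x = (mid :: 'q::finite mat)"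
  by (metis inj_left_mult injD left_mult_mid left_mult_mmul matrix_left_right_inverse)

section \<open>Spectral decomposition\<close>

lemma linear_coeff_nonpos_if_quadratic_nonpos:
  fixes a b :: real
  assumes "\<And>t. 2 * t * a + t\<^sup>2 * b \<le> 0"
  shows "a \<le> 0"
proof (rule ccontr)
  assume "\<not> a \<le> 0"
  then have "0 < a" by simp
  define t where "t = a / (\<bar>b\<bar> + 1)"
  have b1: "0 < \<bar>b\<bar> + 1" by linarith
  have "0 < t" unfolding t_def using \<open>0 < a\<close> b1 by (rule divide_pos_pos)
  have "t * (\<bar>b\<bar> + 1) = a" using b1 by (simp add: t_def)
  then have "t * \<bar>b\<bar> \<le> a" using \<open>0 < t\<close> by (simp add: distrib_left)
  moreover have "t * - \<bar>b\<bar> \<le> t * b" using \<open>0 < t\<close> by (intro mult_left_mono) auto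
  ultimately have "0 < 2 * a + t * b" using \<open>0 < a\<close> by linarith
  then have "0 < t * (2 * a + t * b)" using \<open>0 < t\<close> by (rule mult_pos_pos[rotated])
  then show False using assms[of t] by (simp add: power2_eq_square algebra_simps)
qed

lemma rayleigh_quotient_maximizer:
  fixes f :: "'a::euclidean_space \<Rightarrow> 'a"
  assumes V: "subspace V" "V \<noteq> {0}" and f: "linear f"
  obtains v where "v \<in> V" "norm v = 1" "\<And>w. w \<in> V \<Longrightarrow> w \<bullet> f w \<le> (v \<bullet> f v) * (norm w)\<^sup>2"
proof -
  let ?K = "V \<inter> sphere 0 1"
  obtain w where "w \<in> V" "w \<noteq> 0" using V subspace_0 by blast
  then have "w /\<^sub>R norm w \<in> ?K" using V(1) by (simp add: subspace_scale)
  then have "?K \<noteq> {}" by blast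
  moreover have "continuous_on ?K (\<lambda>v. v \<bullet> f v)"
    using f by (intro continuous_intros linear_continuous_on linear_conv_bounded_linear[THEN iffD1])
  moreover have "compact ?K" by (intro closed_Int_compact closed_subspace V) simp
  ultimately obtain v where v: "v \<in> ?K" and max: "\<And>w. w \<in> ?K \<Longrightarrow> w \<bullet> f w \<le> v \<bullet> f v"
    using continuous_attains_sup[of ?K] by blast
  have "w \<bullet> f w \<le> (v \<bullet> f v) * (norm w)\<^sup>2" if "w \<in> V" for w
  proof (cases "w = 0")
    case False
    let ?z = "w /\<^sub>R norm w"
    have "?z \<bullet> f ?z \<le> v \<bullet> f v" using that False V(1) by (intro max) (simp add: subspace_scale)
    then show ?thesis using False
      by (simp add: linear_cmul[OF f] power2_eq_square field_simps)
  qed (simp add: linear_0[OF f])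
  then show ?thesis using that[of v] v by auto
qed

lemma selfadjoint_eigenvector:
  fixes f :: "'a::euclidean_space \<Rightarrow> 'a"
  assumes V: "subspace V" "V \<noteq> {0}" and f: "linear f" "f ` V \<subseteq> V"
    and selfadjoint: "\<And>v w. v \<in> V \<Longrightarrow> w \<in> V \<Longrightarrow> v \<bullet> f w = f v \<bullet> w"
  obtains v c where "v \<in> V" "norm v = 1" "f v = c *\<^sub>R v"
proof -
  obtain v where v: "v \<in> V" "norm v = 1"
    and max: "\<And>w. w \<in> V \<Longrightarrow> w \<bullet> f w \<le> (v \<bullet> f v) * (norm w)\<^sup>2"
    using rayleigh_quotient_maximizer[OF V f(1)] by blast
  define c where "c = v \<bullet> f v"
  define g where "g = f v - c *\<^sub>R v"
  have gV: "g \<in> V" unfolding g_def using v f(2) V(1) by (auto intro: subspace_diff subspace_scale)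
  have "2 * t * (norm g)\<^sup>2 + t\<^sup>2 * (g \<bullet> f g - c * (norm g)\<^sup>2) \<le> 0" for t
  proof -
    have "v + t *\<^sub>R g \<in> V" using v gV V(1) by (auto intro: subspace_add subspace_scale)
    from max[OF this]
    have "(v + t *\<^sub>R g) \<bullet> f (v + t *\<^sub>R g) \<le> c * (norm (v + t *\<^sub>R g))\<^sup>2" unfolding c_def .
    moreover have "v \<bullet> f g = f v \<bullet> g" using selfadjoint v gV by auto
    moreover have "v \<bullet> v = 1" using v by (simp add: norm_eq_sqrt_inner)
    moreover have "(norm g)\<^sup>2 = g \<bullet> f v - c * (g \<bullet> v)"
      unfolding power2_norm_eq_inner by (subst (2) g_def) (simp add: inner_simps)
    ultimately show ?thesis
      by (simp add: linear_add[OF f(1)] linear_cmul[OF f(1)] power2_norm_eq_inner inner_simps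
          c_def[symmetric])
        (simp add: algebra_simps inner_commute power2_eq_square)
  qed
  then have "(norm g)\<^sup>2 \<le> 0" by (rule linear_coeff_nonpos_if_quadratic_nonpos)
  then have "f v = c *\<^sub>R v" by (simp add: g_def)
  then show ?thesis using that v by blast
qed

locale field_dim =
  fixes d :: nat
  assumes d_cases: "d \<in> {1, 2, 4}"
begin

lemma qmul_comps:
  assumes "\<And>k. k \<notin> comps d \<Longrightarrow> a$k = 0" "\<And>k. k \<notin> comps d \<Longrightarrow> b$k = 0" "k \<notin> comps d"
  shows "qmul a b $ k = 0"
proof -
  have "\<forall>k. k \<notin> comps d \<longrightarrow> qmul a b $ k = 0"
    using d_cases assms(1,2) unfolding comps_def by (auto simp: all_4_iff split: if_splits)
  then show ?thesis using assms(3) by blast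
qed

lemma zero_in_comps: "0 \<in> comps d" by (simp add: comps_def)

lemma card_comps: "card (comps d) = d"
  using d_cases by (auto simp: comps_def)

lemma In_M_simps [simp]:
  "In_M d 0" "In_M d mid" "In_M d (rdiag l)"
  "In_M d x \<Longrightarrow> In_M d (madj x)"
  "In_M d x \<Longrightarrow> In_M d (t *\<^sub>R x)" "In_M d x \<Longrightarrow> In_M d (- x)"
  "In_M d x \<Longrightarrow> In_M d y \<Longrightarrow> In_M d (x + y)"
  "In_M d x \<Longrightarrow> In_M d y \<Longrightarrow> In_M d (x - y)"
  "In_M d x \<Longrightarrow> In_M d y \<Longrightarrow> In_M d (mmul x y)"
  using zero_in_comps
  by (auto simp: In_M_def mid_nth rdiag_nth mmul_nth intro!: sum.neutral qmul_comps)

lemma Herm_simps [simp]: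
  "0 \<in> Herm d" "mid \<in> Herm d" "rdiag l \<in> Herm d"
  "x \<in> Herm d \<Longrightarrow> t *\<^sub>R x \<in> Herm d" "x \<in> Herm d \<Longrightarrow> y \<in> Herm d \<Longrightarrow> x + y \<in> Herm d"
  "x \<in> Herm d \<Longrightarrow> y \<in> Herm d \<Longrightarrow> x - y \<in> Herm d"
  by (auto simp: Herm_def)

lemma Herm_conj [simp]: "In_M d g \<Longrightarrow> x \<in> Herm d \<Longrightarrow> mmul g (mmul x (madj g)) \<in> Herm d"
  by (auto simp: Herm_def mmul_assoc)

lemma Herm_D [simp]: "x \<in> Herm d \<Longrightarrow> In_M d x" "x \<in> Herm d \<Longrightarrow> madj x = x"
  by (auto simp: Herm_def)

lemma subspace_In_M: "subspace {x. In_M d (x::'q::finite mat)}"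
  by (auto intro!: subspaceI)

lemma subspace_Herm: "subspace (Herm d :: 'q::finite mat set)"
  by (auto intro!: subspaceI)

lemmas closed_In_M = closed_subspace[OF subspace_In_M]
lemmas closed_Herm = closed_subspace[OF subspace_Herm]

definition col_space :: "'q::finite set \<Rightarrow> 'q mat set" where
  "col_space S = {x. In_M d x \<and> (\<forall>i j. j \<notin> S \<longrightarrow> x$i$j = 0)}"

lemma col_space_UNIV: "col_space UNIV = {x. In_M d x}"
  by (simp add: col_space_def)

lemma col_space_In_M: "x \<in> col_space S \<Longrightarrow> In_M d x"
  by (simp add: col_space_def)

lemma col_space_nth: "x \<in> col_space S \<Longrightarrow> j \<notin> S \<Longrightarrow> x$i$j = 0"
  by (simp add: col_space_def)

lemma subspace_col_space: "subspace (col_space S)"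
  by (auto intro!: subspaceI simp: col_space_def)

lemma mmul_col_space: "In_M d x \<Longrightarrow> y \<in> col_space S \<Longrightarrow> mmul x y \<in> col_space S"
  by (simp add: col_space_def mmul_nth)

lemma norm_col_sq:
  assumes "y \<in> col_space {l}"
  shows "(norm y)\<^sup>2 = (\<Sum>i\<in>UNIV. (norm (y$i$l))\<^sup>2)"
proof -
  have "(\<Sum>k\<in>UNIV. (norm (y$i$k))\<^sup>2) = (norm (y$i$l))\<^sup>2" for i
    using col_space_nth[OF assms] by (subst sum.remove[of _ l]) auto
  then show ?thesis by (simp add: norm_mat_sq)
qed

lemma madj_mmul_self_col:
  assumes "y \<in> col_space {l}"
  shows "mmul (madj y) y = (norm y)\<^sup>2 *\<^sub>R rdiag (indicator {l})"
proof -
  have "mmul (madj y) y $ i $ k = ((norm y)\<^sup>2 *\<^sub>R rdiag (indicator {l})) $ i $ k" for i k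
  proof (cases "i = l \<and> k = l")
    case True
    then show ?thesis
      by (simp add: mmul_nth rdiag_nth qmul_qconj_self norm_col_sq[OF assms] scaleR_sum_left)
  next
    case False
    then show ?thesis
      using col_space_nth[OF assms, of i] col_space_nth[OF assms, of k]
      by (auto simp: mmul_nth rdiag_nth)
  qed
  then show ?thesis unfolding mat_eq_iff by blast
qed

lemma exists_orthogonal_col:
  assumes u: "u \<in> col_space S" and j: "j \<notin> S"
  shows "{m \<in> col_space {j}. mmul (madj u) m = 0} \<noteq> {0}"
proof
  let ?C = "col_space {j}" and ?f = "mmul (madj u)"
  assume kernel: "{m \<in> ?C. ?f m = 0} = {0}"
  have inj: "inj_on ?f ?C"
    using kernel by (intro linear_inj_on_iff_eq_0[THEN iffD2] linear_mmul_right subspace_col_space) auto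
  have "?f ` ?C \<subseteq> ?C" using mmul_col_space[of "madj u"] col_space_In_M[OF u] by auto
  moreover have "dim (?f ` ?C) = dim ?C"
    using inj subspace_col_space linear_mmul_right by (metis dim_image_eq span_eq_iff)
  ultimately have "?f ` ?C = ?C"
    by (intro subspace_dim_equal linear_subspace_image linear_mmul_right subspace_col_space) auto
  moreover have "(\<chi> i k. if i = j \<and> k = j then qone else 0) \<in> ?C"
    using zero_in_comps by (auto simp: col_space_def In_M_def)
  ultimately obtain m where "(\<chi> i k. if i = j \<and> k = j then qone else 0) = ?f m" by blast
  from this[THEN arg_cong, of "\<lambda>z. z$j$j"] have "qone = (\<Sum>l\<in>UNIV. qmul (qconj (u$l$j)) (m$l$j))"
    by (simp add: mmul_nth)
  also have "\<dots> = 0" using col_space_nth[OF u j] by simp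
  finally show False by (simp add: scal_eq_iff)
qed

lemma orthonormal_eigencolumns:
  assumes x: "(x::'q::finite mat) \<in> Herm d"
  shows "finite S \<Longrightarrow> \<exists>u l. u \<in> col_space S \<and> mmul (madj u) u =
      rdiag (indicator S) \<and> mmul x u = mmul u (rdiag l)"
proof (induction S rule: finite_induct)
  case empty
  show ?case by (rule exI[of _ 0]) (auto simp: col_space_def mat_eq_iff rdiag_nth)
next
  case (insert j S)
  then obtain u l where u: "u \<in> col_space S" "mmul (madj u) u = rdiag (indicator S)"
    "mmul x u = mmul u (rdiag l)"
    by blast
  define V where "V = {m \<in> col_space {j}. mmul (madj u) m = 0}"
  have "subspace V"
    using subspace_col_space[of "{j}"] unfolding V_def
    by (auto intro!: subspaceI simp: subspace_add subspace_0 subspace_scale)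
  moreover have "V \<noteq> {0}" unfolding V_def using u(1) insert.hyps(2) by (rule exists_orthogonal_col)
  moreover have "mmul x ` V \<subseteq> V"
  proof safe
    fix m assume m: "m \<in> V"
    have "mmul (madj u) (mmul x m) = mmul (madj (mmul x u)) m" using x by (simp add: mmul_assoc)
    also have "\<dots> = mmul (rdiag l) (mmul (madj u) m)" by (simp add: u mmul_assoc)
    finally show "mmul x m \<in> V" using m x by (simp add: V_def mmul_col_space)
  qed
  moreover have "v \<bullet> mmul x w = mmul x v \<bullet> w" for v w using x by (simp add: inner_mmul_left)
  ultimately obtain m c where m: "m \<in> V" "norm m = 1" "mmul x m = c *\<^sub>R m"
    by (metis selfadjoint_eigenvector linear_mmul_right)
  have mj: "m \<in> col_space {j}" and um: "mmul (madj u) m = 0" using m by (auto simp: V_def)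
  have mu: "mmul (madj m) u = 0" using um by (metis madj_linear(1) madj_madj madj_mmul)
  have mm: "mmul (madj m) m = rdiag (indicator {j})" using madj_mmul_self_col[OF mj] m(2) by simp
  have "u + m \<in> col_space (insert j S)" using u(1) mj by (auto simp: col_space_def)
  moreover have "mmul (madj (u + m)) (u + m) = rdiag (indicator (insert j S))"
    using insert.hyps by (auto simp: u um mu mm mat_eq_iff rdiag_nth indicator_def)
  moreover have "mmul x (u + m) = mmul (u + m) (rdiag (l(j := c)))"
    using insert.hyps col_space_nth[OF u(1)] col_space_nth[OF mj]
    by (auto simp: u(3) m mat_eq_iff mmul_rdiag_nth)
  ultimately show ?case by blast
qed

lemma unitary_left: "unitary d u \<Longrightarrow> mmul (madj u) u = mid" by (simp add: unitary_def)

lemma unitary_right: "unitary d u \<Longrightarrow> mmul u (madj u) = mid"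
  unfolding unitary_def using mmul_left_right_inverse by blast

lemma unitary_In_M [simp]: "unitary d u \<Longrightarrow> In_M d u" by (simp add: unitary_def)

lemma unitary_madj: "unitary d u \<Longrightarrow> unitary d (madj u)"
  by (simp add: unitary_def unitary_right[unfolded unitary_def])

lemma unitary_cancel:
  assumes "unitary d u"
  shows "mmul u (mmul (madj u) x) = x" "mmul (madj u) (mmul u x) = x"
  using assms by (simp_all add: mmul_assoc[symmetric] unitary_right unitary_left)

abbreviation conj_rdiag :: "'q::finite mat \<Rightarrow> ('q \<Rightarrow> real) \<Rightarrow> 'q mat" where
  "conj_rdiag u l \<equiv> mmul u (mmul (rdiag l) (madj u))"

lemma spectral:
  assumes "(x::'q::finite mat) \<in> Herm d"
  obtains u l where "unitary d u" "x = conj_rdiag u l"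
proof -
  have "indicator (UNIV :: 'q set) = (\<lambda>i. 1 :: real)" by auto
  then obtain u l where "u \<in> col_space UNIV" "mmul (madj u) u = mid"
    and xu: "mmul x u = mmul u (rdiag l)"
    using orthonormal_eigencolumns[OF assms finite, of UNIV] by (metis rdiag_one)
  then have u: "unitary d u" by (simp add: unitary_def col_space_In_M)
  have "x = mmul (mmul x u) (madj u)" using u by (simp add: mmul_assoc unitary_right)
  then have "x = conj_rdiag u l" by (simp add: xu mmul_assoc)
  then show ?thesis using that u by blast
qed

lemma conj_rdiag_mmul:
  "unitary d u \<Longrightarrow> mmul (conj_rdiag u l) (conj_rdiag u m) = conj_rdiag u (\<lambda>i. l i * m i)"
  by (simp add: rdiag_mmul[symmetric] mmul_assoc unitary_cancel)

lemma conj_rdiag_one: "unitary d u \<Longrightarrow> conj_rdiag u (\<lambda>i. 1) = mid"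
  by (simp add: rdiag_one unitary_right)

lemma conj_rdiag_affine:
  fixes u :: "'q::finite mat"
  assumes "unitary d u"
  shows "conj_rdiag u (\<lambda>i. a + t * l i) = a *\<^sub>R mid + t *\<^sub>R conj_rdiag u l"
proof -
  have "rdiag (\<lambda>i. a) = a *\<^sub>R (mid :: 'q mat)"
    using rdiag_linear(3)[of a "\<lambda>i. 1"] by (simp add: rdiag_one)
  then show ?thesis using unitary_right[OF assms] by (simp add: rdiag_linear)
qed

lemma retr_conj_rdiag: "unitary d u \<Longrightarrow> retr (conj_rdiag u l) = (\<Sum>i\<in>UNIV. l i)"
  by (subst retr_mmul_commute) (simp add: mmul_assoc unitary_left retr_rdiag)

end

section \<open>The cone of positive semidefinite matrices\<close>

context field_dim
begin

lemma inner_mmul_self: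
  "m \<bullet> mmul x m =
     (\<Sum>k\<in>UNIV. (\<Sum>i\<in>UNIV. \<Sum>j\<in>UNIV. qmul (qmul (qconj (m$i$k)) (x$i$j)) (m$j$k)) $ 0)"
proof -
  have scalar: "p \<bullet> qmul y q = qmul (qmul (qconj p) y) q $ 0" for p q y
    by (simp add: inner_scal algebra_simps)
  have "m \<bullet> mmul x m =
      (\<Sum>i\<in>UNIV. \<Sum>k\<in>UNIV. \<Sum>j\<in>UNIV. qmul (qmul (qconj (m$i$k)) (x$i$j)) (m$j$k) $ 0)"
    unfolding inner_mat mmul_nth inner_sum_right scalar ..
  also have "\<dots> = (\<Sum>k\<in>UNIV. \<Sum>i\<in>UNIV. \<Sum>j\<in>UNIV. qmul (qmul (qconj (m$i$k)) (x$i$j)) (m$j$k) $ 0)"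
    by (rule sum.swap)
  finally show ?thesis by (simp only: sum_component)
qed

lemma PiQ_iff:
  "(x::'q::finite mat) \<in> PiQ d \<longleftrightarrow> x \<in> Herm d \<and> (\<forall>m. In_M d m \<longrightarrow> 0 \<le> m \<bullet> mmul x m)"
proof safe
  assume x: "x \<in> PiQ d"
  then show "x \<in> Herm d" by (simp add: PiQ_def)
  fix m :: "'q mat" assume m: "In_M d m"
  have "0 \<le> (\<Sum>i\<in>UNIV. \<Sum>j\<in>UNIV. qmul (qmul (qconj (m$i$k)) (x$i$j)) (m$j$k)) $ 0" for k
  proof -
    have "\<forall>i n. n \<notin> comps d \<longrightarrow> (\<chi> i. m$i$k) $ i $ n = 0"
      using m by (simp add: In_M_def)
    with x have "0 \<le> (\<Sum>i\<in>UNIV. \<Sum>j\<in>UNIV.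
       qmul (qmul (qconj ((\<chi> i. m$i$k)$i)) (x$i$j)) ((\<chi> i. m$i$k)$j)) $ 0"
      unfolding PiQ_def by blast
    then show ?thesis by (simp only: vec_lambda_beta)
  qed
  then show "0 \<le> m \<bullet> mmul x m" unfolding inner_mmul_self by (rule sum_nonneg)
next
  assume x: "x \<in> Herm d" "\<forall>m. In_M d m \<longrightarrow> 0 \<le> m \<bullet> mmul x m"
  have "0 \<le> (\<Sum>i\<in>UNIV. \<Sum>j\<in>UNIV. qmul (qmul (qconj (v$i)) (x$i$j)) (v$j)) $ 0" (is "0 \<le> ?form")
    if v: "\<forall>i k. k \<notin> comps d \<longrightarrow> v$i$k = 0" for v :: "real^4^'q"
  proof -
    have "In_M d (\<chi> i j. v$i)" using v by (simp add: In_M_def)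
    then have "0 \<le> (\<chi> i j. v$i) \<bullet> mmul x (\<chi> i j. v$i)" using x by blast
    also have "\<dots> = (\<Sum>k\<in>(UNIV::'q set). ?form)"
      unfolding inner_mmul_self vec_lambda_beta ..
    finally have "0 \<le> real CARD('q) * ?form" by (simp only: sum_constant)
    moreover have "0 < real CARD('q)" by simp
    ultimately show ?thesis by (simp only: zero_le_mult_iff) linarith
  qed
  then show "x \<in> PiQ d" using x(1) unfolding PiQ_def by blast
qed

lemma PiQ_Herm [simp]: "x \<in> PiQ d \<Longrightarrow> x \<in> Herm d" by (simp add: PiQ_iff)

lemma PiQ_nonneg: "x \<in> PiQ d \<Longrightarrow> In_M d m \<Longrightarrow> 0 \<le> m \<bullet> mmul x m"
  unfolding PiQ_iff by blast

lemma PiQ_simps [simp]: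
  "0 \<in> PiQ d" "mid \<in> PiQ d" "x \<in> PiQ d \<Longrightarrow> y \<in> PiQ d \<Longrightarrow> x + y \<in> PiQ d"
  by (auto simp: PiQ_iff inner_simps simp del: PiQ_Herm)

lemma PiQ_scaleR [simp]: "x \<in> PiQ d \<Longrightarrow> 0 \<le> t \<Longrightarrow> t *\<^sub>R x \<in> PiQ d"
  by (auto simp: PiQ_iff inner_simps simp del: PiQ_Herm)

lemma PiQ_scaleR_iff: "0 < t \<Longrightarrow> t *\<^sub>R x \<in> PiQ d \<longleftrightarrow> x \<in> PiQ d"
  using PiQ_scaleR[of "t *\<^sub>R x" "1 / t"] by auto

lemma PiQ_conj: "In_M d g \<Longrightarrow> x \<in> PiQ d \<Longrightarrow> mmul g (mmul x (madj g)) \<in> PiQ d"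
  unfolding PiQ_iff inner_conj by (simp del: PiQ_Herm)

lemma PiQ_mmul_madj: "In_M d g \<Longrightarrow> mmul g (madj g) \<in> PiQ d"
  using PiQ_conj[of g mid] by simp

lemma PiQ_square: "x \<in> Herm d \<Longrightarrow> mmul x x \<in> PiQ d"
  using PiQ_mmul_madj[of x] by simp

lemma PiQ_conj_square: "s \<in> Herm d \<Longrightarrow> r \<in> Herm d \<Longrightarrow> mmul s (mmul (mmul r r) s) \<in> PiQ d"
  using PiQ_conj[OF _ PiQ_square, of s r] by simp

lemma PiQ_scaleR_mid_add:
  assumes "h \<in> Herm d" "norm h \<le> e"
  shows "e *\<^sub>R mid + h \<in> PiQ d"
  unfolding PiQ_iff
proof safe
  fix m :: "'a mat"
  have "\<bar>m \<bullet> mmul h m\<bar> \<le> e * (norm m)\<^sup>2"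
    using abs_inner_mmul_le[of m h] mult_right_mono[OF assms(2), of "(norm m)\<^sup>2"] by simp
  then show "0 \<le> m \<bullet> mmul (e *\<^sub>R mid + h) m" by (simp add: inner_simps power2_norm_eq_inner)
qed (use assms in simp)

lemma closed_PiQ: "closed (PiQ d :: 'q::finite mat set)"
proof -
  have eq: "PiQ d = Herm d \<inter> (\<Inter>m\<in>{m. In_M d m}. {x::'q mat. 0 \<le> m \<bullet> mmul x m})"
    by (rule set_eqI) (unfold PiQ_iff, blast)
  have "closed {x::'q mat. 0 \<le> m \<bullet> mmul x m}" for m
    by (intro closed_Collect_le continuous_on_const continuous_on_inner continuous_on_mmul
        continuous_on_id)
  then show ?thesis unfolding eq by (intro closed_Int closed_Herm closed_INT ballI)
qed

lemma PiQ_rdiag: "rdiag l \<in> PiQ d \<longleftrightarrow> (\<forall>i. 0 \<le> l (i::'q::finite))"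
proof
  assume l: "rdiag l \<in> PiQ d"
  show "\<forall>i. 0 \<le> l i"
  proof
    fix i
    let ?e = "rdiag (indicator {i}) :: 'q mat"
    have "0 \<le> ?e \<bullet> mmul (rdiag l) ?e" using l by (intro PiQ_nonneg) simp_all
    also have "\<dots> = l i" by (simp add: rdiag_mmul inner_rdiag rdiag_nth indicator_def if_distrib
        cong: if_cong)
    finally show "0 \<le> l i" .
  qed
next
  assume "\<forall>i. 0 \<le> l i"
  then show "rdiag l \<in> PiQ d"
    unfolding PiQ_iff inner_mmul_rdiag by (auto intro!: sum_nonneg mult_nonneg_nonneg)
qed

lemma PiQ_conj_rdiag:
  assumes "unitary d u" shows "conj_rdiag u l \<in> PiQ d \<longleftrightarrow> (\<forall>i. 0 \<le> l i)"
proof -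
  have "conj_rdiag u l \<in> PiQ d \<longleftrightarrow> rdiag l \<in> PiQ d"
    using PiQ_conj[of u "rdiag l"] PiQ_conj[of "madj u" "conj_rdiag u l"] assms
    by (auto simp: mmul_assoc unitary_cancel unitary_left)
  then show ?thesis by (simp add: PiQ_rdiag)
qed

lemma spectral_psd:
  assumes "(x::'q::finite mat) \<in> PiQ d"
  obtains u l where "unitary d u" "\<And>i. 0 \<le> l i" "x = conj_rdiag u l"
  using assms spectral[OF PiQ_Herm[OF assms]] PiQ_conj_rdiag by metis

lemma norm_sq_eq_retr: "x \<in> Herm d \<Longrightarrow> (norm x)\<^sup>2 = retr (mmul x x)"
  by (simp add: power2_norm_eq_inner inner_eq_retr)

lemma norm_le_retr:
  assumes "(x::'q::finite mat) \<in> PiQ d" shows "norm x \<le> retr x"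
proof -
  obtain u l where u: "unitary d u" "x = conj_rdiag u l" and l: "\<And>i. 0 \<le> l i"
    using assms by (metis spectral_psd)
  have retr: "retr x = (\<Sum>i\<in>UNIV. l i)" using u by (simp add: retr_conj_rdiag)
  have "(norm x)\<^sup>2 = (\<Sum>i\<in>UNIV. l i * l i)"
    using norm_sq_eq_retr[of x] assms u by (simp add: conj_rdiag_mmul retr_conj_rdiag)
  also have "\<dots> \<le> (\<Sum>i\<in>UNIV. l i * (\<Sum>j\<in>UNIV. l j))"
    using l by (intro sum_mono mult_left_mono member_le_sum) auto
  also have "\<dots> = (retr x)\<^sup>2" by (simp add: retr power2_eq_square sum_distrib_right)
  finally show ?thesis by (rule power2_le_imp_le) (simp only: retr sum_nonneg l)
qed

lemma retr_PiQ_nonneg: "x \<in> PiQ d \<Longrightarrow> 0 \<le> retr x"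
  using norm_le_retr[of x] norm_ge_zero[of x] by linarith

lemma continuous_on_retr: "continuous_on A retr"
  unfolding retr_eq_inner by (intro continuous_intros)

lemma OmegaQ_PiQ [simp]: "x \<in> OmegaQ d \<Longrightarrow> x \<in> PiQ d" by (simp add: OmegaQ_def)

lemma OmegaQ_iff:
  "(x::'q::finite mat) \<in> OmegaQ d \<longleftrightarrow> x \<in> Herm d \<and> (\<exists>e>0. x - e *\<^sub>R mid \<in> PiQ d)"
proof safe
  assume x: "x \<in> OmegaQ d"
  then show xH: "x \<in> Herm d" by simp
  from x obtain e where e: "e > 0" "\<And>y. y \<in> Herm d \<Longrightarrow> dist y x < e \<Longrightarrow> y \<in> PiQ d"
    unfolding OmegaQ_def by blast
  define c where "c = e / (norm (mid :: 'q mat) + 1)"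
  have "0 < norm (mid :: 'q mat) + 1" by (simp add: add_nonneg_pos)
  then have "c > 0" "c * (norm (mid :: 'q mat) + 1) = e" using e by (simp_all add: c_def)
  then have "dist (x - c *\<^sub>R mid) x < e" by (simp add: dist_norm distrib_left)
  then have "x - c *\<^sub>R mid \<in> PiQ d" using xH by (intro e(2)) simp_all
  then show "\<exists>e>0. x - e *\<^sub>R mid \<in> PiQ d" using \<open>c > 0\<close> by blast
next
  fix e :: real assume x: "x \<in> Herm d" and e: "e > 0" "x - e *\<^sub>R mid \<in> PiQ d"
  have near: "y \<in> PiQ d" if "y \<in> Herm d" "dist y x < e" for y
  proof -
    have "e *\<^sub>R mid + (y - x) \<in> PiQ d"
      using that x by (intro PiQ_scaleR_mid_add) (simp_all add: dist_norm)
    then have "(x - e *\<^sub>R mid) + (e *\<^sub>R mid + (y - x)) \<in> PiQ d" by (rule PiQ_simps(3)[OF e(2)])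
    then show ?thesis by simp
  qed
  moreover have "x \<in> PiQ d" using near x e(1) by simp
  ultimately show "x \<in> OmegaQ d" using e(1) unfolding OmegaQ_def by blast
qed

lemma mid_OmegaQ [simp]: "(mid :: 'q::finite mat) \<in> OmegaQ d"
proof -
  have half: "mid - (1/2) *\<^sub>R mid = (1/2) *\<^sub>R (mid :: 'q mat)" by (simp add: mat_eq_iff mid_nth)
  have "mid - (1/2) *\<^sub>R mid \<in> (PiQ d :: 'q mat set)" unfolding half by simp
  then show ?thesis unfolding OmegaQ_iff by (intro conjI exI[of _ "1/2"]) simp_all
qed

lemma OmegaQ_add:
  assumes x: "x \<in> OmegaQ d" and y: "y \<in> PiQ d" shows "x + y \<in> OmegaQ d"
proof -
  obtain e where e: "e > 0" "x - e *\<^sub>R mid \<in> PiQ d" using x unfolding OmegaQ_iff by blast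
  have "(x - e *\<^sub>R mid) + y \<in> PiQ d" by (rule PiQ_simps(3)[OF e(2) y])
  then have "x + y - e *\<^sub>R mid \<in> PiQ d" by (simp add: algebra_simps)
  then show ?thesis using e(1) x y unfolding OmegaQ_iff[of "x + y"] by auto
qed

lemma OmegaQ_conj_rdiag:
  fixes u :: "'q::finite mat"
  assumes u: "unitary d u" shows "conj_rdiag u l \<in> OmegaQ d \<longleftrightarrow> (\<forall>i. 0 < l i)"
proof -
  have shift: "conj_rdiag u l - e *\<^sub>R mid \<in> PiQ d \<longleftrightarrow> (\<forall>i. e \<le> l i)" for e
  proof -
    have "conj_rdiag u l - e *\<^sub>R mid = conj_rdiag u (\<lambda>i. - e + 1 * l i)"
      unfolding conj_rdiag_affine[OF u] by simp
    then show ?thesis by (simp only: PiQ_conj_rdiag[OF u]) simp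
  qed
  have "(\<exists>e>0. \<forall>i. e \<le> l i) \<longleftrightarrow> (\<forall>i. 0 < l i)"
  proof
    assume "\<forall>i. 0 < l i"
    then have "0 < Min (range l)" by (subst Min_gr_iff) auto
    then show "\<exists>e>0. \<forall>i. e \<le> l i" by (intro exI[of _ "Min (range l)"]) simp
  qed (meson less_le_trans)
  then show ?thesis using u unfolding OmegaQ_iff shift by simp
qed

lemma spectral_pd:
  assumes "(x::'q::finite mat) \<in> OmegaQ d"
  obtains u l where "unitary d u" "\<And>i. 0 < l i" "x = conj_rdiag u l"
  using spectral[of x] assms OmegaQ_conj_rdiag by (metis OmegaQ_iff)

lemma OmegaQ_inverse:
  assumes "(x::'q::finite mat) \<in> OmegaQ d"
  obtains y where "y \<in> OmegaQ d" "mmul x y = mid" "mmul y x = mid"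
proof -
  obtain u l where u: "unitary d u" "x = conj_rdiag u l" and l: "\<And>i. 0 < l i"
    using assms by (metis spectral_pd)
  have "mmul x (conj_rdiag u (\<lambda>i. 1 / l i)) = conj_rdiag u (\<lambda>i. 1)"
    using u l by (simp only: conj_rdiag_mmul) (simp add: less_imp_neq[THEN not_sym])
  then have "mmul x (conj_rdiag u (\<lambda>i. 1 / l i)) = mid" using u by (simp only: conj_rdiag_one)
  moreover have "conj_rdiag u (\<lambda>i. 1 / l i) \<in> OmegaQ d" using u l by (simp add: OmegaQ_conj_rdiag)
  ultimately show ?thesis using that mmul_left_right_inverse by blast
qed

section \<open>The determinant\<close>

lemma det_left_mult_conj_rdiag:
  assumes "unitary d u" shows "det (left_mult (conj_rdiag u l)) = (\<Prod>i\<in>UNIV. l i) ^ 4"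
proof -
  have "det (left_mult u) * det (left_mult (madj u)) = 1"
    using det_left_mult_mmul[of u "madj u"] unitary_right[OF assms] by (simp add: left_mult_mid)
  then show ?thesis by (simp add: det_left_mult_mmul det_left_mult_rdiag)
qed

lemma Delta_conj_rdiag:
  assumes u: "unitary d u" and l: "\<And>i. 0 \<le> l (i::'q::finite)"
  shows "Delta d (conj_rdiag u l) = (\<Prod>i\<in>UNIV. l i)"
  unfolding Delta_def
proof (rule the_equality)
  let ?x = "conj_rdiag u l"
  fix p assume "\<exists>u l. unitary d u \<and> ?x = conj_rdiag u l \<and> p = (\<Prod>i\<in>UNIV. l i)"
  then obtain u' l' where u': "unitary d u'" "?x = conj_rdiag u' l'" and p: "p = (\<Prod>i\<in>UNIV. l' i)"
    by blast
  have "?x \<in> PiQ d" using u l by (simp add: PiQ_conj_rdiag)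
  then have "\<And>i. 0 \<le> l' i" unfolding u'(2) using u' by (simp add: PiQ_conj_rdiag)
  then have "0 \<le> p" unfolding p by (intro prod_nonneg) simp
  moreover have "0 \<le> (\<Prod>i\<in>UNIV. l i)" using l by (intro prod_nonneg) simp
  moreover have "p ^ 4 = (\<Prod>i\<in>UNIV. l i) ^ 4"
    unfolding p using det_left_mult_conj_rdiag[OF u] det_left_mult_conj_rdiag[OF u'(1)] u'(2) by metis
  ultimately show "p = (\<Prod>i\<in>UNIV. l i)" by (metis power_eq_imp_eq_base zero_less_numeral)
qed (use u in blast)

lemma Delta_nonneg: "(x::'q::finite mat) \<in> PiQ d \<Longrightarrow> 0 \<le> Delta d x"
  by (erule spectral_psd) (auto simp: Delta_conj_rdiag intro!: prod_nonneg)

lemma Delta_pow4: "(x::'q::finite mat) \<in> PiQ d \<Longrightarrow> Delta d x ^ 4 = det (left_mult x)"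
  by (erule spectral_psd) (auto simp: Delta_conj_rdiag det_left_mult_conj_rdiag)

lemma Delta_eqI:
  assumes "(x::'q::finite mat) \<in> PiQ d" "0 \<le> p" "p ^ 4 = det (left_mult x)"
  shows "Delta d x = p"
  using assms Delta_nonneg Delta_pow4 by (metis power_eq_imp_eq_base zero_less_numeral)

lemma Delta_rdiag: "(\<And>i. 0 \<le> l (i::'q::finite)) \<Longrightarrow> Delta d (rdiag l) = (\<Prod>i\<in>UNIV. l i)"
  by (intro Delta_eqI) (auto simp: PiQ_rdiag det_left_mult_rdiag intro!: prod_nonneg)

lemma Delta_scaleR_mid: "0 \<le> t \<Longrightarrow> Delta d (t *\<^sub>R mid :: 'q::finite mat) = t ^ CARD('q)"
  using Delta_rdiag[of "\<lambda>i::'q. t * 1"] unfolding rdiag_linear rdiag_one by simp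

lemma Delta_mid [simp]: "Delta d mid = 1"
  using Delta_scaleR_mid[of 1] by simp

lemma Delta_conj:
  assumes g: "In_M d g" and x: "(x::'q::finite mat) \<in> PiQ d"
  shows "Delta d (mmul g (mmul x (madj g))) = Delta d (mmul g (madj g)) * Delta d x"
proof (intro Delta_eqI PiQ_conj g x mult_nonneg_nonneg Delta_nonneg PiQ_mmul_madj)
  have "det (left_mult (mmul g (mmul x (madj g)))) =
      det (left_mult (mmul g (madj g))) * det (left_mult x)"
    by (simp add: det_left_mult_mmul)
  then show "(Delta d (mmul g (madj g)) * Delta d x) ^ 4 = det (left_mult (mmul g (mmul x (madj g))))"
    using g x by (simp add: power_mult_distrib Delta_pow4 PiQ_mmul_madj)
qed

lemma Delta_square: "x \<in> PiQ d \<Longrightarrow> Delta d (mmul x x) = (Delta d x)\<^sup>2"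
  by (intro Delta_eqI)
    (simp_all add: PiQ_square det_left_mult_mmul Delta_pow4[symmetric] power_mult_distrib
        power2_eq_square)

lemma Delta_mid_plus_commute:
  "mid + mmul x y \<in> PiQ d \<Longrightarrow> mid + mmul y x \<in> PiQ d \<Longrightarrow> Delta d (mid + mmul x y) =
      Delta d (mid + mmul y x)"
  by (intro Delta_eqI) (simp_all add: Delta_nonneg Delta_pow4 det_left_mult_one_plus_commute)

lemma Delta_le_retr_pow:
  assumes "(x::'q::finite mat) \<in> PiQ d" shows "Delta d x \<le> retr x ^ CARD('q)"
proof -
  obtain u l where u: "unitary d u" "x = conj_rdiag u l" and l: "\<And>i. 0 \<le> l i"
    using assms by (metis spectral_psd)
  have "l i \<le> (\<Sum>j\<in>UNIV. l j)" for i using l by (intro member_le_sum) auto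
  then have "(\<Prod>i\<in>UNIV. l i) \<le> (\<Prod>i\<in>(UNIV::'q set). \<Sum>j\<in>UNIV. l j)" using l by (intro prod_mono) auto
  then show ?thesis using u l by (simp add: Delta_conj_rdiag retr_conj_rdiag)
qed

lemma continuous_on_Delta: "continuous_on (PiQ d) (Delta d :: 'q::finite mat \<Rightarrow> real)"
proof -
  have "continuous_on (PiQ d :: 'q mat set) (\<lambda>x. root 4 (det (left_mult x)))"
    by (intro continuous_intros continuous_on_left_mult)
  then show ?thesis
    by (rule continuous_on_eq) (simp add: Delta_pow4[symmetric] real_root_power_cancel Delta_nonneg)
qed

lemma OmegaQ_iff_Delta: "(x::'q::finite mat) \<in> OmegaQ d \<longleftrightarrow> x \<in> PiQ d \<and> Delta d x > 0"
proof safe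
  assume "x \<in> OmegaQ d"
  then show "0 < Delta d x"
    by (rule spectral_pd) (auto simp: Delta_conj_rdiag less_imp_le intro!: prod_pos)
next
  assume "x \<in> PiQ d" and pos: "0 < Delta d x"
  then obtain u l where u: "unitary d u" "x = conj_rdiag u l" and l: "\<And>i. 0 \<le> l i"
    by (metis spectral_psd)
  have "0 < (\<Prod>i\<in>UNIV. l i)" using pos u l by (simp add: Delta_conj_rdiag)
  then have "\<And>i. l i \<noteq> 0" by (metis UNIV_I finite less_irrefl prod_zero_iff)
  then have "\<And>i. 0 < l i" using l by (simp add: order_less_le)
  then show "x \<in> OmegaQ d" using u by (simp add: OmegaQ_conj_rdiag)
qed simp

lemma OmegaQ_mmul_madj:
  assumes g: "In_M d g" "In_M d h" and inv: "mmul g h = mid"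
  shows "mmul g (madj g) \<in> OmegaQ d"
proof -
  have "mmul (madj h) (madj g) = mid" by (metis inv madj_mid madj_mmul)
  then have "det (left_mult (madj g)) \<noteq> 0" "det (left_mult g) \<noteq> 0"
    using inv by (metis det_I det_left_mult_mmul left_mult_mid mult_zero_left mult_zero_right
        zero_neq_one)+
  then have "Delta d (mmul g (madj g)) ^ 4 \<noteq> 0" using g
    by (simp add: Delta_pow4 PiQ_mmul_madj det_left_mult_mmul)
  then show ?thesis using g Delta_nonneg[of "mmul g (madj g)"]
    by (auto simp: OmegaQ_iff_Delta PiQ_mmul_madj order_less_le)
qed

lemma OmegaQ_conj:
  assumes g: "In_M d g" "In_M d h" "mmul g h = mid" and x: "x \<in> OmegaQ d"
  shows "mmul g (mmul x (madj g)) \<in> OmegaQ d"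
  using OmegaQ_mmul_madj[OF g] g(1) x by (simp add: OmegaQ_iff_Delta Delta_conj PiQ_conj)

lemma OmegaQ_conj_iff:
  assumes g: "In_M d g" "In_M d h" "mmul g h = mid"
  shows "mmul g (mmul x (madj g)) \<in> OmegaQ d \<longleftrightarrow> x \<in> OmegaQ d"
proof
  assume conj: "mmul g (mmul x (madj g)) \<in> OmegaQ d"
  have "mmul h g = mid" using g(3) by (rule mmul_left_right_inverse)
  moreover have "mmul (madj g) (madj h) = mid" by (metis calculation madj_mid madj_mmul)
  ultimately have "mmul h (mmul (mmul g (mmul x (madj g))) (madj h)) = x"
    by (metis mmul_assoc mmul_mid)
  then show "x \<in> OmegaQ d" using OmegaQ_conj[OF g(2,1) \<open>mmul h g = mid\<close> conj] by simp
qed (rule OmegaQ_conj[OF g])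

lemma OmegaQ_scaleR: "0 < t \<Longrightarrow> t *\<^sub>R x \<in> OmegaQ d \<longleftrightarrow> x \<in> OmegaQ d"
  using OmegaQ_conj_iff[of "sqrt t *\<^sub>R mid" "(1 / sqrt t) *\<^sub>R mid" x] by simp

lemma retr_OmegaQ_pos: "x \<in> OmegaQ d \<Longrightarrow> 0 < retr x"
  using Delta_le_retr_pow[of x] retr_PiQ_nonneg[of x]
  by (cases "retr x = 0") (auto simp: OmegaQ_iff_Delta power_0_left)

lemma PiQ_mid_minus_madj_mmul_iff:
  assumes "In_M d v"
  shows "mid - mmul (madj v) v \<in> PiQ d \<longleftrightarrow> (\<forall>m. In_M d m \<longrightarrow> norm (mmul v m) \<le> norm m)"
proof -
  have "m \<bullet> mmul (mid - mmul (madj v) v) m = (norm m)\<^sup>2 - (norm (mmul v m))\<^sup>2" for m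
    by (simp add: inner_simps power2_norm_eq_inner inner_mmul_left mmul_assoc)
  moreover have "mid - mmul (madj v) v \<in> Herm d" unfolding Herm_def using assms by simp
  moreover have "(norm (mmul v m))\<^sup>2 \<le> (norm m)\<^sup>2 \<longleftrightarrow> norm (mmul v m) \<le> norm m" for m
    by (simp add: abs_le_square_iff[symmetric])
  ultimately show ?thesis by (simp add: PiQ_iff del: PiQ_Herm)
qed

lemma norm_madj_mmul_le:
  assumes v: "In_M d v" "\<And>m. In_M d m \<Longrightarrow> norm (mmul v m) \<le> norm m" and m: "In_M d m"
  shows "norm (mmul (madj v) m) \<le> norm m"
proof -
  let ?w = "mmul (madj v) m"
  have "(norm ?w)\<^sup>2 = m \<bullet> mmul v ?w" by (simp add: power2_norm_eq_inner inner_mmul_left)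
  also have "\<dots> \<le> norm m * norm (mmul v ?w)" by (rule norm_cauchy_schwarz)
  also have "\<dots> \<le> norm m * norm ?w" using v m by (intro mult_left_mono) simp_all
  finally have "norm ?w * norm ?w \<le> norm m * norm ?w" by (simp add: power2_eq_square)
  then show ?thesis by (cases "norm ?w = 0") simp_all
qed

lemma PiQ_mid_minus_mmul_madj:
  assumes "In_M d v" "mid - mmul (madj v) v \<in> PiQ d" shows "mid - mmul v (madj v) \<in> PiQ d"
  using assms norm_madj_mmul_le[of v] PiQ_mid_minus_madj_mmul_iff[of v]
    PiQ_mid_minus_madj_mmul_iff[of "madj v"]
  by simp

lemma Delta_mid_minus_mmul_madj:
  assumes "In_M d v" "mid - mmul (madj v) v \<in> PiQ d"
  shows "Delta d (mid - mmul v (madj v)) = Delta d (mid - mmul (madj v) v)"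
  using Delta_mid_plus_commute[of "- v" "madj v"] PiQ_mid_minus_mmul_madj[OF assms] assms by simp

lemma OmegaQ_mid_minus_mmul_madj_iff:
  assumes "In_M d v"
  shows "mid - mmul v (madj v) \<in> OmegaQ d \<longleftrightarrow> mid - mmul (madj v) v \<in> OmegaQ d"
proof -
  have "mid - mmul w (madj w) \<in> OmegaQ d" if "In_M d w" "mid - mmul (madj w) w \<in> OmegaQ d"
    for w :: "'a mat"
    using that by (simp add: OmegaQ_iff_Delta PiQ_mid_minus_mmul_madj Delta_mid_minus_mmul_madj)
  from this[of v] this[of "madj v"] show ?thesis using assms by auto
qed

lemma mid_minus_col:
  fixes y :: "'q::finite mat"
  assumes y: "y \<in> col_space {l}"
  shows "mid - mmul y (madj y) \<in> OmegaQ d \<longleftrightarrow> (norm y)\<^sup>2 < 1"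
    and "(norm y)\<^sup>2 < 1 \<Longrightarrow> Delta d (mid - mmul y (madj y)) = 1 - (norm y)\<^sup>2"
proof -
  let ?l = "\<lambda>i. 1 - (norm y)\<^sup>2 * indicator {l} i"
  have gram: "mid - mmul (madj y) y = rdiag ?l"
    by (simp only: madj_mmul_self_col[OF y] rdiag_linear rdiag_one)
  have "unitary d (mid :: 'q mat)" by (simp add: unitary_def)
  from OmegaQ_conj_rdiag[OF this, of ?l]
  have "rdiag ?l \<in> OmegaQ d \<longleftrightarrow> (\<forall>i. 0 < ?l i)" by simp
  then have gram_iff: "mid - mmul (madj y) y \<in> OmegaQ d \<longleftrightarrow> (norm y)\<^sup>2 < 1"
    unfolding gram by (auto simp: indicator_def split: if_splits)
  then show "mid - mmul y (madj y) \<in> OmegaQ d \<longleftrightarrow> (norm y)\<^sup>2 < 1"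
    using OmegaQ_mid_minus_mmul_madj_iff[OF col_space_In_M[OF y]] by simp
  assume n: "(norm y)\<^sup>2 < 1"
  then have "Delta d (mid - mmul y (madj y)) = Delta d (rdiag ?l)"
    using Delta_mid_minus_mmul_madj[OF col_space_In_M[OF y]] gram_iff by (simp add: gram)
  also have "\<dots> = (\<Prod>i\<in>UNIV. ?l i)" using n by (intro Delta_rdiag) (auto simp: indicator_def)
  also have "\<dots> = 1 - (norm y)\<^sup>2" by (subst prod.remove[of _ l]) auto
  finally show "Delta d (mid - mmul y (madj y)) = 1 - (norm y)\<^sup>2" .
qed

definition Delta_powr :: "real \<Rightarrow> 'q::finite mat \<Rightarrow> real" where
  "Delta_powr a x = (if x \<in> OmegaQ d then Delta d x powr a else 0)"

lemma Delta_powr_nonneg: "0 \<le> Delta_powr a x" by (simp add: Delta_powr_def)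

lemma Delta_powr_conj:
  assumes g: "In_M d g" "In_M d h" "mmul g h = mid"
  shows "Delta_powr a (mmul g (mmul x (madj g))) = Delta d (mmul g (madj g)) powr a * Delta_powr a x"
  using Delta_conj[of g x] g(1) Delta_nonneg[of x] Delta_nonneg[OF PiQ_mmul_madj, of g]
  by (auto simp: Delta_powr_def OmegaQ_conj_iff[OF g] powr_mult)

lemma Delta_powr_scaleR:
  assumes t: "0 < t"
  shows "Delta_powr a (t *\<^sub>R (x::'q::finite mat)) = t powr (real CARD('q) * a) * Delta_powr a x"
proof -
  have "(t ^ CARD('q)) powr a = t powr (real CARD('q) * a)"
    unfolding powr_realpow[OF t, symmetric] powr_powr ..
  then show ?thesis
    using Delta_powr_conj[of "sqrt t *\<^sub>R mid" "(1 / sqrt t) *\<^sub>R mid" a x]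
      Delta_scaleR_mid[of t, where 'q = 'q] t
    by simp
qed

lemma PiQ_borel [measurable]: "PiQ d \<in> sets borel" using closed_PiQ by (rule borel_closed)

lemma Delta_PiQ_measurable [measurable]:
  "(\<lambda>x. if x \<in> PiQ d then Delta d x else 0) \<in> borel_measurable borel"
  by (intro borel_measurable_continuous_on_if continuous_on_Delta continuous_on_const PiQ_borel)

lemma OmegaQ_borel [measurable]: "OmegaQ d \<in> sets borel"
proof -
  have "OmegaQ d = {x. 0 < (if x \<in> PiQ d then Delta d x else 0)}" by (auto simp: OmegaQ_iff_Delta)
  also have "\<dots> \<in> sets borel" by measurable
  finally show ?thesis .
qed

lemma Delta_powr_measurable [measurable]: "Delta_powr a \<in> borel_measurable borel"
proof -
  have "Delta_powr a = (\<lambda>x. if x \<in> OmegaQ d then (if x \<in> PiQ d then Delta d x else 0) powr a else 0)"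
    by (auto simp: Delta_powr_def)
  also have "\<dots> \<in> borel_measurable borel" by measurable
  finally show ?thesis .
qed

section \<open>Square roots\<close>

lemma PiQ_sqrt_exists:
  assumes "(x::'q::finite mat) \<in> PiQ d" obtains s where "s \<in> PiQ d" "mmul s s = x"
proof -
  obtain u l where u: "unitary d u" "x = conj_rdiag u l" and l: "\<And>i. 0 \<le> l i"
    using assms by (metis spectral_psd)
  let ?s = "conj_rdiag u (\<lambda>i. sqrt (l i))"
  have "?s \<in> PiQ d" using u l by (simp add: PiQ_conj_rdiag)
  moreover have "mmul ?s ?s = x" using u l by (simp only: conj_rdiag_mmul) simp
  ultimately show ?thesis using that by blast
qed

lemma PiQ_inner_eq_0:
  assumes x: "(x::'q::finite mat) \<in> PiQ d" and m: "m \<bullet> mmul x m = 0"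
  shows "mmul x m = 0"
proof -
  obtain s where s: "s \<in> PiQ d" "mmul s s = x" using x by (metis PiQ_sqrt_exists)
  then have "mmul s m \<bullet> mmul s m = 0"
    using m by (simp add: inner_mmul_left mmul_assoc[symmetric])
  then show ?thesis unfolding s(2)[symmetric] by (simp add: mmul_assoc)
qed

lemma PiQ_sqrt_unique:
  assumes s: "(s::'q::finite mat) \<in> PiQ d" and t: "t \<in> PiQ d" and eq: "mmul s s = mmul t t"
  shows "s = t"
proof -
  define e where "e = s - t"
  have e: "e \<in> Herm d" using s t by (simp add: e_def)
  have "mmul s e + mmul e t = 0" using eq by (simp add: e_def)
  then have "e \<bullet> mmul s e + e \<bullet> mmul e t = 0" by (metis inner_add_right inner_zero_right)
  moreover have "e \<bullet> mmul e t = e \<bullet> mmul t e"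
    using e t inner_madj[of e "mmul e t"] by simp
  moreover have "0 \<le> e \<bullet> mmul s e" "0 \<le> e \<bullet> mmul t e" using s t e by (auto intro: PiQ_nonneg)
  ultimately have "mmul s e = 0" "mmul t e = 0" using s t by (auto intro!: PiQ_inner_eq_0)
  then have "mmul e e = 0" by (simp add: e_def)
  then have "e \<bullet> e = 0" using e inner_mmul_left[of e mid e] by simp
  then show ?thesis by (simp add: e_def)
qed

lemma msqrt_eqI: "(s::'q::finite mat) \<in> PiQ d \<Longrightarrow> mmul s s = r \<Longrightarrow> msqrt d r = s"
  unfolding msqrt_def by (rule the_equality) (auto intro: PiQ_sqrt_unique)

lemma msqrt_PiQ [simp]: "(r::'q::finite mat) \<in> PiQ d \<Longrightarrow> msqrt d r \<in> PiQ d"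
  by (metis PiQ_sqrt_exists msqrt_eqI)

lemma msqrt_square [simp]: "(r::'q::finite mat) \<in> PiQ d \<Longrightarrow> mmul (msqrt d r) (msqrt d r) = r"
  by (metis PiQ_sqrt_exists msqrt_eqI)

lemma Delta_msqrt: "(x::'q::finite mat) \<in> PiQ d \<Longrightarrow> (Delta d (msqrt d x))\<^sup>2 = Delta d x"
  using Delta_square[of "msqrt d x"] by simp

lemma msqrt_OmegaQ: "(x::'q::finite mat) \<in> OmegaQ d \<Longrightarrow> msqrt d x \<in> OmegaQ d"
  using Delta_msqrt[of x] Delta_nonneg[of "msqrt d x"] by (auto simp: OmegaQ_iff_Delta order_less_le)

lemma inner_PiQ_square: "A \<in> PiQ d \<Longrightarrow> r \<in> Herm d \<Longrightarrow> A \<bullet> mmul r r = (norm (mmul (msqrt d A) r))\<^sup>2"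
  using inner_mmul_left[of "msqrt d A" r "mmul (msqrt d A) r"] inner_mmul_right[of r r A]
  by (simp add: power2_norm_eq_inner mmul_assoc[symmetric] inner_commute)

lemma inner_PiQ_nonneg: "A \<in> PiQ d \<Longrightarrow> P \<in> PiQ d \<Longrightarrow> 0 \<le> A \<bullet> P"
  using inner_PiQ_square[of A "msqrt d P"] by simp

lemma PiQ_diag_nonneg: "P \<in> PiQ d \<Longrightarrow> 0 \<le> P$i$i$0"
  using inner_PiQ_nonneg[of "rdiag (indicator {i})" P] by (simp add: PiQ_rdiag inner_rdiag)

lemma continuous_on_msqrt: "continuous_on (PiQ d) (msqrt d :: 'q::finite mat \<Rightarrow> _)"
proof -
  let ?sq = "\<lambda>s::'q mat. mmul s s"
  have "continuous (at x within PiQ d) (msqrt d)" if x: "x \<in> PiQ d" for x :: "'q mat"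
  proof -
    define R where "R = retr x + 1"
    define K :: "'q mat set" where "K = PiQ d \<inter> {s. (norm s)\<^sup>2 \<le> R}"
    have "K \<subseteq> cball 0 (sqrt R)" by (auto simp: K_def intro: real_le_rsqrt)
    moreover have "closed K" unfolding K_def
      by (intro closed_Int closed_PiQ closed_Collect_le continuous_intros)
    ultimately have K: "compact K" by (metis bounded_cball bounded_subset compact_eq_bounded_closed)
    have "continuous_on (?sq ` K) (msqrt d)"
      by (rule continuous_on_inv[OF _ K]) (auto intro!: continuous_intros msqrt_eqI simp: K_def)
    moreover have sub: "PiQ d \<inter> {y. retr y < R} \<subseteq> ?sq ` K"
    proof
      fix y :: "'q mat" assume y: "y \<in> PiQ d \<inter> {y. retr y < R}"
      then have "msqrt d y \<in> K" using norm_sq_eq_retr[of "msqrt d y"] by (simp add: K_def)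
      then show "y \<in> ?sq ` K" using y by (intro image_eqI[of _ _ "msqrt d y"]) simp_all
    qed
    ultimately have "continuous (at x within PiQ d \<inter> {y. retr y < R}) (msqrt d)"
      using x by (intro continuous_on_imp_continuous_within[OF continuous_on_subset[OF _ sub]])
        (auto simp: R_def)
    moreover have "at x within PiQ d \<inter> {y. retr y < R} = at x within PiQ d"
      by (rule at_within_nhd[where S = "{y. retr y < R}"])
        (auto simp: R_def intro!: open_Collect_less continuous_on_retr continuous_intros)
    ultimately show ?thesis by simp
  qed
  then show ?thesis by (simp add: continuous_on_eq_continuous_within)
qed

end

section \<open>Translation invariant measures on subspaces\<close>

lemma borel_measurable_linear:
  fixes T :: "'a::euclidean_space \<Rightarrow> 'b::euclidean_space"
  shows "linear T \<Longrightarrow> T \<in> borel_measurable borel"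
  by (intro borel_measurable_continuous_onI linear_continuous_on linear_conv_bounded_linear[THEN iffD1])

lemma ball_borel [measurable]: "ball x r \<in> sets borel"
  by simp

locale haar_on =
  fixes V :: "'a::euclidean_space set" and L :: "'a measure"
  assumes sets_L [simp, measurable_cong]: "sets L = sets borel"
    and subspace_V: "subspace V"
    and AE_V: "AE x in L. x \<in> V"
    and distr_plus: "\<And>a. a \<in> V \<Longrightarrow> distr L borel ((+) a) = L"
    and emeasure_cball_finite: "\<And>r. emeasure L (cball 0 r) < \<infinity>"
    and emeasure_ball_pos: "\<And>r. r > 0 \<Longrightarrow> emeasure L (ball 0 r) > 0"
begin

lemma space_L [simp]: "space L = UNIV"
  using sets_eq_imp_space_eq[OF sets_L] by simp

lemma measurable_L [measurable (raw)]: "f \<in> borel_measurable borel \<Longrightarrow> f \<in> borel_measurable L"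
  by (simp add: measurable_cong_sets[OF sets_L refl])

lemma measurable_pair_lborel:
  "f \<in> borel_measurable (borel \<Otimes>\<^sub>M borel) \<Longrightarrow> f \<in> borel_measurable (L \<Otimes>\<^sub>M (lborel :: real measure))"
  by (simp add: measurable_cong_sets[OF sets_pair_measure_cong[OF sets_L sets_lborel] refl])

sublocale sigma_finite_measure L
proof
  show "\<exists>A. countable A \<and> A \<subseteq> sets L \<and> \<Union> A = space L \<and> (\<forall>a\<in>A. emeasure L a \<noteq> \<infinity>)"
  proof (intro exI[of _ "range (\<lambda>n::nat. cball 0 (real n))"] conjI)
    show "\<Union> (range (\<lambda>n::nat. cball 0 (real n))) = space L"
      by (auto intro: real_arch_simple)
    show "\<forall>a\<in>range (\<lambda>n::nat. cball 0 (real n)). emeasure L a \<noteq> \<infinity>"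
      using emeasure_cball_finite by (auto simp: less_top)
  qed auto
qed

lemma nn_integral_plus:
  assumes "a \<in> V" and [measurable]: "f \<in> borel_measurable borel"
  shows "(\<integral>\<^sup>+x. f (a + x) \<partial>L) = (\<integral>\<^sup>+x. f x \<partial>L)"
proof -
  have "(\<integral>\<^sup>+x. f x \<partial>L) = (\<integral>\<^sup>+x. f x \<partial>distr L borel ((+) a))" using distr_plus assms by simp
  also have "\<dots> = (\<integral>\<^sup>+x. f (a + x) \<partial>L)" by (subst nn_integral_distr) auto
  finally show ?thesis by simp
qed

lemma emeasure_ball_finite: "emeasure L (ball 0 r) < \<infinity>"
  by (rule le_less_trans[OF emeasure_mono emeasure_cball_finite[of r]]) auto

lemma emeasure_ball_translate: "x \<in> V \<Longrightarrow> emeasure L (ball x r) = emeasure L (ball 0 r)"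
proof -
  assume "x \<in> V"
  then have "emeasure L (ball x r) = (\<integral>\<^sup>+y. indicator (ball x r) (x + y) \<partial>L)"
    by (subst nn_integral_plus) (auto intro!: borel_measurable_indicator)
  also have "\<dots> = (\<integral>\<^sup>+y. indicator (ball 0 r) y \<partial>L)"
    by (intro nn_integral_cong) (auto simp: indicator_def dist_norm)
  finally show ?thesis by simp
qed

lemma nn_integral_pos:
  assumes f [measurable]: "f \<in> borel_measurable borel" and x: "x \<in> V" and r: "r > 0"
    and pos: "\<And>y. y \<in> V \<Longrightarrow> dist y x < r \<Longrightarrow> 0 < f y"
  shows "0 < (\<integral>\<^sup>+y. f y \<partial>L)"
proof (rule ccontr)
  assume "\<not> ?thesis"
  then have "AE y in L. f y = 0" by (subst nn_integral_0_iff_AE[symmetric]) auto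
  with AE_V have "AE y in L. y \<notin> ball x r"
    by eventually_elim (use pos in \<open>force simp: dist_commute\<close>)
  then have "emeasure L (ball x r) = 0" by (subst (asm) AE_iff_measurable[of "ball x r"]) auto
  then show False using emeasure_ball_pos[OF r] emeasure_ball_translate[OF x, of r] by simp
qed

lemma nn_integral_indicator_ball_minus:
  assumes "y \<in> V"
  shows "(\<integral>\<^sup>+x. indicator (ball 0 r) (y - x) \<partial>L) = emeasure L (ball 0 r)"
proof -
  have "(\<lambda>x. indicator (ball 0 r) (y - x) :: ennreal) \<in> borel_measurable borel" by measurable
  then have "(\<integral>\<^sup>+x. indicator (ball 0 r) (y - x) \<partial>L) = (\<integral>\<^sup>+x. indicator (ball 0 r) (y - (y + x)) \<partial>L)"
    by (rule nn_integral_plus[OF assms, symmetric])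
  also have "\<dots> = (\<integral>\<^sup>+x. indicator (ball 0 r) x \<partial>L)"
    by (intro nn_integral_cong) (auto simp: indicator_def)
  finally show ?thesis by simp
qed

end

lemma haar_on_unique:
  assumes "haar_on V L" "haar_on V M" and A [measurable]: "A \<in> sets borel"
  shows "emeasure M A * emeasure L (ball 0 1) = emeasure M (ball 0 1) * emeasure L A"
proof -
  interpret L: haar_on V L by fact
  interpret M: haar_on V M by fact
  interpret pair_sigma_finite L M ..
  let ?A = "indicator A :: 'a \<Rightarrow> ennreal" and ?B = "indicator (ball 0 1) :: 'a \<Rightarrow> ennreal"
  have "(\<lambda>p. ?B (fst p) * ?A (fst p + snd p)) \<in> borel_measurable (borel \<Otimes>\<^sub>M borel)"
    "(\<lambda>p. ?B (fst p - snd p) * ?A (fst p)) \<in> borel_measurable (borel \<Otimes>\<^sub>M borel)" by measurable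
  then have measurable: "(\<lambda>(y, x). ?B y * ?A (y + x)) \<in> borel_measurable (L \<Otimes>\<^sub>M M)"
    "(\<lambda>(y, x). ?B (y - x) * ?A y) \<in> borel_measurable (L \<Otimes>\<^sub>M M)"
    by (simp_all add: measurable_cong_sets[OF sets_pair_measure_cong[OF L.sets_L M.sets_L] refl]
        case_prod_beta')
  have "emeasure M A * emeasure L (ball 0 1) = (\<integral>\<^sup>+y. ?B y * emeasure M A \<partial>L)"
    by (subst nn_integral_multc) (auto simp: mult.commute)
  also have "\<dots> = (\<integral>\<^sup>+y. (\<integral>\<^sup>+x. ?B y * ?A (y + x) \<partial>M) \<partial>L)"
    by (rule nn_integral_cong_AE)
      (use L.AE_V in eventually_elim, simp add: M.nn_integral_plus nn_integral_cmult)
  also have "\<dots> = (\<integral>\<^sup>+x. (\<integral>\<^sup>+y. ?B y * ?A (y + x) \<partial>L) \<partial>M)"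
    by (rule Fubini'[symmetric, OF measurable(1)])
  also have "\<dots> = (\<integral>\<^sup>+x. (\<integral>\<^sup>+y. ?B (y - x) * ?A y \<partial>L) \<partial>M)"
  proof (rule nn_integral_cong_AE, use M.AE_V in eventually_elim)
    fix x assume "x \<in> V"
    then have "- x \<in> V" using L.subspace_V by (simp add: subspace_neg)
    from L.nn_integral_plus[OF this, of "\<lambda>y. ?B y * ?A (y + x)"]
    show "(\<integral>\<^sup>+y. ?B y * ?A (y + x) \<partial>L) = (\<integral>\<^sup>+y. ?B (y - x) * ?A y \<partial>L)" by simp
  qed
  also have "\<dots> = (\<integral>\<^sup>+y. (\<integral>\<^sup>+x. ?B (y - x) * ?A y \<partial>M) \<partial>L)"
    by (rule Fubini'[OF measurable(2)])
  also have "\<dots> = (\<integral>\<^sup>+y. emeasure M (ball 0 1) * ?A y \<partial>L)"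
    by (rule nn_integral_cong_AE)
      (use L.AE_V in eventually_elim, simp add: nn_integral_multc M.nn_integral_indicator_ball_minus)
  also have "\<dots> = emeasure M (ball 0 1) * emeasure L A" by (simp add: nn_integral_cmult)
  finally show ?thesis .
qed

context haar_on
begin

lemma haar_on_eq_scale_measure:
  assumes M: "haar_on V M" and A: "A \<in> sets borel" "emeasure L A \<noteq> 0" "emeasure L A \<noteq> \<infinity>"
    and eq: "emeasure M A = c * emeasure L A"
  shows "M = scale_measure c L"
proof (rule measure_eqI)
  interpret M: haar_on V M by fact
  let ?b = "emeasure L (ball 0 1)"
  have cancel: "x = y" if "z * x = z * y" "z \<noteq> 0" "z \<noteq> \<infinity>" for x y z :: ennreal
    using that by (simp add: ennreal_mult_cancel_left)
  have "emeasure L A * emeasure M (ball 0 1) = emeasure L A * (c * ?b)"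
    using haar_on_unique[OF haar_on_axioms M A(1)] by (simp add: eq ac_simps)
  then have ball: "emeasure M (ball 0 1) = c * ?b" by (rule cancel[OF _ A(2,3)])
  show "sets M = sets (scale_measure c L)" by simp
  fix B assume "B \<in> sets M"
  then have "?b * emeasure M B = ?b * (c * emeasure L B)"
    using haar_on_unique[OF haar_on_axioms M, of B] by (simp add: ball ac_simps)
  then show "emeasure M B = emeasure (scale_measure c L) B"
    using emeasure_ball_pos[of 1] emeasure_ball_finite[of 1] by (auto dest!: cancel)
qed

lemma haar_on_image:
  assumes T: "linear T" "T ` V = V" "inj_on T V"
  shows "haar_on V (distr L borel T)"
proof
  have [simp, measurable]: "T \<in> borel_measurable borel" "T \<in> borel_measurable L"
    using T(1) borel_measurable_linear measurable_L by auto
  have bl: "bounded_linear T" using T(1) linear_conv_bounded_linear by blast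
  show "AE x in distr L borel T. x \<in> V"
    using subspace_V AE_V T(2)
    by (subst AE_distr_iff) (auto simp: borel_closed closed_subspace elim!: eventually_mono)
  show "distr (distr L borel T) borel ((+) a) = distr L borel T" if a: "a \<in> V" for a
  proof -
    obtain b where b: "b \<in> V" "a = T b" using a T(2) by (metis imageE)
    have "distr (distr L borel T) borel ((+) a) = distr (distr L borel ((+) b)) borel T"
      by (subst (1 2) distr_distr) (auto simp: comp_def b linear_add[OF T(1)])
    then show ?thesis using distr_plus b by simp
  qed
  fix r :: real
  obtain c where c: "c > 0" "\<And>x. x \<in> V \<Longrightarrow> c * norm x \<le> norm (T x)"
    using injective_imp_isometric[OF closed_subspace[OF subspace_V] subspace_V bl] T
      linear_inj_on_iff_eq_0[OF T(1) subspace_V]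
    by blast
  have "emeasure L (T -` cball 0 r) \<le> emeasure L (cball 0 (r / c))"
    by (rule emeasure_mono_AE)
      (use AE_V c in \<open>auto elim!: eventually_mono simp: field_simps intro: order_trans\<close>)
  then show "emeasure (distr L borel T) (cball 0 r) < \<infinity>"
    using emeasure_cball_finite[of "r / c"] by (subst emeasure_distr) (auto intro: le_less_trans)
  assume r: "r > 0"
  obtain B where B: "B > 0" "\<And>x. norm (T x) \<le> norm x * B"
    using bounded_linear.pos_bounded[OF bl] by blast
  have "0 < emeasure L (ball 0 (r / B))" using r B by (intro emeasure_ball_pos) simp
  also have "\<dots> \<le> emeasure L (T -` ball 0 r)"
  proof (intro emeasure_mono subsetI)
    fix x :: 'a assume "x \<in> ball 0 (r / B)"
    then have "norm x * B < r" using B by (simp add: field_simps)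
    then show "x \<in> T -` ball 0 r" using B(2)[of x] by auto
  qed (use measurable_sets_borel[of T borel "ball 0 r"] in simp)
  finally show "0 < emeasure (distr L borel T) (ball 0 r)" by (subst emeasure_distr) auto
qed (use subspace_V in auto)

lemma distr_isometry:
  assumes T: "linear T" "T ` V = V" "\<And>x. x \<in> V \<Longrightarrow> norm (T x) = norm x"
  shows "distr L borel T = L"
proof -
  have [simp, measurable]: "T \<in> borel_measurable borel" "T \<in> borel_measurable L"
    using T(1) borel_measurable_linear measurable_L by auto
  have "inj_on T V" using T(3) linear_inj_on_iff_eq_0[OF T(1) subspace_V] by (metis norm_eq_zero)
  then have "haar_on V (distr L borel T)" using T haar_on_image by blast
  moreover have "emeasure (distr L borel T) (ball 0 1) = emeasure L (ball 0 1)"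
  proof -
    have "emeasure L (T -` ball 0 1) = emeasure L (ball 0 1)"
      by (rule emeasure_eq_AE)
        (use AE_V T(3) measurable_sets_borel[of T borel "ball 0 1"] in \<open>auto elim!: eventually_mono\<close>)
    then show ?thesis by (subst emeasure_distr) auto
  qed
  ultimately have "distr L borel T = scale_measure 1 L"
    using emeasure_ball_pos[of 1] emeasure_ball_finite[of 1]
    by (intro haar_on_eq_scale_measure[of _ "ball 0 1"]) auto
  then show ?thesis by simp
qed

lemma nn_integral_isometry:
  assumes T: "linear T" "T ` V = V" "\<And>x. x \<in> V \<Longrightarrow> norm (T x) = norm x"
    and [measurable]: "f \<in> borel_measurable borel"
  shows "(\<integral>\<^sup>+x. f (T x) \<partial>L) = (\<integral>\<^sup>+x. f x \<partial>L)"
proof -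
  have [measurable]: "T \<in> borel_measurable L" using T(1) borel_measurable_linear measurable_L by blast
  have "(\<integral>\<^sup>+x. f x \<partial>L) = (\<integral>\<^sup>+x. f x \<partial>distr L borel T)" using distr_isometry T by simp
  then show ?thesis by (simp add: nn_integral_distr)
qed

end

section \<open>Lebesgue measure in an orthogonal frame\<close>

lemma distr_PiM_lborel_plus:
  fixes a :: "'i \<Rightarrow> real"
  assumes I: "finite I"
  shows "distr (PiM I (\<lambda>_. lborel)) (PiM I (\<lambda>_. lborel)) (\<lambda>f. \<lambda>i\<in>I. a i + f i) = PiM I (\<lambda>_. lborel)"
proof -
  interpret product_sigma_finite "\<lambda>_. lborel :: real measure" by standard
  show ?thesis
  proof (rule PiM_eqI[OF I])
    have [intro]: "(+) c -` S \<in> sets borel" if "S \<in> sets borel" for c :: real and S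
      using measurable_sets_borel[OF _ that, of "(+) c"] by simp
    fix A :: "'i \<Rightarrow> real set" assume A: "\<And>i. i \<in> I \<Longrightarrow> A i \<in> sets lborel"
    have "emeasure (distr (PiM I (\<lambda>_. lborel)) (PiM I (\<lambda>_. lborel)) (\<lambda>f. \<lambda>i\<in>I. a i + f i)) (Pi\<^sub>E I A)
       = emeasure (PiM I (\<lambda>_. lborel)) (Pi\<^sub>E I (\<lambda>i. (+) (a i) -` A i))"
      using I A by (subst emeasure_distr)
        (auto intro!: arg_cong2[where f = emeasure] sets_PiM_I_finite simp: space_PiM PiE_iff)
    also have "\<dots> = (\<Prod>i\<in>I. emeasure lborel ((+) (a i) -` A i))"
      using I A by (intro emeasure_PiM) auto
    also have "\<dots> = (\<Prod>i\<in>I. emeasure lborel (A i))"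
    proof (rule prod.cong[OF refl])
      fix i assume "i \<in> I"
      then have "emeasure (distr lborel borel ((+) (a i))) (A i) = emeasure lborel ((+) (a i) -` A i)"
        using A by (subst emeasure_distr) auto
      then show "emeasure lborel ((+) (a i) -` A i) = emeasure lborel (A i)"
        by (simp add: lborel_distr_plus)
    qed
    finally show "emeasure (distr (PiM I (\<lambda>_. lborel)) (PiM I (\<lambda>_. lborel))
        (\<lambda>f. \<lambda>i\<in>I. a i + f i)) (Pi\<^sub>E I A)
       = (\<Prod>i\<in>I. emeasure lborel (A i))" .
  qed simp
qed

locale frame =
  fixes I :: "'i set" and e :: "'i \<Rightarrow> 'a::euclidean_space"
  assumes finite_I: "finite I" and nonzero: "\<And>i. i \<in> I \<Longrightarrow> e i \<noteq> 0"
    and orthogonal: "\<And>i j. i \<in> I \<Longrightarrow> j \<in> I \<Longrightarrow> i \<noteq> j \<Longrightarrow> e i \<bullet> e j = 0"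
begin

definition comb :: "('i \<Rightarrow> real) \<Rightarrow> 'a" where
  "comb f = (\<Sum>i\<in>I. f i *\<^sub>R e i)"

definition frame_span :: "'a set" where
  "frame_span = range comb"

definition leb :: "'a measure" where
  "leb = distr (PiM I (\<lambda>_. lborel)) borel comb"

sublocale product_sigma_finite "\<lambda>_. lborel :: real measure" by standard

lemma measurable_comb [measurable]: "comb \<in> borel_measurable (PiM I (\<lambda>_. lborel))"
  unfolding comb_def[abs_def] by measurable

lemma comb_restrict: "comb (restrict f I) = comb f" unfolding comb_def by (intro sum.cong) auto

lemma comb_add: "comb (\<lambda>i. f i + g i) = comb f + comb g"
  by (simp add: comb_def algebra_simps sum.distrib)

lemma comb_scale: "comb (\<lambda>i. t * f i) = t *\<^sub>R comb f"
  by (simp add: comb_def scaleR_sum_right)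

lemma comb_in_span: "comb f \<in> frame_span" by (simp add: frame_span_def)

lemma subspace_span: "subspace frame_span"
  unfolding frame_span_def
proof (rule subspaceI)
  show "0 \<in> range comb" by (rule image_eqI[of _ _ "\<lambda>_. 0"]) (auto simp: comb_def)
qed (auto simp: comb_add[symmetric] comb_scale[symmetric])

lemma e_in_span: "i \<in> I \<Longrightarrow> e i \<in> frame_span"
  unfolding frame_span_def by (rule image_eqI[of _ _ "\<lambda>j. if j = i then 1 else 0"])
    (use finite_I in \<open>auto simp: comb_def if_distrib[of "\<lambda>x. x *\<^sub>R _"] cong: if_cong\<close>)

lemma comb_inner:
  assumes i: "i \<in> I" shows "comb f \<bullet> e i = f i * (norm (e i))\<^sup>2"
proof -
  have "comb f \<bullet> e i = (\<Sum>j\<in>I. f j * (e j \<bullet> e i))" by (simp add: comb_def inner_sum_left)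
  also have "\<dots> = f i * (e i \<bullet> e i)" using finite_I i orthogonal by (subst sum.remove[of _ i]) auto
  finally show ?thesis by (simp add: power2_norm_eq_inner)
qed

lemma parseval:
  assumes "y \<in> frame_span"
  shows "(\<Sum>i\<in>I. ((e i /\<^sub>R norm (e i)) \<bullet> y)\<^sup>2) = (norm y)\<^sup>2"
proof -
  obtain f where f: "y = comb f" using assms by (auto simp: frame_span_def)
  have "(norm y)\<^sup>2 = (\<Sum>i\<in>I. f i * (comb f \<bullet> e i))"
    unfolding f power2_norm_eq_inner by (subst (2) comb_def) (simp add: inner_sum_right)
  also have "\<dots> = (\<Sum>i\<in>I. ((e i /\<^sub>R norm (e i)) \<bullet> y)\<^sup>2)"
  proof (rule sum.cong[OF refl])
    fix i assume i: "i \<in> I"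
    show "f i * (comb f \<bullet> e i) = ((e i /\<^sub>R norm (e i)) \<bullet> y)\<^sup>2"
      using nonzero[OF i] comb_inner[OF i, of f] unfolding f
      by (simp add: inner_commute[of "e i"] power2_eq_square divide_simps)
  qed
  finally show ?thesis by simp
qed

lemma emeasure_leb:
  "A \<in> sets borel \<Longrightarrow>
    emeasure leb A = emeasure (PiM I (\<lambda>_. lborel)) (comb -` A \<inter> space (PiM I (\<lambda>_. lborel)))"
  unfolding leb_def by (rule emeasure_distr) simp_all

lemma distr_leb_plus:
  assumes "a \<in> frame_span" shows "distr leb borel ((+) a) = leb"
proof -
  obtain g where g: "a = comb g" using assms by (auto simp: frame_span_def)
  have "distr leb borel ((+) a) = distr (PiM I (\<lambda>_. lborel)) borel (\<lambda>f. comb g + comb f)"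
    unfolding leb_def g by (subst distr_distr) (auto simp: comp_def)
  also have "\<dots> = distr (distr (PiM I (\<lambda>_. lborel)) (PiM I (\<lambda>_. lborel))
      (\<lambda>f. \<lambda>i\<in>I. g i + f i)) borel comb"
    by (subst distr_distr) (auto simp: comp_def comb_restrict comb_add)
  finally show ?thesis by (simp add: distr_PiM_lborel_plus[OF finite_I] leb_def)
qed

lemma emeasure_leb_cball_finite: "emeasure leb (cball 0 r) < \<infinity>"
proof -
  let ?P = "PiM I (\<lambda>_. lborel) :: ('i \<Rightarrow> real) measure"
    and ?Q = "Pi\<^sub>E I (\<lambda>i. {- r / norm (e i) .. r / norm (e i)})"
  have "comb -` cball 0 r \<inter> space ?P \<subseteq> ?Q"
  proof (intro subsetI PiE_I)
    fix f i assume f: "f \<in> comb -` cball 0 r \<inter> space ?P" and i: "i \<in> I"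
    have "\<bar>f i * (norm (e i))\<^sup>2\<bar> \<le> norm (comb f) * norm (e i)"
      unfolding comb_inner[OF i, symmetric] by (rule Cauchy_Schwarz_ineq2)
    also have "\<dots> \<le> r * norm (e i)" using f by (intro mult_right_mono) auto
    finally have "\<bar>f i\<bar> * norm (e i) \<le> r"
      using nonzero[OF i] by (simp add: abs_mult power2_eq_square mult.assoc[symmetric])
    then have "\<bar>f i\<bar> \<le> r / norm (e i)" using nonzero[OF i] by (simp add: field_simps)
    then show "f i \<in> {- r / norm (e i) .. r / norm (e i)}" by auto
  qed (auto simp: space_PiM PiE_iff extensional_def)
  then have "emeasure leb (cball 0 r) \<le> emeasure ?P ?Q"
    using finite_I by (subst emeasure_leb) (auto intro!: emeasure_mono sets_PiM_I_finite)
  also have "\<dots> < \<infinity>"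
    using finite_I by (subst emeasure_PiM) (simp_all add: emeasure_lborel_Icc_eq prod_ennreal)
  finally show ?thesis .
qed

lemma emeasure_leb_ball_pos:
  assumes r: "r > 0" shows "emeasure leb (ball 0 r) > 0"
proof -
  let ?P = "PiM I (\<lambda>_. lborel) :: ('i \<Rightarrow> real) measure"
  define s where "s = (\<Sum>i\<in>I. norm (e i))"
  have s: "0 \<le> s" by (simp add: s_def sum_nonneg)
  define \<delta> where "\<delta> = r / (s + 1)"
  have \<delta>: "\<delta> > 0" "\<delta> * (s + 1) = r" using r s by (simp_all add: \<delta>_def)
  have "Pi\<^sub>E I (\<lambda>i. {-\<delta>..\<delta>}) \<subseteq> comb -` ball 0 r \<inter> space ?P"
  proof
    fix f assume f: "f \<in> Pi\<^sub>E I (\<lambda>i. {-\<delta>..\<delta>})"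
    have "norm (comb f) \<le> (\<Sum>i\<in>I. \<delta> * norm (e i))"
      unfolding comb_def
    proof (rule sum_norm_le)
      fix i assume "i \<in> I"
      then have "\<bar>f i\<bar> \<le> \<delta>" using f by (auto simp: PiE_iff abs_le_iff)
      then show "norm (f i *\<^sub>R e i) \<le> \<delta> * norm (e i)" by (simp add: mult_right_mono)
    qed
    also have "\<dots> < r" using \<delta> by (simp add: s_def sum_distrib_left[symmetric] distrib_left)
    finally show "f \<in> comb -` ball 0 r \<inter> space ?P"
      using f by (auto simp: space_PiM PiE_iff)
  qed
  then have "emeasure ?P (Pi\<^sub>E I (\<lambda>i. {-\<delta>..\<delta>})) \<le> emeasure leb (ball 0 r)"
    by (subst emeasure_leb) (auto intro!: emeasure_mono)
  moreover have "0 < emeasure ?P (Pi\<^sub>E I (\<lambda>i. {-\<delta>..\<delta>}))"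
    using finite_I \<delta> by (subst emeasure_PiM) (simp_all add: emeasure_lborel_Icc_eq ennreal_power)
  ultimately show ?thesis by (rule less_le_trans[rotated])
qed

sublocale haar_on frame_span leb
proof
  show "sets leb = sets borel" by (simp add: leb_def)
  have "frame_span \<in> sets borel" using subspace_span by (simp add: borel_closed closed_subspace)
  then show "AE x in leb. x \<in> frame_span"
    unfolding leb_def by (subst AE_distr_iff) (simp_all add: comb_in_span)
qed (simp_all add: subspace_span distr_leb_plus emeasure_leb_cball_finite[simplified]
    emeasure_leb_ball_pos)

lemma nn_integral_leb_Un:
  assumes IJ: "I = A \<union> B" "A \<inter> B = {}" and f [measurable]: "f \<in> borel_measurable borel"
  shows "(\<integral>\<^sup>+x. f x \<partial>leb) = (\<integral>\<^sup>+x. (\<integral>\<^sup>+y. f (x + y) \<partial>frame.leb B e) \<partial>frame.leb A e)"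
proof -
  interpret A: frame A e using IJ finite_I nonzero orthogonal by unfold_locales auto
  interpret B: frame B e using IJ finite_I nonzero orthogonal by unfold_locales auto
  have merge: "comb (merge A B (x, y)) = A.comb x + B.comb y" for x y
  proof -
    have "(\<Sum>i\<in>A. merge A B (x, y) i *\<^sub>R e i) = (\<Sum>i\<in>A. x i *\<^sub>R e i)"
      by (rule sum.cong) (auto simp: merge_def)
    moreover have "(\<Sum>i\<in>B. merge A B (x, y) i *\<^sub>R e i) = (\<Sum>i\<in>B. y i *\<^sub>R e i)"
      using IJ by (intro sum.cong) (auto simp: merge_def)
    ultimately show ?thesis
      unfolding comb_def A.comb_def B.comb_def unfolding IJ(1)
      using IJ(2) A.finite_I B.finite_I by (simp add: sum.union_disjoint)
  qed
  have "(\<lambda>x. f (comb x)) \<in> borel_measurable (PiM (A \<union> B) (\<lambda>_. lborel))"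
    using measurable_compose[OF measurable_comb f] unfolding IJ(1)[symmetric] .
  moreover have "(\<integral>\<^sup>+x. f x \<partial>leb) = (\<integral>\<^sup>+x. f (comb x) \<partial>PiM (A \<union> B) (\<lambda>_. lborel))"
    unfolding leb_def IJ(1)[symmetric] by (rule nn_integral_distr) simp_all
  ultimately have "(\<integral>\<^sup>+x. f x \<partial>leb) =
      (\<integral>\<^sup>+x. (\<integral>\<^sup>+y. f (comb (merge A B (x, y))) \<partial>PiM B (\<lambda>_. lborel)) \<partial>PiM A (\<lambda>_. lborel))"
    using IJ A.finite_I B.finite_I by (simp add: product_nn_integral_fold)
  also have "\<dots> = (\<integral>\<^sup>+x. (\<integral>\<^sup>+y. f (A.comb x + y) \<partial>B.leb) \<partial>PiM A (\<lambda>_. lborel))"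
    unfolding merge B.leb_def by (subst nn_integral_distr) auto
  also have "\<dots> = (\<integral>\<^sup>+x. (\<integral>\<^sup>+y. f (x + y) \<partial>B.leb) \<partial>A.leb)"
  proof -
    have "(\<lambda>p. f (fst p + snd p)) \<in> borel_measurable (borel \<Otimes>\<^sub>M borel)" by measurable
    then have "(\<lambda>(x, y). f (x + y)) \<in> borel_measurable (borel \<Otimes>\<^sub>M B.leb)"
      by (simp add: measurable_cong_sets[OF sets_pair_measure_cong[OF refl B.sets_L] refl]
          case_prod_beta')
    then have "(\<lambda>x. \<integral>\<^sup>+y. f (x + y) \<partial>B.leb) \<in> borel_measurable borel"
      by (rule B.borel_measurable_nn_integral)
    then show ?thesis unfolding A.leb_def by (subst nn_integral_distr) auto
  qed
  finally show ?thesis .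
qed

lemma nn_integral_leb_singleton:
  assumes I: "I = {i}" and f: "f \<in> borel_measurable borel"
  shows "(\<integral>\<^sup>+x. f x \<partial>leb) = (\<integral>\<^sup>+t. f (t *\<^sub>R e i) \<partial>lborel)"
proof -
  have "(\<lambda>t. f (t *\<^sub>R e i)) \<in> borel_measurable borel"
    by (rule measurable_compose[OF _ f]) measurable
  then have "(\<integral>\<^sup>+x. f (x i *\<^sub>R e i) \<partial>PiM {i} (\<lambda>_. lborel)) = (\<integral>\<^sup>+t. f (t *\<^sub>R e i) \<partial>lborel)"
    by (intro product_nn_integral_singleton) simp
  moreover have "(\<integral>\<^sup>+x. f x \<partial>leb) = (\<integral>\<^sup>+x. f (comb x) \<partial>PiM I (\<lambda>_. lborel))"
    unfolding leb_def by (rule nn_integral_distr) (simp_all add: f)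
  moreover have "comb x = x i *\<^sub>R e i" for x unfolding comb_def unfolding I by simp
  ultimately show ?thesis by (simp add: I)
qed

definition cell :: "('i \<Rightarrow> real) \<Rightarrow> 'a set" where
  "cell t = {x. \<forall>i\<in>I. 0 \<le> x \<bullet> e i \<and> x \<bullet> e i \<le> t i * (norm (e i))\<^sup>2}"

lemma cell_borel [measurable]: "cell t \<in> sets borel"
proof -
  have "cell t = (\<Inter>i\<in>I. {x. 0 \<le> x \<bullet> e i} \<inter> {x. x \<bullet> e i \<le> t i * (norm (e i))\<^sup>2})"
    by (auto simp: cell_def)
  also have "closed \<dots>" by (intro closed_INT ballI closed_Int closed_Collect_le continuous_intros)
  finally show ?thesis by (rule borel_closed)
qed

lemma comb_in_cell_iff: "comb f \<in> cell t \<longleftrightarrow> (\<forall>i\<in>I. 0 \<le> f i \<and> f i \<le> t i)"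
  using nonzero by (auto simp: cell_def comb_inner zero_le_mult_iff)

lemma emeasure_leb_cell:
  assumes t: "\<And>i. i \<in> I \<Longrightarrow> t i > 0"
  shows "emeasure leb (cell t) = ennreal (\<Prod>i\<in>I. t i)"
proof -
  have "comb -` cell t \<inter> space (PiM I (\<lambda>_. lborel)) = Pi\<^sub>E I (\<lambda>i. {0..t i})"
    by (auto simp: comb_in_cell_iff space_PiM PiE_iff)
  then have "emeasure leb (cell t) = emeasure (PiM I (\<lambda>_. lborel)) (Pi\<^sub>E I (\<lambda>i. {0..t i}))"
    by (simp add: emeasure_leb)
  also have "\<dots> = (\<Prod>i\<in>I. ennreal (t i))"
    using finite_I t by (subst emeasure_PiM) (auto intro!: prod.cong simp: less_imp_le)
  also have "\<dots> = ennreal (\<Prod>i\<in>I. t i)" using t by (intro prod_ennreal) (auto simp: less_imp_le)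
  finally show ?thesis .
qed

context
  fixes T :: "'a \<Rightarrow> 'a" and t :: "'i \<Rightarrow> real"
  assumes T: "linear T" and t: "\<And>i. i \<in> I \<Longrightarrow> t i > 0" and T_e: "\<And>i. i \<in> I \<Longrightarrow> T (e i) = t i *\<^sub>R e i"
begin

lemma diag_comb: "T (comb f) = comb (\<lambda>i. t i * f i)"
  using T_e by (simp add: comb_def linear_sum[OF T] linear_cmul[OF T] mult.commute)

lemma diag_image_span: "T ` frame_span = frame_span"
proof -
  have "comb f \<in> T ` range comb" for f
  proof
    show "comb f = T (comb (\<lambda>i. f i / t i))"
      unfolding diag_comb unfolding comb_def
      using t by (intro sum.cong) (auto simp: less_imp_neq[THEN not_sym])
  qed simp
  then show ?thesis by (auto simp: frame_span_def diag_comb)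
qed

lemma diag_inj_on_span: "inj_on T frame_span"
proof (rule linear_inj_on_iff_eq_0[THEN iffD2, OF T subspace_span], safe)
  fix x assume x: "x \<in> frame_span" "T x = 0"
  then obtain f where f: "x = comb f" by (auto simp: frame_span_def)
  have "f i = 0" if i: "i \<in> I" for i
    using comb_inner[OF i, of "\<lambda>i. t i * f i"] x i t[OF i] nonzero[OF i] by (auto simp: f diag_comb)
  then show "x = 0" by (simp add: f comb_def)
qed

lemma distr_leb_diag: "distr leb borel T = scale_measure (ennreal (\<Prod>i\<in>I. 1 / t i)) leb"
proof (rule haar_on_eq_scale_measure)
  have T_borel [measurable]: "T \<in> borel_measurable borel" by (rule borel_measurable_linear[OF T])
  have unit: "emeasure leb (cell (\<lambda>_. 1)) = 1" using emeasure_leb_cell[of "\<lambda>_. 1"] by simp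
  then show "emeasure leb (cell (\<lambda>_. 1)) \<noteq> 0" "emeasure leb (cell (\<lambda>_. 1)) \<noteq> \<infinity>" by simp_all
  have "emeasure (distr leb borel T) (cell (\<lambda>_. 1)) = emeasure leb (T -` cell (\<lambda>_. 1))"
    by (subst emeasure_distr) auto
  also have "\<dots> = emeasure leb (cell (\<lambda>i. 1 / t i))"
  proof (rule emeasure_eq_AE, use AE_V in eventually_elim)
    fix x assume "x \<in> frame_span"
    then obtain f where f: "x = comb f" by (auto simp: frame_span_def)
    have "0 \<le> t i * f i \<and> t i * f i \<le> 1 \<longleftrightarrow> 0 \<le> f i \<and> f i \<le> 1 / t i" if "i \<in> I" for i
      using t[OF that] by (simp add: zero_le_mult_iff pos_le_divide_eq mult.commute)
    then show "x \<in> T -` cell (\<lambda>_. 1) \<longleftrightarrow> x \<in> cell (\<lambda>i. 1 / t i)"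
      by (simp add: f diag_comb comb_in_cell_iff)
  qed (use measurable_sets_borel[OF T_borel, of "cell (\<lambda>_. 1)"] in simp_all)
  also have "\<dots> = ennreal (\<Prod>i\<in>I. 1 / t i)" using t by (intro emeasure_leb_cell) auto
  finally show "emeasure (distr leb borel T) (cell (\<lambda>_. 1)) =
      ennreal (\<Prod>i\<in>I. 1 / t i) * emeasure leb (cell (\<lambda>_. 1))"
    by (simp add: unit)
qed (intro haar_on_image T diag_image_span diag_inj_on_span cell_borel)+

lemma nn_integral_diag:
  assumes [measurable]: "f \<in> borel_measurable borel"
  shows "(\<integral>\<^sup>+x. f (T x) \<partial>leb) = ennreal (\<Prod>i\<in>I. 1 / t i) * (\<integral>\<^sup>+x. f x \<partial>leb)"
proof -
  have [measurable]: "T \<in> borel_measurable leb" using borel_measurable_linear[OF T]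
    by (rule measurable_L)
  have "(\<integral>\<^sup>+x. f (T x) \<partial>leb) = (\<integral>\<^sup>+x. f x \<partial>distr leb borel T)" by (simp add: nn_integral_distr)
  then show ?thesis by (simp add: distr_leb_diag nn_integral_scale_measure)
qed

end

lemma nn_integral_scale:
  assumes "t > 0" "f \<in> borel_measurable borel"
  shows "(\<integral>\<^sup>+x. f (t *\<^sub>R x) \<partial>leb) = ennreal (t powr - real (card I)) * (\<integral>\<^sup>+x. f x \<partial>leb)"
proof -
  have "(\<Prod>i\<in>I. 1 / t) = t powr - real (card I)"
    using assms(1) by (simp add: powr_minus powr_realpow field_simps power_one_over)
  then show ?thesis using nn_integral_diag[of "\<lambda>x. t *\<^sub>R x" "\<lambda>_. t" f] assms by simp
qed

end

section \<open>Moments of powers of the distance to the unit sphere\<close>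

lemma nn_integral_powr_shift:
  assumes a: "a > (-1::real)" and c: "c \<le> 1"
  shows "(\<integral>\<^sup>+t. indicator {c<..1} t * ennreal ((t - c) powr a) \<partial>lborel) =
      ennreal ((1 - c) powr (a + 1) / (a + 1))"
proof -
  let ?f = "\<lambda>x. ennreal (if x \<in> {0..1-c} then x powr a else 0)"
  have "((\<lambda>x. if x \<in> {0..1-c} then x powr a else 0) has_integral ((1 - c) powr (a + 1) / (a + 1))) UNIV"
    using has_integral_powr_from_0[OF a, of "1 - c"] c by (subst has_integral_restrict_UNIV) simp
  then have "(\<integral>\<^sup>+x. ?f x \<partial>lborel) = ennreal ((1 - c) powr (a + 1) / (a + 1))"
    by (intro nn_integral_has_integral_lborel) auto
  moreover have "(\<integral>\<^sup>+t. indicator {c<..1} t * ennreal ((t - c) powr a) \<partial>lborel) = (\<integral>\<^sup>+x. ?f x \<partial>lborel)"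
    by (subst nn_integral_real_affine[where c = 1 and t = c])
      (auto intro!: nn_integral_cong simp: indicator_def)
  ultimately show ?thesis by simp
qed

definition ball_weight :: "real \<Rightarrow> real \<Rightarrow> 'a::euclidean_space \<Rightarrow> ennreal" where
  "ball_weight a t y = indicator {y. (norm y)\<^sup>2 < t} y * ennreal ((t - (norm y)\<^sup>2) powr a)"

lemma ball_weight_measurable [measurable]: "ball_weight a t \<in> borel_measurable borel"
  unfolding ball_weight_def by measurable

lemma ball_weight_minus [simp]: "ball_weight a t (- y) = ball_weight a t y"
  by (simp add: ball_weight_def indicator_def)

lemma ball_weight_scale:
  assumes t: "t > 0"
  shows "ball_weight a t y = ennreal (t powr a) * ball_weight a 1 ((1 / sqrt t) *\<^sub>R y)"
proof -
  have n: "(norm ((1 / sqrt t) *\<^sub>R y))\<^sup>2 = (norm y)\<^sup>2 / t" using t by (simp add: power_divide)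
  have "(t - (norm y)\<^sup>2) powr a = t powr a * (1 - (norm y)\<^sup>2 / t) powr a" if "(norm y)\<^sup>2 < t"
  proof -
    have "t * (1 - (norm y)\<^sup>2 / t) = t - (norm y)\<^sup>2" "0 \<le> 1 - (norm y)\<^sup>2 / t"
      using t that by (auto simp: field_simps)
    then show ?thesis using t by (metis less_imp_le powr_mult)
  qed
  then show ?thesis using t unfolding ball_weight_def
    by (auto simp: indicator_def n ennreal_mult'[symmetric] simp del: norm_scaleR)
qed

lemma ball_weight_Suc: "ennreal ((norm y)\<^sup>2) * ball_weight a 1 y + ball_weight (a + 1) 1 y =
    ball_weight a 1 y"
proof (cases "(norm y)\<^sup>2 < 1")
  case True
  then have "(norm y)\<^sup>2 * (1 - (norm y)\<^sup>2) powr a + (1 - (norm y)\<^sup>2) powr (a + 1) = (1 - (norm y)\<^sup>2) powr a"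
    by (simp add: powr_add algebra_simps)
  then show ?thesis using True
    by (simp add: ball_weight_def ennreal_mult'[symmetric] ennreal_plus[symmetric] del: ennreal_plus)
qed (simp add: ball_weight_def)

lemma nn_integral_ball_weight_radius:
  assumes a: "a > -1"
  shows "(\<integral>\<^sup>+t. indicator {..1} t * ball_weight a t y \<partial>lborel) =
      ennreal (1 / (a + 1)) * ball_weight (a + 1) 1 y"
proof -
  have "indicator {..1} t * ball_weight a t y =
      indicator {(norm y)\<^sup>2<..1} t * ennreal ((t - (norm y)\<^sup>2) powr a)" for t
    by (auto simp: ball_weight_def indicator_def)
  moreover have "(\<integral>\<^sup>+t. indicator {(norm y)\<^sup>2<..1} t * ennreal ((t - (norm y)\<^sup>2) powr a) \<partial>lborel) =
      ennreal (1 / (a + 1)) * ball_weight (a + 1) 1 y"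
  proof (cases "(norm y)\<^sup>2 < 1")
    case True
    then show ?thesis using a
      by (subst nn_integral_powr_shift) (auto simp: ball_weight_def ennreal_mult'[symmetric])
  next
    case False
    then show ?thesis by (simp add: ball_weight_def)
  qed
  ultimately show ?thesis by simp
qed

lemma ennreal_eq_diffI:
  assumes "X + ennreal y = ennreal c" "0 \<le> y" shows "X = ennreal (c - y)"
  using assms by (metis ennreal_add_diff_cancel_right ennreal_minus ennreal_neq_top)

context frame
begin

definition ball_mass :: "real \<Rightarrow> ennreal" where
  "ball_mass a = (\<integral>\<^sup>+y. ball_weight a 1 y \<partial>leb)"

lemma nn_integral_ball_weight_scaled:
  assumes t: "t > 0"
  shows "(\<integral>\<^sup>+y. ball_weight a t y \<partial>leb) = ennreal (t powr (a + real (card I) / 2)) * ball_mass a"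
proof -
  have "(\<integral>\<^sup>+y. ball_weight a t y \<partial>leb) =
      ennreal (t powr a) * (\<integral>\<^sup>+y. ball_weight a 1 ((1 / sqrt t) *\<^sub>R y) \<partial>leb)"
    unfolding ball_weight_scale[OF t] by (rule nn_integral_cmult) measurable
  also have "\<dots> = ennreal (t powr a) * (ennreal ((1 / sqrt t) powr - real (card I)) * ball_mass a)"
    using t unfolding ball_mass_def by (subst nn_integral_scale) auto
  also have "(1 / sqrt t) powr - real (card I) = t powr (real (card I) / 2)"
    using t by (simp add: powr_half_sqrt[symmetric] powr_divide powr_powr powr_minus)
  finally show ?thesis using t by (simp add: powr_add ennreal_mult' mult.assoc)
qed

lemma ball_mass_Suc:
  assumes a: "a > -1"
  shows "ball_mass (a + 1) = ennreal ((a + 1) / (a + 1 + real (card I) / 2)) * ball_mass a"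
proof -
  interpret P: pair_sigma_finite leb lborel ..
  let ?g = "\<lambda>y t. indicator {..1} t * ball_weight a t (y::'a)" and ?b = "a + real (card I) / 2"
  have "(\<lambda>p. ?g (fst p) (snd p)) \<in> borel_measurable (borel \<Otimes>\<^sub>M borel)"
    unfolding ball_weight_def indicator_def by measurable
  then have g: "(\<lambda>(y, t). ?g y t) \<in> borel_measurable (leb \<Otimes>\<^sub>M lborel)"
    by (intro measurable_pair_lborel) (simp add: case_prod_beta')
  have radial: "(\<integral>\<^sup>+y. ?g y t \<partial>leb) = indicator {0<..1} t * ennreal ((t - 0) powr ?b) * ball_mass a"
    for t
  proof (cases "t > 0")
    case True
    then show ?thesis
      by (subst nn_integral_cmult) (auto simp: nn_integral_ball_weight_scaled indicator_def)
  next
    case False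
    then have "\<not> (norm y)\<^sup>2 < t" for y :: 'a by (meson not_le order_trans zero_le_power2 less_le_trans)
    then show ?thesis using False by (simp add: ball_weight_def)
  qed
  have "ennreal (1 / (a + 1)) * ball_mass (a + 1) = (\<integral>\<^sup>+y. (\<integral>\<^sup>+t. ?g y t \<partial>lborel) \<partial>leb)"
    unfolding nn_integral_ball_weight_radius[OF a] ball_mass_def
    by (rule nn_integral_cmult[symmetric]) measurable
  also have "\<dots> = (\<integral>\<^sup>+t. (\<integral>\<^sup>+y. ?g y t \<partial>leb) \<partial>lborel)" by (rule P.Fubini'[symmetric, OF g])
  also have "\<dots> = (\<integral>\<^sup>+t. indicator {0<..1} t * ennreal ((t - 0) powr ?b) \<partial>lborel) * ball_mass a"
    unfolding radial by (rule nn_integral_multc) measurable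
  also have "\<dots> = ennreal (1 / (?b + 1)) * ball_mass a"
    using a by (subst nn_integral_powr_shift) (auto intro: less_le_trans)
  finally have "ennreal (a + 1) * (ennreal (1 / (a + 1)) * ball_mass (a + 1)) =
    ennreal (a + 1) * (ennreal (1 / (?b + 1)) * ball_mass a)" by simp
  moreover have "?b + 1 = a + 1 + real (card I) / 2" by simp
  ultimately show ?thesis
    using a by (simp add: mult.assoc[symmetric] ennreal_mult'[symmetric] del: add_divide_distrib)
qed

lemma ball_mass_finite:
  assumes a: "a > -1" shows "ball_mass a < \<infinity>"
proof -
  have "ball_mass (a + 1) \<le> (\<integral>\<^sup>+y. indicator (cball 0 1) y \<partial>leb)"
    unfolding ball_mass_def
  proof (rule nn_integral_mono)
    fix y :: 'a
    have "(1 - (norm y)\<^sup>2) powr (a + 1) \<le> 1" "norm y \<le> 1" if "(norm y)\<^sup>2 < 1"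
      using that a abs_square_less_1[of "norm y"] by (auto intro!: powr_le1)
    then show "ball_weight (a + 1) 1 y \<le> indicator (cball 0 1) y"
      by (auto simp: ball_weight_def indicator_def)
  qed
  also have "\<dots> < \<infinity>" using emeasure_cball_finite[of 1] by simp
  finally have "ball_mass (a + 1) < \<infinity>" .
  moreover have "0 < (a + 1) / (a + 1 + real (card I) / 2)" using a by (simp add: add_pos_nonneg)
  ultimately show ?thesis unfolding ball_mass_Suc[OF a]
    by (auto simp: ennreal_mult_less_top)
qed

lemma ball_mass_pos: "ball_mass a > 0"
  unfolding ball_mass_def
proof (rule nn_integral_pos[of _ 0 1])
  fix y :: 'a assume "dist y 0 < 1"
  then have "(norm y)\<^sup>2 < 1" by (simp add: abs_square_less_1)
  then show "0 < ball_weight a 1 y" by (simp add: ball_weight_def)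
qed (simp_all add: subspace_0[OF subspace_span])

lemma nn_integral_ball_weight_norm:
  assumes a: "a > -1"
  shows "(\<integral>\<^sup>+y. ennreal ((norm y)\<^sup>2) * ball_weight a 1 y \<partial>leb) =
     ennreal (real (card I) / (real (card I) + 2 + 2 * a)) * ball_mass a"
    (is "?X = _")
proof -
  let ?m = "real (card I)"
  obtain z where z: "ball_mass a = ennreal z" "0 \<le> z"
    using ball_mass_finite[OF a] by (cases "ball_mass a") auto
  have "?X + ball_mass (a + 1) = ball_mass a"
    unfolding ball_mass_def by (subst nn_integral_add[symmetric]) (simp_all add: ball_weight_Suc)
  then have "?X + ennreal ((a + 1) / (a + 1 + ?m / 2) * z) = ennreal z"
    using a by (simp add: ball_mass_Suc z ennreal_mult'[symmetric])
  then have "?X = ennreal (z - (a + 1) / (a + 1 + ?m / 2) * z)"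
    using a z by (intro ennreal_eq_diffI) auto
  also have "z - (a + 1) / (a + 1 + ?m / 2) * z = ?m / (?m + 2 + 2 * a) * z"
  proof -
    have "0 \<le> ?m" by simp
    then have "?m + 2 + 2 * a > 0" using a by linarith
    then show ?thesis by (simp add: field_simps)
  qed
  finally show ?thesis by (simp add: z ennreal_mult''[symmetric])
qed

lemma nn_integral_ball_weight_inner_cong:
  assumes "c \<in> frame_span" "c' \<in> frame_span" "norm c = norm c'"
  shows "(\<integral>\<^sup>+y. ennreal ((c \<bullet> y)\<^sup>2) * ball_weight a 1 y \<partial>leb) =
      (\<integral>\<^sup>+y. ennreal ((c' \<bullet> y)\<^sup>2) * ball_weight a 1 y \<partial>leb)"
proof (cases "c = c'")
  case False
  define w where "w = c - c'"
  define reflect where "reflect y = y - (2 * (w \<bullet> y) / (w \<bullet> w)) *\<^sub>R w" for y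
  have w: "w \<bullet> w \<noteq> 0" using False by (simp add: w_def)
  have w_span: "w \<in> frame_span" using assms subspace_span by (simp add: w_def subspace_diff)
  have linear: "linear reflect"
    unfolding reflect_def by (auto simp: linear_iff algebra_simps inner_simps add_divide_distrib
        scaleR_add_left)
  have isometry: "reflect x \<bullet> reflect y = x \<bullet> y" for x y
    using w by (simp add: reflect_def inner_simps inner_commute field_simps)
  have involution: "reflect (reflect y) = y" for y
    using w by (simp add: reflect_def inner_simps algebra_simps field_simps)
  have "reflect y \<in> frame_span" if "y \<in> frame_span" for y
    unfolding reflect_def using that w_span subspace_span by (intro subspace_diff subspace_scale)
  then have "reflect ` frame_span = frame_span"
    using involution by (auto intro: image_eqI[of _ reflect, OF involution[symmetric]])
  moreover have "norm (reflect y) = norm y" for y by (simp add: norm_eq_sqrt_inner isometry)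
  moreover have "c \<bullet> reflect y = c' \<bullet> y" for y
  proof -
    have "c \<bullet> c = c' \<bullet> c'" using assms by (simp add: norm_eq_sqrt_inner)
    then have "w \<bullet> w = 2 * (w \<bullet> c)" by (simp add: w_def inner_simps inner_commute)
    then have "reflect c = c'" using w by (simp add: reflect_def w_def)
    then show ?thesis by (metis isometry involution)
  qed
  ultimately show ?thesis
    using nn_integral_isometry[OF linear, of "\<lambda>y. ennreal ((c \<bullet> y)\<^sup>2) * ball_weight a 1 y"]
    by (simp add: ball_weight_def indicator_def)
qed simp

lemma nn_integral_ball_weight_inner:
  assumes a: "a > -1" and c: "c \<in> frame_span" and I0: "I \<noteq> {}"
  shows "(\<integral>\<^sup>+y. ennreal ((c \<bullet> y)\<^sup>2) * ball_weight a 1 y \<partial>leb) =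
     ennreal ((norm c)\<^sup>2 / (real (card I) + 2 + 2 * a)) * ball_mass a"
proof -
  let ?m = "real (card I)"
  define u where "u i = e i /\<^sub>R norm (e i)" for i
  define Q where "Q c = (\<integral>\<^sup>+y. ennreal ((c \<bullet> y)\<^sup>2) * ball_weight a 1 y \<partial>leb)" for c
  have u: "u i \<in> frame_span" "norm (u i) = 1" if "i \<in> I" for i
    using that nonzero subspace_span by (simp_all add: u_def e_in_span subspace_scale)
  obtain i where i: "i \<in> I" using I0 by blast
  have m: "?m > 0" using I0 finite_I by (simp add: card_gt_0_iff)
  have "ennreal ?m * Q (u i) = (\<Sum>j\<in>I. Q (u j))"
  proof -
    have "Q (u j) = Q (u i)" if "j \<in> I" for j
      unfolding Q_def using u that i by (intro nn_integral_ball_weight_inner_cong) auto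
    then show ?thesis by (simp add: ennreal_of_nat_eq_real_of_nat)
  qed
  also have "\<dots> = (\<integral>\<^sup>+y. (\<Sum>j\<in>I. ennreal ((u j \<bullet> y)\<^sup>2) * ball_weight a 1 y) \<partial>leb)"
    unfolding Q_def by (rule nn_integral_sum[symmetric]) measurable
  also have "\<dots> = (\<integral>\<^sup>+y. ennreal ((norm y)\<^sup>2) * ball_weight a 1 y \<partial>leb)"
    by (rule nn_integral_cong_AE, use AE_V in eventually_elim)
      (simp add: sum_distrib_right[symmetric] sum_ennreal parseval[symmetric] u_def)
  finally have "ennreal (1 / ?m) * (ennreal ?m * Q (u i)) =
      ennreal (1 / ?m) * (ennreal (?m / (?m + 2 + 2 * a)) * ball_mass a)"
    by (simp add: nn_integral_ball_weight_norm[OF a])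
  then have unit: "Q (u i) = ennreal (1 / (?m + 2 + 2 * a)) * ball_mass a"
    using m a by (simp add: mult.assoc[symmetric] ennreal_mult'[symmetric])
  have "Q c = Q (norm c *\<^sub>R u i)"
    unfolding Q_def using c u[OF i] subspace_span
    by (intro nn_integral_ball_weight_inner_cong) (auto simp: subspace_scale)
  also have "\<dots> = (\<integral>\<^sup>+y. ennreal ((norm c)\<^sup>2) * (ennreal ((u i \<bullet> y)\<^sup>2) * ball_weight a 1 y) \<partial>leb)"
    by (simp add: Q_def power_mult_distrib ennreal_mult' mult.assoc)
  also have "\<dots> = ennreal ((norm c)\<^sup>2) * Q (u i)" unfolding Q_def by (rule nn_integral_cmult) measurable
  finally have "Q c = ennreal ((norm c)\<^sup>2 / (?m + 2 + 2 * a)) * ball_mass a"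
    by (simp add: unit mult.assoc[symmetric] ennreal_mult'[symmetric])
  then show ?thesis by (simp add: Q_def)
qed

lemma nn_integral_ball_weight_affine:
  assumes a: "a > -1" and c: "c \<in> frame_span" and I0: "I \<noteq> {}"
  shows "(\<integral>\<^sup>+y. ennreal ((p + c \<bullet> y)\<^sup>2) * ball_weight a 1 y \<partial>leb) =
     ennreal (p\<^sup>2 + (norm c)\<^sup>2 / (real (card I) + 2 + 2 * a)) * ball_mass a"
proof -
  let ?f = "\<lambda>y. ennreal ((p + c \<bullet> y)\<^sup>2) * ball_weight a 1 y"
  have "uminus ` frame_span = frame_span"
    using subspace_neg[OF subspace_span] by (force intro: image_eqI[of _ uminus])
  then have "(\<integral>\<^sup>+y. ?f (- y) \<partial>leb) = (\<integral>\<^sup>+y. ?f y \<partial>leb)"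
    by (intro nn_integral_isometry) (auto simp: linear_iff)
  then have "2 * (\<integral>\<^sup>+y. ?f y \<partial>leb) = (\<integral>\<^sup>+y. ?f y \<partial>leb) + (\<integral>\<^sup>+y. ?f (- y) \<partial>leb)"
    by (simp add: mult_2)
  also have "\<dots> = (\<integral>\<^sup>+y. ?f y + ?f (- y) \<partial>leb)"
    by (rule nn_integral_add[symmetric]) measurable
  also have "\<dots> = (\<integral>\<^sup>+y. 2 * (ennreal (p\<^sup>2) * ball_weight a 1 y + ennreal ((c \<bullet> y)\<^sup>2) * ball_weight a 1 y)
      \<partial>leb)"
  proof (rule nn_integral_cong)
    fix y :: 'a
    have "?f y + ?f (- y) = ennreal ((p + c \<bullet> y)\<^sup>2 + (p - c \<bullet> y)\<^sup>2) * ball_weight a 1 y"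
      by (simp add: distrib_right)
    also have "(p + c \<bullet> y)\<^sup>2 + (p - c \<bullet> y)\<^sup>2 = 2 * (p\<^sup>2 + (c \<bullet> y)\<^sup>2)"
      by (simp add: power2_eq_square algebra_simps)
    also have "ennreal \<dots> = 2 * (ennreal (p\<^sup>2) + ennreal ((c \<bullet> y)\<^sup>2))" by (simp add: ennreal_mult')
    finally show "?f y + ?f (- y) =
        2 * (ennreal (p\<^sup>2) * ball_weight a 1 y + ennreal ((c \<bullet> y)\<^sup>2) * ball_weight a 1 y)"
      by (simp add: distrib_right mult.assoc distrib_left)
  qed
  also have "\<dots> = 2 * (ennreal (p\<^sup>2) * ball_mass a + (\<integral>\<^sup>+y. ennreal ((c \<bullet> y)\<^sup>2) * ball_weight a 1 y \<partial>leb))"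
    by (simp add: nn_integral_cmult nn_integral_add ball_mass_def)
  also have "\<dots> = 2 * (ennreal (p\<^sup>2 + (norm c)\<^sup>2 / (real (card I) + 2 + 2 * a)) * ball_mass a)"
    using a by (subst nn_integral_ball_weight_inner[OF a c I0])
      (simp add: distrib_right[symmetric] ennreal_plus[symmetric] add_nonneg_nonneg del: ennreal_plus)
  finally show ?thesis by (simp add: ennreal_mult_cancel_left)
qed

end

section \<open>Column-wise integration over the matrix ball\<close>

definition mat_unit :: "'q::finite \<times> 'q \<times> 4 \<Rightarrow> 'q mat" where
  "mat_unit = (\<lambda>(i, j, k). axis i (axis j (axis k 1)))"

lemma mat_unit_nth: "mat_unit (i, j, k) $ a $ b $ c = (if a = i \<and> b = j \<and> c = k then 1 else 0)"
  by (simp add: mat_unit_def axis_def)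

lemma inner_mat_unit: "mat_unit p \<bullet> mat_unit r = (if p = r then 1 else 0)"
  by (cases p; cases r) (auto simp: mat_unit_def inner_axis_axis)

context field_dim
begin

definition col_idx :: "'q::finite set \<Rightarrow> ('q \<times> 'q \<times> 4) set" where
  "col_idx S = UNIV \<times> S \<times> comps d"

lemma card_col_idx: "card (col_idx (S :: 'q::finite set)) = CARD('q) * (card S * d)"
  by (simp add: col_idx_def card_cartesian_product card_comps)

sublocale col: frame "col_idx S" mat_unit for S :: "'q::finite set"
proof
  show "mat_unit p \<noteq> 0" for p :: "'q \<times> 'q \<times> 4" by (metis inner_mat_unit inner_zero_left zero_neq_one)
qed (simp_all add: inner_mat_unit)

abbreviation col_ball_mass :: "'q::finite \<Rightarrow> real \<Rightarrow> ennreal" where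
  "col_ball_mass l \<equiv> frame.ball_mass (col_idx {l}) mat_unit"

lemma comb_col_nth: "col.comb S f $ i $ j $ k = (if j \<in> S \<and> k \<in> comps d then f (i, j, k) else 0)"
proof -
  have "col.comb S f $ i $ j $ k = (\<Sum>p\<in>col_idx S. f p * (mat_unit p $ i $ j $ k))"
    by (simp add: col.comb_def)
  also have "\<dots> = (\<Sum>p\<in>col_idx S. if p = (i, j, k) then f p else 0)"
    by (intro sum.cong refl) (auto simp: mat_unit_nth split: if_splits)
  finally show ?thesis by (simp add: col_idx_def)
qed

lemma span_col: "col.frame_span S = col_space S"
proof -
  have "x \<in> range (col.comb S)" if "x \<in> col_space S" for x
    by (rule image_eqI[of _ _ "\<lambda>(i, j, k). x$i$j$k"])
      (use that in \<open>auto simp: vec_eq_iff comb_col_nth col_space_def In_M_def\<close>)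
  then show ?thesis by (auto simp: col.frame_span_def col_space_def In_M_def comb_col_nth vec_eq_iff)
qed

lemma AE_col_space: "AE v in col.leb S. v \<in> col_space S"
  using col.AE_V[of S] unfolding span_col .

lemma lebM_eq: "(lebM d :: 'q::finite mat measure) = col.leb UNIV"
proof -
  have "(\<chi> i j k. if k \<in> comps d then f (i,j,k) else 0) = col.comb (UNIV :: 'q set) f" for f
    by (simp add: vec_eq_iff comb_col_nth)
  moreover have "{(i::'q, j::'q, k). k \<in> comps d} = col_idx UNIV" by (auto simp: col_idx_def)
  ultimately show ?thesis by (simp add: lebM_def col.leb_def)
qed

lemma nn_integral_col_unitary:
  fixes f :: "'q::finite mat \<Rightarrow> ennreal"
  assumes u: "unitary d u" and f: "f \<in> borel_measurable borel"
  shows "(\<integral>\<^sup>+y. f (mmul u y) \<partial>col.leb S) = (\<integral>\<^sup>+y. f y \<partial>col.leb S)"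
proof (rule col.nn_integral_isometry[OF linear_mmul_right _ _ f])
  have "m \<in> mmul u ` col_space S" if "m \<in> col_space S" for m
    using that u by (intro image_eqI[of _ _ "mmul (madj u) m"])
      (auto simp: unitary_cancel mmul_col_space)
  then show "mmul u ` col.frame_span S = col.frame_span S"
    unfolding span_col using u by (auto simp: mmul_col_space)
  show "norm (mmul u x) = norm x" for x
    using u by (simp add: norm_eq_sqrt_inner inner_mmul_left unitary_cancel)
qed

lemma nn_integral_col_rdiag:
  fixes f :: "'q::finite mat \<Rightarrow> ennreal"
  assumes s: "\<And>i. 0 < s i" and f: "f \<in> borel_measurable borel"
  shows "(\<integral>\<^sup>+y. f (mmul (rdiag s) y) \<partial>col.leb {l}) =
      ennreal ((\<Prod>i\<in>UNIV. 1 / s i) ^ d) * (\<integral>\<^sup>+y. f y \<partial>col.leb {l})"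
proof -
  have "(\<integral>\<^sup>+y. f (mmul (rdiag s) y) \<partial>col.leb {l}) =
      ennreal (\<Prod>p\<in>col_idx {l}. 1 / s (fst p)) * (\<integral>\<^sup>+y. f y \<partial>col.leb {l})"
    using s f by (intro col.nn_integral_diag linear_mmul_right)
      (auto simp: vec_eq_iff rdiag_mmul_nth mat_unit_nth)
  also have "(\<Prod>p\<in>col_idx {l}. 1 / s (fst p)) = (\<Prod>i\<in>UNIV. \<Prod>r\<in>{l} \<times> comps d. 1 / s i)"
    unfolding col_idx_def prod.cartesian_product by (rule prod.cong) auto
  also have "\<dots> = (\<Prod>i\<in>UNIV. 1 / s i) ^ d"
    by (simp add: card_cartesian_product card_comps prod_power_distrib power_one_over prod_dividef)
  finally show ?thesis .
qed

lemma nn_integral_col_mmul: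
  fixes f :: "'q::finite mat \<Rightarrow> ennreal"
  assumes h: "h \<in> OmegaQ d" and f: "f \<in> borel_measurable borel"
  shows "(\<integral>\<^sup>+y. f y \<partial>col.leb {l}) = ennreal (Delta d h ^ d) * (\<integral>\<^sup>+y. f (mmul h y) \<partial>col.leb {l})"
proof -
  obtain u s where u: "unitary d u" "h = conj_rdiag u s" and s: "\<And>i. 0 < s i"
    using h by (metis spectral_pd)
  have [measurable]: "(\<lambda>y. f (mmul x y)) \<in> borel_measurable borel" for x
    using measurable_compose[OF borel_measurable_linear[OF linear_mmul_right] f] .
  have Delta: "Delta d h = (\<Prod>i\<in>UNIV. s i)" using u s by (simp add: Delta_conj_rdiag less_imp_le)
  then have pos: "0 < Delta d h" using s by (simp add: prod_pos)
  have "(\<integral>\<^sup>+y. f (mmul h y) \<partial>col.leb {l}) =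
      (\<integral>\<^sup>+y. f (mmul u (mmul (rdiag s) (mmul (madj u) y))) \<partial>col.leb {l})"
    by (simp add: u mmul_assoc)
  also have "\<dots> = (\<integral>\<^sup>+y. f (mmul u (mmul (rdiag s) y)) \<partial>col.leb {l})"
    by (rule nn_integral_col_unitary[OF unitary_madj[OF u(1)], of "\<lambda>y. f (mmul u (mmul (rdiag s) y))"])
      (simp add: mmul_assoc[symmetric])
  also have "\<dots> = ennreal ((\<Prod>i\<in>UNIV. 1 / s i) ^ d) * (\<integral>\<^sup>+y. f (mmul u y) \<partial>col.leb {l})"
    by (rule nn_integral_col_rdiag[OF s]) measurable
  also have "(\<integral>\<^sup>+y. f (mmul u y) \<partial>col.leb {l}) = (\<integral>\<^sup>+y. f y \<partial>col.leb {l})"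
    by (rule nn_integral_col_unitary[OF u(1) f])
  also have "(\<Prod>i\<in>UNIV. 1 / s i) ^ d = 1 / Delta d h ^ d"
    by (simp add: Delta prod_dividef power_one_over)
  finally show ?thesis using pos by (simp add: mult.assoc[symmetric] ennreal_mult'[symmetric])
qed

lemma Delta_powr_mid_minus_col:
  "y \<in> col_space {l} \<Longrightarrow> ennreal (Delta_powr a (mid - mmul y (madj y))) = ball_weight a 1 y"
  using mid_minus_col[of y l] by (simp add: Delta_powr_def ball_weight_def)

lemma Delta_powr_minus_mmul_madj_measurable [measurable]:
  "(\<lambda>v. Delta_powr a (A - mmul v (madj v))) \<in> borel_measurable borel"
  by (rule measurable_compose[OF borel_measurable_continuous_onI Delta_powr_measurable])
    (intro continuous_intros)

lemma Delta_powr_minus_mmul_col: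
  assumes h: "h \<in> OmegaQ d" and y: "y \<in> col_space {l}"
  shows "ennreal (Delta_powr a (mmul h h - mmul (mmul h y) (madj (mmul h y)))) =
    ennreal (Delta d (mmul h h) powr a) * ball_weight a 1 y"
proof -
  have h': "madj h = h" "In_M d h" using h by simp_all
  obtain g where g: "g \<in> OmegaQ d" "mmul h g = mid" using OmegaQ_inverse[OF h] by metis
  have residual: "mmul h h - mmul (mmul h y) (madj (mmul h y)) =
      mmul h (mmul (mid - mmul y (madj y)) (madj h))"
    using h' by (simp add: mmul_assoc)
  have "Delta_powr a (mmul h h - mmul (mmul h y) (madj (mmul h y))) =
      Delta d (mmul h h) powr a * Delta_powr a (mid - mmul y (madj y))"
    unfolding residual using Delta_powr_conj[OF h'(2) _ g(2), of a "mid - mmul y (madj y)"] g(1)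
    by (simp add: h' del: madj_mmul mmul_linear)
  then show ?thesis by (simp add: Delta_powr_mid_minus_col[OF y, symmetric] ennreal_mult')
qed

text \<open>One column is integrated out by the substitution \<open>w = A\<^sup>1\<^sup>/\<^sup>2 y\<close>.\<close>

lemma nn_integral_column_pd:
  fixes A :: "'q::finite mat"
  assumes a: "a > -1" and A: "A \<in> OmegaQ d" and b: "b \<in> col_space {l}"
  shows "(\<integral>\<^sup>+w. ennreal ((p + b \<bullet> w)\<^sup>2 * Delta_powr a (A - mmul w (madj w))) \<partial>col.leb {l}) =
    ennreal ((p\<^sup>2 + (b \<bullet> mmul A b) / (real (d * CARD('q)) + 2 + 2 * a)) * Delta_powr (a + real d / 2) A)
      * col_ball_mass l a"
proof -
  define h where "h = msqrt d A"
  have h: "h \<in> OmegaQ d" "mmul h h = A" "madj h = h" "In_M d h"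
    using A msqrt_OmegaQ[OF A] by (simp_all add: h_def)
  have Delta_h: "0 < Delta d h" "Delta d A = (Delta d h)\<^sup>2"
    using h(1) A Delta_msqrt[of A] by (simp_all add: OmegaQ_iff_Delta h_def)
  let ?f = "\<lambda>w. ennreal ((p + b \<bullet> w)\<^sup>2 * Delta_powr a (A - mmul w (madj w)))"
  let ?c = "p\<^sup>2 + (b \<bullet> mmul A b) / (real (d * CARD('q)) + 2 + 2 * a)"
  have subst: "?f (mmul h y) =
      ennreal (Delta d A powr a) * (ennreal ((p + mmul h b \<bullet> y)\<^sup>2) * ball_weight a 1 y)"
    if y: "y \<in> col_space {l}" for y
    using Delta_powr_minus_mmul_col[OF h(1) y, of a] h
    by (simp add: inner_mmul_left ennreal_mult' mult_ac)
  have hb: "mmul h b \<in> col.frame_span {l}" using b h by (simp add: span_col mmul_col_space)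
  have norm_hb: "(norm (mmul h b))\<^sup>2 = b \<bullet> mmul A b"
    using h by (simp add: power2_norm_eq_inner inner_mmul_left mmul_assoc[symmetric])
  have card: "real (card (col_idx {l})) = real (d * CARD('q))" by (simp add: card_col_idx)
  have ne: "col_idx {l} \<noteq> {}" using zero_in_comps by (auto simp: col_idx_def)
  have "(\<integral>\<^sup>+w. ?f w \<partial>col.leb {l}) = ennreal (Delta d h ^ d) * (\<integral>\<^sup>+y. ?f (mmul h y) \<partial>col.leb {l})"
    by (rule nn_integral_col_mmul[OF h(1)]) measurable
  also have "(\<integral>\<^sup>+y. ?f (mmul h y) \<partial>col.leb {l}) =
      (\<integral>\<^sup>+y. ennreal (Delta d A powr a) * (ennreal ((p + mmul h b \<bullet> y)\<^sup>2) * ball_weight a 1 y)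
        \<partial>col.leb {l})"
    by (rule nn_integral_cong_AE) (use AE_col_space in eventually_elim, simp only: subst)
  also have "\<dots> = ennreal (Delta d A powr a) * (ennreal ?c * col_ball_mass l a)"
    using col.nn_integral_ball_weight_affine[OF a hb ne, of p] unfolding card norm_hb
    by (subst nn_integral_cmult) simp_all
  also have "Delta d h ^ d = Delta d A powr (real d / 2)"
    using Delta_h(1) powr_powr[of "Delta d h" 2 "real d / 2"] by (simp add: Delta_h(2) powr_realpow)
  finally show ?thesis
    using A by (simp add: Delta_powr_def powr_add ennreal_mult' ennreal_mult'' mult_ac)
qed

lemma nn_integral_column:
  fixes A :: "'q::finite mat"
  assumes a: "a > -1" and b: "b \<in> col_space {l}"
  shows "(\<integral>\<^sup>+w. ennreal ((p + b \<bullet> w)\<^sup>2 * Delta_powr a (A - mmul w (madj w))) \<partial>col.leb {l}) =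
    ennreal ((p\<^sup>2 + (b \<bullet> mmul A b) / (real (d * CARD('q)) + 2 + 2 * a)) * Delta_powr (a + real d / 2) A)
      * col_ball_mass l a"
proof (cases "A \<in> OmegaQ d")
  case False
  have "Delta_powr a (A - mmul w (madj w)) = 0" if "w \<in> col_space {l}" for w
    using OmegaQ_add[of "A - mmul w (madj w)" "mmul w (madj w)"]
      PiQ_mmul_madj[OF col_space_In_M[OF that]] False
    by (auto simp: Delta_powr_def)
  then have "(\<integral>\<^sup>+w. ennreal ((p + b \<bullet> w)\<^sup>2 * Delta_powr a (A - mmul w (madj w))) \<partial>col.leb {l}) =
      (\<integral>\<^sup>+w. 0 \<partial>col.leb {l})"
    by (intro nn_integral_cong_AE) (use AE_col_space in eventually_elim, simp)
  then show ?thesis using False by (simp add: Delta_powr_def)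
qed (rule nn_integral_column_pd[OF a _ b])

lemma col_space_disjoint:
  assumes "x \<in> col_space S" "y \<in> col_space T" "S \<inter> T = {}"
  shows "mmul x (madj y) = 0" "x \<bullet> y = 0"
proof -
  have zero: "x$i$j = 0 \<or> y$k$j = 0" for i j k
    using assms by (meson col_space_nth disjoint_iff)
  then have "qmul (x$i$j) (qconj (y$k$j)) = 0" for i j k by (metis qconj_simps(6) qmul_zero)
  then show "mmul x (madj y) = 0" by (simp add: mat_eq_iff mmul_nth)
  have "x$i$j \<bullet> y$i$j = 0" for i j using zero[of i j i] by auto
  then show "x \<bullet> y = 0" by (simp add: inner_mat)
qed

definition col_spread :: "'q::finite mat \<Rightarrow> 'q \<Rightarrow> 'q \<Rightarrow> 4 \<Rightarrow> 'q mat" where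
  "col_spread b l j k = (\<chi> i j'. if j' = j then qmul (b$i$l) (qconj (axis k 1)) else 0)"

lemma col_spread_in_col_space:
  assumes "In_M d b" "j \<in> S" "k \<in> comps d"
  shows "col_spread b l j k \<in> col_space S"
proof -
  have "qmul (b$i$l) (qconj (axis k 1)) $ n = 0" if n: "n \<notin> comps d" for i n
    using assms n by (intro qmul_comps[OF _ _ n]) (auto simp: In_M_def axis_def)
  then show ?thesis using assms by (auto simp: col_space_def In_M_def col_spread_def)
qed

lemma norm_col_spread:
  assumes b: "b \<in> col_space {l}" and k: "k \<in> comps d" shows "norm (col_spread b l j k) = norm b"
proof -
  have "col_spread b l j k \<in> col_space {j}" using col_space_In_M[OF b] k
    by (intro col_spread_in_col_space) auto
  then have "(norm (col_spread b l j k))\<^sup>2 = (norm b)\<^sup>2"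
    by (simp add: norm_col_sq[OF b] norm_col_sq) (simp add: col_spread_def norm_qmul)
  then show ?thesis by simp
qed

lemma inner_col_spread: "col_spread b l j k \<bullet> v = mmul (madj v) b $ j $ l $ k"
proof -
  have "col_spread b l j k \<bullet> v = (\<Sum>i\<in>UNIV. qmul (b$i$l) (qconj (axis k 1)) \<bullet> v$i$j)"
    unfolding inner_mat by (intro sum.cong refl, subst sum.remove[of _ j]) (auto simp: col_spread_def)
  also have "\<dots> = (\<Sum>i\<in>UNIV. qmul (qconj (v$i$j)) (b$i$l) \<bullet> axis k 1)"
    by (intro sum.cong refl) (metis inner_qmul_left inner_qmul_right qconj_simps(2))
  also have "\<dots> = mmul (madj v) b $ j $ l \<bullet> axis k 1" by (simp only: mmul_nth madj_nth inner_sum_left)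
  finally show ?thesis by (simp only: cart_eq_inner_axis)
qed

lemma norm_madj_mmul_col:
  assumes v: "v \<in> col_space S" and b: "b \<in> col_space {l}"
  shows "(norm (mmul (madj v) b))\<^sup>2 = (\<Sum>j\<in>S. \<Sum>k\<in>comps d. (col_spread b l j k \<bullet> v)\<^sup>2)"
proof -
  let ?m = "mmul (madj v) b"
  have m: "?m \<in> col_space {l}" using b col_space_In_M[OF v] by (simp add: mmul_col_space)
  have "(norm (?m$j$l))\<^sup>2 = (\<Sum>k\<in>comps d. (?m$j$l$k)\<^sup>2)" for j
  proof -
    have "(norm (?m$j$l))\<^sup>2 = (\<Sum>k\<in>UNIV. (?m$j$l$k)\<^sup>2)"
      by (subst power2_norm_eq_inner) (simp add: inner_vec_def power2_eq_square)
    also have "\<dots> = (\<Sum>k\<in>comps d. (?m$j$l$k)\<^sup>2)"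
      using col_space_In_M[OF m] by (intro sum.mono_neutral_right) (auto simp: In_M_def)
    finally show ?thesis .
  qed
  moreover have "?m$j$l = 0" if "j \<notin> S" for j using col_space_nth[OF v that] by (simp add: mmul_nth)
  ultimately have "(norm ?m)\<^sup>2 = (\<Sum>j\<in>S. \<Sum>k\<in>comps d. (?m$j$l$k)\<^sup>2)"
    unfolding norm_col_sq[OF m] by (intro sum.mono_neutral_cong_right) auto
  then show ?thesis by (simp only: inner_col_spread)
qed

definition col_moment :: "real \<Rightarrow> 'q::finite set \<Rightarrow> real \<Rightarrow> 'q mat \<Rightarrow> ennreal" where
  "col_moment a S p b = (\<integral>\<^sup>+v. ennreal ((p + b \<bullet> v)\<^sup>2 * Delta_powr a (mid - mmul v (madj v))) \<partial>col.leb S)"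

definition col_variance_inv :: "real \<Rightarrow> 'q::finite set \<Rightarrow> real" where
  "col_variance_inv a S = 2 * a + 2 - real d + real (d * CARD('q)) + real (d * card S)"

definition isotropic :: "real \<Rightarrow> 'q::finite set \<Rightarrow> real \<Rightarrow> bool" where
  "isotropic a S Z \<longleftrightarrow> 0 < Z \<and>
     (\<forall>p. \<forall>b\<in>col_space S. col_moment a S p b = ennreal ((p\<^sup>2 + (norm b)\<^sup>2 / col_variance_inv a S) * Z))"

lemma isotropicD:
  "isotropic a S Z \<Longrightarrow> b \<in> col_space S \<Longrightarrow>
    (\<integral>\<^sup>+v. ennreal ((p + b \<bullet> v)\<^sup>2 * Delta_powr a (mid - mmul v (madj v))) \<partial>col.leb S) =
      ennreal ((p\<^sup>2 + (norm b)\<^sup>2 / col_variance_inv a S) * Z)"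
  unfolding isotropic_def col_moment_def by blast

lemma isotropic_mass:
  "isotropic a S Z \<Longrightarrow> (\<integral>\<^sup>+v. ennreal (Delta_powr a (mid - mmul v (madj v))) \<partial>col.leb S) = ennreal Z"
  using isotropicD[of a S Z 0 1] by (simp add: col_space_def)

lemma isotropic_empty: "isotropic a {} 1"
proof -
  have idx: "col_idx {} = {}" by (simp add: col_idx_def)
  have zero: "col.comb {} f = 0" for f using col.comb_def[of "{}" f] unfolding idx by simp
  have eval: "(\<integral>\<^sup>+v. f v \<partial>col.leb {}) = f 0" if "f \<in> borel_measurable borel" for f :: "'a mat \<Rightarrow> ennreal"
  proof -
    have "(\<integral>\<^sup>+v. f v \<partial>col.leb {}) = (\<integral>\<^sup>+x. f (col.comb {} x) \<partial>PiM (col_idx {}) (\<lambda>_. lborel))"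
      unfolding col.leb_def using that by (intro nn_integral_distr) auto
    also have "\<dots> = f 0" unfolding zero unfolding idx by (simp add: space_PiM_empty emeasure_PiM_empty)
    finally show ?thesis .
  qed
  have "col_moment a {} p b = ennreal (p\<^sup>2)" for p and b :: "'a mat"
    unfolding col_moment_def by (subst eval) (measurable, simp add: Delta_powr_def)
  moreover have "col_space {} = {0 :: 'a mat}" by (auto simp: col_space_def mat_eq_iff)
  ultimately show ?thesis by (simp add: isotropic_def)
qed

lemma nn_integral_isotropic_norm_madj_mmul:
  assumes iso: "isotropic a S Z" and K: "0 < col_variance_inv a S" and b: "b \<in> col_space {l}"
  shows "(\<integral>\<^sup>+v. ennreal ((norm (mmul (madj v) b))\<^sup>2 * Delta_powr a (mid - mmul v (madj v))) \<partial>col.leb S) =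
    ennreal (real (d * card S) * ((norm b)\<^sup>2 / col_variance_inv a S * Z))"
proof -
  let ?W = "\<lambda>v. Delta_powr a (mid - mmul v (madj v))" and ?c = "(norm b)\<^sup>2 / col_variance_inv a S * Z"
  have Z: "0 < Z" using iso by (simp add: isotropic_def)
  have "(\<integral>\<^sup>+v. ennreal ((norm (mmul (madj v) b))\<^sup>2 * ?W v) \<partial>col.leb S) =
    (\<integral>\<^sup>+v. (\<Sum>j\<in>S. \<Sum>k\<in>comps d. ennreal ((col_spread b l j k \<bullet> v)\<^sup>2 * ?W v)) \<partial>col.leb S)"
    by (rule nn_integral_cong_AE, use AE_col_space in eventually_elim)
      (simp add: norm_madj_mmul_col[OF _ b] sum_distrib_right sum_ennreal Delta_powr_nonneg sum_nonneg)
  also have "\<dots> = (\<Sum>j\<in>S. \<Sum>k\<in>comps d. \<integral>\<^sup>+v. ennreal ((col_spread b l j k \<bullet> v)\<^sup>2 * ?W v) \<partial>col.leb S)"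
    by (simp add: nn_integral_sum)
  also have "\<dots> = (\<Sum>j\<in>S. \<Sum>k\<in>comps d. ennreal ?c)"
  proof (intro sum.cong refl)
    fix j k assume "j \<in> S" "k \<in> comps d"
    then have "col_spread b l j k \<in> col_space S" "norm (col_spread b l j k) = norm b"
      using col_space_In_M[OF b] by (simp_all add: col_spread_in_col_space norm_col_spread[OF b])
    then show "(\<integral>\<^sup>+v. ennreal ((col_spread b l j k \<bullet> v)\<^sup>2 * ?W v) \<partial>col.leb S) = ennreal ?c"
      using isotropicD[OF iso, of "col_spread b l j k" 0] by simp
  qed
  also have "\<dots> = ennreal (\<Sum>j\<in>S. \<Sum>k\<in>comps d. ?c)"
    using K Z by (simp add: sum_ennreal sum_nonneg del: sum_constant)
  also have "(\<Sum>j\<in>S. \<Sum>k\<in>comps d. ?c) = real (d * card S) * ?c" by (simp add: card_comps)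
  finally show ?thesis .
qed

lemma col_moment_insert:
  fixes S :: "'q::finite set"
  assumes a: "a > -1" and l: "l \<notin> S" and b1: "b1 \<in> col_space S" and b2: "b2 \<in> col_space {l}"
  shows "col_moment a (insert l S) p (b1 + b2) =
    (\<integral>\<^sup>+v. ennreal (((p + b1 \<bullet> v)\<^sup>2 + ((norm b2)\<^sup>2 - (norm (mmul (madj v) b2))\<^sup>2) / (real (d * CARD('q)) + 2 + 2 * a))
      * Delta_powr (a + real d / 2) (mid - mmul v (madj v))) \<partial>col.leb S) * col_ball_mass l a"
proof -
  let ?f = "\<lambda>v. ennreal ((p + (b1 + b2) \<bullet> v)\<^sup>2 * Delta_powr a (mid - mmul v (madj v)))"
  let ?g = "\<lambda>v. ((p + b1 \<bullet> v)\<^sup>2 + ((norm b2)\<^sup>2 - (norm (mmul (madj v) b2))\<^sup>2)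
      / (real (d * CARD('q)) + 2 + 2 * a))
    * Delta_powr (a + real d / 2) (mid - mmul v (madj v))"
  have disjoint: "S \<inter> {l} = {}" "{l} \<inter> S = {}" using l by auto
  have inner: "(\<integral>\<^sup>+w. ?f (v + w) \<partial>col.leb {l}) = ennreal (?g v) * col_ball_mass l a"
    if v: "v \<in> col_space S" for v
  proof -
    have "(\<integral>\<^sup>+w. ?f (v + w) \<partial>col.leb {l}) =
      (\<integral>\<^sup>+w. ennreal (((p + b1 \<bullet> v) + b2 \<bullet> w)\<^sup>2 * Delta_powr a (mid - mmul v (madj v) - mmul w (madj w)))
          \<partial>col.leb {l})"
    proof (rule nn_integral_cong_AE, use AE_col_space in eventually_elim)
      fix w assume w: "w \<in> col_space {l}"
      have "(b1 + b2) \<bullet> (v + w) = b1 \<bullet> v + b2 \<bullet> w"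
        using col_space_disjoint(2)[OF b1 w disjoint(1)] col_space_disjoint(2)[OF v b2 disjoint(1)]
        by (simp add: inner_simps inner_commute)
      moreover have "mid - mmul (v + w) (madj (v + w)) = mid - mmul v (madj v) - mmul w (madj w)"
        using col_space_disjoint(1)[OF v w disjoint(1)] col_space_disjoint(1)[OF w v disjoint(2)]
        by simp
      ultimately show "?f (v + w) =
          ennreal (((p + b1 \<bullet> v) + b2 \<bullet> w)\<^sup>2 * Delta_powr a (mid - mmul v (madj v) - mmul w (madj w)))"
        by (simp only: add.assoc)
    qed
    also have "b2 \<bullet> mmul (mid - mmul v (madj v)) b2 = (norm b2)\<^sup>2 - (norm (mmul (madj v) b2))\<^sup>2"
      by (simp add: inner_simps power2_norm_eq_inner inner_mmul_left mmul_assoc)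
    then have "(\<integral>\<^sup>+w. ennreal (((p + b1 \<bullet> v) + b2 \<bullet> w)\<^sup>2
        * Delta_powr a (mid - mmul v (madj v) - mmul w (madj w))) \<partial>col.leb {l}) =
        ennreal (?g v) * col_ball_mass l a"
      by (simp only: nn_integral_column[OF a b2])
    finally show ?thesis .
  qed
  have [measurable]: "(\<lambda>v. norm (mmul (madj v) b2)) \<in> borel_measurable borel"
    by (intro borel_measurable_continuous_onI continuous_intros)
  have "col_moment a (insert l S) p (b1 + b2) = (\<integral>\<^sup>+v. (\<integral>\<^sup>+w. ?f (v + w) \<partial>col.leb {l}) \<partial>col.leb S)"
    unfolding col_moment_def using l by (intro col.nn_integral_leb_Un) (auto simp: col_idx_def)
  also have "\<dots> = (\<integral>\<^sup>+v. ennreal (?g v) * col_ball_mass l a \<partial>col.leb S)"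
    by (rule nn_integral_cong_AE) (use AE_col_space in eventually_elim, rule inner)
  also have "\<dots> = (\<integral>\<^sup>+v. ennreal (?g v) \<partial>col.leb S) * col_ball_mass l a"
    by (rule nn_integral_multc) measurable
  finally show ?thesis .
qed

lemma norm_madj_mmul_le_of_PiQ:
  assumes "In_M d v" "In_M d b" "mid - mmul v (madj v) \<in> PiQ d"
  shows "norm (mmul (madj v) b) \<le> norm b"
  using PiQ_mid_minus_madj_mmul_iff[of "madj v"] assms by simp

lemma ennreal_add_diff_mult_eq:
  fixes W x m n k :: real
  assumes "0 \<le> W" "W \<noteq> 0 \<Longrightarrow> m \<le> n" "0 \<le> m" "0 \<le> x" and k: "0 < k"
  shows "ennreal ((x + (n - m) / k) * W) + ennreal (1 / k) * ennreal (m * W) =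
    ennreal (x * W) + ennreal (n / k) * ennreal W"
proof (cases "W = 0")
  case False
  then have "ennreal ((x + (n - m) / k) * W) + ennreal (1 / k * (m * W)) =
      ennreal ((x + (n - m) / k) * W + 1 / k * (m * W))"
    using assms by (intro ennreal_plus[symmetric]) auto
  also have "(x + (n - m) / k) * W + 1 / k * (m * W) = x * W + n / k * W"
    by (simp add: algebra_simps diff_divide_distrib)
  also have "ennreal \<dots> = ennreal (x * W) + ennreal (n / k * W)"
    using assms False by (intro ennreal_plus) auto
  also have "ennreal (n / k * W) = ennreal (n / k) * ennreal W"
    using assms False by (intro ennreal_mult') auto
  finally show ?thesis using k by (subst ennreal_mult'[symmetric]) auto
qed simp

lemma divide_minus_weighted_divide:
  fixes k c n z :: real
  assumes "0 < k" "0 < k + c"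
  shows "n / k * z - 1 / k * (c * (n / (k + c) * z)) = n / (k + c) * z"
proof -
  have "n / k * z - 1 / k * (c * (n / (k + c) * z)) = n * z * (1 / k * (1 - c / (k + c)))"
    by (simp add: algebra_simps)
  also have "1 - c / (k + c) = k / (k + c)" using assms by (simp add: field_simps)
  finally show ?thesis using assms by simp
qed

lemma nn_integral_isotropic_residual:
  assumes iso: "isotropic a S Z" and K1: "0 < K1" and K: "col_variance_inv a S = K1 + real (d * card S)"
    and b1: "b1 \<in> col_space S" and b2: "b2 \<in> col_space {l}"
  shows "(\<integral>\<^sup>+v. ennreal (((p + b1 \<bullet> v)\<^sup>2 + ((norm b2)\<^sup>2 - (norm (mmul (madj v) b2))\<^sup>2) / K1)
      * Delta_powr a (mid - mmul v (madj v))) \<partial>col.leb S) =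
    ennreal ((p\<^sup>2 + ((norm b1)\<^sup>2 + (norm b2)\<^sup>2) / col_variance_inv a S) * Z)"
    (is "?T = _")
proof -
  let ?W = "\<lambda>v. Delta_powr a (mid - mmul v (madj v))" and ?K = "col_variance_inv a S"
  define n where "n = (norm b2)\<^sup>2"
  define m where "m v = (norm (mmul (madj v) b2))\<^sup>2" for v
  have Z: "0 < Z" using iso by (simp add: isotropic_def)
  have Kpos: "0 < ?K" unfolding K using K1 by (rule add_pos_nonneg) simp
  have m_le: "m v \<le> n" if "?W v \<noteq> 0" "v \<in> col_space S" for v
    unfolding m_def n_def using that b2
    by (intro power_mono norm_madj_mmul_le_of_PiQ)
      (auto simp: Delta_powr_def col_space_In_M split: if_splits)
  have [measurable]: "m \<in> borel_measurable borel" unfolding m_def[abs_def]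
    by (intro borel_measurable_continuous_onI continuous_intros)
  have "?T + ennreal (1 / K1) * (\<integral>\<^sup>+v. ennreal (m v * ?W v) \<partial>col.leb S) =
      (\<integral>\<^sup>+v. ennreal (((p + b1 \<bullet> v)\<^sup>2 + (n - m v) / K1) * ?W v) + ennreal (1 / K1) * ennreal (m v * ?W v)
          \<partial>col.leb S)"
    unfolding n_def[symmetric] m_def[symmetric]
    by (subst nn_integral_add) (simp_all add: nn_integral_cmult)
  also have "\<dots> = (\<integral>\<^sup>+v. ennreal ((p + b1 \<bullet> v)\<^sup>2 * ?W v) + ennreal (n / K1) * ennreal (?W v) \<partial>col.leb S)"
  proof (rule nn_integral_cong_AE, use AE_col_space in eventually_elim)
    fix v assume v: "v \<in> col_space S"
    show "ennreal (((p + b1 \<bullet> v)\<^sup>2 + (n - m v) / K1) * ?W v)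
        + ennreal (1 / K1) * ennreal (m v * ?W v) =
        ennreal ((p + b1 \<bullet> v)\<^sup>2 * ?W v) + ennreal (n / K1) * ennreal (?W v)"
      using m_le[OF _ v] K1 by (intro ennreal_add_diff_mult_eq) (auto simp: Delta_powr_nonneg m_def)
  qed
  also have "\<dots> = ennreal ((p\<^sup>2 + (norm b1)\<^sup>2 / ?K) * Z) + ennreal (n / K1) * ennreal Z"
    by (subst nn_integral_add)
      (simp_all add: nn_integral_cmult isotropicD[OF iso b1] isotropic_mass[OF iso])
  also have "(\<integral>\<^sup>+v. ennreal (m v * ?W v) \<partial>col.leb S) = ennreal (real (d * card S) * (n / ?K * Z))"
    unfolding m_def n_def by (rule nn_integral_isotropic_norm_madj_mmul[OF iso Kpos b2])
  finally have "?T + ennreal (1 / K1 * (real (d * card S) * (n / ?K * Z))) =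
      ennreal ((p\<^sup>2 + (norm b1)\<^sup>2 / ?K) * Z + n / K1 * Z)"
    using K1 Kpos Z by (simp add: ennreal_mult'[symmetric] ennreal_plus[symmetric] n_def
        add_nonneg_nonneg del: ennreal_plus)
  then have "?T = ennreal ((p\<^sup>2 + (norm b1)\<^sup>2 / ?K) * Z + n / K1 * Z
      - 1 / K1 * (real (d * card S) * (n / ?K * Z)))"
    using K1 Kpos Z by (intro ennreal_eq_diffI) (auto simp: n_def)
  also have "(p\<^sup>2 + (norm b1)\<^sup>2 / ?K) * Z + n / K1 * Z - 1 / K1 * (real (d * card S) * (n / ?K * Z)) =
      (p\<^sup>2 + ((norm b1)\<^sup>2 + n) / ?K) * Z"
    using divide_minus_weighted_divide[OF K1 Kpos[unfolded K], of n Z, folded K]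
    unfolding add_divide_distrib distrib_right by linarith
  finally show ?thesis unfolding n_def .
qed

lemma isotropic_insert:
  fixes S :: "'q::finite set"
  assumes a: "a > -1" and l: "l \<notin> S" and iso: "isotropic (a + real d / 2) S Z"
  obtains Z' where "isotropic a (insert l S) Z'"
proof -
  define K1 where "K1 = real (d * CARD('q)) + 2 + 2 * a"
  have K1: "0 < K1" unfolding K1_def using a by (simp add: add_nonneg_pos add.assoc)
  have K: "col_variance_inv (a + real d / 2) S = K1 + real (d * card S)"
    "col_variance_inv a (insert l S) = K1 + real (d * card S)"
    using l by (simp_all add: col_variance_inv_def K1_def algebra_simps)
  obtain B where B: "0 < B" "col_ball_mass l a = ennreal B"
    using col.ball_mass_finite[OF a, of "{l}"] col.ball_mass_pos[of "{l}" a]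
    by (cases "col_ball_mass l a") auto
  have Z: "0 < Z" using iso by (simp add: isotropic_def)
  have "col_moment a (insert l S) p b =
      ennreal ((p\<^sup>2 + (norm b)\<^sup>2 / col_variance_inv a (insert l S)) * (Z * B))"
    if b: "b \<in> col_space (insert l S)" for p b
  proof -
    define b1 b2 :: "'q mat" where "b1 = (\<chi> i j. if j = l then 0 else b$i$j)"
      and "b2 = (\<chi> i j. if j = l then b$i$j else 0)"
    have b_eq: "b = b1 + b2" by (simp add: b1_def b2_def mat_eq_iff)
    have b1: "b1 \<in> col_space S" and b2: "b2 \<in> col_space {l}"
      using b by (auto simp: b1_def b2_def col_space_def In_M_def)
    have "(norm b)\<^sup>2 = (norm b1)\<^sup>2 + (norm b2)\<^sup>2"
      using col_space_disjoint(2)[OF b1 b2] l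
      by (simp add: b_eq power2_norm_eq_inner inner_simps inner_commute)
    then have "col_moment a (insert l S) p b =
        ennreal ((p\<^sup>2 + (norm b)\<^sup>2 / col_variance_inv a (insert l S)) * Z) * ennreal B"
      unfolding b_eq col_moment_insert[OF a l b1 b2] K1_def[symmetric] B(2)
      by (simp add: nn_integral_isotropic_residual[OF iso K1 K(1) b1 b2] K b_eq[symmetric])
    then show ?thesis using B by (simp add: ennreal_mult''[symmetric] mult.assoc)
  qed
  then show ?thesis using that[of "Z * B"] Z B by (simp add: isotropic_def)
qed

lemma exists_isotropic:
  fixes S :: "'q::finite set"
  shows "finite S \<Longrightarrow> a > -1 \<Longrightarrow> \<exists>Z. isotropic a S Z"
proof (induction S arbitrary: a rule: finite_induct)
  case empty
  show ?case using isotropic_empty by blast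
next
  case (insert l S)
  have "a + real d / 2 > -1" using insert.prems by (simp add: add_pos_nonneg less_le_trans)
  then show ?case using insert.IH insert.hyps(2) insert.prems isotropic_insert by metis
qed

end

section \<open>The law of the random contraction\<close>

context field_dim
begin

lemma Dset_iff: "v \<in> Dset d \<longleftrightarrow> In_M d v \<and> mid - mmul v (madj v) \<in> OmegaQ d"
  unfolding Dset_def using OmegaQ_mid_minus_mmul_madj_iff by blast

lemma Dset_contraction: "v \<in> Dset d \<Longrightarrow> In_M d m \<Longrightarrow> norm (mmul v m) \<le> norm m"
  unfolding Dset_def using PiQ_mid_minus_madj_mmul_iff[of v] OmegaQ_PiQ by blast

lemma norm_Dset_le: "v \<in> Dset d \<Longrightarrow> norm v \<le> norm (mid :: 'q mat)" for v :: "'q::finite mat"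
  using Dset_contraction[of v mid] by simp

lemma Dset_borel [measurable]: "(Dset d :: 'q::finite mat set) \<in> sets borel"
proof -
  have "(\<lambda>v::'q mat. mid - mmul v (madj v)) \<in> borel_measurable borel"
    by (intro borel_measurable_continuous_onI continuous_intros)
  then have "(\<lambda>v::'q mat. mid - mmul v (madj v)) -` OmegaQ d \<in> sets borel"
    by (rule measurable_sets_borel[OF _ OmegaQ_borel])
  then have "{v. In_M d v} \<inter> (\<lambda>v::'q mat. mid - mmul v (madj v)) -` OmegaQ d \<in> sets borel"
    using closed_In_M by (intro sets.Int) (auto intro: borel_closed)
  moreover have "Dset d = {v. In_M d v} \<inter> (\<lambda>v::'q mat. mid - mmul v (madj v)) -` OmegaQ d"
    by (auto simp: Dset_iff)
  ultimately show ?thesis by simp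
qed

lemma sets_lebM [simp, measurable_cong]: "sets (lebM d) = sets borel" by (simp add: lebM_def)

lemma AE_lebM: "AE v in lebM d. In_M d (v :: 'q::finite mat)"
  using AE_col_space[of "UNIV :: 'q set"] unfolding lebM_eq by (simp add: col_space_UNIV)

lemma nn_integral_lebM_madj:
  fixes f :: "'q::finite mat \<Rightarrow> ennreal"
  assumes "f \<in> borel_measurable borel"
  shows "(\<integral>\<^sup>+v. f (madj v) \<partial>lebM d) = (\<integral>\<^sup>+v. f v \<partial>lebM d)"
  unfolding lebM_eq
proof (rule col.nn_integral_isometry[OF linear_madj _ _ assms])
  show "madj ` col.frame_span UNIV = (col.frame_span UNIV :: 'q mat set)"
    by (auto simp: span_col col_space_UNIV intro!: image_eqI[of _ madj "madj _"])
qed simp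

lemma kappa_eq_nn_integral:
  "kappa d \<mu> TYPE('q::finite) =
    enn2real (\<integral>\<^sup>+v. ennreal (Delta_powr (\<mu> - rho d TYPE('q)) (mid - mmul v (madj v)))
        \<partial>(lebM d :: 'q mat measure))"
proof -
  let ?f = "\<lambda>v::'q mat. Delta_powr (\<mu> - rho d TYPE('q)) (mid - mmul (madj v) v)"
  have f [measurable]: "?f \<in> borel_measurable borel"
    by (rule measurable_compose[OF borel_measurable_continuous_onI Delta_powr_measurable])
      (intro continuous_intros)
  have "indicator (Dset d) v *\<^sub>R Delta d (mid - mmul (madj v) v) powr (\<mu> - rho d TYPE('q)) =
      indicator (Dset d) v * ?f v"
    for v :: "'q mat" by (auto simp: Delta_powr_def Dset_def indicator_def)
  then have "kappa d \<mu> TYPE('q) = (\<integral>v. indicator (Dset d) v * ?f v \<partial>lebM d)"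
    by (simp only: kappa_def set_lebesgue_integral_def)
  also have "\<dots> = (\<integral>v. ?f v \<partial>lebM d)"
  proof (rule integral_cong_AE)
    show "AE v in lebM d. indicator (Dset d) v * ?f v = ?f v"
      using AE_lebM by eventually_elim (auto simp: Delta_powr_def Dset_def indicator_def)
  qed measurable
  also have "\<dots> = enn2real (\<integral>\<^sup>+v. ennreal (?f v) \<partial>lebM d)"
    by (rule integral_eq_nn_integral)
      (use f in \<open>simp_all add: Delta_powr_nonneg cong: measurable_cong_sets\<close>)
  also have "(\<integral>\<^sup>+v. ennreal (?f v) \<partial>lebM d) = (\<integral>\<^sup>+v. ennreal (?f (madj v)) \<partial>lebM d)"
    by (rule nn_integral_lebM_madj[symmetric]) measurable
  finally show ?thesis by simp
qed

definition conv_sq :: "'q::finite mat \<Rightarrow> 'q mat \<Rightarrow> 'q mat \<Rightarrow> 'q mat" where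
  "conv_sq r s v = mmul r r + mmul s s + mmul s (mmul v r) + mmul r (mmul (madj v) s)"

lemma inner_mmul_conv_sq:
  assumes "r \<in> Herm d" "s \<in> Herm d"
  shows "m \<bullet> mmul (conv_sq r s v) m =
    (norm (mmul r m))\<^sup>2 + (norm (mmul s m))\<^sup>2 + 2 * (mmul v (mmul r m) \<bullet> mmul s m)"
proof -
  have "m \<bullet> mmul (mmul s (mmul v r)) m = mmul v (mmul r m) \<bullet> mmul s m"
    using assms by (simp add: mmul_assoc inner_mmul_left[of s] inner_commute)
  moreover have "m \<bullet> mmul (mmul r (mmul (madj v) s)) m = mmul v (mmul r m) \<bullet> mmul s m"
    using assms by (simp add: mmul_assoc inner_mmul_left)
  moreover have "m \<bullet> mmul (mmul r r) m = (norm (mmul r m))\<^sup>2"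
    "m \<bullet> mmul (mmul s s) m = (norm (mmul s m))\<^sup>2"
    using assms by (simp_all add: mmul_assoc inner_mmul_left power2_norm_eq_inner)
  ultimately show ?thesis by (simp add: conv_sq_def inner_simps)
qed

lemma conv_sq_Herm: "r \<in> Herm d \<Longrightarrow> s \<in> Herm d \<Longrightarrow> In_M d v \<Longrightarrow> conv_sq r s v \<in> Herm d"
  unfolding Herm_def by (simp add: conv_sq_def mmul_assoc)

lemma conv_sq_lower_bound:
  assumes rs: "r \<in> Herm d" "s \<in> Herm d" and v: "v \<in> Dset d" and c: "0 < c"
  shows "conv_sq r s v - ((1 - c) *\<^sub>R mmul r r - (1 / c - 1) *\<^sub>R mmul s s) \<in> PiQ d"
  unfolding PiQ_iff
proof safe
  have "In_M d v" using v by (simp add: Dset_def)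
  then show "conv_sq r s v - ((1 - c) *\<^sub>R mmul r r - (1 / c - 1) *\<^sub>R mmul s s) \<in> Herm d"
    using conv_sq_Herm[OF rs] PiQ_square[OF rs(1)] PiQ_square[OF rs(2)] by simp
  fix m :: "'a mat" assume m: "In_M d m"
  let ?x = "norm (mmul r m)" and ?y = "norm (mmul s m)"
  have "norm (mmul v (mmul r m)) \<le> ?x" using Dset_contraction[OF v] rs m by simp
  then have "\<bar>mmul v (mmul r m) \<bullet> mmul s m\<bar> \<le> ?x * ?y"
    by (meson Cauchy_Schwarz_ineq2 mult_right_mono norm_ge_zero order_trans)
  moreover have "0 \<le> (sqrt c * ?x - ?y / sqrt c)\<^sup>2" by simp
  then have "2 * (?x * ?y) \<le> c * ?x\<^sup>2 + ?y\<^sup>2 / c"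
    using c by (simp add: power2_diff power_mult_distrib power_divide)
  ultimately have "0 \<le> c * ?x\<^sup>2 + ?y\<^sup>2 / c + 2 * (mmul v (mmul r m) \<bullet> mmul s m)" by linarith
  moreover have "m \<bullet> mmul (mmul r r) m = ?x\<^sup>2" "m \<bullet> mmul (mmul s s) m = ?y\<^sup>2"
    using rs by (simp_all add: mmul_assoc inner_mmul_left power2_norm_eq_inner)
  ultimately show "0 \<le> m \<bullet> mmul (conv_sq r s v - ((1 - c) *\<^sub>R mmul r r - (1 / c - 1) *\<^sub>R mmul s s)) m"
    by (simp add: inner_simps inner_mmul_conv_sq[OF rs] algebra_simps)
qed

lemma conv_sq_PiQ: "r \<in> Herm d \<Longrightarrow> s \<in> Herm d \<Longrightarrow> v \<in> Dset d \<Longrightarrow> conv_sq r s v \<in> PiQ d"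
  using conv_sq_lower_bound[of r s v 1] by simp

lemma space_PiS: "space (PiS d) = PiQ d" by (simp add: PiS_def space_restrict_space)

lemma measurable_PiS: "f \<in> borel_measurable borel \<Longrightarrow> f \<in> borel_measurable (PiS d)"
  unfolding PiS_def by (rule measurable_restrict_space1)

text \<open>Outside the cone \<^const>\<open>msqrt\<close> is an unspecified matrix, possibly not in the cone.\<close>

definition psqrt :: "'q::finite mat \<Rightarrow> 'q mat" where
  "psqrt x = (if x \<in> PiQ d then msqrt d x else 0)"

lemma psqrt_PiQ [simp]: "psqrt x \<in> PiQ d" by (simp add: psqrt_def)

lemma psqrt_borel: "psqrt \<in> borel_measurable borel"
  unfolding psqrt_def[abs_def]
  by (intro borel_measurable_continuous_on_if continuous_on_msqrt continuous_on_const PiQ_borel)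

lemma psqrt_measurable [measurable]: "psqrt \<in> borel \<rightarrow>\<^sub>M PiS d"
  unfolding PiS_def by (rule measurable_restrict_space2) (auto simp: psqrt_borel)

lemma msqrt_borel: "msqrt d \<in> borel_measurable borel"
proof -
  have "msqrt d x = (if x \<in> PiQ d then msqrt d x else (THE s. False))" for x :: "'a mat"
  proof (cases "x \<in> PiQ d")
    case False
    then have "(\<lambda>s. s \<in> PiQ d \<and> mmul s s = x) = (\<lambda>s. False)" using PiQ_square PiQ_Herm by blast
    then show ?thesis using False by (simp add: msqrt_def)
  qed simp
  then have "msqrt d = (\<lambda>x::'a mat. if x \<in> PiQ d then msqrt d x else (THE s. False))" by (rule ext)
  also have "\<dots> \<in> borel_measurable borel"
    by (intro borel_measurable_continuous_on_if continuous_on_msqrt continuous_on_const PiQ_borel)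
  finally show ?thesis .
qed

lemma distr_msqrt:
  fixes X :: "'b \<Rightarrow> 'q::finite mat"
  assumes X: "X \<in> borel_measurable M" and "AE v in M. X v \<in> PiQ d"
  shows "distr M (PiS d) (\<lambda>v. msqrt d (X v)) = distr M (PiS d) (\<lambda>v. psqrt (X v))"
  unfolding distr_def
proof (rule measure_of_eq[OF sets.space_closed])
  fix A assume "A \<in> sigma_sets (space (PiS d)) (sets (PiS d :: 'q mat measure))"
  then have "A \<in> sets borel"
    unfolding sets.sigma_sets_eq by (auto simp: PiS_def sets_restrict_space_iff)
  then have "(\<lambda>v. msqrt d (X v)) -` A \<inter> space M \<in> sets M" "(\<lambda>v. psqrt (X v)) -` A \<inter> space M \<in> sets M"
    using measurable_compose[OF X msqrt_borel] measurable_compose[OF X psqrt_borel]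
    by (auto intro: measurable_sets)
  then show "emeasure M ((\<lambda>v. msqrt d (X v)) -` A \<inter> space M) =
      emeasure M ((\<lambda>v. psqrt (X v)) -` A \<inter> space M)"
    by (rule emeasure_eq_AE[rotated]) (use assms(2) in \<open>auto simp: psqrt_def elim!: eventually_mono\<close>)
qed

end

locale wishart_setting = field_dim +
  fixes \<mu> :: real and ty :: "'q::finite itself"
  assumes mu_gt: "\<mu> > rho d TYPE('q) - 1"
begin

lemma mu_pos: "\<mu> > 0"
proof -
  have "real CARD('q) \<ge> 1" by (simp add: Suc_le_eq)
  then have "0 \<le> real CARD('q) - 1 / 2" by linarith
  then have "0 \<le> real d * (real CARD('q) - 1 / 2)" by simp
  then show ?thesis using mu_gt by (simp add: rho_def)
qed

lemma isotropic_kappa: "isotropic (\<mu> - rho d TYPE('q)) (UNIV :: 'q set) (kappa d \<mu> TYPE('q))"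
proof -
  obtain Z where Z: "isotropic (\<mu> - rho d TYPE('q)) (UNIV :: 'q set) Z"
    using exists_isotropic[of UNIV "\<mu> - rho d TYPE('q)"] mu_gt by auto
  then have "0 \<le> Z" by (simp add: isotropic_def)
  then have "kappa d \<mu> TYPE('q) = Z" by (simp add: kappa_eq_nn_integral lebM_eq isotropic_mass[OF Z])
  then show ?thesis using Z by simp
qed

lemma kappa_pos: "0 < kappa d \<mu> TYPE('q)"
  using isotropic_kappa by (simp add: isotropic_def)

definition ball_law :: "'q mat measure" where
  "ball_law = density (lebM d) (\<lambda>v. ennreal (indicator (Dset d) v *
         Delta d (mid - mmul v (madj v)) powr (\<mu> - rho d TYPE('q)) / kappa d \<mu> TYPE('q)))"

lemma sets_ball_law [simp, measurable_cong]: "sets ball_law = sets borel" by (simp add: ball_law_def)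

lemma space_ball_law [simp]: "space ball_law = UNIV" using sets_eq_imp_space_eq[OF sets_ball_law]
  by simp

lemma ball_law_eq: "ball_law = density (lebM d) (\<lambda>v. ennreal (indicator (Dset d) v *
   (Delta_powr (\<mu> - rho d TYPE('q)) (mid - mmul v (madj v)) / kappa d \<mu> TYPE('q))))"
  unfolding ball_law_def
  by (rule arg_cong[where f = "density _"], rule ext) (auto simp: Dset_iff Delta_powr_def indicator_def)

lemma AE_ball_law: "AE v in ball_law. v \<in> Dset d"
  unfolding ball_law_eq by (subst AE_density) (auto simp: indicator_def)

lemma nn_integral_ball_law_affine_sq:
  assumes b: "In_M d b"
  shows "(\<integral>\<^sup>+v. ennreal ((p + b \<bullet> v)\<^sup>2) \<partial>ball_law) = ennreal (p\<^sup>2 + (norm b)\<^sup>2 / (2 * \<mu>))"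
proof -
  let ?k = "kappa d \<mu> TYPE('q)" and ?W = "\<lambda>v. Delta_powr (\<mu> - rho d TYPE('q)) (mid - mmul v (madj v))"
  have K: "col_variance_inv (\<mu> - rho d TYPE('q)) (UNIV :: 'q set) = 2 * \<mu>"
    by (simp add: col_variance_inv_def rho_def algebra_simps)
  have "(\<integral>\<^sup>+v. ennreal ((p + b \<bullet> v)\<^sup>2) \<partial>ball_law) =
     (\<integral>\<^sup>+v. ennreal (indicator (Dset d) v * (?W v / ?k)) * ennreal ((p + b \<bullet> v)\<^sup>2) \<partial>lebM d)"
    unfolding ball_law_eq by (rule nn_integral_density) measurable
  also have "\<dots> = (\<integral>\<^sup>+v. ennreal (1 / ?k) * ennreal ((p + b \<bullet> v)\<^sup>2 * ?W v) \<partial>lebM d)"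
    by (rule nn_integral_cong_AE, use AE_lebM in eventually_elim)
      (use kappa_pos in \<open>auto simp: ennreal_mult'[symmetric] ennreal_mult''[symmetric] Delta_powr_def Dset_iff
          indicator_def mult.commute\<close>)
  also have "\<dots> = ennreal (1 / ?k) * ennreal ((p\<^sup>2 + (norm b)\<^sup>2 / (2 * \<mu>)) * ?k)"
    using isotropicD[OF isotropic_kappa, of b p] b unfolding K
    by (subst nn_integral_cmult) (simp_all add: lebM_eq col_space_UNIV)
  also have "\<dots> = ennreal (p\<^sup>2 + (norm b)\<^sup>2 / (2 * \<mu>))"
    using kappa_pos mu_pos by (simp add: ennreal_mult'[symmetric])
  finally show ?thesis .
qed

sublocale ball_law: prob_space ball_law
proof
  show "emeasure ball_law (space ball_law) = 1" using nn_integral_ball_law_affine_sq[of 0 1] by simp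
qed

lemma integrable_ball_law_inner: "integrable ball_law (\<lambda>v. b \<bullet> v)"
proof (rule ball_law.integrable_const_bound[where B = "norm b * norm (mid :: 'q mat)"])
  show "AE v in ball_law. norm (b \<bullet> v) \<le> norm b * norm (mid :: 'q mat)"
    using AE_ball_law
  proof eventually_elim
    fix v :: "'q mat" assume "v \<in> Dset d"
    then have "norm b * norm v \<le> norm b * norm (mid :: 'q mat)"
      by (intro mult_left_mono norm_Dset_le) simp_all
    then show "norm (b \<bullet> v) \<le> norm b * norm (mid :: 'q mat)" using Cauchy_Schwarz_ineq2[of b v] by simp
  qed
qed measurable

lemma ball_law_affine_sq:
  assumes b: "In_M d b"
  shows integrable_ball_law_affine_sq: "integrable ball_law (\<lambda>v. (p + b \<bullet> v)\<^sup>2)"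
    and integral_ball_law_affine_sq: "(\<integral>v. (p + b \<bullet> v)\<^sup>2 \<partial>ball_law) = p\<^sup>2 + (norm b)\<^sup>2 / (2 * \<mu>)"
proof -
  show "integrable ball_law (\<lambda>v. (p + b \<bullet> v)\<^sup>2)"
    by (rule integrableI_nonneg) (auto simp: nn_integral_ball_law_affine_sq[OF b])
  show "(\<integral>v. (p + b \<bullet> v)\<^sup>2 \<partial>ball_law) = p\<^sup>2 + (norm b)\<^sup>2 / (2 * \<mu>)"
    using mu_pos by (subst integral_eq_nn_integral)
      (auto simp: nn_integral_ball_law_affine_sq[OF b] simp del: ennreal_plus)
qed

lemma integral_ball_law_inner:
  assumes b: "In_M d b" shows "(\<integral>v. b \<bullet> v \<partial>ball_law) = 0"
proof -
  have "(\<integral>v. (1 + b \<bullet> v)\<^sup>2 - (-1 + b \<bullet> v)\<^sup>2 \<partial>ball_law) = 0"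
    using ball_law_affine_sq[OF b, of 1] ball_law_affine_sq[OF b, of "-1"]
    by (subst Bochner_Integration.integral_diff) simp_all
  moreover have "(1 + b \<bullet> v)\<^sup>2 - (-1 + b \<bullet> v)\<^sup>2 = 4 * (b \<bullet> v)" for v
    by (simp add: power2_eq_square algebra_simps)
  ultimately show ?thesis by simp
qed

end

section \<open>Bounded functions and Markov kernels\<close>

lemma integrable_prob_algebra:
  fixes f :: "'a \<Rightarrow> real"
  assumes M: "M \<in> space (prob_algebra K)" and f: "f \<in> borel_measurable K" "\<And>x. x \<in> space K \<Longrightarrow> \<bar>f x\<bar> \<le> B"
  shows "integrable M f"
proof -
  have "prob_space M" and sets: "sets M = sets K" using M by (auto simp: space_prob_algebra)
  then interpret prob_space M by simp
  show ?thesis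
    using f sets_eq_imp_space_eq[OF sets] measurable_cong_sets[OF sets refl]
    by (intro integrable_const_bound[where B = B]) auto
qed

lemma abs_integral_prob_algebra_le:
  fixes f :: "'a \<Rightarrow> real"
  assumes M: "M \<in> space (prob_algebra K)" and f: "f \<in> borel_measurable K" "\<And>x. x \<in> space K \<Longrightarrow> \<bar>f x\<bar> \<le> B"
  shows "\<bar>integral\<^sup>L M f\<bar> \<le> B"
proof -
  interpret prob_space M using M by (simp add: space_prob_algebra)
  have "space M = space K" using M by (auto simp: space_prob_algebra dest: sets_eq_imp_space_eq)
  then have "norm (integral\<^sup>L M f) \<le> (\<integral>y. B \<partial>M)"
    using f integrable_prob_algebra[OF M f]
    by (intro order_trans[OF integral_norm_bound integral_mono]) auto
  then show ?thesis by (simp add: prob_space)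
qed

lemma
  fixes f :: "'b \<Rightarrow> real"
  assumes M: "M \<in> space (prob_algebra L)" and N: "N \<in> L \<rightarrow>\<^sub>M prob_algebra K"
    and f: "f \<in> borel_measurable K" "\<And>x. x \<in> space K \<Longrightarrow> \<bar>f x\<bar> \<le> B"
  shows integrable_kernel: "integrable M (\<lambda>x. integral\<^sup>L (N x) f)"
    and integral_bind_kernel: "integral\<^sup>L (M \<bind> N) f = (\<integral>x. integral\<^sup>L (N x) f \<partial>M)"
proof -
  have sets: "sets M = sets L" and "prob_space M" using M by (auto simp: space_prob_algebra)
  then interpret M: prob_space M by simp
  have space: "space M = space L" using sets by (rule sets_eq_imp_space_eq)
  show "integrable M (\<lambda>x. integral\<^sup>L (N x) f)"
  proof (rule integrable_prob_algebra[OF M])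
    show "(\<lambda>x. integral\<^sup>L (N x) f) \<in> borel_measurable L"
      by (rule measurable_compose[OF measurable_prob_algebraD[OF N] integral_measurable_subprob_algebra[OF f(1)]])
    show "\<bar>integral\<^sup>L (N x) f\<bar> \<le> B" if "x \<in> space L" for x
      by (rule abs_integral_prob_algebra_le[OF measurable_space[OF N that] f])
  qed
  show "integral\<^sup>L (M \<bind> N) f = (\<integral>x. integral\<^sup>L (N x) f \<partial>M)"
  proof (rule integral_bind[OF f, where B' = 1])
    show "N \<in> M \<rightarrow>\<^sub>M subprob_algebra K"
      using measurable_prob_algebraD[OF N] measurable_cong_sets[OF sets refl] by blast
    show "AE x in M. emeasure (N x) (space (N x)) \<le> ennreal 1"
      using measurable_space[OF N]
      by (intro AE_I2) (auto simp: space space_prob_algebra prob_space.emeasure_space_1)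
  qed (simp_all add: M.finite_measure_axioms)
qed

section \<open>The convolution\<close>

context field_dim
begin

abbreviation cone_law :: "'q::finite mat measure \<Rightarrow> bool" where
  "cone_law M \<equiv> M \<in> space (prob_algebra (PiS d))"

lemma cone_lawD:
  assumes "cone_law M" shows "prob_space M" "sets M = sets (PiS d)" "space M = PiQ d"
  using assms by (auto simp: space_prob_algebra space_PiS dest: sets_eq_imp_space_eq)

lemma measurable_cone_law: "cone_law M \<Longrightarrow> f \<in> PiS d \<rightarrow>\<^sub>M N \<Longrightarrow> f \<in> M \<rightarrow>\<^sub>M N"
  using measurable_cong_sets[OF cone_lawD(2) refl] by blast

lemma norm_sq_measurable: "(\<lambda>r. ennreal ((norm r)\<^sup>2)) \<in> borel_measurable (PiS d)"
  by (rule measurable_PiS) measurable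

lemma Tmap_scale: "0 \<le> c \<Longrightarrow> r \<in> PiQ d \<Longrightarrow> Tmap d (c *\<^sub>R mid) r = c *\<^sub>R r"
  unfolding Tmap_def by (rule msqrt_eqI) (simp_all add: mmul_assoc)

lemma scale_measurable: "0 \<le> c \<Longrightarrow> (\<lambda>r. c *\<^sub>R r) \<in> PiS d \<rightarrow>\<^sub>M PiS d"
  by (subst (2) PiS_def, rule measurable_restrict_space2) (auto simp: space_PiS intro!: measurable_PiS)

lemma Tmeas_scale:
  assumes "cone_law M" "0 \<le> c" shows "Tmeas d (c *\<^sub>R mid) M = distr M (PiS d) (\<lambda>r. c *\<^sub>R r)"
  unfolding Tmeas_def using assms by (intro distr_cong) (auto simp: cone_lawD Tmap_scale)

lemma cone_law_scale: "cone_law M \<Longrightarrow> 0 \<le> c \<Longrightarrow> cone_law (distr M (PiS d) (\<lambda>r. c *\<^sub>R r))"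
  by (rule measurable_space[OF measurable_distr_prob_space[OF scale_measurable]])

lemma psqrt_scale:
  assumes c: "0 < c" shows "psqrt (conv_sq (c *\<^sub>R r) (c *\<^sub>R s) v) = c *\<^sub>R psqrt (conv_sq r s v)"
proof -
  have "conv_sq (c *\<^sub>R r) (c *\<^sub>R s) v = c\<^sup>2 *\<^sub>R conv_sq r s v"
    by (simp add: conv_sq_def scaleR_add_right power2_eq_square)
  moreover have "msqrt d (c\<^sup>2 *\<^sub>R conv_sq r s v) = c *\<^sub>R msqrt d (conv_sq r s v)"
    if "conv_sq r s v \<in> PiQ d"
    using that c by (intro msqrt_eqI) (auto simp: power2_eq_square)
  ultimately show ?thesis using c by (simp add: psqrt_def PiQ_scaleR_iff)
qed

end

context wishart_setting
begin

definition conv_kernel :: "'q mat \<Rightarrow> 'q mat \<Rightarrow> 'q mat measure" where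
  "conv_kernel r s = distr ball_law (PiS d) (\<lambda>v. psqrt (conv_sq r s v))"

lemma conv_sq_measurable [measurable]: "conv_sq r s \<in> borel_measurable borel" for r s :: "'q mat"
  unfolding conv_sq_def[abs_def] by (intro borel_measurable_continuous_onI continuous_intros)

lemma psqrt_conv_sq_measurable: "(\<lambda>v. psqrt (conv_sq r s v)) \<in> ball_law \<rightarrow>\<^sub>M PiS d"
  by measurable

lemma pconv_eq_conv_kernel:
  assumes "r \<in> PiQ d" "s \<in> PiQ d" shows "pconv d \<mu> r s = conv_kernel r s"
proof -
  have "pconv d \<mu> r s = distr ball_law (PiS d) (\<lambda>v. msqrt d (conv_sq r s v))"
    by (simp add: pconv_def ball_law_def conv_sq_def)
  also have "\<dots> = conv_kernel r s"
    unfolding conv_kernel_def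
  proof (rule distr_msqrt)
    show "AE v in ball_law. conv_sq r s v \<in> PiQ d"
      using AE_ball_law by eventually_elim (use assms in \<open>simp add: conv_sq_PiQ\<close>)
  qed measurable
  finally show ?thesis .
qed

lemma conv_kernel_measurable: "(\<lambda>(r, s). conv_kernel r s) \<in> PiS d \<Otimes>\<^sub>M PiS d \<rightarrow>\<^sub>M prob_algebra (PiS d)"
proof -
  have PiS_borel: "(\<lambda>x. x) \<in> PiS d \<rightarrow>\<^sub>M borel" by (rule measurable_PiS) simp
  have joint: "(\<lambda>x::('q mat \<times> 'q mat) \<times> 'q mat. conv_sq (fst (fst x)) (snd (fst x)) (snd x)) \<in>
      borel_measurable ((borel \<Otimes>\<^sub>M borel) \<Otimes>\<^sub>M borel)"
    unfolding borel_prod conv_sq_def by (intro borel_measurable_continuous_onI continuous_intros)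
  have embed: "(\<lambda>x. ((fst (fst x), snd (fst x)), snd x)) \<in> (PiS d \<Otimes>\<^sub>M PiS d) \<Otimes>\<^sub>M ball_law \<rightarrow>\<^sub>M
      (borel \<Otimes>\<^sub>M borel) \<Otimes>\<^sub>M borel"
    using PiS_borel by measurable
  have "(\<lambda>x. psqrt (conv_sq (fst (fst x)) (snd (fst x)) (snd x))) \<in>
      (PiS d \<Otimes>\<^sub>M PiS d) \<Otimes>\<^sub>M ball_law \<rightarrow>\<^sub>M PiS d"
    using measurable_compose[OF measurable_compose[OF embed joint] psqrt_measurable] by simp
  moreover have "(\<lambda>p. ball_law) \<in> PiS d \<Otimes>\<^sub>M PiS d \<rightarrow>\<^sub>M prob_algebra ball_law"
    by (intro measurable_const) (simp add: space_prob_algebra ball_law.prob_space_axioms)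
  ultimately have "(\<lambda>p. distr ball_law (PiS d) (\<lambda>v. psqrt (conv_sq (fst p) (snd p) v))) \<in>
      PiS d \<Otimes>\<^sub>M PiS d \<rightarrow>\<^sub>M prob_algebra (PiS d)"
    by (intro measurable_distr_prob_space2) (simp_all add: case_prod_beta')
  then show ?thesis by (simp add: conv_kernel_def case_prod_beta')
qed

lemma conv_kernel_measurable_right:
  assumes "r \<in> PiQ d" shows "conv_kernel r \<in> PiS d \<rightarrow>\<^sub>M prob_algebra (PiS d)"
  using measurable_compose[OF measurable_Pair1' conv_kernel_measurable, of r] assms
  by (simp add: space_PiS)

lemma cone_law_conv_kernel: "cone_law (conv_kernel r s)"
  unfolding conv_kernel_def
  using ball_law.prob_space_distr[OF psqrt_conv_sq_measurable] by (simp add: space_prob_algebra)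

lemma bind_conv_kernel_measurable:
  "cone_law N \<Longrightarrow> (\<lambda>r. N \<bind> conv_kernel r) \<in> PiS d \<rightarrow>\<^sub>M prob_algebra (PiS d)"
  by (rule measurable_bind_prob_space2[OF measurable_const conv_kernel_measurable])

lemma mconv_eq:
  assumes "cone_law M" "cone_law N" shows "mconv d \<mu> M N = M \<bind> (\<lambda>r. N \<bind> conv_kernel r)"
  unfolding mconv_def using assms
  by (intro bind_cong refl) (auto simp: cone_lawD pconv_eq_conv_kernel intro!: bind_cong)

lemma cone_law_mconv:
  assumes M: "cone_law M" and N: "cone_law (N :: 'q mat measure)" shows "cone_law (mconv d \<mu> M N)"
  using prob_space_bind'[OF M bind_conv_kernel_measurable[OF N]]
    sets_bind'[OF M bind_conv_kernel_measurable[OF N]]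
  by (simp add: mconv_eq[OF M N] space_prob_algebra)

lemma cone_law_convpow: "cone_law \<nu> \<Longrightarrow> cone_law (convpow d \<mu> \<nu> n)" for \<nu> :: "'q mat measure"
proof (induction n)
  case 0
  show ?case by (simp add: space_prob_algebra prob_space_return space_PiS)
qed (simp add: cone_law_mconv)

lemma integral_conv_kernel:
  fixes f :: "'q mat \<Rightarrow> real"
  shows "f \<in> borel_measurable (PiS d) \<Longrightarrow>
    (\<integral>x. f x \<partial>conv_kernel r s) = (\<integral>v. f (psqrt (conv_sq r s v)) \<partial>ball_law)"
  unfolding conv_kernel_def by (rule integral_distr[OF psqrt_conv_sq_measurable])

lemma nn_integral_mconv:
  assumes M: "cone_law M" and N: "cone_law N" and f: "f \<in> borel_measurable (PiS d)"
  shows "(\<integral>\<^sup>+x. f x \<partial>mconv d \<mu> M N) = (\<integral>\<^sup>+r. (\<integral>\<^sup>+s. (\<integral>\<^sup>+x. f x \<partial>conv_kernel r s) \<partial>N) \<partial>M)"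
proof -
  have "(\<integral>\<^sup>+x. f x \<partial>mconv d \<mu> M N) = (\<integral>\<^sup>+r. (\<integral>\<^sup>+x. f x \<partial>(N \<bind> conv_kernel r)) \<partial>M)"
    unfolding mconv_eq[OF M N]
    by (intro nn_integral_bind[OF f] measurable_cone_law[OF M] measurable_prob_algebraD
        bind_conv_kernel_measurable N)
  also have "\<dots> = (\<integral>\<^sup>+r. (\<integral>\<^sup>+s. (\<integral>\<^sup>+x. f x \<partial>conv_kernel r s) \<partial>N) \<partial>M)"
    using cone_lawD(3)[OF M]
    by (intro nn_integral_cong nn_integral_bind[OF f] measurable_cone_law[OF N] measurable_prob_algebraD
        conv_kernel_measurable_right) simp
  finally show ?thesis .
qed

lemma
  fixes f :: "'q mat \<Rightarrow> real"
  assumes M: "cone_law M" and N: "cone_law N"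
    and f: "f \<in> borel_measurable (PiS d)" "\<And>r. r \<in> PiQ d \<Longrightarrow> \<bar>f r\<bar> \<le> B"
  shows integral_mconv: "(\<integral>x. f x \<partial>mconv d \<mu> M N) = (\<integral>r. (\<integral>s. (\<integral>x. f x \<partial>conv_kernel r s) \<partial>N) \<partial>M)"
    and integrable_mconv_outer: "integrable M (\<lambda>r. \<integral>s. (\<integral>x. f x \<partial>conv_kernel r s) \<partial>N)"
    and integrable_mconv_inner: "r \<in> PiQ d \<Longrightarrow> integrable N (\<lambda>s. \<integral>x. f x \<partial>conv_kernel r s)"
proof -
  have bound: "\<bar>f r\<bar> \<le> B" if "r \<in> space (PiS d)" for r using f(2) that by (simp add: space_PiS)
  note outer = bind_conv_kernel_measurable[OF N] and inner = conv_kernel_measurable_right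
  have bind: "integral\<^sup>L (N \<bind> conv_kernel r) f = (\<integral>s. (\<integral>x. f x \<partial>conv_kernel r s) \<partial>N)" if "r \<in> PiQ d"
    for r
    by (rule integral_bind_kernel[OF N inner[OF that] f(1) bound])
  have "(\<integral>x. f x \<partial>mconv d \<mu> M N) = (\<integral>r. integral\<^sup>L (N \<bind> conv_kernel r) f \<partial>M)"
    unfolding mconv_eq[OF M N] by (rule integral_bind_kernel[OF M outer f(1) bound])
  also have "\<dots> = (\<integral>r. (\<integral>s. (\<integral>x. f x \<partial>conv_kernel r s) \<partial>N) \<partial>M)"
    by (rule Bochner_Integration.integral_cong[OF refl]) (simp add: bind cone_lawD(3)[OF M])
  finally show "(\<integral>x. f x \<partial>mconv d \<mu> M N) = (\<integral>r. (\<integral>s. (\<integral>x. f x \<partial>conv_kernel r s) \<partial>N) \<partial>M)" .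
  show "integrable M (\<lambda>r. \<integral>s. (\<integral>x. f x \<partial>conv_kernel r s) \<partial>N)"
    using integrable_kernel[OF M outer f(1) bound]
    by (rule Bochner_Integration.integrable_cong[OF refl, THEN iffD1, rotated])
      (use bind cone_lawD(3)[OF M] in auto)
  show "integrable N (\<lambda>s. \<integral>x. f x \<partial>conv_kernel r s)" if "r \<in> PiQ d"
    by (rule integrable_kernel[OF N inner[OF that] f(1) bound])
qed

section \<open>Scaling and second moments\<close>

lemma conv_kernel_scale:
  assumes "0 < c"
  shows "distr (conv_kernel r s) (PiS d) (\<lambda>x. c *\<^sub>R x) = conv_kernel (c *\<^sub>R r) (c *\<^sub>R s)"
  unfolding conv_kernel_def psqrt_scale[OF assms] using assms
  by (subst distr_distr[OF scale_measurable psqrt_conv_sq_measurable]) (simp_all add: comp_def)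

lemma mconv_scale:
  fixes M N :: "'q mat measure"
  assumes M: "cone_law M" and N: "cone_law N" and c: "0 < c"
  shows "distr (mconv d \<mu> M N) (PiS d) (\<lambda>r. c *\<^sub>R r) =
     mconv d \<mu> (distr M (PiS d) (\<lambda>r. c *\<^sub>R r)) (distr N (PiS d) (\<lambda>r. c *\<^sub>R r))"
proof -
  let ?T = "\<lambda>M :: 'q mat measure. distr M (PiS d) (\<lambda>r. c *\<^sub>R r)"
  have scale: "(\<lambda>r. c *\<^sub>R r) \<in> PiS d \<rightarrow>\<^sub>M PiS d" and TM: "cone_law (?T M)" and TN: "cone_law (?T N)"
    using c M N by (auto intro: scale_measurable cone_law_scale)
  have nonempty: "space M \<noteq> {}" "space N \<noteq> {}" using M N by (auto simp: cone_lawD intro: PiQ_simps)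
  note subprob = measurable_prob_algebraD[OF conv_kernel_measurable_right]
  have inner: "?T (N \<bind> conv_kernel r) = ?T N \<bind> conv_kernel (c *\<^sub>R r)" if r: "r \<in> PiQ d" for r
  proof -
    have "?T (N \<bind> conv_kernel r) = N \<bind> (\<lambda>s. ?T (conv_kernel r s))"
      by (rule distr_bind[OF measurable_cone_law[OF N subprob[OF r]] nonempty(2) scale])
    also have "\<dots> = N \<bind> (\<lambda>s. conv_kernel (c *\<^sub>R r) (c *\<^sub>R s))" by (simp only: conv_kernel_scale[OF c])
    also have "\<dots> = ?T N \<bind> conv_kernel (c *\<^sub>R r)"
      using r c by (intro bind_distr[OF measurable_cone_law[OF N scale] subprob nonempty(2), symmetric])
        simp
    finally show ?thesis .
  qed
  have "?T (mconv d \<mu> M N) = M \<bind> (\<lambda>r. ?T (N \<bind> conv_kernel r))"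
    unfolding mconv_eq[OF M N]
    by (rule distr_bind[OF measurable_cone_law[OF M measurable_prob_algebraD[OF bind_conv_kernel_measurable[OF N]]]
          nonempty(1) scale])
  also have "\<dots> = M \<bind> (\<lambda>r. ?T N \<bind> conv_kernel (c *\<^sub>R r))"
    by (rule bind_cong[OF refl]) (simp add: inner cone_lawD(3)[OF M])
  also have "\<dots> = mconv d \<mu> (?T M) (?T N)"
    unfolding mconv_eq[OF TM TN]
    by (rule bind_distr[OF measurable_cone_law[OF M scale]
          measurable_prob_algebraD[OF bind_conv_kernel_measurable[OF TN]] nonempty(1), symmetric])
  finally show ?thesis .
qed

lemma Tmeas_convpow:
  fixes \<nu> :: "'q mat measure"
  assumes "cone_law \<nu>" "0 < c"
  shows "Tmeas d (c *\<^sub>R mid) (convpow d \<mu> \<nu> n) = convpow d \<mu> (Tmeas d (c *\<^sub>R mid) \<nu>) n"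
proof (induction n)
  case 0
  have "cone_law (return (PiS d) (0 :: 'q mat))" using cone_law_convpow[OF assms(1), of 0] by simp
  then show ?case using assms scale_measurable[of c]
    by (simp add: Tmeas_scale less_imp_le) (subst distr_return, auto simp: space_PiS)
next
  case (Suc n)
  then show ?case using assms
    by (simp add: Tmeas_scale cone_law_mconv cone_law_convpow mconv_scale less_imp_le)
qed

lemma norm_psqrt_conv_sq:
  assumes r: "r \<in> PiQ d" and s: "s \<in> PiQ d" and v: "v \<in> Dset d"
  shows "(norm (psqrt (conv_sq r s v)))\<^sup>2 = (norm r)\<^sup>2 + (norm s)\<^sup>2 + (2 *\<^sub>R mmul s r) \<bullet> v"
proof -
  have "(norm (psqrt (conv_sq r s v)))\<^sup>2 = retr (conv_sq r s v)"
    using conv_sq_PiQ[of r s v] assms norm_sq_eq_retr[of "psqrt (conv_sq r s v)"]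
    by (simp add: psqrt_def)
  also have "\<dots> = mid \<bullet> mmul (conv_sq r s v) mid" by (simp add: retr_eq_inner)
  also have "\<dots> = (norm r)\<^sup>2 + (norm s)\<^sup>2 + 2 * (mmul v r \<bullet> s)"
    using r s by (subst inner_mmul_conv_sq) auto
  also have "mmul v r \<bullet> s = mmul s r \<bullet> v"
    using r inner_mmul_right[of v r s] by (simp add: inner_commute)
  finally show ?thesis by simp
qed

lemma nn_integral_conv_kernel_norm_sq:
  assumes r: "r \<in> PiQ d" and s: "s \<in> PiQ d"
  shows "(\<integral>\<^sup>+x. ennreal ((norm x)\<^sup>2) \<partial>conv_kernel r s) = ennreal ((norm r)\<^sup>2 + (norm s)\<^sup>2)"
proof -
  define b where "b = 2 *\<^sub>R mmul s r"
  let ?X = "\<lambda>v. (norm r)\<^sup>2 + (norm s)\<^sup>2 + b \<bullet> v"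
  have b: "In_M d b" using r s by (simp add: b_def)
  have eq: "AE v in ball_law. (norm (psqrt (conv_sq r s v)))\<^sup>2 = ?X v"
    using AE_ball_law unfolding b_def by eventually_elim (rule norm_psqrt_conv_sq[OF assms])
  then have nonneg: "AE v in ball_law. 0 \<le> ?X v" by eventually_elim (metis zero_le_power2)
  have int: "integrable ball_law ?X"
    by (intro Bochner_Integration.integrable_add integrable_ball_law_inner) simp_all
  have "(\<integral>\<^sup>+x. ennreal ((norm x)\<^sup>2) \<partial>conv_kernel r s) =
      (\<integral>\<^sup>+v. ennreal ((norm (psqrt (conv_sq r s v)))\<^sup>2) \<partial>ball_law)"
    unfolding conv_kernel_def
    by (rule nn_integral_distr[OF psqrt_conv_sq_measurable]) (simp add: norm_sq_measurable)
  also have "\<dots> = (\<integral>\<^sup>+v. ennreal (?X v) \<partial>ball_law)"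
    by (rule nn_integral_cong_AE) (use eq in eventually_elim, simp)
  also have "\<dots> = ennreal (\<integral>v. ?X v \<partial>ball_law)" using nn_integral_eq_integral[OF int nonneg] .
  also have "(\<integral>v. ?X v \<partial>ball_law) = (norm r)\<^sup>2 + (norm s)\<^sup>2"
    using integral_ball_law_inner[OF b] integrable_ball_law_inner[of b] ball_law.prob_space
    by (subst Bochner_Integration.integral_add) auto
  finally show ?thesis .
qed

lemma convpow_second_moment:
  fixes \<nu> :: "'q mat measure"
  assumes \<nu>: "cone_law \<nu>"
  shows "(\<integral>\<^sup>+r. ennreal ((norm r)\<^sup>2) \<partial>convpow d \<mu> \<nu> n) = of_nat n * (\<integral>\<^sup>+r. ennreal ((norm r)\<^sup>2) \<partial>\<nu>)"
proof (induction n)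
  case 0
  then show ?case using nn_integral_return[OF _ norm_sq_measurable, of 0] by (simp add: space_PiS)
next
  case (Suc n)
  let ?M = "convpow d \<mu> \<nu> n" and ?f = "\<lambda>r::'q mat. ennreal ((norm r)\<^sup>2)"
  have M: "cone_law ?M" using \<nu> by (rule cone_law_convpow)
  interpret M: prob_space ?M using M by (rule cone_lawD)
  interpret N: prob_space \<nu> using \<nu> by (rule cone_lawD)
  have f: "?f \<in> borel_measurable ?M" "?f \<in> borel_measurable \<nu>"
    using measurable_cone_law[OF M norm_sq_measurable] measurable_cone_law[OF \<nu> norm_sq_measurable] .
  have "(\<integral>\<^sup>+r. ?f r \<partial>convpow d \<mu> \<nu> (Suc n)) = (\<integral>\<^sup>+r. (\<integral>\<^sup>+s. (\<integral>\<^sup>+x. ?f x \<partial>conv_kernel r s) \<partial>\<nu>) \<partial>?M)"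
    using nn_integral_mconv[OF M \<nu> norm_sq_measurable] by simp
  also have "\<dots> = (\<integral>\<^sup>+r. (\<integral>\<^sup>+s. ?f r + ?f s \<partial>\<nu>) \<partial>?M)"
    using cone_lawD(3)[OF M] cone_lawD(3)[OF \<nu>]
    by (intro nn_integral_cong) (simp add: nn_integral_conv_kernel_norm_sq)
  also have "\<dots> = (\<integral>\<^sup>+r. ?f r + (\<integral>\<^sup>+s. ?f s \<partial>\<nu>) \<partial>?M)"
    using f by (intro nn_integral_cong) (simp add: nn_integral_add N.emeasure_space_1)
  also have "\<dots> = (\<integral>\<^sup>+r. ?f r \<partial>?M) + (\<integral>\<^sup>+s. ?f s \<partial>\<nu>)"
    using f by (simp add: nn_integral_add M.emeasure_space_1)
  also have "\<dots> = of_nat (Suc n) * (\<integral>\<^sup>+s. ?f s \<partial>\<nu>)" by (simp add: Suc distrib_right add.commute)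
  finally show ?case .
qed

end

section \<open>The one-step expansion\<close>

lemma abs_exp_minus_second_order_le: "\<bar>exp x - (1 + x + x\<^sup>2 / 2)\<bar> \<le> \<bar>x\<bar> ^ 3 * max 1 (exp (x::real))"
proof -
  have "\<exists>t. exp x = (\<Sum>m<3. exp 0 / fact m * x ^ m) + exp t / fact 3 * x ^ 3 \<and> exp t \<le> max 1 (exp x)"
  proof (cases x "0::real" rule: linorder_cases)
    case less
    have "\<exists>t>x. t < 0 \<and> exp x = (\<Sum>m<3. exp 0 / fact m * x ^ m) + exp t / fact 3 * x ^ 3"
      using less by (intro Maclaurin_minus) (auto intro!: derivative_eq_intros)
    then show ?thesis by (metis exp_le_cancel_iff exp_zero less_imp_le max.coboundedI1)
  next
    case equal
    then show ?thesis by (intro exI[of _ 0]) (simp add: eval_nat_numeral)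
  next
    case greater
    have "\<exists>t>0. t < x \<and> exp x = (\<Sum>m<3. exp 0 / fact m * x ^ m) + exp t / fact 3 * x ^ 3"
      using greater by (intro Maclaurin) (auto intro!: derivative_eq_intros)
    then show ?thesis by (metis exp_le_cancel_iff less_imp_le max.coboundedI2)
  qed
  moreover have "(\<Sum>m<3. exp 0 / fact m * x ^ m) = 1 + x + x\<^sup>2 / 2" "fact 3 = (6::real)"
    by (simp_all add: eval_nat_numeral)
  ultimately obtain t where t: "exp x = (1 + x + x\<^sup>2 / 2) + exp t / 6 * x ^ 3" "exp t \<le> max 1 (exp x)"
    by (metis (no_types, lifting))
  then have "\<bar>exp x - (1 + x + x\<^sup>2 / 2)\<bar> = exp t / 6 * \<bar>x\<bar> ^ 3" by (simp add: abs_mult power_abs)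
  also have "\<dots> \<le> max 1 (exp x) * \<bar>x\<bar> ^ 3" using t(2) by (intro mult_right_mono) auto
  finally show ?thesis by (simp add: mult.commute)
qed

lemma power_mult_exp_minus_le:
  fixes a p :: real
  assumes "0 < n" "0 < a" "0 \<le> p"
  shows "(1 + p) ^ n * exp (- a * p) \<le> (real n / a) ^ n * exp a"
proof -
  have "a * (1 + p) / real n \<le> exp (a * (1 + p) / real n)"
    using exp_ge_add_one_self[of "a * (1 + p) / real n"] by linarith
  then have "1 + p \<le> real n / a * exp (a * (1 + p) / real n)" using assms by (simp add: field_simps)
  then have "(1 + p) ^ n \<le> (real n / a) ^ n * exp (a * (1 + p) / real n) ^ n"
    unfolding power_mult_distrib[symmetric] by (rule power_mono) (use assms in simp)
  also have "exp (a * (1 + p) / real n) ^ n = exp (a * (1 + p))"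
    using assms by (simp add: exp_of_nat_mult[symmetric])
  finally have "(1 + p) ^ n * exp (- a * p) \<le> (real n / a) ^ n * exp (a * (1 + p)) * exp (- a * p)"
    by (rule mult_right_mono) simp
  also have "\<dots> = (real n / a) ^ n * exp a" by (simp add: exp_add[symmetric] algebra_simps)
  finally show ?thesis .
qed

context field_dim
begin

lemma norm_msqrt_le: "A \<in> PiQ d \<Longrightarrow> norm (msqrt d A) \<le> sqrt (retr A)"
  using norm_sq_eq_retr[of "msqrt d A"] by (intro real_le_rsqrt) simp

lemma norm_msqrt_mmul_le: "A \<in> PiQ d \<Longrightarrow> norm (mmul (msqrt d A) m) \<le> sqrt (retr A) * norm m"
  by (rule order_trans[OF norm_mmul mult_right_mono[OF norm_msqrt_le]]) simp_all

lemma inner_PiQ_square_le: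
  assumes A: "A \<in> PiQ d" and s: "s \<in> Herm d" shows "A \<bullet> mmul s s \<le> retr A * (norm s)\<^sup>2"
proof -
  have "(norm (mmul (msqrt d A) s))\<^sup>2 \<le> (sqrt (retr A) * norm s)\<^sup>2"
    by (rule power_mono[OF norm_msqrt_mmul_le[OF A]]) simp
  then show ?thesis using retr_PiQ_nonneg[OF A]
    by (simp add: inner_PiQ_square[OF A s] power_mult_distrib)
qed

lemma norm_mmul_mmul_le:
  assumes A: "A \<in> PiQ d" and r: "r \<in> Herm d"
  shows "norm (mmul s (mmul A r)) \<le> norm s * (sqrt (retr A) * sqrt (A \<bullet> mmul r r))"
proof -
  let ?a = "msqrt d A"
  have "mmul A r = mmul ?a (mmul ?a r)" using A by (simp add: mmul_assoc[symmetric])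
  then have "norm (mmul s (mmul A r)) \<le> norm s * norm (mmul ?a (mmul ?a r))" by (simp add: norm_mmul)
  also have "\<dots> \<le> norm s * (sqrt (retr A) * norm (mmul ?a r))"
    by (intro mult_left_mono norm_msqrt_mmul_le A) simp
  finally show ?thesis by (simp add: inner_PiQ_square[OF A r])
qed

lemma norm_mmul_mmul_sq_le:
  assumes A: "A \<in> PiQ d" and r: "r \<in> Herm d"
  shows "(norm (mmul s (mmul A r)))\<^sup>2 \<le> (norm s)\<^sup>2 * (retr A * (A \<bullet> mmul r r))"
  using power_mono[OF norm_mmul_mmul_le[OF A r, of s], of 2] retr_PiQ_nonneg[OF A]
    inner_PiQ_nonneg[OF A PiQ_square[OF r]]
  by (simp add: power_mult_distrib)

lemma exp_inner_measurable: "(\<lambda>r. exp (- (A \<bullet> mmul r r))) \<in> borel_measurable (PiS d)"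
  for A :: "'q::finite mat"
  by (intro measurable_PiS borel_measurable_continuous_onI continuous_intros)

lemma exp_inner_le_1: "A \<in> PiQ d \<Longrightarrow> r \<in> PiQ d \<Longrightarrow> \<bar>exp (- (A \<bullet> mmul r r))\<bar> \<le> 1" for A r :: "'q::finite mat"
  using inner_PiQ_nonneg[of A "mmul r r"] PiQ_square[of r] by simp

definition increment :: "'q::finite mat \<Rightarrow> 'q mat \<Rightarrow> 'q mat \<Rightarrow> 'q mat \<Rightarrow> real" where
  "increment A r s v = A \<bullet> mmul s s + (2 *\<^sub>R mmul s (mmul A r)) \<bullet> v"

lemma inner_conv_sq:
  assumes A: "A \<in> Herm d" and r: "r \<in> Herm d" and s: "s \<in> Herm d"
  shows "A \<bullet> conv_sq r s v = A \<bullet> mmul r r + increment A r s v"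
proof -
  have cross: "A \<bullet> mmul s (mmul v r) = mmul s (mmul A r) \<bullet> v"
    using r s by (simp add: inner_mmul_left[of s] inner_mmul_right[of v] mmul_assoc inner_commute[of A]
        inner_commute[of _ v])
  have "A \<bullet> mmul r (mmul (madj v) s) = madj A \<bullet> madj (mmul r (mmul (madj v) s))"
    by (rule inner_madj[symmetric])
  also have "\<dots> = A \<bullet> mmul s (mmul v r)" using A r s by (simp add: mmul_assoc)
  finally show ?thesis using cross by (simp add: conv_sq_def increment_def inner_simps)
qed

lemma increment_ge:
  assumes A: "A \<in> PiQ d" and r: "r \<in> Herm d" and s: "s \<in> Herm d" and v: "v \<in> Dset d"
  shows "- (A \<bullet> mmul r r) \<le> increment A r s v"
    and "- (A \<bullet> mmul r r) / 2 - A \<bullet> mmul s s \<le> increment A r s v"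
proof -
  note conv = inner_conv_sq[OF PiQ_Herm[OF A] r s, of v]
  show "- (A \<bullet> mmul r r) \<le> increment A r s v"
    using inner_PiQ_nonneg[OF A conv_sq_PiQ[OF r s v]] conv by simp
  have "0 \<le> A \<bullet> (conv_sq r s v - ((1 - 1 / 2) *\<^sub>R mmul r r - (1 / (1 / 2) - 1) *\<^sub>R mmul s s))"
    by (rule inner_PiQ_nonneg[OF A conv_sq_lower_bound[OF r s v]]) simp
  then show "- (A \<bullet> mmul r r) / 2 - A \<bullet> mmul s s \<le> increment A r s v"
    by (simp add: inner_simps conv)
qed

end

context wishart_setting
begin

lemma
  assumes "In_M d A" "In_M d r" "In_M d s"
  shows integrable_increment: "integrable ball_law (increment A r s)"
    and integrable_increment_sq: "integrable ball_law (\<lambda>v. (increment A r s v)\<^sup>2)"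
    and integral_increment: "(\<integral>v. increment A r s v \<partial>ball_law) = A \<bullet> mmul s s"
    and integral_increment_sq: "(\<integral>v. (increment A r s v)\<^sup>2 \<partial>ball_law) =
      (A \<bullet> mmul s s)\<^sup>2 + 2 * (norm (mmul s (mmul A r)))\<^sup>2 / \<mu>"
proof -
  define b where "b = 2 *\<^sub>R mmul s (mmul A r)"
  have b: "In_M d b" using assms by (simp add: b_def)
  have inc: "increment A r s = (\<lambda>v. A \<bullet> mmul s s + b \<bullet> v)" by (simp add: increment_def[abs_def] b_def)
  show "integrable ball_law (increment A r s)"
    unfolding inc by (intro Bochner_Integration.integrable_add integrable_ball_law_inner) simp
  show "integrable ball_law (\<lambda>v. (increment A r s v)\<^sup>2)" unfolding inc
    by (rule integrable_ball_law_affine_sq[OF b])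
  show "(\<integral>v. increment A r s v \<partial>ball_law) = A \<bullet> mmul s s"
    unfolding inc using integral_ball_law_inner[OF b]
      integrable_ball_law_inner[of b] ball_law.prob_space
    by (subst Bochner_Integration.integral_add) auto
  show "(\<integral>v. (increment A r s v)\<^sup>2 \<partial>ball_law) = (A \<bullet> mmul s s)\<^sup>2 + 2 * (norm (mmul s (mmul A r)))\<^sup>2 / \<mu>"
    unfolding inc integral_ball_law_affine_sq[OF b] using mu_pos
    by (simp add: b_def power_mult_distrib field_simps)
qed

definition conv_laplace :: "'q mat \<Rightarrow> 'q mat \<Rightarrow> 'q mat \<Rightarrow> real" where
  "conv_laplace A r s = (\<integral>x. exp (- (A \<bullet> mmul x x)) \<partial>conv_kernel r s)"

lemma conv_laplace_bounds:
  assumes "A \<in> PiQ d" "r \<in> PiQ d" "s \<in> PiQ d" shows "0 \<le> conv_laplace A r s" "conv_laplace A r s \<le> 1"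
proof -
  show "0 \<le> conv_laplace A r s" unfolding conv_laplace_def by (rule integral_nonneg_AE) simp
  have "\<bar>conv_laplace A r s\<bar> \<le> 1"
    unfolding conv_laplace_def using assms exp_inner_le_1
    by (intro abs_integral_prob_algebra_le[OF cone_law_conv_kernel exp_inner_measurable])
      (simp add: space_PiS)
  then show "conv_laplace A r s \<le> 1" by simp
qed

lemma conv_laplace_eq:
  assumes A: "A \<in> PiQ d" and r: "r \<in> PiQ d" and s: "s \<in> PiQ d"
  shows "conv_laplace A r s = (\<integral>v. exp (- (A \<bullet> mmul r r)) * exp (- increment A r s v) \<partial>ball_law)"
proof -
  have [measurable]: "increment A r s \<in> borel_measurable borel" unfolding increment_def by measurable
  have "conv_laplace A r s = (\<integral>v. exp (- (A \<bullet> mmul (psqrt (conv_sq r s v)) (psqrt (conv_sq r s v))))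
      \<partial>ball_law)"
    unfolding conv_laplace_def by (rule integral_conv_kernel[OF exp_inner_measurable])
  also have "\<dots> = (\<integral>v. exp (- (A \<bullet> mmul r r)) * exp (- increment A r s v) \<partial>ball_law)"
  proof (rule integral_cong_AE)
    show "(\<lambda>v. exp (- (A \<bullet> mmul (psqrt (conv_sq r s v)) (psqrt (conv_sq r s v))))) \<in>
        borel_measurable ball_law"
      by (rule measurable_compose[OF psqrt_conv_sq_measurable exp_inner_measurable])
    show "AE v in ball_law. exp (- (A \<bullet> mmul (psqrt (conv_sq r s v)) (psqrt (conv_sq r s v)))) =
        exp (- (A \<bullet> mmul r r)) * exp (- increment A r s v)"
      using AE_ball_law
    proof eventually_elim
      fix v :: "'q mat" assume "v \<in> Dset d"
      then have "mmul (psqrt (conv_sq r s v)) (psqrt (conv_sq r s v)) = conv_sq r s v"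
        using r s by (simp add: psqrt_def conv_sq_PiQ)
      then show "exp (- (A \<bullet> mmul (psqrt (conv_sq r s v)) (psqrt (conv_sq r s v)))) =
          exp (- (A \<bullet> mmul r r)) * exp (- increment A r s v)"
        using A r s by (simp add: inner_conv_sq exp_add[symmetric])
    qed
  qed measurable
  finally show ?thesis .
qed

definition increment_const :: "real \<Rightarrow> real" where
  "increment_const L = L + 2 * norm (mid :: 'q mat) * sqrt L"

lemma increment_const_nonneg: "0 \<le> L \<Longrightarrow> 0 \<le> increment_const L" by (simp add: increment_const_def)

lemma abs_increment_le:
  fixes A r s v :: "'q mat"
  assumes A: "A \<in> PiQ d" "retr A \<le> L" and r: "r \<in> PiQ d" and s: "s \<in> PiQ d" "norm s \<le> 1"
    and v: "v \<in> Dset d"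
  shows "\<bar>increment A r s v\<bar> \<le> norm s * (increment_const L * (1 + A \<bullet> mmul r r))"
proof -
  define p where "p = A \<bullet> mmul r r"
  let ?w = "norm (mid :: 'q mat)" and ?B = "mmul s (mmul A r)"
  have L: "0 \<le> L" using retr_PiQ_nonneg[OF A(1)] A(2) by simp
  have p: "0 \<le> p" using inner_PiQ_nonneg[OF A(1) PiQ_square] r by (simp add: p_def)
  have "A \<bullet> mmul s s \<le> L * (norm s)\<^sup>2"
    using inner_PiQ_square_le[OF A(1), of s] s(1) mult_right_mono[OF A(2), of "(norm s)\<^sup>2"] by simp
  also have "\<dots> \<le> L * norm s"
    using s(2) L by (intro mult_left_mono) (auto simp: power2_eq_square intro: mult_left_le_one_le)
  finally have diagonal: "A \<bullet> mmul s s \<le> L * norm s" "0 \<le> A \<bullet> mmul s s"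
    using inner_PiQ_nonneg[OF A(1) PiQ_square] s by auto
  have "norm ?B \<le> norm s * (sqrt (retr A) * sqrt p)" unfolding p_def using r
    by (intro norm_mmul_mmul_le A) simp
  also have "\<dots> \<le> norm s * (sqrt L * sqrt p)" using A(2) p by (intro mult_left_mono mult_right_mono) auto
  finally have "\<bar>?B \<bullet> v\<bar> \<le> (norm s * (sqrt L * sqrt p)) * ?w"
    by (intro order_trans[OF Cauchy_Schwarz_ineq2 mult_mono] norm_Dset_le[OF v]) (use L p in auto)
  then have "\<bar>increment A r s v\<bar> \<le> L * norm s + 2 * ((norm s * (sqrt L * sqrt p)) * ?w)"
    unfolding increment_def using diagonal by simp
  also have "\<dots> = norm s * (L + 2 * ?w * sqrt L * sqrt p)" by (simp add: algebra_simps)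
  also have "\<dots> \<le> norm s * (increment_const L * (1 + p))"
  proof (rule mult_left_mono)
    have "sqrt p \<le> 1 + p" using p by (intro real_le_lsqrt) (auto simp: power2_eq_square algebra_simps)
    then have "2 * ?w * sqrt L * sqrt p \<le> 2 * ?w * sqrt L * (1 + p)" using L
      by (intro mult_left_mono) auto
    moreover have "L * 1 \<le> L * (1 + p)" using L p by (intro mult_left_mono) auto
    ultimately show "L + 2 * ?w * sqrt L * sqrt p \<le> increment_const L * (1 + p)"
      by (simp add: increment_const_def algebra_simps)
  qed simp
  finally show ?thesis unfolding p_def .
qed

definition cubic_const :: "real \<Rightarrow> real" where
  "cubic_const L = increment_const L ^ 3 * exp L * (216 * exp (1 / 2))"

lemma cubic_const_nonneg: "0 \<le> L \<Longrightarrow> 0 \<le> cubic_const L"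
  by (simp add: cubic_const_def increment_const_nonneg)

lemma exp_increment_remainder:
  fixes A r s v :: "'q mat"
  assumes A: "A \<in> PiQ d" "retr A \<le> L" and r: "r \<in> PiQ d" and s: "s \<in> PiQ d" "norm s \<le> 1"
    and v: "v \<in> Dset d"
  shows "exp (- (A \<bullet> mmul r r)) * \<bar>exp (- increment A r s v)
      - (1 - increment A r s v + (increment A r s v)\<^sup>2 / 2)\<bar>
    \<le> norm s ^ 3 * cubic_const L"
proof -
  define p z where "p = A \<bullet> mmul r r" and "z = increment A r s v"
  let ?c = "increment_const L"
  have L: "0 \<le> L" using retr_PiQ_nonneg[OF A(1)] A(2) by simp
  have p: "0 \<le> p" using inner_PiQ_nonneg[OF A(1) PiQ_square] r by (simp add: p_def)
  have "A \<bullet> mmul s s \<le> retr A * (norm s)\<^sup>2" using s(1) by (intro inner_PiQ_square_le A) simp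
  also have "\<dots> \<le> L * 1" using s(2) A(2) L by (intro mult_mono) (auto simp: power_le_one)
  finally have lower: "- (p / 2) - L \<le> z"
    using increment_ge(2)[OF A(1) PiQ_Herm[OF r] PiQ_Herm[OF s(1)] v] by (simp add: p_def z_def)
  have "exp (- p) * \<bar>exp (- z) - (1 - z + z\<^sup>2 / 2)\<bar> \<le> exp (- p) * (\<bar>z\<bar> ^ 3 * max 1 (exp (- z)))"
    using abs_exp_minus_second_order_le[of "- z"] by (intro mult_left_mono) auto
  also have "\<dots> = \<bar>z\<bar> ^ 3 * (exp (- p) * max 1 (exp (- z)))" by simp
  also have "\<dots> \<le> (norm s * (?c * (1 + p))) ^ 3 * (exp L * exp (- p / 2))"
  proof (rule mult_mono)
    show "\<bar>z\<bar> ^ 3 \<le> (norm s * (?c * (1 + p))) ^ 3"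
      unfolding z_def p_def by (intro power_mono abs_increment_le assms) simp
    have "exp (- p) * max 1 (exp (- z)) = max (exp (- p)) (exp (- p - z))"
      by (simp add: max_mult_distrib_left exp_diff exp_minus field_simps)
    also have "\<dots> \<le> exp (L - p / 2)" using lower p L by auto
    finally show "exp (- p) * max 1 (exp (- z)) \<le> exp L * exp (- p / 2)"
      by (simp add: exp_add[symmetric])
  qed (use L p in \<open>auto simp: increment_const_nonneg\<close>)
  also have "\<dots> = norm s ^ 3 * (?c ^ 3 * exp L * ((1 + p) ^ 3 * exp (- (1 / 2) * p)))"
    by (simp add: power_mult_distrib)
  also have "\<dots> \<le> norm s ^ 3 * (?c ^ 3 * exp L * (216 * exp (1 / 2)))"
    using power_mult_exp_minus_le[of 3 "1 / 2" p] p increment_const_nonneg[OF L]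
    by (intro mult_left_mono) auto
  finally show ?thesis unfolding p_def z_def cubic_const_def .
qed

definition conv_laplace_expansion :: "'q mat \<Rightarrow> 'q mat \<Rightarrow> 'q mat \<Rightarrow> real" where
  "conv_laplace_expansion A r s =
      exp (- (A \<bullet> mmul r r)) * (1 - A \<bullet> mmul s s + (norm (mmul s (mmul A r)))\<^sup>2 / \<mu>)"

lemma exp_mult_inner_square_sq_le:
  assumes A: "A \<in> PiQ d" "retr A \<le> L" and s: "s \<in> PiQ d" "norm s \<le> 1" and p: "0 \<le> p"
  shows "exp (- p) * (A \<bullet> mmul s s)\<^sup>2 / 2 \<le> norm s ^ 3 * L\<^sup>2"
proof -
  have y: "0 \<le> A \<bullet> mmul s s" using inner_PiQ_nonneg[OF A(1) PiQ_square] s by simp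
  have "A \<bullet> mmul s s \<le> L * (norm s)\<^sup>2"
    using inner_PiQ_square_le[OF A(1), of s] s(1) mult_right_mono[OF A(2), of "(norm s)\<^sup>2"] by simp
  then have "(A \<bullet> mmul s s)\<^sup>2 \<le> norm s ^ 4 * L\<^sup>2"
    using power_mono[OF _ y, of "L * (norm s)\<^sup>2" 2] by (simp add: power_mult_distrib mult.commute)
  also have "\<dots> \<le> norm s ^ 3 * L\<^sup>2" using s(2) by (intro mult_right_mono power_decreasing) auto
  finally have "(A \<bullet> mmul s s)\<^sup>2 \<le> norm s ^ 3 * L\<^sup>2" .
  moreover have "exp (- p) * (A \<bullet> mmul s s)\<^sup>2 \<le> 1 * (A \<bullet> mmul s s)\<^sup>2"
    using p by (intro mult_right_mono) auto
  ultimately show ?thesis using zero_le_power2[of "A \<bullet> mmul s s"] by linarith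
qed

lemma
  fixes A r s :: "'q mat"
  assumes In_M: "In_M d A" "In_M d r" "In_M d s"
  defines "z \<equiv> increment A r s"
  shows integrable_increment_quadratic: "integrable ball_law (\<lambda>v. 1 - z v + (z v)\<^sup>2 / 2)"
    and integral_increment_quadratic: "(\<integral>v. 1 - z v + (z v)\<^sup>2 / 2 \<partial>ball_law) =
      1 - A \<bullet> mmul s s + ((A \<bullet> mmul s s)\<^sup>2 / 2 + (norm (mmul s (mmul A r)))\<^sup>2 / \<mu>)"
  unfolding z_def
  using integrable_increment[OF In_M] integrable_increment_sq[OF In_M] integral_increment[OF In_M]
    integral_increment_sq[OF In_M] ball_law.prob_space
  by (simp_all add: add_divide_distrib)

lemma conv_laplace_expansion_small:
  assumes A: "A \<in> PiQ d" "retr A \<le> L" and r: "r \<in> PiQ d" and s: "s \<in> PiQ d" "norm s \<le> 1"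
  shows "\<bar>conv_laplace A r s - conv_laplace_expansion A r s\<bar> \<le> norm s ^ 3 * (L\<^sup>2 + cubic_const L)"
proof -
  define p y where "p = A \<bullet> mmul r r" and "y = A \<bullet> mmul s s"
  let ?z = "increment A r s" and ?B = "mmul s (mmul A r)"
  let ?R = "\<lambda>v. exp (- p) * (exp (- ?z v) - (1 - ?z v + (?z v)\<^sup>2 / 2))"
  have In_M: "In_M d A" "In_M d r" "In_M d s" using A r s by simp_all
  have p: "0 \<le> p" using inner_PiQ_nonneg[OF A(1) PiQ_square] r by (simp add: p_def)
  have bound: "AE v in ball_law. \<bar>?R v\<bar> \<le> norm s ^ 3 * cubic_const L"
    using AE_ball_law exp_increment_remainder[OF A r s]
    by (auto simp: abs_mult p_def elim!: eventually_mono)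
  have [measurable]: "?z \<in> borel_measurable borel" unfolding increment_def by measurable
  have R: "integrable ball_law ?R"
    using bound by (intro ball_law.integrable_const_bound[where B = "norm s ^ 3 * cubic_const L"]) auto
  have split: "conv_laplace A r s =
      (\<integral>v. ?R v \<partial>ball_law) + exp (- p) * (\<integral>v. 1 - ?z v + (?z v)\<^sup>2 / 2 \<partial>ball_law)"
  proof -
    have "?R v + exp (- p) * (1 - ?z v + (?z v)\<^sup>2 / 2) = exp (- p) * exp (- ?z v)" for v
      by (simp add: algebra_simps)
    then have "conv_laplace A r s = (\<integral>v. ?R v + exp (- p) * (1 - ?z v + (?z v)\<^sup>2 / 2) \<partial>ball_law)"
      unfolding conv_laplace_eq[OF A(1) r s(1)] p_def[symmetric] by simp
    also have "\<dots> = (\<integral>v. ?R v \<partial>ball_law) + (\<integral>v. exp (- p) * (1 - ?z v + (?z v)\<^sup>2 / 2) \<partial>ball_law)"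
      by (rule Bochner_Integration.integral_add[OF R integrable_mult_right[OF integrable_increment_quadratic[OF In_M]]])
    finally show ?thesis by simp
  qed
  have "conv_laplace A r s - conv_laplace_expansion A r s = (\<integral>v. ?R v \<partial>ball_law) + exp (- p) * y\<^sup>2 / 2"
    unfolding split integral_increment_quadratic[OF In_M] conv_laplace_expansion_def p_def y_def
    by (simp add: algebra_simps)
  moreover have "\<bar>\<integral>v. ?R v \<partial>ball_law\<bar> \<le> norm s ^ 3 * cubic_const L"
  proof -
    have "\<bar>\<integral>v. ?R v \<partial>ball_law\<bar> \<le> (\<integral>v. \<bar>?R v\<bar> \<partial>ball_law)" by (rule integral_abs_bound)
    also have "\<dots> \<le> (\<integral>v. norm s ^ 3 * cubic_const L \<partial>ball_law)"
      by (rule integral_mono_AE) (use R bound in auto)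
    finally show ?thesis using ball_law.prob_space by simp
  qed
  moreover have "0 \<le> exp (- p) * y\<^sup>2 / 2" by simp
  moreover have "exp (- p) * y\<^sup>2 / 2 \<le> norm s ^ 3 * L\<^sup>2"
    unfolding y_def by (rule exp_mult_inner_square_sq_le[OF A s p])
  ultimately show ?thesis unfolding distrib_left by linarith
qed

lemma conv_laplace_expansion_large:
  assumes A: "A \<in> PiQ d" "retr A \<le> L" and r: "r \<in> PiQ d" and s: "s \<in> PiQ d" "1 \<le> norm s"
  shows "\<bar>conv_laplace A r s - conv_laplace_expansion A r s\<bar> \<le> (norm s)\<^sup>2 * (2 + L + L / \<mu>)"
proof -
  define p y where "p = A \<bullet> mmul r r" and "y = A \<bullet> mmul s s"
  let ?n = "(norm s)\<^sup>2" and ?B = "mmul s (mmul A r)"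
  have L: "0 \<le> L" using retr_PiQ_nonneg[OF A(1)] A(2) by simp
  have p: "0 \<le> p" and y: "0 \<le> y" using inner_PiQ_nonneg[OF A(1) PiQ_square] r s
    by (auto simp: p_def y_def)
  have "y \<le> L * ?n"
    using inner_PiQ_square_le[OF A(1), of s] s(1) mult_right_mono[OF A(2), of ?n] by (simp add: y_def)
  then have first: "exp (- p) * (1 + y) \<le> 1 * (1 + L * ?n)" using p y by (intro mult_mono) auto
  have "(norm ?B)\<^sup>2 \<le> ?n * (retr A * p)" unfolding p_def using r by (intro norm_mmul_mmul_sq_le A) simp
  also have "\<dots> \<le> ?n * (L * p)" using A(2) p by (intro mult_left_mono mult_right_mono) auto
  finally have "exp (- p) * (norm ?B)\<^sup>2 \<le> exp (- p) * (?n * (L * p))" by (rule mult_left_mono) simp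
  also have "\<dots> = (?n * L) * (p * exp (- p))" by simp
  also have "\<dots> \<le> (?n * L) * 1"
  proof (rule mult_left_mono)
    have "p \<le> exp p" using exp_ge_add_one_self[of p] by linarith
    then show "p * exp (- p) \<le> 1" by (simp add: exp_minus field_simps)
  qed (use L in simp)
  finally have second: "exp (- p) * (norm ?B)\<^sup>2 / \<mu> \<le> ?n * L / \<mu>" using mu_pos
    by (simp add: divide_right_mono)
  have "\<bar>conv_laplace_expansion A r s\<bar> \<le> exp (- p) * (1 + y) + exp (- p) * (norm ?B)\<^sup>2 / \<mu>"
  proof -
    have "\<bar>1 - y + (norm ?B)\<^sup>2 / \<mu>\<bar> \<le> 1 + y + (norm ?B)\<^sup>2 / \<mu>" using y mu_pos by (simp add: abs_le_iff)
    then show ?thesis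
      by (simp add: conv_laplace_expansion_def p_def[symmetric] y_def[symmetric] abs_mult
          distrib_left[symmetric]
          times_divide_eq_right[symmetric] del: times_divide_eq_right)
  qed
  then have "\<bar>conv_laplace A r s - conv_laplace_expansion A r s\<bar> \<le> 2 + L * ?n + ?n * L / \<mu>"
    using conv_laplace_bounds[OF A(1) r s(1)] first second
      abs_triangle_ineq4[of "conv_laplace A r s" "conv_laplace_expansion A r s"] by simp
  also have "\<dots> \<le> 2 * ?n + L * ?n + ?n * L / \<mu>" using s(2) by (simp add: one_le_power)
  also have "\<dots> = ?n * (2 + L + L / \<mu>)" by (simp add: algebra_simps)
  finally show ?thesis .
qed

definition step_const :: "real \<Rightarrow> real" where
  "step_const L = 2 + L + L / \<mu> + L\<^sup>2 + cubic_const L"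

lemma conv_laplace_expansion_error:
  assumes A: "A \<in> PiQ d" "retr A \<le> L" and r: "r \<in> PiQ d" and s: "s \<in> PiQ d"
  shows "\<bar>conv_laplace A r s - conv_laplace_expansion A r s\<bar> \<le>
      step_const L * ((norm s)\<^sup>2 * min (norm s) 1)"
proof -
  have L: "0 \<le> L" using retr_PiQ_nonneg[OF A(1)] A(2) by simp
  show ?thesis
  proof (cases "norm s \<le> 1")
    case True
    have "norm s ^ 3 * (L\<^sup>2 + cubic_const L) \<le> norm s ^ 3 * step_const L"
      unfolding step_const_def using L mu_pos by (intro mult_left_mono) auto
    then show ?thesis
      using conv_laplace_expansion_small[OF A r s True] True
      by (simp add: power3_eq_cube power2_eq_square mult_ac)
  next
    case False
    have "(norm s)\<^sup>2 * (2 + L + L / \<mu>) \<le> (norm s)\<^sup>2 * step_const L"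
      unfolding step_const_def using cubic_const_nonneg[OF L] by (intro mult_left_mono) auto
    then show ?thesis using conv_laplace_expansion_large[OF A r s] False by (simp add: mult.commute)
  qed
qed

end

section \<open>The heat flow of Laplace exponents\<close>

lemma second_order_taylor_bound:
  fixes f f' f'' :: "real \<Rightarrow> real"
  assumes f: "\<And>x. a \<le> x \<Longrightarrow> x \<le> a + e \<Longrightarrow> (f has_real_derivative f' x) (at x)"
    and f': "\<And>x. a \<le> x \<Longrightarrow> x \<le> a + e \<Longrightarrow> (f' has_real_derivative f'' x) (at x)"
    and bound: "\<And>x. a \<le> x \<Longrightarrow> x \<le> a + e \<Longrightarrow> \<bar>f'' x\<bar> \<le> K" and e: "0 < e"
  shows "\<bar>f (a + e) - (f a + e * f' a)\<bar> \<le> K * e\<^sup>2"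
proof -
  obtain u where u: "a < u" "u < a + e" "f (a + e) - f a = e * f' u"
    using MVT2[of a "a + e" f f'] f e by auto
  obtain v where v: "a < v" "v < u" "f' u - f' a = (u - a) * f'' v"
    using MVT2[of a u f' f''] f' u by auto
  have "f (a + e) - (f a + e * f' a) = e * (f' u - f' a)" using u(3) by (simp add: algebra_simps)
  then have "\<bar>f (a + e) - (f a + e * f' a)\<bar> = e * ((u - a) * \<bar>f'' v\<bar>)"
    using e u v by (simp add: abs_mult)
  also have "\<dots> \<le> e * (e * K)" using u v e bound[of v] by (intro mult_left_mono mult_mono) auto
  finally show ?thesis by (simp add: power2_eq_square mult_ac)
qed

locale heat_exponent =
  fixes m :: real and l X :: "'i::finite \<Rightarrow> real"
  assumes m_nonneg: "0 \<le> m" and l_nonneg: "\<And>i. 0 \<le> l i" and X_nonneg: "\<And>i. 0 \<le> X i"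
begin

definition exponent :: "real \<Rightarrow> real" where
  "exponent t = (\<Sum>i\<in>UNIV. - m * ln (1 + 2 * t * l i) - X i / (1 + 2 * t * l i))"

definition exponent' :: "real \<Rightarrow> real" where
  "exponent' t = (\<Sum>i\<in>UNIV. - 2 * m * l i / (1 + 2 * t * l i) + 2 * l i * X i / (1 + 2 * t * l i)\<^sup>2)"

definition exponent'' :: "real \<Rightarrow> real" where
  "exponent'' t = (\<Sum>i\<in>UNIV. 4 * m * (l i)\<^sup>2 / (1 + 2 * t * l i)\<^sup>2
      - 8 * (l i)\<^sup>2 * X i / (1 + 2 * t * l i) ^ 3)"

definition decay :: real where
  "decay = (\<Sum>i\<in>UNIV. X i / (1 + 2 * l i))"

definition growth :: real where
  "growth = (\<Sum>i\<in>UNIV. 2 * m * l i + 4 * m * (l i)\<^sup>2 + (2 * l i + 8 * (l i)\<^sup>2) * (1 + 2 * l i))"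

lemma denominator_ge_1: "0 \<le> t \<Longrightarrow> 1 \<le> 1 + 2 * t * l i"
  using l_nonneg[of i] by simp

lemma denominator_pos: "0 \<le> t \<Longrightarrow> 0 < 1 + 2 * t * l i"
  using denominator_ge_1[of t i] by linarith

lemma divide_denominator:
  assumes "0 \<le> t" "0 \<le> a" shows "0 \<le> a / (1 + 2 * t * l i) ^ n" "a / (1 + 2 * t * l i) ^ n \<le> a"
  using assms denominator_ge_1[OF assms(1), of i] denominator_pos[OF assms(1), of i]
  by (auto simp: divide_le_eq mult_le_cancel_left1 one_le_power)

lemma exponent_has_derivative:
  assumes t: "0 \<le> t" shows "(exponent has_real_derivative exponent' t) (at t)"
  unfolding exponent_def[abs_def] exponent'_def
proof (rule DERIV_sum)
  fix i
  show "((\<lambda>t. - m * ln (1 + 2 * t * l i) - X i / (1 + 2 * t * l i)) has_real_derivative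
    - 2 * m * l i / (1 + 2 * t * l i) + 2 * l i * X i / (1 + 2 * t * l i)\<^sup>2) (at t)"
    using denominator_pos[OF t, of i]
    by (auto intro!: derivative_eq_intros simp: power2_eq_square mult_ac)
qed

lemma exponent'_has_derivative:
  assumes t: "0 \<le> t" shows "(exponent' has_real_derivative exponent'' t) (at t)"
  unfolding exponent'_def[abs_def] exponent''_def
proof (rule DERIV_sum)
  fix i
  show "((\<lambda>t. - 2 * m * l i / (1 + 2 * t * l i)
      + 2 * l i * X i / (1 + 2 * t * l i)\<^sup>2) has_real_derivative
    4 * m * (l i)\<^sup>2 / (1 + 2 * t * l i)\<^sup>2 - 8 * (l i)\<^sup>2 * X i / (1 + 2 * t * l i) ^ 3) (at t)"
    unfolding divide_inverse power_inverse[symmetric]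
    using denominator_pos[OF t, of i]
    by (auto intro!: derivative_eq_intros simp: eval_nat_numeral algebra_simps)
qed

lemma decay_nonneg: "0 \<le> decay"
  unfolding decay_def using X_nonneg l_nonneg
  by (intro sum_nonneg divide_nonneg_nonneg) (auto simp: add_nonneg_nonneg)

lemma growth_nonneg: "0 \<le> growth"
  unfolding growth_def using l_nonneg m_nonneg
  by (intro sum_nonneg) (auto intro!: add_nonneg_nonneg mult_nonneg_nonneg)

lemma X_le_decay: "X i \<le> (1 + 2 * l i) * decay"
proof -
  have "X i / (1 + 2 * l i) \<le> decay" unfolding decay_def
    using X_nonneg l_nonneg by (intro member_le_sum)
      (auto intro!: divide_nonneg_nonneg add_nonneg_nonneg)
  then show ?thesis using l_nonneg[of i] by (simp add: field_simps add_pos_nonneg)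
qed

lemma abs_exponent'_le:
  assumes t: "0 \<le> t" shows "\<bar>exponent' t\<bar> \<le> growth * (1 + decay)"
  unfolding exponent'_def growth_def sum_distrib_right
proof (rule order_trans[OF sum_abs sum_mono])
  fix i
  have "0 \<le> 2 * m * l i" "0 \<le> 2 * l i * X i" using l_nonneg[of i] X_nonneg[of i] m_nonneg by simp_all
  then have "\<bar>- 2 * m * l i / (1 + 2 * t * l i) + 2 * l i * X i / (1 + 2 * t * l i)\<^sup>2\<bar> \<le>
      2 * m * l i + 2 * l i * X i"
    using divide_denominator[OF t, of "2 * m * l i" i 1]
      divide_denominator[OF t, of "2 * l i * X i" i 2]
    unfolding power_one_right by linarith
  also have "\<dots> \<le> 2 * m * l i + 2 * l i * ((1 + 2 * l i) * decay)"
    using X_le_decay[of i] l_nonneg[of i] by (intro add_left_mono mult_left_mono) auto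
  also have "\<dots> \<le> (2 * m * l i + 4 * m * (l i)\<^sup>2 + (2 * l i + 8 * (l i)\<^sup>2) * (1 + 2 * l i)) * (1 + decay)"
    using l_nonneg[of i] m_nonneg decay_nonneg by (simp add: algebra_simps)
  finally show "\<bar>- 2 * m * l i / (1 + 2 * t * l i) + 2 * l i * X i / (1 + 2 * t * l i)\<^sup>2\<bar> \<le> \<dots>" .
qed

lemma abs_exponent''_le:
  assumes t: "0 \<le> t" shows "\<bar>exponent'' t\<bar> \<le> growth * (1 + decay)"
  unfolding exponent''_def growth_def sum_distrib_right
proof (rule order_trans[OF sum_abs sum_mono])
  fix i
  have "0 \<le> 4 * m * (l i)\<^sup>2" "0 \<le> 8 * (l i)\<^sup>2 * X i" using X_nonneg[of i] m_nonneg by simp_all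
  then have "\<bar>4 * m * (l i)\<^sup>2 / (1 + 2 * t * l i)\<^sup>2 - 8 * (l i)\<^sup>2 * X i / (1 + 2 * t * l i) ^ 3\<bar>
      \<le> 4 * m * (l i)\<^sup>2 + 8 * (l i)\<^sup>2 * X i"
    using divide_denominator[OF t, of "4 * m * (l i)\<^sup>2" i 2]
      divide_denominator[OF t, of "8 * (l i)\<^sup>2 * X i" i 3]
    by linarith
  also have "\<dots> \<le> 4 * m * (l i)\<^sup>2 + 8 * (l i)\<^sup>2 * ((1 + 2 * l i) * decay)"
    using X_le_decay[of i] by (intro add_left_mono mult_left_mono) auto
  also have "\<dots> \<le> (2 * m * l i + 4 * m * (l i)\<^sup>2 + (2 * l i + 8 * (l i)\<^sup>2) * (1 + 2 * l i)) * (1 + decay)"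
    using l_nonneg[of i] m_nonneg decay_nonneg by (simp add: algebra_simps)
  finally show "\<bar>4 * m * (l i)\<^sup>2 / (1 + 2 * t * l i)\<^sup>2 - 8 * (l i)\<^sup>2 * X i / (1 + 2 * t * l i) ^ 3\<bar> \<le> \<dots>" .
qed

lemma exponent_le: "0 \<le> t \<Longrightarrow> t \<le> 1 \<Longrightarrow> exponent t \<le> - decay"
  unfolding exponent_def decay_def sum_negf[symmetric]
proof (rule sum_mono)
  fix i assume t: "0 \<le> t" "t \<le> 1"
  have "0 \<le> m * ln (1 + 2 * t * l i)" using denominator_ge_1[OF t(1), of i] m_nonneg by simp
  moreover have "X i / (1 + 2 * l i) \<le> X i / (1 + 2 * t * l i)"
    using t l_nonneg[of i] X_nonneg[of i] denominator_pos[OF t(1), of i]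
    by (intro divide_left_mono) (auto simp: mult_left_le_one_le add_pos_nonneg)
  ultimately show "- m * ln (1 + 2 * t * l i) - X i / (1 + 2 * t * l i) \<le> - (X i / (1 + 2 * l i))"
    by simp
qed

lemma exp_exponent_second_derivative_le:
  assumes t: "0 \<le> t" "t \<le> 1"
  shows "\<bar>exp (exponent t) * (exponent'' t + (exponent' t)\<^sup>2)\<bar> \<le> (growth + growth\<^sup>2) * (4 * exp 1)"
proof -
  have "\<bar>exponent'' t + (exponent' t)\<^sup>2\<bar> \<le> growth * (1 + decay) + (growth * (1 + decay))\<^sup>2"
    using abs_exponent''_le[OF t(1)] power_mono[OF abs_exponent'_le[OF t(1)], of 2]
      abs_triangle_ineq[of "exponent'' t" "(exponent' t)\<^sup>2"] by simp
  also have "\<dots> \<le> growth * (1 + decay)\<^sup>2 + growth\<^sup>2 * (1 + decay)\<^sup>2"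
    using growth_nonneg decay_nonneg self_le_power[of "1 + decay" 2]
    by (simp add: power_mult_distrib mult_left_mono)
  finally have "\<bar>exponent'' t + (exponent' t)\<^sup>2\<bar> \<le> (growth + growth\<^sup>2) * (1 + decay)\<^sup>2"
    by (simp add: distrib_right)
  then have "exp (exponent t) * \<bar>exponent'' t + (exponent' t)\<^sup>2\<bar> \<le>
      exp (- decay) * ((growth + growth\<^sup>2) * (1 + decay)\<^sup>2)"
    using exponent_le[OF t] by (intro mult_mono) auto
  also have "\<dots> = (growth + growth\<^sup>2) * ((1 + decay)\<^sup>2 * exp (- 1 * decay))" by simp
  also have "\<dots> \<le> (growth + growth\<^sup>2) * (4 * exp 1)"
    using power_mult_exp_minus_le[of 2 1 decay] decay_nonneg growth_nonneg
    by (intro mult_left_mono) auto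
  finally show ?thesis by (simp add: abs_mult)
qed

lemma exp_exponent_taylor:
  assumes t: "0 \<le> t" "0 < e" "t + e \<le> 1"
  shows "\<bar>exp (exponent (t + e)) - exp (exponent t) * (1 + e * exponent' t)\<bar> \<le>
      (growth + growth\<^sup>2) * (4 * exp 1) * e\<^sup>2"
proof -
  have "\<bar>exp (exponent (t + e)) - (exp (exponent t) + e * (exp (exponent t) * exponent' t))\<bar>
      \<le> (growth + growth\<^sup>2) * (4 * exp 1) * e\<^sup>2"
  proof (rule second_order_taylor_bound[of t e "\<lambda>t. exp (exponent t)"
        "\<lambda>t. exp (exponent t) * exponent' t"
        "\<lambda>t. exp (exponent t) * (exponent'' t + (exponent' t)\<^sup>2)"])
    fix x assume x: "t \<le> x" "x \<le> t + e"
    then have x': "0 \<le> x" "x \<le> 1" using t by simp_all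
    show "((\<lambda>t. exp (exponent t)) has_real_derivative exp (exponent x) * exponent' x) (at x)"
      using exponent_has_derivative[OF x'(1)] by (auto intro!: derivative_eq_intros)
    show "((\<lambda>t. exp (exponent t) * exponent' t) has_real_derivative
        exp (exponent x) * (exponent'' x + (exponent' x)\<^sup>2)) (at x)"
      using exponent_has_derivative[OF x'(1)] exponent'_has_derivative[OF x'(1)]
      by (auto intro!: derivative_eq_intros simp: power2_eq_square algebra_simps)
    show "\<bar>exp (exponent x) * (exponent'' x + (exponent' x)\<^sup>2)\<bar> \<le> (growth + growth\<^sup>2) * (4 * exp 1)"
      by (rule exp_exponent_second_derivative_le[OF x'])
  qed (rule t(2))
  then show ?thesis by (simp add: algebra_simps)
qed

end

section \<open>Convergence of Laplace transforms\<close>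

context field_dim
begin

lemma integral_Herm:
  fixes f :: "'a \<Rightarrow> 'q::finite mat"
  assumes int: "integrable M f" and f: "\<And>x. x \<in> space M \<Longrightarrow> f x \<in> Herm d"
  shows "integral\<^sup>L M f \<in> Herm d"
proof -
  have "madj (integral\<^sup>L M f) = (\<integral>x. madj (f x) \<partial>M)"
    using int by (rule integral_bounded_linear[OF bounded_linear_madj, symmetric])
  also have "\<dots> = integral\<^sup>L M f"
    by (rule Bochner_Integration.integral_cong[OF refl]) (rule Herm_D(2)[OF f])
  finally have "madj (integral\<^sup>L M f) = integral\<^sup>L M f" .
  moreover have "integral\<^sup>L M f $ i $ j $ k = 0" if k: "k \<notin> comps d" for i j k
  proof -
    have "bounded_linear (\<lambda>x::'q mat. x $ i $ j $ k)"
      by (simp add: linear_conv_bounded_linear[symmetric] linear_iff)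
    then have "integral\<^sup>L M f $ i $ j $ k = (\<integral>x. f x $ i $ j $ k \<partial>M)"
      using int by (rule integral_bounded_linear[symmetric])
    also have "\<dots> = (\<integral>x. 0 \<partial>M)"
      using k Herm_D(1)[OF f] by (intro Bochner_Integration.integral_cong refl) (auto simp: In_M_def)
    finally show ?thesis by simp
  qed
  ultimately show ?thesis unfolding Herm_def by (simp add: In_M_def)
qed

lemma integral_PiQ:
  fixes f :: "'a \<Rightarrow> 'q::finite mat"
  assumes int: "integrable M f" and f: "\<And>x. x \<in> space M \<Longrightarrow> f x \<in> PiQ d"
  shows "integral\<^sup>L M f \<in> PiQ d"
  unfolding PiQ_iff
proof safe
  show "integral\<^sup>L M f \<in> Herm d" using int f by (intro integral_Herm) simp_all
  fix m :: "'q mat" assume m: "In_M d m"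
  have "bounded_linear (\<lambda>x. m \<bullet> mmul x m)"
    by (simp add: linear_conv_bounded_linear[symmetric] linear_iff inner_simps)
  then have "m \<bullet> mmul (integral\<^sup>L M f) m = (\<integral>x. m \<bullet> mmul (f x) m \<partial>M)"
    using int by (rule integral_bounded_linear[symmetric])
  also have "0 \<le> \<dots>" using f m by (intro integral_nonneg_AE) (auto intro!: AE_I2 PiQ_nonneg)
  finally show "0 \<le> m \<bullet> mmul (integral\<^sup>L M f) m" .
qed

end

locale clt_setting = wishart_setting d \<mu> ty for d \<mu> and ty :: "'q::finite itself" +
  fixes \<nu> :: "'q mat measure"
  assumes cone_law: "cone_law \<nu>" and integrable_norm_sq: "integrable \<nu> (\<lambda>r. (norm r)\<^sup>2)"
begin

sublocale nu: prob_space \<nu> using cone_law by (rule cone_lawD)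

lemma space_nu: "space \<nu> = PiQ d" using cone_law by (rule cone_lawD)

lemma nu_measurable: "f \<in> borel_measurable borel \<Longrightarrow> f \<in> borel_measurable \<nu>"
  by (intro measurable_cone_law[OF cone_law] measurable_PiS)

definition second_moment :: "'q mat" where
  "second_moment = (\<integral>r. mmul r r \<partial>\<nu>)"

lemma integrable_square: "integrable \<nu> (\<lambda>r. mmul r r)"
proof (rule Bochner_Integration.integrable_bound[OF integrable_norm_sq])
  show "(\<lambda>r. mmul r r) \<in> borel_measurable \<nu>"
    by (intro nu_measurable borel_measurable_continuous_onI continuous_intros)
  show "AE r in \<nu>. norm (mmul r r) \<le> norm ((norm r)\<^sup>2)"
    using norm_mmul by (auto simp: power2_eq_square)
qed

lemma
  assumes "linear (T :: 'q mat \<Rightarrow> real)"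
  shows integrable_linear_square: "integrable \<nu> (\<lambda>r. T (mmul r r))"
    and integral_linear_square: "(\<integral>r. T (mmul r r) \<partial>\<nu>) = T second_moment"
proof -
  have "bounded_linear T" using assms linear_conv_bounded_linear by blast
  then show "integrable \<nu> (\<lambda>r. T (mmul r r))" "(\<integral>r. T (mmul r r) \<partial>\<nu>) = T second_moment"
    unfolding second_moment_def using integrable_square
    by (auto intro: integrable_bounded_linear integral_bounded_linear)
qed

lemma second_moment_PiQ: "second_moment \<in> PiQ d"
  unfolding second_moment_def
  by (rule integral_PiQ[OF integrable_square]) (simp add: space_nu PiQ_square)

definition truncated_moment :: "real \<Rightarrow> real" where
  "truncated_moment c = (\<integral>s. (norm s)\<^sup>2 * min (c * norm s) 1 \<partial>\<nu>)"

lemma truncated_le: "0 \<le> c \<Longrightarrow> norm ((norm s)\<^sup>2 * min (c * norm s) 1) \<le> (norm s)\<^sup>2" for s :: "'q mat"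
  using mult_left_mono[of "min (c * norm s) 1" 1 "(norm s)\<^sup>2"] by (simp add: abs_mult)

lemma truncated_integrable: "0 \<le> c \<Longrightarrow> integrable \<nu> (\<lambda>s. (norm s)\<^sup>2 * min (c * norm s) 1)"
  by (rule Bochner_Integration.integrable_bound[OF integrable_norm_sq])
    (use truncated_le in \<open>auto intro!: nu_measurable\<close>)

lemma truncated_moment_tendsto_0: "(\<lambda>n. truncated_moment (1 / sqrt (real n))) \<longlonglongrightarrow> 0"
proof -
  have "(\<lambda>n. \<integral>s. (norm s)\<^sup>2 * min (1 / sqrt (real n) * norm s) 1 \<partial>\<nu>) \<longlonglongrightarrow> (\<integral>s. 0 \<partial>\<nu>)"
  proof (rule integral_dominated_convergence[where w = "\<lambda>s. (norm s)\<^sup>2"])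
    show "AE s in \<nu>. (\<lambda>n. (norm s)\<^sup>2 * min (1 / sqrt (real n) * norm s) 1) \<longlonglongrightarrow> 0"
    proof (rule AE_I2)
      fix s :: "'q mat"
      have "(\<lambda>n. 1 / sqrt (real n)) \<longlonglongrightarrow> 0"
        by (intro tendsto_divide_0[OF tendsto_const] filterlim_at_top_imp_at_infinity
            filterlim_compose[OF sqrt_at_top filterlim_real_sequentially])
      then have "(\<lambda>n. (norm s)\<^sup>2 * min (1 / sqrt (real n) * norm s) 1) \<longlonglongrightarrow> (norm s)\<^sup>2 * min (0 * norm s) 1"
        by (intro tendsto_intros)
      then show "(\<lambda>n. (norm s)\<^sup>2 * min (1 / sqrt (real n) * norm s) 1) \<longlonglongrightarrow> 0" by simp
    qed
    show "AE s in \<nu>. norm ((norm s)\<^sup>2 * min (1 / sqrt (real n) * norm s) 1) \<le> (norm s)\<^sup>2" for n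
      by (intro AE_I2 truncated_le) simp
  qed (auto intro!: nu_measurable integrable_norm_sq)
  then show ?thesis by (simp add: truncated_moment_def)
qed

abbreviation scaled_law :: "real \<Rightarrow> 'q mat measure" where
  "scaled_law c \<equiv> distr \<nu> (PiS d) (\<lambda>r. c *\<^sub>R r)"

lemma cone_law_scaled_law: "0 \<le> c \<Longrightarrow> cone_law (scaled_law c)"
  using cone_law by (rule cone_law_scale)

definition step_expansion :: "'q mat \<Rightarrow> 'q mat \<Rightarrow> real \<Rightarrow> real" where
  "step_expansion A r e = exp (- (A \<bullet> mmul r r)) *
     (1 - e * (A \<bullet> second_moment) + e * (mmul A r \<bullet> mmul second_moment (mmul A r)) / \<mu>)"

lemma
  shows integrable_conv_laplace_expansion: "integrable \<nu> (\<lambda>s. conv_laplace_expansion A r (c *\<^sub>R s))"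
    and integral_conv_laplace_expansion:
      "(\<integral>s. conv_laplace_expansion A r (c *\<^sub>R s) \<partial>\<nu>) = step_expansion A r (c\<^sup>2)"
proof -
  let ?Q = "\<lambda>x. mmul A r \<bullet> mmul x (mmul A r)"
  have expand: "conv_laplace_expansion A r (c *\<^sub>R s) =
      exp (- (A \<bullet> mmul r r)) * (1 - c\<^sup>2 * (A \<bullet> mmul s s) + c\<^sup>2 * ?Q (mmul s s) / \<mu>)"
    if "s \<in> space \<nu>" for s
  proof -
    have "(norm (mmul s (mmul A r)))\<^sup>2 = ?Q (mmul s s)"
      using that by (simp add: space_nu power2_norm_eq_inner inner_mmul_left[of s] mmul_assoc)
    then show ?thesis by (simp add: conv_laplace_expansion_def power2_eq_square mult_ac
        power_mult_distrib)
  qed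
  have linear: "linear (\<lambda>x. A \<bullet> x)" "linear ?Q" by (simp_all add: linear_iff inner_simps)
  note int = linear[THEN integrable_linear_square]
  have "integrable \<nu> (\<lambda>s. exp (- (A \<bullet> mmul r r)) * (1 - c\<^sup>2 * (A \<bullet> mmul s s) + c\<^sup>2 * ?Q (mmul s s) / \<mu>))"
    using int by simp
  then show "integrable \<nu> (\<lambda>s. conv_laplace_expansion A r (c *\<^sub>R s))"
    by (rule Bochner_Integration.integrable_cong[OF refl, THEN iffD2, rotated]) (rule expand)
  have "(\<integral>s. conv_laplace_expansion A r (c *\<^sub>R s) \<partial>\<nu>) =
      (\<integral>s. exp (- (A \<bullet> mmul r r)) * (1 - c\<^sup>2 * (A \<bullet> mmul s s) + c\<^sup>2 * ?Q (mmul s s) / \<mu>) \<partial>\<nu>)"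
    by (rule Bochner_Integration.integral_cong[OF refl expand])
  also have "\<dots> = step_expansion A r (c\<^sup>2)"
    using int nu.prob_space by (simp add: step_expansion_def linear[THEN integral_linear_square])
  finally show "(\<integral>s. conv_laplace_expansion A r (c *\<^sub>R s) \<partial>\<nu>) = step_expansion A r (c\<^sup>2)" .
qed

lemma
  fixes f :: "'q mat \<Rightarrow> real"
  assumes c: "0 \<le> c" and f: "integrable (scaled_law c) f"
  shows integrable_scaled_law: "integrable \<nu> (\<lambda>s. f (c *\<^sub>R s))"
    and integral_scaled_law: "(\<integral>s. f s \<partial>scaled_law c) = (\<integral>s. f (c *\<^sub>R s) \<partial>\<nu>)"
  using measurable_cone_law[OF cone_law scale_measurable[OF c]] f
  by (auto intro: integrable_distr integral_distr dest: borel_measurable_integrable)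

lemma step_expansion_error:
  assumes A: "A \<in> PiQ d" "retr A \<le> L" and r: "r \<in> PiQ d" and c: "0 < c"
  shows "\<bar>(\<integral>s. conv_laplace A r s \<partial>scaled_law c) - step_expansion A r (c\<^sup>2)\<bar> \<le>
      step_const L * c\<^sup>2 * truncated_moment c"
proof -
  let ?G = "\<lambda>s. conv_laplace_expansion A r (c *\<^sub>R s)" and ?F = "\<lambda>s. conv_laplace A r (c *\<^sub>R s)"
  have c': "0 \<le> c" using c by simp
  have "integrable (scaled_law c) (conv_laplace A r)"
    using integrable_mconv_inner[OF cone_law_scaled_law[OF c'] cone_law_scaled_law[OF c']
        exp_inner_measurable
        exp_inner_le_1[OF A(1)] r] by (simp add: conv_laplace_def[abs_def])
  note F = integrable_scaled_law[OF c' this] integral_scaled_law[OF c' this]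
  note G = integrable_conv_laplace_expansion[of A r c]
  have "\<bar>(\<integral>s. conv_laplace A r s \<partial>scaled_law c) - step_expansion A r (c\<^sup>2)\<bar> = \<bar>\<integral>s. ?F s - ?G s \<partial>\<nu>\<bar>"
    unfolding F(2) integral_conv_laplace_expansion[symmetric] using F(1) G
    by (subst Bochner_Integration.integral_diff) auto
  also have "\<dots> \<le> (\<integral>s. \<bar>?F s - ?G s\<bar> \<partial>\<nu>)" by (rule integral_abs_bound)
  also have "\<dots> \<le> (\<integral>s. step_const L * c\<^sup>2 * ((norm s)\<^sup>2 * min (c * norm s) 1) \<partial>\<nu>)"
  proof (rule integral_mono)
    show "integrable \<nu> (\<lambda>s. \<bar>?F s - ?G s\<bar>)" using F(1) G by auto
    show "integrable \<nu> (\<lambda>s. step_const L * c\<^sup>2 * ((norm s)\<^sup>2 * min (c * norm s) 1))"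
      using truncated_integrable[OF c'] by simp
    fix s assume "s \<in> space \<nu>"
    then have "c *\<^sub>R s \<in> PiQ d" using c by (simp add: space_nu)
    then have "\<bar>?F s - ?G s\<bar> \<le> step_const L * ((norm (c *\<^sub>R s))\<^sup>2 * min (norm (c *\<^sub>R s)) 1)"
      by (rule conv_laplace_expansion_error[OF A r])
    also have "\<dots> = step_const L * c\<^sup>2 * ((norm s)\<^sup>2 * min (c * norm s) 1)" using c
      by (simp add: power_mult_distrib)
    finally show "\<bar>?F s - ?G s\<bar> \<le> step_const L * c\<^sup>2 * ((norm s)\<^sup>2 * min (c * norm s) 1)" .
  qed
  also have "\<dots> = step_const L * c\<^sup>2 * truncated_moment c" by (simp add: truncated_moment_def)
  finally show ?thesis .
qed

end

locale laplace_setting = clt_setting d \<mu> ty \<nu> for d \<mu> and ty :: "'q::finite itself" and \<nu> +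
  fixes k :: "'q mat" and l :: "'q \<Rightarrow> real"
  assumes k_In_M: "In_M d k" and l_nonneg: "\<And>i. 0 \<le> l i"
    and conj_second_moment: "mmul k (mmul second_moment (madj k)) = (2 * \<mu>) *\<^sub>R rdiag l"
begin

definition resolvent :: "real \<Rightarrow> 'q \<Rightarrow> real" where
  "resolvent t i = 1 / (1 + 2 * t * l i)"

definition flow :: "real \<Rightarrow> 'q mat" where
  "flow t = mmul (madj k) (mmul (rdiag (resolvent t)) k)"

definition coordinate :: "'q mat \<Rightarrow> 'q \<Rightarrow> real" where
  "coordinate r i = (mmul k (mmul (mmul r r) (madj k)))$i$i$0"

definition normalizer :: "real \<Rightarrow> real" where
  "normalizer t = exp (\<Sum>i\<in>UNIV. - \<mu> * ln (1 + 2 * t * l i))"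

definition heat :: "real \<Rightarrow> 'q mat \<Rightarrow> real" where
  "heat t r = normalizer t * exp (- (flow t \<bullet> mmul r r))"

lemma resolvent_bounds: "0 \<le> t \<Longrightarrow> 0 \<le> resolvent t i \<and> resolvent t i \<le> 1"
  using l_nonneg[of i] by (simp add: resolvent_def add_nonneg_nonneg add_pos_nonneg)

lemma inner_flow: "flow t \<bullet> P = rdiag (resolvent t) \<bullet> mmul k (mmul P (madj k))"
  by (simp add: flow_def inner_mmul_left[of "madj k"] inner_mmul_right[of "rdiag (resolvent t)"]
      mmul_assoc)

lemma flow_PiQ: "0 \<le> t \<Longrightarrow> flow t \<in> PiQ d"
  using PiQ_conj[of "madj k" "rdiag (resolvent t)"] k_In_M resolvent_bounds
  by (simp add: flow_def PiQ_rdiag)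

lemma retr_flow_le:
  assumes t: "0 \<le> t" shows "retr (flow t) \<le> retr (mmul k (madj k))"
proof -
  have "retr (flow t) = rdiag (resolvent t) \<bullet> mmul k (madj k)"
    using inner_flow[of t mid] by (simp add: retr_eq_inner inner_commute)
  also have "\<dots> \<le> rdiag (\<lambda>i. 1) \<bullet> mmul k (madj k)"
    unfolding inner_rdiag using resolvent_bounds[OF t] PiQ_diag_nonneg[OF PiQ_mmul_madj[OF k_In_M]]
    by (intro sum_mono mult_right_mono) auto
  finally show ?thesis by (simp add: rdiag_one retr_eq_inner)
qed

lemma coordinate_nonneg: "r \<in> PiQ d \<Longrightarrow> 0 \<le> coordinate r i"
  unfolding coordinate_def using k_In_M by (intro PiQ_diag_nonneg PiQ_conj PiQ_square) auto

lemma inner_flow_square: "flow t \<bullet> mmul r r = (\<Sum>i\<in>UNIV. coordinate r i / (1 + 2 * t * l i))"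
  by (simp add: inner_flow inner_rdiag coordinate_def resolvent_def)

lemma inner_flow_second_moment: "flow t \<bullet> second_moment = (\<Sum>i\<in>UNIV. 2 * \<mu> * l i / (1 + 2 * t * l i))"
  unfolding inner_flow conj_second_moment
  by (simp add: inner_rdiag rdiag_nth resolvent_def sum_distrib_left mult_ac)

lemma second_moment_flow:
  assumes r: "r \<in> PiQ d"
  shows "mmul (flow t) r \<bullet> mmul second_moment (mmul (flow t) r) =
    (\<Sum>i\<in>UNIV. 2 * \<mu> * l i * coordinate r i / (1 + 2 * t * l i)\<^sup>2)"
proof -
  let ?m = "mmul (rdiag (resolvent t)) (mmul k r)"
  have "mmul (flow t) r \<bullet> mmul second_moment (mmul (flow t) r) =
      ?m \<bullet> mmul (mmul k (mmul second_moment (madj k))) ?m"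
    by (simp add: flow_def mmul_assoc inner_mmul_left[of "madj k"])
  also have "\<dots> = 2 * \<mu> * (mmul (rdiag l) ?m \<bullet> ?m)" unfolding conj_second_moment
    by (simp add: inner_commute)
  also have "mmul (rdiag l) ?m \<bullet> ?m = rdiag l \<bullet> mmul ?m (madj ?m)" by (rule inner_mmul_right)
  also have "mmul ?m (madj ?m) =
      mmul (rdiag (resolvent t)) (mmul (mmul k (mmul (mmul r r) (madj k))) (rdiag (resolvent t)))"
    using r by (simp add: mmul_assoc)
  also have "rdiag l \<bullet> \<dots> = (\<Sum>i\<in>UNIV. l i * (resolvent t i * (resolvent t i * coordinate r i)))"
    by (simp add: inner_rdiag rdiag_mmul_nth mmul_rdiag_nth coordinate_def mult.assoc)
  finally show ?thesis by (simp add: sum_distrib_left resolvent_def power2_eq_square mult_ac)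
qed

lemma heat_exponent_coordinate: "r \<in> PiQ d \<Longrightarrow> heat_exponent \<mu> l (coordinate r)"
  using mu_pos l_nonneg coordinate_nonneg by unfold_locales auto

lemma heat_eq:
  assumes "r \<in> PiQ d" shows "heat t r = exp (heat_exponent.exponent \<mu> l (coordinate r) t)"
  unfolding heat_exponent.exponent_def[OF heat_exponent_coordinate[OF assms]]
  by (simp add: heat_def normalizer_def inner_flow_square exp_add[symmetric] sum_subtractf exp_diff
      exp_minus field_simps)

lemma heat_step_expansion:
  assumes r: "r \<in> PiQ d"
  shows "normalizer t * step_expansion (flow t) r e =
    heat t r * (1 + e * heat_exponent.exponent' \<mu> l (coordinate r) t)"
proof -
  have "(mmul (flow t) r \<bullet> mmul second_moment (mmul (flow t) r)) / \<mu> =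
      (\<Sum>i\<in>UNIV. 2 * l i * coordinate r i / (1 + 2 * t * l i)\<^sup>2)"
    unfolding second_moment_flow[OF r] sum_divide_distrib using mu_pos by (intro sum.cong refl) simp
  moreover have "- (flow t \<bullet> second_moment) = (\<Sum>i\<in>UNIV. - 2 * \<mu> * l i / (1 + 2 * t * l i))"
    unfolding inner_flow_second_moment by (simp add: sum_negf[symmetric])
  ultimately have "heat_exponent.exponent' \<mu> l (coordinate r) t =
      - (flow t \<bullet> second_moment) + (mmul (flow t) r \<bullet> mmul second_moment (mmul (flow t) r)) / \<mu>"
    by (simp only: heat_exponent.exponent'_def[OF heat_exponent_coordinate[OF r]] sum.distrib)
  then show ?thesis by (simp only: heat_def step_expansion_def) (simp add: algebra_simps)
qed

lemma normalizer_bounds: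
  assumes t: "0 \<le> t" shows "0 \<le> normalizer t" "normalizer t \<le> 1"
proof -
  have "0 \<le> \<mu> * ln (1 + 2 * t * l i)" for i
    using l_nonneg[of i] t mu_pos by (intro mult_nonneg_nonneg ln_ge_zero) auto
  then have "(\<Sum>i\<in>UNIV. - \<mu> * ln (1 + 2 * t * l i)) \<le> 0" by (intro sum_nonpos) simp
  then show "0 \<le> normalizer t" "normalizer t \<le> 1" by (simp_all add: normalizer_def)
qed

lemma abs_heat_le_1: "0 \<le> t \<Longrightarrow> r \<in> PiQ d \<Longrightarrow> \<bar>heat t r\<bar> \<le> 1"
  using mult_mono[OF normalizer_bounds(2) exp_inner_le_1[OF flow_PiQ], of t t r]
    normalizer_bounds(1)[of t]
  by (simp add: heat_def abs_mult)

lemma heat_measurable: "heat t \<in> borel_measurable (PiS d)"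
  unfolding heat_def[abs_def] by (intro borel_measurable_times exp_inner_measurable) simp

definition flow_const :: real where
  "flow_const = step_const (retr (mmul k (madj k)))"

definition taylor_const :: real where
  "taylor_const = (let C = \<Sum>i\<in>UNIV. 2 * \<mu> * l i + 4 * \<mu> * (l i)\<^sup>2
      + (2 * l i + 8 * (l i)\<^sup>2) * (1 + 2 * l i)
    in (C + C\<^sup>2) * (4 * exp 1))"

definition step_error :: "real \<Rightarrow> real" where
  "step_error c = flow_const * c\<^sup>2 * truncated_moment c + taylor_const * (c\<^sup>2)\<^sup>2"

lemma heat_one_step:
  assumes r: "r \<in> PiQ d" and t: "0 \<le> t" "0 < c" "t + c\<^sup>2 \<le> 1"
  shows "\<bar>(\<integral>s. (\<integral>x. heat t x \<partial>conv_kernel r s) \<partial>scaled_law c) - heat (t + c\<^sup>2) r\<bar> \<le> step_error c"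
proof -
  interpret heat_exponent \<mu> l "coordinate r" by (rule heat_exponent_coordinate[OF r])
  let ?E = "\<integral>s. conv_laplace (flow t) r s \<partial>scaled_law c" and ?T = "step_expansion (flow t) r (c\<^sup>2)"
  have "\<bar>normalizer t * ?E - normalizer t * ?T\<bar> = normalizer t * \<bar>?E - ?T\<bar>"
    using normalizer_bounds[OF t(1)] by (simp add: right_diff_distrib[symmetric] abs_mult)
  also have "\<dots> \<le> 1 * \<bar>?E - ?T\<bar>" using normalizer_bounds[OF t(1)] by (intro mult_right_mono) auto
  also have "\<dots> \<le> flow_const * c\<^sup>2 * truncated_moment c"
    unfolding mult_1_left flow_const_def
    by (rule step_expansion_error[OF flow_PiQ[OF t(1)] retr_flow_le[OF t(1)] r t(2)])
  finally have expansion: "\<bar>normalizer t * ?E - normalizer t * ?T\<bar> \<le>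
      flow_const * c\<^sup>2 * truncated_moment c" .
  have "\<bar>heat (t + c\<^sup>2) r - heat t r * (1 + c\<^sup>2 * exponent' t)\<bar> \<le> taylor_const * (c\<^sup>2)\<^sup>2"
    unfolding heat_eq[OF r] taylor_const_def Let_def growth_def[symmetric]
    using t by (intro exp_exponent_taylor) auto
  then have "\<bar>heat (t + c\<^sup>2) r - normalizer t * ?T\<bar> \<le> taylor_const * (c\<^sup>2)\<^sup>2"
    by (simp only: heat_step_expansion[OF r])
  moreover have "(\<integral>s. (\<integral>x. heat t x \<partial>conv_kernel r s) \<partial>scaled_law c) = normalizer t * ?E"
    by (simp add: heat_def conv_laplace_def)
  ultimately show ?thesis using expansion unfolding step_error_def by linarith
qed

lemma heat_telescope:
  assumes c: "0 < c"
  shows "0 \<le> t \<Longrightarrow> t + real j * c\<^sup>2 \<le> 1 \<Longrightarrow>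
    \<bar>(\<integral>r. heat t r \<partial>convpow d \<mu> (scaled_law c) j) - heat (t + real j * c\<^sup>2) 0\<bar> \<le> real j * step_error c"
proof (induction j arbitrary: t)
  case 0
  have "(\<integral>r. heat t r \<partial>return (PiS d) 0) = heat t 0"
    by (intro integral_return) (auto simp: space_PiS heat_measurable)
  then show ?case by simp
next
  case (Suc j)
  let ?P = "convpow d \<mu> (scaled_law c) j"
    and ?F = "\<lambda>r. \<integral>s. (\<integral>x. heat t x \<partial>conv_kernel r s) \<partial>scaled_law c"
  have scaled: "cone_law (scaled_law c)" using c by (intro cone_law_scaled_law) simp
  have P: "cone_law ?P" by (rule cone_law_convpow[OF scaled])
  interpret P: prob_space ?P using P by (rule cone_lawD)
  have next_time: "0 \<le> t + c\<^sup>2" "t + c\<^sup>2 \<le> 1" "t + c\<^sup>2 + real j * c\<^sup>2 \<le> 1"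
    using Suc.prems mult_nonneg_nonneg[OF of_nat_0_le_iff[of j] zero_le_power2[of c]]
      zero_le_power2[of c]
    unfolding of_nat_Suc distrib_right by linarith+
  note F = integral_mconv[OF P scaled heat_measurable abs_heat_le_1[OF Suc.prems(1)]]
    integrable_mconv_outer[OF P scaled heat_measurable abs_heat_le_1[OF Suc.prems(1)]]
  have heat: "integrable ?P (heat (t + c\<^sup>2))"
    using abs_heat_le_1[OF next_time(1)]
    by (intro integrable_prob_algebra[OF P heat_measurable]) (simp add: space_PiS)
  have "\<bar>(\<integral>r. heat t r \<partial>convpow d \<mu> (scaled_law c) (Suc j)) - (\<integral>r. heat (t + c\<^sup>2) r \<partial>?P)\<bar> =
      \<bar>\<integral>r. ?F r - heat (t + c\<^sup>2) r \<partial>?P\<bar>"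
    using F heat by (subst Bochner_Integration.integral_diff) auto
  also have "\<dots> \<le> (\<integral>r. \<bar>?F r - heat (t + c\<^sup>2) r\<bar> \<partial>?P)" by (rule integral_abs_bound)
  also have "\<dots> \<le> (\<integral>r. step_error c \<partial>?P)"
    using F(2) heat heat_one_step[OF _ Suc.prems(1) c next_time(2)] cone_lawD(3)[OF P]
    by (intro integral_mono) auto
  also have "\<dots> = step_error c" using P.prob_space by simp
  finally have "\<bar>(\<integral>r. heat t r \<partial>convpow d \<mu> (scaled_law c) (Suc j)) - (\<integral>r. heat (t + c\<^sup>2) r \<partial>?P)\<bar> \<le>
      step_error c" .
  moreover have "\<bar>(\<integral>r. heat (t + c\<^sup>2) r \<partial>?P) - heat (t + c\<^sup>2 + real j * c\<^sup>2) 0\<bar> \<le> real j * step_error c"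
    by (rule Suc.IH[OF next_time(1,3)])
  moreover have "t + real (Suc j) * c\<^sup>2 = t + c\<^sup>2 + real j * c\<^sup>2" by (simp add: algebra_simps)
  ultimately show ?case by (simp add: algebra_simps)
qed

lemma laplace_error:
  assumes n: "0 < n"
  shows "\<bar>(\<integral>r. heat 0 r \<partial>convpow d \<mu> (scaled_law (1 / sqrt (real n))) n) - heat 1 0\<bar> \<le>
    flow_const * truncated_moment (1 / sqrt (real n)) + taylor_const * (1 / real n)"
proof -
  let ?c = "1 / sqrt (real n)"
  have square: "?c\<^sup>2 = 1 / real n" using n by (simp add: power_divide)
  have "\<bar>(\<integral>r. heat 0 r \<partial>convpow d \<mu> (scaled_law ?c) n) - heat (0 + real n * ?c\<^sup>2) 0\<bar> \<le>
      real n * step_error ?c"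
    using n by (intro heat_telescope) (auto simp: square)
  moreover have "real n * step_error ?c =
      flow_const * truncated_moment ?c + taylor_const * (1 / real n)"
    unfolding step_error_def square using n by (simp add: field_simps power2_eq_square)
  ultimately show ?thesis using n by (simp add: square)
qed

lemma laplace_limit:
  "(\<lambda>n. \<integral>r. exp (- (mmul (madj k) k \<bullet> mmul r r)) \<partial>convpow d \<mu> (scaled_law (1 / sqrt (real n))) n) \<longlonglongrightarrow>
     exp (\<Sum>i\<in>UNIV. - \<mu> * ln (1 + 2 * l i))"
proof -
  let ?c = "\<lambda>n. 1 / sqrt (real n)"
  have "(\<lambda>n. flow_const * truncated_moment (?c n) + taylor_const * (1 / real n)) \<longlonglongrightarrow>
      flow_const * 0 + taylor_const * 0"
    by (intro tendsto_add tendsto_mult tendsto_const truncated_moment_tendsto_0 lim_1_over_n)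
  then have bound: "(\<lambda>n. flow_const * truncated_moment (?c n) + taylor_const * (1 / real n)) \<longlonglongrightarrow> 0"
    by (simp only: mult_zero_right add_0)
  have "(\<lambda>n. (\<integral>r. heat 0 r \<partial>convpow d \<mu> (scaled_law (?c n)) n) - heat 1 0) \<longlonglongrightarrow> 0"
    by (rule Lim_null_comparison[OF eventually_sequentiallyI[of 1] bound])
      (simp only: real_norm_def laplace_error)
  then have "(\<lambda>n. \<integral>r. heat 0 r \<partial>convpow d \<mu> (scaled_law (?c n)) n) \<longlonglongrightarrow> heat 1 0" by (rule LIM_zero_cancel)
  moreover have "resolvent 0 = (\<lambda>i. 1)" by (rule ext) (simp add: resolvent_def)
  then have "heat 0 r = exp (- (mmul (madj k) k \<bullet> mmul r r))" for r
    by (simp add: heat_def normalizer_def flow_def rdiag_one)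
  moreover have "heat 1 0 = exp (\<Sum>i\<in>UNIV. - \<mu> * ln (1 + 2 * l i))"
    by (simp add: heat_def normalizer_def)
  ultimately show ?thesis by simp
qed

end

section \<open>Lebesgue measure on Hermitian matrices\<close>

lemma qord_inj [simp]: "qord i = qord j \<longleftrightarrow> i = (j::'q::finite)"
  unfolding qord_def using inj_on_to_nat_on[of "UNIV :: 'q set"]
  by (auto simp: inj_on_def countable_finite)

context field_dim
begin

definition herm_idx :: "('q::finite \<times> 'q \<times> 4) set" where
  "herm_idx = {(i,j,k). (i = j \<and> k = 0) \<or> (qord i < qord j \<and> k \<in> comps d)}"

definition herm_unit :: "'q::finite \<times> 'q \<times> 4 \<Rightarrow> 'q mat" where
  "herm_unit = (\<lambda>(i, j, k). if i = j then mat_unit (i, i, 0)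
     else mat_unit (i, j, k) + (if k = 0 then 1 else -1) *\<^sub>R mat_unit (j, i, k))"

sublocale herm: frame "herm_idx :: ('q::finite \<times> 'q \<times> 4) set" herm_unit
proof
  show "finite (herm_idx :: ('q \<times> 'q \<times> 4) set)" by simp
  fix p r :: "'q \<times> 'q \<times> 4"
  obtain i j k i' j' k' where pr: "p = (i, j, k)" "r = (i', j', k')" by (cases p; cases r)
  show "herm_unit p \<bullet> herm_unit r = 0" if "p \<in> herm_idx" "r \<in> herm_idx" "p \<noteq> r"
    using that by (auto simp: pr herm_idx_def herm_unit_def inner_simps inner_mat_unit)
  show "herm_unit p \<noteq> 0" if "p \<in> herm_idx"
  proof -
    have "herm_unit p \<bullet> mat_unit (i, j, k) = 1"
      using that by (auto simp: pr herm_idx_def herm_unit_def inner_simps inner_mat_unit)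
    then show ?thesis by (metis inner_zero_left zero_neq_one)
  qed
qed

lemma comb_herm:
  "herm.comb f = (\<chi> i j. if i = j then (\<chi> k. if k = 0 then f (i,i,0) else 0)
                 else if qord i < qord j then (\<chi> k. if k \<in> comps d then f (i,j,k) else 0)
                 else qconj (\<chi> k. if k \<in> comps d then f (j,i,k) else 0))" (is "_ = ?R")
proof -
  have delta: "(\<Sum>p\<in>herm_idx. f p * (if p = p0 then s else 0)) = (if p0 \<in> herm_idx then f p0 * s else 0)"
    for p0 and s :: real
    by (simp add: if_distrib[of "(*) _"] cong: if_cong)
  have "(\<Sum>p\<in>herm_idx. f p * (herm_unit p $ a $ b $ c)) = ?R $ a $ b $ c" for a b c
  proof (cases "qord a" "qord b" rule: linorder_cases)
    case equal
    then have ab: "a = b" by simp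
    have "(\<Sum>p\<in>herm_idx. f p * (herm_unit p $ a $ b $ c)) =
        (\<Sum>p\<in>herm_idx. f p * (if p = (a, a, c) then (if c = 0 then 1 else 0) else 0))"
      by (intro sum.cong refl) (auto simp: ab herm_idx_def herm_unit_def mat_unit_nth split: if_splits)
    then show ?thesis unfolding delta by (auto simp: ab herm_idx_def)
  next
    case less
    have "(\<Sum>p\<in>herm_idx. f p * (herm_unit p $ a $ b $ c)) =
        (\<Sum>p\<in>herm_idx. f p * (if p = (a, b, c) then 1 else 0))"
      using less by (intro sum.cong refl)
        (auto simp: herm_idx_def herm_unit_def mat_unit_nth split: if_splits)
    then show ?thesis unfolding delta using less by (auto simp: herm_idx_def)
  next
    case greater
    have "(\<Sum>p\<in>herm_idx. f p * (herm_unit p $ a $ b $ c)) =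
        (\<Sum>p\<in>herm_idx. f p * (if p = (b, a, c) then (if c = 0 then 1 else -1) else 0))"
      using greater by (intro sum.cong refl)
        (auto simp: herm_idx_def herm_unit_def mat_unit_nth split: if_splits)
    then show ?thesis unfolding delta using greater zero_in_comps by (auto simp: herm_idx_def)
  qed
  then show ?thesis by (simp add: vec_eq_iff herm.comb_def)
qed

lemma lebH_eq: "(lebH d :: 'q::finite mat measure) = herm.leb"
  unfolding lebH_def herm.leb_def herm_idx_def[symmetric] comb_herm[abs_def, symmetric]
  by (simp only: eta_contract_eq)

lemma sets_lebH [simp, measurable_cong]: "sets (lebH d) = sets borel" by (simp add: lebH_def)

lemma measurable_lebH: "f \<in> borel \<rightarrow>\<^sub>M N \<Longrightarrow> f \<in> lebH d \<rightarrow>\<^sub>M N"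
  using measurable_cong_sets[OF sets_lebH refl] by blast

lemma comb_herm_Herm: "herm.comb f \<in> Herm d"
proof -
  have "In_M d (herm.comb f)" using zero_in_comps by (auto simp: In_M_def comb_herm)
  moreover have "madj (herm.comb f) $ i $ j = herm.comb f $ i $ j" for i j
    by (cases "qord i" "qord j" rule: linorder_cases) (auto simp: comb_herm vec_eq_iff)
  ultimately show ?thesis unfolding Herm_def by (simp add: mat_eq_iff)
qed

lemma Herm_eq_comb:
  assumes x: "x \<in> Herm d" shows "x = herm.comb (\<lambda>(i,j,k). x$i$j$k)"
proof -
  have adj: "x$i$j = qconj (x$j$i)" for i j using arg_cong[OF Herm_D(2)[OF x], of "\<lambda>y. y$i$j"] by simp
  have comps: "k \<notin> comps d \<Longrightarrow> x$i$j$k = 0" for i j k using Herm_D(1)[OF x] by (simp add: In_M_def)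
  have "x$i$j$k = herm.comb (\<lambda>(i,j,k). x$i$j$k)$i$j$k" for i j k
  proof (cases "qord i" "qord j" rule: linorder_cases)
    case equal
    moreover have "x$i$i$k = 0" if "k \<noteq> 0" using arg_cong[OF adj[of i i], of "\<lambda>y. y$k"] that by simp
    ultimately show ?thesis by (auto simp: comb_herm)
  next
    case less
    then show ?thesis using comps[of k i j] by (auto simp: comb_herm)
  next
    case greater
    then show ?thesis using comps[of k j i] arg_cong[OF adj[of i j], of "\<lambda>y. y$k"] zero_in_comps
      by (auto simp: comb_herm)
  qed
  then show ?thesis unfolding vec_eq_iff by blast
qed

lemma span_herm: "herm.frame_span = (Herm d :: 'q::finite mat set)"
  unfolding herm.frame_span_def using comb_herm_Herm Herm_eq_comb by blast

lemma prod_off_diagonal: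
  fixes g :: "'q::finite \<Rightarrow> real"
  shows "(\<Prod>p\<in>{p. qord (fst p) < qord (snd p)}. g (fst p) * g (snd p)) = (\<Prod>i\<in>UNIV. g i) ^ (CARD('q) - 1)"
proof -
  let ?O = "{p::'q \<times> 'q. qord (fst p) < qord (snd p)}"
    and ?O' = "{p::'q \<times> 'q. qord (snd p) < qord (fst p)}"
  have "(\<Prod>p\<in>?O. g (snd p)) = (\<Prod>p\<in>?O'. g (fst p))"
    by (rule prod.reindex_bij_witness[of _ prod.swap prod.swap]) auto
  then have "(\<Prod>p\<in>?O. g (fst p) * g (snd p)) = (\<Prod>p\<in>?O. g (fst p)) * (\<Prod>p\<in>?O'. g (fst p))"
    by (simp add: prod.distrib)
  also have "\<dots> = (\<Prod>p\<in>?O \<union> ?O'. g (fst p))" by (intro prod.union_disjoint[symmetric]) auto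
  also have "?O \<union> ?O' = Sigma UNIV (\<lambda>i. UNIV - {i})" by (auto simp: neq_iff[symmetric])
  also have "(\<Prod>p\<in>Sigma UNIV (\<lambda>i. UNIV - {i}). g (fst p)) = (\<Prod>i\<in>UNIV. \<Prod>j\<in>UNIV - {i}. g i)"
    by (subst prod.Sigma) (auto simp: case_prod_beta)
  also have "\<dots> = (\<Prod>i\<in>UNIV. g i) ^ (CARD('q) - 1)" by (simp add: card_Diff_singleton prod_power_distrib)
  finally show ?thesis .
qed

lemma prod_herm_idx:
  fixes g :: "'q::finite \<Rightarrow> real"
  shows "(\<Prod>p\<in>herm_idx. g (fst p) * g (fst (snd p))) = (\<Prod>i\<in>UNIV. g i) ^ (2 + d * (CARD('q) - 1))"
proof -
  let ?D = "(\<lambda>i::'q. (i, i, 0::4)) ` UNIV" and ?O = "{p::'q \<times> 'q. qord (fst p) < qord (snd p)}"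
  let ?U = "(\<lambda>((i, j), k). (i, j, k)) ` (?O \<times> comps d)"
  have "herm_idx = ?D \<union> ?U" by (auto simp: herm_idx_def image_iff)
  then have "(\<Prod>p\<in>herm_idx. g (fst p) * g (fst (snd p))) =
      (\<Prod>p\<in>?D. g (fst p) * g (fst (snd p))) * (\<Prod>p\<in>?U. g (fst p) * g (fst (snd p)))"
    by (simp only:) (intro prod.union_disjoint, auto)
  also have "(\<Prod>p\<in>?D. g (fst p) * g (fst (snd p))) = (\<Prod>i\<in>UNIV. g i) ^ 2"
    by (subst prod.reindex) (auto simp: inj_on_def power2_eq_square prod.distrib)
  also have "(\<Prod>p\<in>?U. g (fst p) * g (fst (snd p))) =
      (\<Prod>q\<in>?O \<times> comps d. g (fst (fst q)) * g (snd (fst q)))"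
    by (subst prod.reindex) (auto simp: inj_on_def case_prod_beta)
  also have "\<dots> = (\<Prod>p\<in>?O. \<Prod>k\<in>comps d. g (fst p) * g (snd p))"
    by (subst prod.cartesian_product) (auto simp: case_prod_beta)
  also have "\<dots> = (\<Prod>p\<in>?O. g (fst p) * g (snd p)) ^ d" by (simp add: card_comps prod_power_distrib)
  finally show ?thesis by (simp only: prod_off_diagonal power_add mult.commute[of d] power_mult)
qed

lemma two_n0: "2 * n0 d TYPE('q::finite) = real (CARD('q) * (2 + d * (CARD('q) - 1)))"
proof -
  have "real (CARD('q) - 1) = real CARD('q) - 1" by (simp add: of_nat_diff Suc_le_eq)
  then show ?thesis by (simp only: n0_def of_nat_mult of_nat_add of_nat_numeral)
    (simp add: algebra_simps diff_divide_distrib)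
qed

lemma card_herm_idx: "real (card (herm_idx :: ('q::finite \<times> 'q \<times> 4) set)) = n0 d TYPE('q)"
proof -
  let ?n = "card (herm_idx :: ('q \<times> 'q \<times> 4) set)" and ?m = "2 + d * (CARD('q) - 1)"
  have "(\<Prod>p\<in>(herm_idx :: ('q \<times> 'q \<times> 4) set). 2 * (2::real)) = (\<Prod>i\<in>(UNIV::'q set). 2) ^ ?m"
    using prod_herm_idx[of "\<lambda>i::'q. 2"] by simp
  then have "(2 * (2::real)) ^ ?n = (2 ^ CARD('q)) ^ ?m" by (simp only: prod_constant)
  then have "(2::real) ^ (2 * ?n) = 2 ^ (CARD('q) * ?m)" by (simp only: power_mult power2_eq_square)
  then have "2 * ?n = CARD('q) * ?m" by (subst (asm) power_inject_exp) auto
  then have "real (2 * ?n) = 2 * n0 d TYPE('q)" by (simp only: two_n0)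
  then show ?thesis by simp
qed

lemma nn_integral_lebH_unitary:
  fixes f :: "'q::finite mat \<Rightarrow> ennreal"
  assumes u: "unitary d u" and f: "f \<in> borel_measurable borel"
  shows "(\<integral>\<^sup>+x. f (mmul u (mmul x (madj u))) \<partial>lebH d) = (\<integral>\<^sup>+x. f x \<partial>lebH d)"
  unfolding lebH_eq
proof (rule herm.nn_integral_isometry[OF linear_conj _ _ f])
  have "x \<in> (\<lambda>x. mmul u (mmul x (madj u))) ` Herm d" if "x \<in> Herm d" for x
    using u Herm_conj[of "madj u" x] that
    by (intro image_eqI[of _ _ "mmul (madj u) (mmul x u)"])
      (auto simp: mmul_assoc unitary_cancel unitary_right)
  then show "(\<lambda>x. mmul u (mmul x (madj u))) ` herm.frame_span = herm.frame_span"
    using u by (auto simp: span_herm)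
  show "norm (mmul u (mmul x (madj u))) = norm x" for x
    using u by (simp add: norm_eq_sqrt_inner inner_mmul_conj mmul_assoc unitary_cancel unitary_left)
qed

lemma nn_integral_lebH_rdiag:
  fixes f :: "'q::finite mat \<Rightarrow> ennreal"
  assumes s: "\<And>i. 0 < s i" and f: "f \<in> borel_measurable borel"
  shows "(\<integral>\<^sup>+x. f (mmul (rdiag s) (mmul x (rdiag s))) \<partial>lebH d) =
    ennreal ((\<Prod>i\<in>UNIV. s i) powr (- (2 * n0 d TYPE('q) / real CARD('q)))) * (\<integral>\<^sup>+x. f x \<partial>lebH d)"
proof -
  have pos: "0 < (\<Prod>i\<in>UNIV. s i)" using s by (simp add: prod_pos)
  have "(\<integral>\<^sup>+x. f (mmul (rdiag s) (mmul x (rdiag s))) \<partial>lebH d) =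
      ennreal (\<Prod>p\<in>herm_idx. 1 / (s (fst p) * s (fst (snd p)))) * (\<integral>\<^sup>+x. f x \<partial>lebH d)"
    unfolding lebH_eq
  proof (rule herm.nn_integral_diag[OF _ _ _ f])
    show "linear (\<lambda>x. mmul (rdiag s) (mmul x (rdiag s)))" using linear_conj[of "rdiag s"] by simp
    fix p :: "'q \<times> 'q \<times> 4"
    show "0 < s (fst p) * s (fst (snd p))" using s by simp
    show "mmul (rdiag s) (mmul (herm_unit p) (rdiag s)) = (s (fst p) * s (fst (snd p))) *\<^sub>R herm_unit p"
      by (cases p) (auto simp: vec_eq_iff rdiag_mmul_nth mmul_rdiag_nth herm_unit_def mat_unit_nth)
  qed
  also have "(\<Prod>p\<in>herm_idx. 1 / (s (fst p) * s (fst (snd p)))) =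
      1 / (\<Prod>i\<in>UNIV. s i) ^ (2 + d * (CARD('q) - 1))"
    unfolding prod_herm_idx[symmetric] by (simp add: prod_dividef)
  also have "\<dots> = (\<Prod>i\<in>UNIV. s i) powr - real (2 + d * (CARD('q) - 1))"
    using pos unfolding powr_minus powr_realpow[OF pos] by (simp add: divide_inverse)
  also have "real (2 + d * (CARD('q) - 1)) = 2 * n0 d TYPE('q) / real CARD('q)"
    unfolding two_n0 of_nat_mult by simp
  finally show ?thesis .
qed

lemma nn_integral_lebH_conj:
  fixes f :: "'q::finite mat \<Rightarrow> ennreal"
  assumes h: "h \<in> OmegaQ d" and f [measurable]: "f \<in> borel_measurable borel"
  shows "(\<integral>\<^sup>+x. f x \<partial>lebH d) =
    ennreal (Delta d h powr (2 * n0 d TYPE('q) / real CARD('q))) * (\<integral>\<^sup>+x. f (mmul h (mmul x h)) \<partial>lebH d)"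
proof -
  let ?e = "2 * n0 d TYPE('q) / real CARD('q)"
  obtain u s where u: "unitary d u" "h = conj_rdiag u s" and s: "\<And>i. 0 < s i"
    using h by (metis spectral_pd)
  have Delta: "Delta d h = (\<Prod>i\<in>UNIV. s i)" using u s by (simp add: Delta_conj_rdiag less_imp_le)
  then have pos: "0 < Delta d h" using s by (simp add: prod_pos)
  have f_conj: "(\<lambda>x. f (mmul u (mmul x (madj u)))) \<in> borel_measurable borel"
    using measurable_compose[OF borel_measurable_linear[OF linear_conj] f] .
  have f_diag: "(\<lambda>x. f (mmul u (mmul (mmul (rdiag s) (mmul x (rdiag s))) (madj u)))) \<in>
      borel_measurable borel"
    using measurable_compose[OF borel_measurable_linear[OF linear_conj[of "rdiag s"]] f_conj] by simp
  have "(\<integral>\<^sup>+x. f (mmul h (mmul x h)) \<partial>lebH d) =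
      (\<integral>\<^sup>+x. f (mmul u (mmul (mmul (rdiag s) (mmul (mmul (madj u) (mmul x u)) (rdiag s))) (madj u)))
          \<partial>lebH d)"
    by (simp add: u mmul_assoc)
  also have "\<dots> = (\<integral>\<^sup>+x. f (mmul u (mmul (mmul (rdiag s) (mmul x (rdiag s))) (madj u))) \<partial>lebH d)"
    using nn_integral_lebH_unitary[OF unitary_madj[OF u(1)] f_diag] by simp
  also have "\<dots> = ennreal (Delta d h powr (- ?e)) * (\<integral>\<^sup>+x. f (mmul u (mmul x (madj u))) \<partial>lebH d)"
    unfolding Delta by (rule nn_integral_lebH_rdiag[OF s f_conj])
  also have "(\<integral>\<^sup>+x. f (mmul u (mmul x (madj u))) \<partial>lebH d) = (\<integral>\<^sup>+x. f x \<partial>lebH d)"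
    by (rule nn_integral_lebH_unitary[OF u(1) f])
  finally show ?thesis using pos
    by (simp add: mult.assoc[symmetric] ennreal_mult'[symmetric] powr_add[symmetric])
qed

lemma retr_borel [measurable]: "(retr :: 'q::finite mat \<Rightarrow> real) \<in> borel_measurable borel"
  by (intro borel_measurable_continuous_onI continuous_on_retr)

section \<open>The cone Gamma integral\<close>

definition trace_ball_volume :: "'q::finite itself \<Rightarrow> real \<Rightarrow> real \<Rightarrow> ennreal" where
  "trace_ball_volume Q a t = (\<integral>\<^sup>+x.
      indicator {x. retr x \<le> t} x * ennreal (Delta_powr a x) \<partial>(lebH d :: 'q mat measure))"

lemma trace_ball_volume_nonpos:
  assumes "t \<le> 0" shows "trace_ball_volume Q a t = 0"
proof -
  have "indicator {x. retr x \<le> t} x * ennreal (Delta_powr a x) = 0" for x :: "'a mat"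
    using retr_OmegaQ_pos[of x] assms by (auto simp: Delta_powr_def indicator_def)
  then show ?thesis by (simp only: trace_ball_volume_def nn_integral_const mult_zero_left)
qed

lemma trace_ball_volume_scale:
  assumes t: "0 < t"
  shows "trace_ball_volume TYPE('q::finite) a t =
    ennreal (t powr (real CARD('q) * a + n0 d TYPE('q))) * trace_ball_volume TYPE('q) a 1"
proof -
  let ?f = "\<lambda>x::'q mat. indicator {x. retr x \<le> 1} x * ennreal (Delta_powr a x)"
  have f: "?f \<in> borel_measurable borel" by measurable
  have "indicator {x. retr x \<le> t} x * ennreal (Delta_powr a x) =
      ennreal (t powr (real CARD('q) * a)) * ?f ((1 / t) *\<^sub>R x)" for x :: "'q mat"
  proof -
    have "Delta_powr a x = t powr (real CARD('q) * a) * Delta_powr a ((1 / t) *\<^sub>R x)"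
      using t Delta_powr_scaleR[of t a "(1 / t) *\<^sub>R x"] by simp
    moreover have "retr ((1 / t) *\<^sub>R x) \<le> 1 \<longleftrightarrow> retr x \<le> t" using t by (simp add: retr_eq_inner)
    ultimately show ?thesis by (simp add: indicator_def ennreal_mult')
  qed
  then have "trace_ball_volume TYPE('q) a t =
      ennreal (t powr (real CARD('q) * a)) * (\<integral>\<^sup>+x. ?f ((1 / t) *\<^sub>R x) \<partial>lebH d)"
    unfolding trace_ball_volume_def
    using measurable_compose[OF borel_measurable_linear[of "\<lambda>x. (1 / t) *\<^sub>R x"] f]
    by (subst nn_integral_cmult[symmetric]) (auto simp: linear_iff algebra_simps)
  also have "(\<integral>\<^sup>+x. ?f ((1 / t) *\<^sub>R x) \<partial>lebH d) =
      ennreal ((1 / t) powr - n0 d TYPE('q)) * trace_ball_volume TYPE('q) a 1"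
    unfolding trace_ball_volume_def lebH_eq card_herm_idx[symmetric]
    by (rule herm.nn_integral_scale[OF _ f]) (use t in simp)
  also have "(1 / t) powr - n0 d TYPE('q) = t powr n0 d TYPE('q)" using t
    by (simp add: powr_minus powr_divide)
  finally show ?thesis by (simp add: powr_add ennreal_mult' mult.assoc)
qed

lemma trace_ball_volume_finite_nonneg:
  assumes a: "0 \<le> a" shows "trace_ball_volume TYPE('q::finite) a 1 < \<infinity>"
proof -
  have "trace_ball_volume TYPE('q) a 1 \<le> (\<integral>\<^sup>+x. indicator (cball 0 1) (x :: 'q mat) \<partial>lebH d)"
    unfolding trace_ball_volume_def
  proof (rule nn_integral_mono)
    fix x :: "'q mat"
    have "Delta d x powr a \<le> 1" "norm x \<le> 1" if x: "x \<in> PiQ d" "retr x \<le> 1"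
      using Delta_le_retr_pow[OF x(1)] norm_le_retr[OF x(1)] retr_PiQ_nonneg[OF x(1)]
        Delta_nonneg[OF x(1)] x(2) a
        power_le_one[of "retr x" "CARD('q)"]
      by (auto intro!: powr_le1)
    then show "indicator {x. retr x \<le> 1} x * ennreal (Delta_powr a x) \<le> indicator (cball 0 1) x"
      by (auto simp: Delta_powr_def indicator_def)
  qed
  also have "\<dots> < \<infinity>" using herm.emeasure_cball_finite[of 1] by (simp add: lebH_eq)
  finally show ?thesis .
qed

lemma trace_ball_volume_finite_real_line:
  assumes q: "CARD('q::finite) = 1" and d: "d = 1" and a: "-1 < a"
  shows "trace_ball_volume TYPE('q) a 1 < \<infinity>"
proof -
  obtain i where UNIV: "UNIV = {i :: 'q}" using q by (auto simp: card_1_singleton_iff)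
  then have all_eq: "j = i" for j :: 'q by blast
  have "\<not> qord j < qord k" for j k :: 'q using all_eq[of j] all_eq[of k] by simp
  then have idx: "herm_idx = {(i, i, 0)}" using all_eq by (auto simp: herm_idx_def)
  have unit: "herm_unit (i, i, 0) = mid"
    by (simp add: herm_unit_def mat_unit_def mid_def vec_eq_iff axis_def qone_def) (metis all_eq)
  have retr: "retr (t *\<^sub>R mid :: 'q mat) = t" for t unfolding retr_def UNIV
    by (simp add: mid_nth qone_def)
  have Delta_powr: "Delta_powr a (t *\<^sub>R mid :: 'q mat) = (if 0 < t then t powr a else 0)" for t
  proof (cases "0 < t")
    case True
    then show ?thesis by (simp add: Delta_powr_def OmegaQ_scaleR Delta_scaleR_mid q)
  next
    case False
    then have "t *\<^sub>R mid \<notin> (OmegaQ d :: 'q mat set)"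
      using retr_OmegaQ_pos[of "t *\<^sub>R mid :: 'q mat"] retr[of t] by auto
    then show ?thesis using False by (simp add: Delta_powr_def)
  qed
  let ?f = "\<lambda>x::'q mat. indicator {x. retr x \<le> 1} x * ennreal (Delta_powr a x)"
  have f: "?f \<in> borel_measurable borel" by measurable
  have "trace_ball_volume TYPE('q) a 1 = (\<integral>\<^sup>+t. ?f (t *\<^sub>R mid) \<partial>lborel)"
    unfolding trace_ball_volume_def lebH_eq herm.nn_integral_leb_singleton[OF idx f] unit ..
  also have "\<dots> = (\<integral>\<^sup>+t. indicator {0<..1} t * ennreal ((t - 0) powr a) \<partial>lborel)"
    by (rule nn_integral_cong) (simp add: retr Delta_powr indicator_def)
  also have "\<dots> < \<infinity>" using a by (subst nn_integral_powr_shift) simp_all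
  finally show ?thesis .
qed

end

lemma nn_integral_exp_tail:
  "(\<integral>\<^sup>+t. indicator {c..} t * ennreal (exp (- t)) \<partial>lborel) = ennreal (exp (- c :: real))"
proof -
  have "(\<integral>\<^sup>+t. ennreal (exp (- t)) * indicator {c..} t \<partial>lborel) = ennreal (0 - (- exp (- c)))"
  proof (rule nn_integral_FTC_atLeast[where F = "\<lambda>t. - exp (- t)"])
    show "((\<lambda>t::real. - exp (- t)) \<longlongrightarrow> 0) at_top"
      using tendsto_minus[OF filterlim_compose[OF exp_at_bot filterlim_uminus_at_bot_at_top]] by simp
  qed (auto intro!: derivative_eq_intros)
  then show ?thesis by (simp add: mult.commute)
qed

lemma nn_integral_powr_exp_finite:
  assumes "s > 0" shows "(\<integral>\<^sup>+t. indicator {0<..} t * ennreal (exp (- t) * t powr s) \<partial>lborel) < \<infinity>"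
proof -
  have "((\<lambda>t. t powr (s + 1 - 1) / exp t) has_integral Gamma (s + 1)) {0..}"
    using assms by (intro Gamma_integral_real) auto
  then have "((\<lambda>t. if t \<in> {0..} then t powr s / exp t else 0) has_integral Gamma (s + 1)) UNIV"
    by (subst has_integral_restrict_UNIV) simp
  then have "(\<integral>\<^sup>+t. ennreal (if t \<in> {0..} then t powr s / exp t else 0) \<partial>lborel) =
      ennreal (Gamma (s + 1))"
    by (intro nn_integral_has_integral_lborel) auto
  moreover have "(\<integral>\<^sup>+t. indicator {0<..} t * ennreal (exp (- t) * t powr s) \<partial>lborel) \<le>
     (\<integral>\<^sup>+t. ennreal (if t \<in> {0..} then t powr s / exp t else 0) \<partial>lborel)"
    by (intro nn_integral_mono) (auto simp: indicator_def exp_minus field_simps)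
  ultimately show ?thesis by (auto intro: le_less_trans)
qed

context wishart_setting
begin

definition gamma_exponent :: real where
  "gamma_exponent = \<mu> - n0 d TYPE('q) / real CARD('q)"

definition cone_gamma :: ennreal where
  "cone_gamma = (\<integral>\<^sup>+x. ennreal (Delta_powr gamma_exponent x * exp (- retr x))
      \<partial>(lebH d :: 'q mat measure))"

lemma gamma_exponent_gt: "gamma_exponent > real (d * CARD('q)) / 2 - 1"
proof -
  have "n0 d TYPE('q) / real CARD('q) = 1 + real d / 2 * (real CARD('q) - 1)"
    by (simp add: n0_def field_simps)
  then show ?thesis using mu_gt
    by (simp add: gamma_exponent_def rho_def algebra_simps diff_divide_distrib)
qed

lemma trace_ball_volume_finite: "trace_ball_volume TYPE('q) gamma_exponent 1 < \<infinity>"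
proof (cases "2 \<le> d * CARD('q)")
  case True
  then have "2 \<le> real (d * CARD('q))" by linarith
  then have "0 \<le> gamma_exponent" using gamma_exponent_gt by linarith
  then show ?thesis by (rule trace_ball_volume_finite_nonneg)
next
  case False
  moreover have "0 < d * CARD('q)" using d_cases by auto
  ultimately have "d * CARD('q) = 1" by linarith
  then have "d = 1" "CARD('q) = 1" by simp_all
  then show ?thesis using gamma_exponent_gt by (intro trace_ball_volume_finite_real_line) simp_all
qed

text \<open>Layer-cake formula for \<open>exp (- retr x)\<close>; by homogeneity the layers are multiples of
the first one.\<close>

lemma cone_gamma_eq_layers:
  "cone_gamma = (\<integral>\<^sup>+t. indicator {0<..} t * ennreal (exp (- t) * t powr (real CARD('q) * \<mu>)) \<partial>lborel)
    * trace_ball_volume TYPE('q) gamma_exponent 1"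
proof -
  interpret P: pair_sigma_finite "herm.leb :: 'q mat measure" lborel ..
  define g where "g = (\<lambda>(x::'q mat) t. ennreal (Delta_powr gamma_exponent x)
      * (indicator {retr x..} t * ennreal (exp (- t))))"
  let ?V = "trace_ball_volume TYPE('q) gamma_exponent"
  have exponent: "real CARD('q) * gamma_exponent + n0 d TYPE('q) = real CARD('q) * \<mu>"
    by (simp add: gamma_exponent_def field_simps)
  have "(\<lambda>p. g (fst p) (snd p)) \<in> borel_measurable (borel \<Otimes>\<^sub>M borel)"
    unfolding g_def indicator_def atLeast_iff by measurable
  then have g: "(\<lambda>(x, t). g x t) \<in> borel_measurable (herm.leb \<Otimes>\<^sub>M lborel)"
    by (intro herm.measurable_pair_lborel) (simp add: case_prod_beta')
  have "ennreal (Delta_powr gamma_exponent x * exp (- retr x)) = (\<integral>\<^sup>+t. g x t \<partial>lborel)" for x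
    unfolding g_def by (subst nn_integral_cmult)
      (simp_all add: nn_integral_exp_tail ennreal_mult' Delta_powr_nonneg)
  then have "cone_gamma = (\<integral>\<^sup>+x. (\<integral>\<^sup>+t. g x t \<partial>lborel) \<partial>herm.leb)" by (simp add: cone_gamma_def lebH_eq)
  also have "\<dots> = (\<integral>\<^sup>+t. (\<integral>\<^sup>+x. g x t \<partial>herm.leb) \<partial>lborel)" by (rule P.Fubini'[symmetric, OF g])
  also have "\<dots> = (\<integral>\<^sup>+t. indicator {0<..} t * ennreal (exp (- t) * t powr (real CARD('q) * \<mu>))
      * ?V 1 \<partial>lborel)"
  proof (rule nn_integral_cong)
    fix t :: real
    have "g x t = ennreal (exp (- t)) *
        (indicator {x. retr x \<le> t} x * ennreal (Delta_powr gamma_exponent x))" for x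
      by (simp add: g_def indicator_def mult.commute)
    then have "(\<integral>\<^sup>+x. g x t \<partial>herm.leb) = ennreal (exp (- t)) * ?V t"
      by (simp add: trace_ball_volume_def lebH_eq) (rule nn_integral_cmult, measurable)
    also have "\<dots> = indicator {0<..} t * ennreal (exp (- t) * t powr (real CARD('q) * \<mu>)) * ?V 1"
    proof (cases "0 < t")
      case True
      then show ?thesis by (simp add: trace_ball_volume_scale[of t] exponent ennreal_mult' mult.assoc)
    qed (simp add: trace_ball_volume_nonpos)
    finally show "(\<integral>\<^sup>+x. g x t \<partial>herm.leb) = \<dots>" .
  qed
  also have "\<dots> = (\<integral>\<^sup>+t. indicator {0<..} t * ennreal (exp (- t) * t powr (real CARD('q) * \<mu>)) \<partial>lborel)
      * ?V 1"
    by (rule nn_integral_multc) measurable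
  finally show ?thesis .
qed

lemma cone_gamma_finite: "cone_gamma < \<infinity>"
  unfolding cone_gamma_eq_layers
  using nn_integral_powr_exp_finite[of "real CARD('q) * \<mu>"] trace_ball_volume_finite mu_pos
  by (simp add: ennreal_mult_less_top)

lemma cone_gamma_pos: "0 < cone_gamma"
  unfolding cone_gamma_def lebH_eq
proof (rule herm.nn_integral_pos[of _ mid "1 / 2"])
  fix y :: "'q mat" assume y: "y \<in> herm.frame_span" "dist y mid < 1 / 2"
  then have yH: "y \<in> Herm d" by (simp add: span_herm)
  have "(1 / 2) *\<^sub>R mid + (y - mid) \<in> PiQ d"
    using y yH by (intro PiQ_scaleR_mid_add) (simp_all add: dist_norm)
  moreover have "(1 / 2) *\<^sub>R mid + (y - mid) = y - (1 / 2) *\<^sub>R mid" by (simp add: mat_eq_iff mid_nth)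
  ultimately have "y \<in> OmegaQ d" using yH unfolding OmegaQ_iff
    by (intro conjI exI[of _ "1 / 2"]) simp_all
  then show "0 < ennreal (Delta_powr gamma_exponent y * exp (- retr y))"
    by (simp add: Delta_powr_def OmegaQ_iff_Delta)
qed (simp_all add: span_herm)

lemma cone_gamma_eq: "cone_gamma = ennreal (GammaOmega d \<mu> TYPE('q))"
proof -
  have "GammaOmega d \<mu> TYPE('q) =
      (\<integral>x. Delta_powr gamma_exponent x * exp (- retr x) \<partial>(lebH d :: 'q mat measure))"
    unfolding GammaOmega_def set_lebesgue_integral_def
    by (intro Bochner_Integration.integral_cong)
      (auto simp: Delta_powr_def indicator_def gamma_exponent_def)
  also have "\<dots> = enn2real cone_gamma"
    unfolding cone_gamma_def by (rule integral_eq_nn_integral) (auto simp: Delta_powr_nonneg)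
  finally show ?thesis using cone_gamma_finite by simp
qed

lemma GammaOmega_pos: "0 < GammaOmega d \<mu> TYPE('q)"
  using cone_gamma_pos unfolding cone_gamma_eq by simp

lemma cone_laplace:
  fixes c :: "'q mat"
  assumes c: "c \<in> OmegaQ d"
  shows "(\<integral>\<^sup>+x. ennreal (Delta_powr gamma_exponent x * exp (- (c \<bullet> x))) \<partial>lebH d) =
    ennreal (Delta_powr (- \<mu>) c) * cone_gamma"
proof -
  let ?b = "gamma_exponent" and ?e = "2 * n0 d TYPE('q) / real CARD('q)"
  define s where "s = msqrt d c"
  have s: "s \<in> OmegaQ d" "mmul s s = c" using c msqrt_OmegaQ by (simp_all add: s_def)
  obtain h where h: "h \<in> OmegaQ d" "mmul s h = mid" "mmul h s = mid" using OmegaQ_inverse[OF s(1)] .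
  have "mmul h (mmul c h) = mid" using h
    by (simp add: s(2)[symmetric] mmul_assoc mmul_assoc[of h s, symmetric])
  then have exponent: "c \<bullet> mmul h (mmul x h) = retr x" for x
    using h(1) inner_mmul_conj[of c h x] by (simp add: retr_eq_inner)
  have Delta_pos: "0 < Delta d h" "0 < Delta d c" using h(1) c by (simp_all add: OmegaQ_iff_Delta)
  have Delta_inv: "(Delta d h)\<^sup>2 = 1 / Delta d c"
  proof -
    have "Delta d (mmul h (mmul c (madj h))) = Delta d (mmul h (madj h)) * Delta d c"
      using h(1) c by (intro Delta_conj) simp_all
    then have "(Delta d h)\<^sup>2 * Delta d c = 1" using h(1) \<open>mmul h (mmul c h) = mid\<close>
      by (simp add: Delta_square)
    then show ?thesis using Delta_pos by (simp add: field_simps)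
  qed
  have Delta_conj: "Delta_powr ?b (mmul h (mmul x h)) = (Delta d h)\<^sup>2 powr ?b * Delta_powr ?b x" for x
    using Delta_powr_conj[OF _ _ h(3), of ?b x] h(1) s(1) by (simp add: Delta_square)
  have "(\<integral>\<^sup>+x. ennreal (Delta_powr ?b x * exp (- (c \<bullet> x))) \<partial>lebH d) =
      ennreal (Delta d h powr ?e) * (\<integral>\<^sup>+x.
        ennreal ((Delta d h)\<^sup>2 powr ?b * (Delta_powr ?b x * exp (- retr x))) \<partial>(lebH d :: 'q mat measure))"
    by (subst nn_integral_lebH_conj[OF h(1)]) (simp_all add: exponent Delta_conj mult.assoc)
  also have "\<dots> = ennreal (Delta d h powr ?e) * (ennreal ((Delta d h)\<^sup>2 powr ?b) * cone_gamma)"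
    unfolding cone_gamma_def by (subst nn_integral_cmult[symmetric]) (simp_all add: ennreal_mult')
  also have "\<dots> = ennreal (Delta d h powr ?e * (Delta d h)\<^sup>2 powr ?b) * cone_gamma"
    by (simp add: ennreal_mult' mult.assoc)
  also have "Delta d h powr ?e * (Delta d h)\<^sup>2 powr ?b = (Delta d h)\<^sup>2 powr \<mu>"
  proof -
    have square: "(Delta d h)\<^sup>2 = Delta d h powr 2" using Delta_pos by simp
    show ?thesis unfolding square powr_powr powr_add[symmetric]
      by (simp add: gamma_exponent_def algebra_simps)
  qed
  also have "\<dots> = Delta_powr (- \<mu>) c"
    using c Delta_pos unfolding Delta_inv by (simp add: Delta_powr_def powr_divide powr_minus_divide)
  finally show ?thesis .
qed

section \<open>The Wishart distribution and its Laplace transform\<close>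

definition wishart_const :: real where
  "wishart_const = 2 powr (- real CARD('q) * \<mu>) / GammaOmega d \<mu> TYPE('q)"

lemma haar_eq:
  "haar d \<mu> = distr (density (lebH d)
     (\<lambda>r. ennreal (pi powr (real CARD('q) * \<mu>) / GammaOmega d \<mu> TYPE('q) * Delta_powr gamma_exponent r)))
   (PiS d) (psqrt :: 'q mat \<Rightarrow> _)"
proof -
  let ?D = "density (lebH d)
    (\<lambda>r::'q mat. ennreal (pi powr (real CARD('q) * \<mu>) / GammaOmega d \<mu> TYPE('q) * Delta_powr gamma_exponent r))"
  have "haar d \<mu> = distr ?D (PiS d) (\<lambda>v. msqrt d v)"
    unfolding haar_def by (intro arg_cong2[where f = "\<lambda>a b. distr (density (lebH d) a) (PiS d) b"] ext)
      (auto simp: Delta_powr_def indicator_def gamma_exponent_def)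
  also have "\<dots> = distr ?D (PiS d) (\<lambda>v. psqrt v)"
  proof (rule distr_msqrt)
    show "(\<lambda>v. v) \<in> borel_measurable ?D" by (rule measurable_ident_sets) simp
    have "AE r in lebH d. 0 < ennreal (pi powr (real CARD('q) * \<mu>)
        / GammaOmega d \<mu> TYPE('q) * Delta_powr gamma_exponent r)
        \<longrightarrow> r \<in> PiQ d"
      by (auto simp: Delta_powr_def intro!: AE_I2 split: if_splits)
    then show "AE v in ?D. v \<in> PiQ d" by (subst AE_density) measurable
  qed
  finally show ?thesis .
qed

lemma wishart_eq:
  "wishart d \<mu> = distr (density (lebH d)
     (\<lambda>x. ennreal (wishart_const * (Delta_powr gamma_exponent x * exp (- retr x / 2))))) (PiS d) (psqrt :: 'q mat \<Rightarrow> _)"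
proof -
  let ?k = "pi powr (real CARD('q) * \<mu>) / GammaOmega d \<mu> TYPE('q)"
    and ?l = "(2 * pi) powr (- real CARD('q) * \<mu>)"
  let ?D = "\<lambda>x::'q mat. ennreal (?k * Delta_powr gamma_exponent x)"
  let ?E = "\<lambda>r::'q mat. ennreal (?l * exp (- retr (mmul r r) / 2))"
  have const_eq: "?k * ?l = wishart_const"
  proof -
    have rearrange: "x / g * (y * z) = y * (x * z) / g" for x y z g :: real by simp
    have "pi powr (real CARD('q) * \<mu>) * pi powr (- real CARD('q) * \<mu>) = 1"
      unfolding powr_add[symmetric] by simp
    then show ?thesis unfolding powr_mult rearrange wishart_const_def by (simp only: mult_1_right)
  qed
  have [measurable]: "(\<lambda>r::'q mat. retr (mmul r r)) \<in> borel_measurable borel"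
    unfolding retr_eq_inner by (intro borel_measurable_continuous_onI continuous_intros)
  have E: "?E \<in> borel_measurable (PiS d)" by (rule measurable_PiS) measurable
  have "wishart d \<mu> = distr (density (density (lebH d) ?D) (\<lambda>x. ?E (psqrt x))) (PiS d) psqrt"
    unfolding wishart_def haar_eq by (rule density_distr[OF E]) measurable
  also have "density (density (lebH d) ?D) (\<lambda>x. ?E (psqrt x)) =
      density (lebH d) (\<lambda>x. ?D x * ?E (psqrt x))"
    by (rule density_density_eq[OF _ measurable_lebH[OF measurable_compose[OF psqrt_measurable E]]]) measurable
  also have "(\<lambda>x. ?D x * ?E (psqrt x)) =
      (\<lambda>x. ennreal (wishart_const * (Delta_powr gamma_exponent x * exp (- retr x / 2))))"
  proof
    fix x :: "'q mat"
    have "?D x * ?E (psqrt x) =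
        ennreal ((?k * ?l) * (Delta_powr gamma_exponent x * exp (- retr (mmul (psqrt x) (psqrt x)) / 2)))"
      by (simp add: ennreal_mult''[symmetric] mult_ac)
    also have "Delta_powr gamma_exponent x * exp (- retr (mmul (psqrt x) (psqrt x)) / 2) =
        Delta_powr gamma_exponent x * exp (- retr x / 2)"
      by (simp add: Delta_powr_def psqrt_def)
    finally show "?D x * ?E (psqrt x) =
        ennreal (wishart_const * (Delta_powr gamma_exponent x * exp (- retr x / 2)))"
      by (simp only: const_eq)
  qed
  finally show ?thesis .
qed

lemma nn_integral_wishart_exp:
  fixes b :: "'q mat"
  assumes b: "b \<in> PiQ d"
  shows "(\<integral>\<^sup>+r. ennreal (exp (- (b \<bullet> mmul r r))) \<partial>wishart d \<mu>) =
      ennreal (Delta_powr (- \<mu>) (mid + 2 *\<^sub>R b))"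
proof -
  let ?f = "\<lambda>x::'q mat. Delta_powr gamma_exponent x" and ?c = "(1 / 2) *\<^sub>R (mid + 2 *\<^sub>R b)"
  have c: "?c \<in> OmegaQ d" using OmegaQ_add[OF mid_OmegaQ, of "2 *\<^sub>R b"] b by (simp add: OmegaQ_scaleR)
  have const: "0 \<le> wishart_const" using GammaOmega_pos by (simp add: wishart_const_def)
  have e: "(\<lambda>r. ennreal (exp (- (b \<bullet> mmul r r)))) \<in> borel_measurable (PiS d)"
    using exp_inner_measurable[of b] by measurable
  have "(\<integral>\<^sup>+r. ennreal (exp (- (b \<bullet> mmul r r))) \<partial>wishart d \<mu>) =
      (\<integral>\<^sup>+x. ennreal (exp (- (b \<bullet> mmul (psqrt x) (psqrt x)))) \<partial>density (lebH d)
          (\<lambda>x. ennreal (wishart_const * (?f x * exp (- retr x / 2)))))"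
    unfolding wishart_eq by (rule nn_integral_distr) (use e in simp_all)
  also have "\<dots> = (\<integral>\<^sup>+x. ennreal (wishart_const * (?f x * exp (- retr x / 2)))
      * ennreal (exp (- (b \<bullet> mmul (psqrt x) (psqrt x)))) \<partial>lebH d)"
    by (rule nn_integral_density[OF _ measurable_lebH[OF measurable_compose[OF psqrt_measurable e]]]) measurable
  also have "\<dots> = (\<integral>\<^sup>+x. ennreal wishart_const * ennreal (?f x * exp (- (?c \<bullet> x))) \<partial>lebH d)"
  proof (rule nn_integral_cong)
    fix x :: "'q mat"
    have "exp (- retr x / 2) * exp (- (b \<bullet> x)) = exp (- (?c \<bullet> x))"
      by (simp add: exp_add[symmetric] retr_eq_inner inner_simps add_divide_distrib)
    then have "?f x * exp (- retr x / 2) * exp (- (b \<bullet> mmul (psqrt x) (psqrt x))) =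
        ?f x * exp (- (?c \<bullet> x))"
      by (simp add: Delta_powr_def psqrt_def)
    then have "wishart_const * (?f x * exp (- retr x / 2)) * exp (- (b \<bullet> mmul (psqrt x) (psqrt x))) =
        wishart_const * (?f x * exp (- (?c \<bullet> x)))"
      by (simp only: mult.assoc)
    then show "ennreal (wishart_const * (?f x * exp (- retr x / 2)))
        * ennreal (exp (- (b \<bullet> mmul (psqrt x) (psqrt x)))) =
        ennreal wishart_const * ennreal (?f x * exp (- (?c \<bullet> x)))"
      unfolding ennreal_mult'[OF const, symmetric]
      by (subst ennreal_mult''[symmetric]) (simp_all only: exp_ge_zero)
  qed
  also have "\<dots> = ennreal wishart_const * (ennreal (Delta_powr (- \<mu>) ?c) * cone_gamma)"
    unfolding cone_laplace[OF c, symmetric] by (rule nn_integral_cmult) measurable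
  also have "\<dots> = ennreal (2 powr (- real CARD('q) * \<mu>) * Delta_powr (- \<mu>) ?c)"
    using GammaOmega_pos by (simp add: cone_gamma_eq wishart_const_def ennreal_mult'[symmetric]
        ennreal_mult''[symmetric] Delta_powr_nonneg)
  also have "Delta_powr (- \<mu>) ?c = (1 / 2) powr (real CARD('q) * - \<mu>) * Delta_powr (- \<mu>) (mid + 2 *\<^sub>R b)"
    by (rule Delta_powr_scaleR) simp
  finally show ?thesis by (simp add: powr_divide mult.assoc[symmetric] powr_add[symmetric])
qed

lemma cone_law_wishart: "cone_law (wishart d \<mu> :: 'q mat measure)"
proof -
  have "emeasure (wishart d \<mu> :: 'q mat measure) (space (wishart d \<mu>)) = 1"
    using nn_integral_wishart_exp[of 0] by (simp add: Delta_powr_def)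
  then have "prob_space (wishart d \<mu> :: 'q mat measure)" by (rule prob_spaceI)
  then show ?thesis by (simp add: space_prob_algebra wishart_eq)
qed

lemma integral_wishart_exp:
  fixes b :: "'q mat"
  assumes b: "b \<in> PiQ d"
  shows "(\<integral>r. exp (- (b \<bullet> mmul r r)) \<partial>wishart d \<mu>) = Delta_powr (- \<mu>) (mid + 2 *\<^sub>R b)"
  using nn_integral_wishart_exp[OF b]
  by (subst integral_eq_nn_integral)
    (simp_all add: measurable_cone_law[OF cone_law_wishart exp_inner_measurable] Delta_powr_nonneg)

lemma conj_square_measurable: "(\<lambda>r. psqrt (mmul s (mmul (mmul r r) s))) \<in> PiS d \<rightarrow>\<^sub>M PiS d"
  for s :: "'q mat"
  by (rule measurable_compose[OF _ psqrt_measurable])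
    (intro measurable_PiS borel_measurable_continuous_onI continuous_intros)

lemma wishart_sq_eq:
  assumes "A \<in> PiQ d"
  shows "wishart_sq d \<mu> A =
    distr (wishart d \<mu>) (PiS d)
      (\<lambda>r. psqrt (mmul (msqrt d A) (mmul (mmul r r) (msqrt d (A :: 'q mat)))))"
  unfolding wishart_sq_def Tmeas_def
proof (rule distr_cong)
  fix r :: "'q mat" assume "r \<in> space (wishart d \<mu>)"
  then have "r \<in> PiQ d" using cone_lawD(3)[OF cone_law_wishart] by simp
  then show "Tmap d (msqrt d A) r = psqrt (mmul (msqrt d A) (mmul (mmul r r) (msqrt d A)))"
    unfolding Tmap_def psqrt_def using PiQ_conj_square[of "msqrt d A" r] assms by simp
qed simp_all

lemma cone_law_wishart_sq: "A \<in> PiQ d \<Longrightarrow> cone_law (wishart_sq d \<mu> (A :: 'q mat))"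
  unfolding wishart_sq_eq
  by (rule measurable_space[OF measurable_distr_prob_space[OF conj_square_measurable] cone_law_wishart])

lemma integral_wishart_sq_exp:
  fixes a A :: "'q mat"
  assumes a: "a \<in> PiQ d" and A: "A \<in> PiQ d"
  shows "(\<integral>r. exp (- (a \<bullet> mmul r r)) \<partial>wishart_sq d \<mu> A) =
    Delta_powr (- \<mu>) (mid + 2 *\<^sub>R mmul (msqrt d A) (mmul a (msqrt d A)))"
proof -
  define s where "s = msqrt d A"
  have s: "s \<in> PiQ d" unfolding s_def using A by simp
  have b: "mmul s (mmul a s) \<in> PiQ d" using PiQ_conj[OF _ a, of s] s by simp
  have "(\<integral>r. exp (- (a \<bullet> mmul r r)) \<partial>wishart_sq d \<mu> A) =
    (\<integral>r. exp (- (a \<bullet> mmul (psqrt (mmul s (mmul (mmul r r) s))) (psqrt (mmul s (mmul (mmul r r) s)))))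
        \<partial>wishart d \<mu>)"
    unfolding wishart_sq_eq[OF A] s_def
    by (rule integral_distr[OF measurable_cone_law[OF cone_law_wishart conj_square_measurable] exp_inner_measurable])
  also have "\<dots> = (\<integral>r. exp (- (mmul s (mmul a s) \<bullet> mmul r r)) \<partial>wishart d \<mu>)"
  proof (rule Bochner_Integration.integral_cong[OF refl])
    fix r :: "'q mat" assume "r \<in> space (wishart d \<mu>)"
    then have "mmul s (mmul (mmul r r) s) \<in> PiQ d"
      using cone_lawD(3)[OF cone_law_wishart] PiQ_conj_square[of s r] s by simp
    moreover have "a \<bullet> mmul s (mmul (mmul r r) s) = mmul s (mmul a s) \<bullet> mmul r r"
      using inner_mmul_conj[of a s "mmul r r"] s by simp
    ultimately show "exp (- (a \<bullet> mmul (psqrt (mmul s (mmul (mmul r r) s))) (psqrt (mmul s (mmul (mmul r r) s))))) =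
      exp (- (mmul s (mmul a s) \<bullet> mmul r r))"
      by (simp add: psqrt_def)
  qed
  also have "\<dots> = Delta_powr (- \<mu>) (mid + 2 *\<^sub>R mmul s (mmul a s))" by (rule integral_wishart_exp[OF b])
  finally show ?thesis unfolding s_def .
qed

end

section \<open>Laplace transforms determine weak convergence\<close>

lemma mat_unit_cases: "b \<in> (Basis :: 'q::finite mat set) \<Longrightarrow> \<exists>i j k. b = mat_unit (i, j, k)"
  unfolding Basis_vec_def mat_unit_def by auto

lemma inner_mat_unit_right: "x \<bullet> mat_unit (i, j, k) = x$i$j$k"
  by (simp add: mat_unit_def inner_axis)

definition truncation :: "real \<Rightarrow> 'a::real_normed_vector \<Rightarrow> real" where
  "truncation R x = min 1 ((norm x)\<^sup>2 / R\<^sup>2)"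

lemma truncation_bounds: "0 \<le> truncation R x" "truncation R x \<le> 1"
  by (auto simp: truncation_def)

lemma truncation_eq_1: "0 < R \<Longrightarrow> R \<le> norm x \<Longrightarrow> truncation R x = 1"
  by (simp add: truncation_def power_mono)

lemma truncation_tendsto_0: "(\<lambda>m. truncation (real m) x) \<longlonglongrightarrow> 0"
proof -
  have "(\<lambda>m. (norm x)\<^sup>2 * (1 / real m)\<^sup>2) \<longlonglongrightarrow> (norm x)\<^sup>2 * 0\<^sup>2" by (intro tendsto_intros lim_1_over_n)
  then have "(\<lambda>m. min 1 ((norm x)\<^sup>2 / (real m)\<^sup>2)) \<longlonglongrightarrow> min 1 0"
    by (intro tendsto_intros) (simp add: power_divide)
  then show ?thesis by (simp add: truncation_def)
qed

context field_dim
begin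

inductive exp_comb :: "('q::finite mat \<Rightarrow> real) \<Rightarrow> bool" where
  exp: "a \<in> PiQ d \<Longrightarrow> exp_comb (\<lambda>r. c * exp (- (a \<bullet> mmul r r)))"
| add: "exp_comb f \<Longrightarrow> exp_comb g \<Longrightarrow> exp_comb (\<lambda>r. f r + g r)"

lemma exp_comb_const: "exp_comb (\<lambda>r. c)"
  using exp_comb.exp[of 0 c] by simp

lemma exp_comb_sum: "finite A \<Longrightarrow> (\<And>i. i \<in> A \<Longrightarrow> exp_comb (f i)) \<Longrightarrow> exp_comb (\<lambda>r. \<Sum>i\<in>A. f i r)"
  by (induction A rule: finite_induct) (auto intro: exp_comb_const exp_comb.add)

lemma exp_comb_mult_exp: "exp_comb g \<Longrightarrow> a \<in> PiQ d \<Longrightarrow> exp_comb (\<lambda>r. c * exp (- (a \<bullet> mmul r r)) * g r)"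
proof (induction rule: exp_comb.induct)
  case (exp b c')
  have "(\<lambda>r. c * exp (- (a \<bullet> mmul r r)) * (c' * exp (- (b \<bullet> mmul r r)))) =
      (\<lambda>r. (c * c') * exp (- ((a + b) \<bullet> mmul r r)))"
    by (rule ext) (simp add: inner_simps exp_diff exp_minus field_simps)
  then show ?case using exp by (simp only:) (intro exp_comb.exp PiQ_simps)
next
  case (add f g)
  show ?case unfolding distrib_left
    by (rule exp_comb.add[OF add.IH(1)[OF add.prems] add.IH(2)[OF add.prems]])
qed

lemma exp_comb_mult: "exp_comb f \<Longrightarrow> exp_comb g \<Longrightarrow> exp_comb (\<lambda>r. f r * g r)"
proof (induction rule: exp_comb.induct)
  case (exp a c)
  then show ?case by (intro exp_comb_mult_exp)
next
  case (add f g')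
  show ?case unfolding distrib_right
    by (rule exp_comb.add[OF add.IH(1)[OF add.prems] add.IH(2)[OF add.prems]])
qed

lemma exp_inner_integrable:
  assumes "cone_law M" "a \<in> PiQ d" shows "integrable M (\<lambda>r. exp (- (a \<bullet> mmul r r)))"
  using exp_inner_le_1[OF assms(2)]
  by (intro integrable_prob_algebra[OF assms(1) exp_inner_measurable, where B = 1])
    (simp add: space_PiS)

lemma exp_comb_integrable: "exp_comb f \<Longrightarrow> cone_law M \<Longrightarrow> integrable M f"
  by (induction rule: exp_comb.induct) (auto simp: exp_inner_integrable)

lemma exp_comb_tendsto:
  assumes P: "\<And>n. cone_law (P n)" and Q: "cone_law Q"
    and lim: "\<And>a. a \<in> PiQ d \<Longrightarrow> (\<lambda>n. \<integral>r. exp (- (a \<bullet> mmul r r)) \<partial>P n) \<longlonglongrightarrow> (\<integral>r. exp (- (a \<bullet> mmul r r)) \<partial>Q)"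
  shows "exp_comb f \<Longrightarrow> (\<lambda>n. \<integral>r. f r \<partial>P n) \<longlonglongrightarrow> (\<integral>r. f r \<partial>Q)"
proof (induction rule: exp_comb.induct)
  case (exp a c)
  then show ?case using tendsto_mult[OF tendsto_const lim[of a], of c] by simp
next
  case (add f g)
  then show ?case using tendsto_add[OF add.IH] P Q by (simp add: exp_comb_integrable)
qed

text \<open>The shift by the identity makes the Hermitian part of a basis matrix positive.\<close>

definition shifted_basis :: "'q::finite mat \<Rightarrow> 'q mat" where
  "shifted_basis b = mid + (1 / 2) *\<^sub>R ((if In_M d b then b else 0) + madj (if In_M d b then b else 0))"

lemma shifted_basis_PiQ:
  assumes b: "b \<in> Basis" shows "shifted_basis b \<in> PiQ d"
proof -
  define b' where "b' = (if In_M d b then b else 0)"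
  have b': "In_M d b'" "norm b' \<le> 1" using b by (auto simp: b'_def)
  let ?h = "(1 / 2) *\<^sub>R (b' + madj b')"
  have "norm ?h \<le> 1" using norm_triangle_ineq[of b' "madj b'"] b' by simp
  moreover have "?h \<in> Herm d" unfolding Herm_def using b' by (simp add: add.commute)
  ultimately show ?thesis using PiQ_scaleR_mid_add[of ?h 1] by (simp add: shifted_basis_def b'_def)
qed

lemma inner_shifted_basis:
  assumes "b \<in> Basis" "y \<in> Herm d" shows "shifted_basis b \<bullet> y = b \<bullet> y + retr y"
proof -
  have "(if In_M d b then b else 0) \<bullet> y = b \<bullet> y"
  proof (cases "In_M d b")
    case False
    obtain i j k where b: "b = mat_unit (i, j, k)" using mat_unit_cases[OF assms(1)] by blast
    have "k \<notin> comps d" using False by (auto simp: b In_M_def mat_unit_nth split: if_splits)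
    then have "y$i$j$k = 0" using Herm_D(1)[OF assms(2)] by (simp add: In_M_def)
    then show ?thesis using False inner_mat_unit_right[of y i j k] by (simp add: b inner_commute)
  qed simp
  moreover have "madj x \<bullet> y = x \<bullet> y" for x using inner_madj[of x y] assms(2) by simp
  ultimately show ?thesis by (simp add: shifted_basis_def inner_simps retr_eq_inner)
qed

lemma shifted_basis_separates:
  fixes y :: "'q::finite mat"
  assumes y: "y \<in> Herm d" and zero: "\<And>b. b \<in> Basis \<Longrightarrow> shifted_basis b \<bullet> y = 0"
  shows "y = 0"
proof -
  have coord: "y \<bullet> b = - retr y" if "b \<in> Basis" for b
    using zero[OF that] inner_shifted_basis[OF that y] by (simp add: inner_commute[of y])
  have "retr y = (\<Sum>b\<in>Basis. ((mid :: 'q mat) \<bullet> b) * (y \<bullet> b))" unfolding retr_eq_inner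
    by (rule euclidean_inner)
  also have "\<dots> = (\<Sum>b\<in>Basis. (mid :: 'q mat) \<bullet> b) * (- retr y)"
    by (simp add: coord sum_distrib_right sum_negf)
  finally have "retr y * (1 + (\<Sum>b\<in>Basis. (mid :: 'q mat) \<bullet> b)) = 0" by (simp add: algebra_simps)
  moreover have "0 \<le> (\<Sum>b\<in>Basis. (mid :: 'q mat) \<bullet> b)"
  proof (rule sum_nonneg)
    fix b :: "'q mat" assume "b \<in> Basis"
    then obtain i j k where "b = mat_unit (i, j, k)" using mat_unit_cases by blast
    then have "mid \<bullet> b = (mid :: 'q mat)$i$j$k" by (simp add: inner_mat_unit_right)
    then show "0 \<le> (mid :: 'q mat) \<bullet> b" by (simp add: mid_nth qone_def)
  qed
  ultimately have "retr y = 0" unfolding mult_eq_0_iff by linarith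
  then show ?thesis using coord euclidean_all_zero_iff[of y] by simp
qed

definition laplace_map :: "'q::finite mat \<Rightarrow> 'q mat" where
  "laplace_map r = (\<Sum>b\<in>Basis. exp (- (shifted_basis b \<bullet> mmul r r)) *\<^sub>R b)"

lemma laplace_map_inner: "b \<in> Basis \<Longrightarrow> laplace_map r \<bullet> b = exp (- (shifted_basis b \<bullet> mmul r r))"
  unfolding laplace_map_def by simp

lemma inj_on_laplace_map: "inj_on laplace_map (PiQ d)"
proof (rule inj_onI)
  fix r s :: "'a mat" assume rs: "r \<in> PiQ d" "s \<in> PiQ d" and eq: "laplace_map r = laplace_map s"
  have "shifted_basis b \<bullet> (mmul r r - mmul s s) = 0" if "b \<in> Basis" for b
    using arg_cong[OF eq, of "\<lambda>x. x \<bullet> b"] laplace_map_inner[OF that] by (simp add: inner_simps)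
  moreover have "mmul r r - mmul s s \<in> Herm d" using rs
    by (intro Herm_simps(6) PiQ_Herm PiQ_square) simp_all
  ultimately have "mmul r r - mmul s s = 0" using shifted_basis_separates by blast
  then show "r = s" using PiQ_sqrt_unique[OF rs] by simp
qed

lemma continuous_on_laplace_map: "continuous_on A laplace_map"
  unfolding laplace_map_def[abs_def] by (intro continuous_intros)

lemma laplace_map_in_cube:
  assumes r: "r \<in> PiQ d" shows "laplace_map r \<in> cbox 0 One"
proof -
  have "0 \<le> shifted_basis b \<bullet> mmul r r" if "b \<in> Basis" for b
    using shifted_basis_PiQ[OF that] r by (intro inner_PiQ_nonneg PiQ_square) auto
  then show ?thesis by (simp add: mem_box laplace_map_inner)
qed

lemma exp_comb_polynomial: "real_polynomial_function g \<Longrightarrow> exp_comb (\<lambda>r. g (laplace_map r))"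
proof (induction rule: real_polynomial_function.induct)
  case (linear f)
  then have f: "linear f" by (rule bounded_linear.linear)
  have "f (laplace_map r) = (\<Sum>b\<in>Basis. f b * exp (- (shifted_basis b \<bullet> mmul r r)))" for r
    by (simp add: laplace_map_def linear_sum[OF f] linear_cmul[OF f] mult.commute)
  then show ?case using shifted_basis_PiQ by (simp only:) (intro exp_comb_sum exp_comb.exp finite_Basis)
next
  case (const c)
  show ?case by (rule exp_comb_const)
qed (auto intro: exp_comb.add exp_comb_mult)

lemma laplace_map_extension:
  fixes f :: "'q::finite mat \<Rightarrow> real"
  assumes f: "continuous_on (PiQ d) f" and K: "0 \<le> K" "\<And>r. r \<in> PiQ d \<Longrightarrow> \<bar>f r\<bar> \<le> K"
  obtains G where "continuous_on UNIV G" "\<And>x. \<bar>G x\<bar> \<le> K"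
    "\<And>r. r \<in> PiQ d \<Longrightarrow> norm r \<le> R \<Longrightarrow> G (laplace_map r) = f r"
proof -
  define D where "D = PiQ d \<inter> cball (0::'q mat) R"
  have D: "compact D" unfolding D_def by (intro closed_Int_compact closed_PiQ) simp
  have "inj_on laplace_map D" using inj_on_laplace_map by (rule inj_on_subset) (auto simp: D_def)
  then have inverse: "the_inv_into D laplace_map (laplace_map r) = r" if "r \<in> D" for r
    using that by (rule the_inv_into_f_f)
  have "continuous_on (laplace_map ` D) (the_inv_into D laplace_map)"
    by (rule continuous_on_inv[OF continuous_on_laplace_map D]) (simp add: inverse)
  moreover have image: "the_inv_into D laplace_map ` (laplace_map ` D) \<subseteq> PiQ d" using inverse
    by (auto simp: D_def)
  ultimately have cont: "continuous_on (laplace_map ` D) (\<lambda>x. f (the_inv_into D laplace_map x))"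
    by (rule continuous_on_compose2[OF f])
  have closed: "closedin (top_of_set UNIV) (laplace_map ` D)"
    using compact_continuous_image[OF continuous_on_laplace_map D] by (simp add: compact_imp_closed)
  have bound: "norm (f (the_inv_into D laplace_map x)) \<le> K" if "x \<in> laplace_map ` D" for x
    using K(2) image that by auto
  obtain G where G: "continuous_on UNIV G"
    "\<And>x. x \<in> laplace_map ` D \<Longrightarrow> G x = f (the_inv_into D laplace_map x)"
    "\<And>x. x \<in> UNIV \<Longrightarrow> norm (G x) \<le> K"
    by (rule Tietze[OF cont closed K(1) bound]) blast+
  show thesis
  proof (rule that[OF G(1)])
    show "\<bar>G x\<bar> \<le> K" for x using G(3) by simp
    show "G (laplace_map r) = f r" if "r \<in> PiQ d" "norm r \<le> R" for r
      using G(2)[of "laplace_map r"] inverse[of r] that by (simp add: D_def)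
  qed
qed

lemma exp_comb_approximation:
  fixes f :: "'q::finite mat \<Rightarrow> real"
  assumes f: "continuous_on (PiQ d) f" and K: "0 \<le> K" "\<And>r. r \<in> PiQ d \<Longrightarrow> \<bar>f r\<bar> \<le> K" and R: "0 < R"
    and e: "0 < e"
  obtains p where "exp_comb p" "\<And>r. r \<in> PiQ d \<Longrightarrow> \<bar>f r - p r\<bar> \<le> 2 * K * truncation R r + e"
proof -
  obtain G where G: "continuous_on UNIV G" "\<And>x. \<bar>G x\<bar> \<le> K"
    "\<And>r. r \<in> PiQ d \<Longrightarrow> norm r \<le> R \<Longrightarrow> G (laplace_map r) = f r"
    using laplace_map_extension[OF f K] by blast
  obtain p where p: "real_polynomial_function p" "\<And>x. x \<in> cbox 0 (One :: 'q mat) \<Longrightarrow> \<bar>G x - p x\<bar> < e"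
    using Stone_Weierstrass_real_polynomial_function[OF compact_cbox
        continuous_on_subset[OF G(1) subset_UNIV] e] by blast
  show thesis
  proof (rule that[OF exp_comb_polynomial[OF p(1)]])
    fix r :: "'q mat" assume r: "r \<in> PiQ d"
    have "\<bar>f r - G (laplace_map r)\<bar> \<le> 2 * K * truncation R r"
    proof (cases "norm r \<le> R")
      case True
      then show ?thesis using G(3)[OF r] K(1) truncation_bounds(1)[of R r] by simp
    next
      case False
      then have "truncation R r = 1" using R by (simp add: truncation_eq_1)
      then show ?thesis using K(2)[OF r] G(2)[of "laplace_map r"] by simp
    qed
    moreover have "\<bar>G (laplace_map r) - p (laplace_map r)\<bar> < e"
      by (rule p(2)[OF laplace_map_in_cube[OF r]])
    ultimately show "\<bar>f r - p (laplace_map r)\<bar> \<le> 2 * K * truncation R r + e" by linarith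
  qed
qed

lemma truncation_measurable: "truncation R \<in> borel_measurable (PiS d)"
  unfolding truncation_def[abs_def] by (rule measurable_PiS) measurable

lemma truncation_integrable: "cone_law M \<Longrightarrow> integrable M (truncation R)"
  by (rule integrable_prob_algebra[OF _ truncation_measurable, where B = 1])
    (simp_all add: truncation_bounds)

lemma integral_truncation_tendsto_0:
  assumes Q: "cone_law Q" shows "(\<lambda>m. \<integral>r. truncation (real m) r \<partial>Q) \<longlonglongrightarrow> 0"
proof -
  interpret prob_space Q using Q by (rule cone_lawD)
  have "(\<lambda>m. \<integral>r. truncation (real m) r \<partial>Q) \<longlonglongrightarrow> (\<integral>r. 0 \<partial>Q)"
    by (rule integral_dominated_convergence[where w = "\<lambda>_. 1"])
      (auto intro!: measurable_cone_law[OF Q] truncation_measurable truncation_tendsto_0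
          simp: truncation_bounds)
  then show ?thesis by simp
qed

lemma integral_truncation_le:
  assumes M: "cone_law M" and B: "0 \<le> B" "(\<integral>\<^sup>+r. ennreal ((norm r)\<^sup>2) \<partial>M) \<le> ennreal B"
  shows "(\<integral>r. truncation R r \<partial>M) \<le> B / R\<^sup>2"
proof -
  have "ennreal (\<integral>r. truncation R r \<partial>M) = (\<integral>\<^sup>+r. ennreal (truncation R r) \<partial>M)"
    using truncation_integrable[OF M] truncation_bounds by (subst nn_integral_eq_integral) auto
  also have "\<dots> \<le> (\<integral>\<^sup>+r. ennreal (1 / R\<^sup>2) * ennreal ((norm r)\<^sup>2) \<partial>M)"
    by (intro nn_integral_mono) (auto simp: ennreal_mult'[symmetric] truncation_def)
  also have "\<dots> = ennreal (1 / R\<^sup>2) * (\<integral>\<^sup>+r. ennreal ((norm r)\<^sup>2) \<partial>M)"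
    by (rule nn_integral_cmult) (rule measurable_cone_law[OF M norm_sq_measurable])
  also have "\<dots> \<le> ennreal (1 / R\<^sup>2) * ennreal B" using B(2) by (rule mult_left_mono) simp
  also have "\<dots> = ennreal (B / R\<^sup>2)" using B(1) by (simp add: ennreal_mult'[symmetric])
  finally show ?thesis using B(1) by (subst (asm) ennreal_le_iff) auto
qed

lemma abs_integral_diff_truncation_le:
  fixes f p :: "'q::finite mat \<Rightarrow> real"
  assumes M: "cone_law M" and f: "integrable M f" and p: "integrable M p"
    and approx: "\<And>r. r \<in> PiQ d \<Longrightarrow> \<bar>f r - p r\<bar> \<le> c * truncation R r + e"
  shows "\<bar>(\<integral>r. f r \<partial>M) - (\<integral>r. p r \<partial>M)\<bar> \<le> c * (\<integral>r. truncation R r \<partial>M) + e"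
proof -
  interpret prob_space M using M by (rule cone_lawD)
  have "\<bar>(\<integral>r. f r \<partial>M) - (\<integral>r. p r \<partial>M)\<bar> = \<bar>\<integral>r. f r - p r \<partial>M\<bar>" using f p by simp
  also have "\<dots> \<le> (\<integral>r. \<bar>f r - p r\<bar> \<partial>M)" by (rule integral_abs_bound)
  also have "\<dots> \<le> (\<integral>r. c * truncation R r + e \<partial>M)"
    using f p truncation_integrable[OF M] approx cone_lawD(3)[OF M] by (intro integral_mono) auto
  also have "\<dots> = c * (\<integral>r. truncation R r \<partial>M) + e" using truncation_integrable[OF M] prob_space by simp
  finally show ?thesis .
qed

lemma exists_truncation_radius:
  assumes Q: "cone_law Q" and e: "0 < e"
  obtains m :: nat where "0 < m" "K * (B * (1 / real m)\<^sup>2) < e"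
    "K * (\<integral>r. truncation (real m) r \<partial>Q) < e"
proof -
  have "(\<lambda>m. K * (B * (1 / real m)\<^sup>2)) \<longlonglongrightarrow> K * (B * 0\<^sup>2)"
    by (intro tendsto_intros lim_1_over_n)
  then have "\<forall>\<^sub>F m in sequentially. K * (B * (1 / real m)\<^sup>2) < e"
    by (rule order_tendstoD) (use e in simp)
  moreover have "(\<lambda>m. K * (\<integral>r. truncation (real m) r \<partial>Q)) \<longlonglongrightarrow> K * 0"
    by (intro tendsto_intros integral_truncation_tendsto_0 Q)
  then have "\<forall>\<^sub>F m in sequentially. K * (\<integral>r. truncation (real m) r \<partial>Q) < e"
    by (rule order_tendstoD) (use e in simp)
  ultimately have "\<forall>\<^sub>F m in sequentially. 0 < m \<and> K * (B * (1 / real m)\<^sup>2) < e \<and>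
      K * (\<integral>r. truncation (real m) r \<partial>Q) < e"
    using eventually_gt_at_top[of 0] by eventually_elim simp
  then show ?thesis using that eventually_happens' sequentially_bot by blast
qed

lemma weak_conv_PiI_laplace:
  fixes P :: "nat \<Rightarrow> 'q::finite mat measure"
  assumes P: "\<And>n. cone_law (P n)" and Q: "cone_law Q"
    and lim: "\<And>a. a \<in> PiQ d \<Longrightarrow> (\<lambda>n. \<integral>r. exp (- (a \<bullet> mmul r r)) \<partial>P n) \<longlonglongrightarrow> (\<integral>r. exp (- (a \<bullet> mmul r r)) \<partial>Q)"
    and tight: "\<And>n. n \<ge> 1 \<Longrightarrow> (\<integral>\<^sup>+r. ennreal ((norm r)\<^sup>2) \<partial>P n) \<le> ennreal B" and B: "0 \<le> B"
  shows "weak_conv_Pi d P Q"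
  unfolding weak_conv_Pi_def
proof (intro allI impI LIMSEQ_I, elim conjE)
  fix f :: "'q mat \<Rightarrow> real" and e :: real
  assume f: "continuous_on (PiQ d) f" and "bounded (f ` PiQ d)" and "0 < e"
  then have e: "0 < e / 5" by simp
  obtain K where K: "K > 0" "\<And>r. r \<in> PiQ d \<Longrightarrow> \<bar>f r\<bar> \<le> K"
    using \<open>bounded (f ` PiQ d)\<close> unfolding bounded_pos by auto
  have "f \<in> borel_measurable (PiS d)" unfolding PiS_def
    by (rule borel_measurable_continuous_on_restrict[OF f])
  then have f_int: "integrable M f" if "cone_law M" for M
    using K(2) by (intro integrable_prob_algebra[OF that]) (simp_all add: space_PiS)
  obtain m :: nat where m: "0 < m" "2 * K * (B * (1 / real m)\<^sup>2) < e / 5"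
    "2 * K * (\<integral>r. truncation (real m) r \<partial>Q) < e / 5"
    by (rule exists_truncation_radius[OF Q e])
  obtain p where p: "exp_comb p" "\<And>r. r \<in> PiQ d \<Longrightarrow> \<bar>f r - p r\<bar> \<le> 2 * K * truncation (real m) r + e / 5"
    using exp_comb_approximation[OF f less_imp_le[OF K(1)] K(2) _ e, of "real m"] m(1) by auto
  note estimate = abs_integral_diff_truncation_le[OF _ f_int exp_comb_integrable[OF p(1)] p(2)]
  obtain N where N: "\<And>n. n \<ge> N \<Longrightarrow> \<bar>(\<integral>r. p r \<partial>P n) - (\<integral>r. p r \<partial>Q)\<bar> < e / 5"
    using LIMSEQ_D[OF exp_comb_tendsto[OF P Q lim p(1)] e] unfolding real_norm_def by blast
  have "norm ((\<integral>r. f r \<partial>P n) - (\<integral>r. f r \<partial>Q)) < e" if n: "n \<ge> max N 1" for n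
  proof -
    have "2 * K * (\<integral>r. truncation (real m) r \<partial>P n) \<le> 2 * K * (B * (1 / real m)\<^sup>2)"
      using integral_truncation_le[OF P B tight, of n "real m"] n K(1)
      by (intro mult_left_mono) (auto simp: power_divide)
    then have "\<bar>(\<integral>r. f r \<partial>P n) - (\<integral>r. p r \<partial>P n)\<bar> < e / 5 + e / 5" using estimate[OF P P P, of n] m(2)
      by linarith
    moreover have "\<bar>(\<integral>r. f r \<partial>Q) - (\<integral>r. p r \<partial>Q)\<bar> < e / 5 + e / 5" using estimate[OF Q Q Q] m(3)
      by linarith
    ultimately show ?thesis using N[of n] n unfolding real_norm_def by linarith
  qed
  then show "\<exists>N. \<forall>n\<ge>N. norm ((\<integral>r. f r \<partial>P n) - (\<integral>r. f r \<partial>Q)) < e" by blast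
qed

end

section \<open>The central limit theorem\<close>

context field_dim
begin

lemma simultaneous_diagonalization:
  assumes a: "a \<in> PiQ d" and A: "A \<in> PiQ d"
  obtains k l where "In_M d k" "\<And>i. 0 \<le> l i" "mmul (madj k) k = a" "mmul k (mmul A (madj k)) = rdiag l"
proof -
  define s where "s = msqrt d a"
  have s: "s \<in> PiQ d" "mmul s s = a" "madj s = s" "In_M d s" using a by (simp_all add: s_def)
  have "mmul s (mmul A s) \<in> PiQ d" using PiQ_conj[OF s(4) A] unfolding s(3) .
  then obtain u l where u: "unitary d u" "mmul s (mmul A s) = conj_rdiag u l" and l: "\<And>i. 0 \<le> l i"
    by (metis spectral_psd)
  show thesis
  proof (rule that)
    show "In_M d (mmul (madj u) s)" using u(1) s(4) by simp
    show "mmul (madj (mmul (madj u) s)) (mmul (madj u) s) = a" using u(1)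
      by (simp add: s mmul_assoc unitary_cancel)
    have "mmul (mmul (madj u) s) (mmul A (madj (mmul (madj u) s))) =
        mmul (madj u) (mmul (mmul s (mmul A s)) u)"
      by (simp add: s mmul_assoc)
    also have "\<dots> = rdiag l" unfolding u(2) using u(1)
      by (simp add: mmul_assoc unitary_cancel unitary_left)
    finally show "mmul (mmul (madj u) s) (mmul A (madj (mmul (madj u) s))) = rdiag l" .
  qed (rule l)
qed

lemma Delta_mid_plus_rdiag:
  assumes s: "s \<in> PiQ d" and k: "In_M d k" and l: "\<And>i. 0 \<le> l i"
    and diag: "mmul k (mmul (mmul s s) (madj k)) = rdiag l"
  shows "Delta d (mid + 2 *\<^sub>R mmul s (mmul (mmul (madj k) k) s)) = (\<Prod>i\<in>UNIV. 1 + 2 * l i)"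
proof -
  have rdiag: "mid + 2 *\<^sub>R mmul k (mmul (mmul s s) (madj k)) = rdiag (\<lambda>i. 1 + 2 * l i)"
    unfolding diag by (simp add: rdiag_linear rdiag_one)
  have "mid + 2 *\<^sub>R mmul s (mmul (mmul (madj k) k) s) \<in> PiQ d"
    using PiQ_mmul_madj[of "mmul s (madj k)"] s k by (simp add: mmul_assoc)
  moreover have "mid + 2 *\<^sub>R mmul k (mmul (mmul s s) (madj k)) \<in> PiQ d" unfolding rdiag using l
    by (simp add: PiQ_rdiag)
  ultimately have "Delta d (mid + 2 *\<^sub>R mmul s (mmul (mmul (madj k) k) s)) =
      Delta d (mid + 2 *\<^sub>R mmul k (mmul (mmul s s) (madj k)))"
    using Delta_mid_plus_commute[of "2 *\<^sub>R mmul s (madj k)" "mmul k s"] by (simp add: mmul_assoc)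
  then show ?thesis unfolding rdiag using l by (simp add: Delta_rdiag)
qed

end

context clt_setting
begin

definition covariance :: "'q mat" where
  "covariance = (1 / (2 * \<mu>)) *\<^sub>R second_moment"

lemma covariance_PiQ: "covariance \<in> PiQ d"
  unfolding covariance_def using second_moment_PiQ mu_pos by simp

lemma laplace_convergence:
  assumes a: "a \<in> PiQ d"
  shows "(\<lambda>n. \<integral>r. exp (- (a \<bullet> mmul r r)) \<partial>convpow d \<mu> (scaled_law (1 / sqrt (real n))) n)
    \<longlonglongrightarrow> (\<integral>r. exp (- (a \<bullet> mmul r r)) \<partial>wishart_sq d \<mu> covariance)"
proof -
  obtain k l where k: "In_M d k" "mmul (madj k) k = a" and l: "\<And>i. 0 \<le> l i"
    and diag: "mmul k (mmul covariance (madj k)) = rdiag l"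
    using simultaneous_diagonalization[OF a covariance_PiQ] by blast
  interpret laplace_setting d \<mu> ty \<nu> k l
  proof
    show "mmul k (mmul second_moment (madj k)) = (2 * \<mu>) *\<^sub>R rdiag l"
      using mu_pos by (simp add: diag[symmetric] covariance_def)
  qed (simp_all add: k l)
  let ?s = "msqrt d covariance"
  have "0 < (\<Prod>i\<in>UNIV. 1 + 2 * l i)" using l by (intro prod_pos) (simp add: add_pos_nonneg)
  moreover have "1 + 2 * l i \<noteq> 0" for i using l[of i] by simp
  ultimately have "exp (\<Sum>i\<in>UNIV. - \<mu> * ln (1 + 2 * l i)) = (\<Prod>i\<in>UNIV. 1 + 2 * l i) powr (- \<mu>)"
    by (simp add: powr_def ln_prod sum_distrib_left sum_negf)
  also have "(\<Prod>i\<in>UNIV. 1 + 2 * l i) = Delta d (mid + 2 *\<^sub>R mmul ?s (mmul a ?s))"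
    using Delta_mid_plus_rdiag[of ?s k l] k l diag covariance_PiQ by simp
  also have "\<dots> powr (- \<mu>) = Delta_powr (- \<mu>) (mid + 2 *\<^sub>R mmul ?s (mmul a ?s))"
    using OmegaQ_add[OF mid_OmegaQ, of "2 *\<^sub>R mmul ?s (mmul a ?s)"] PiQ_conj[OF _ a, of ?s]
      covariance_PiQ
    by (simp add: Delta_powr_def)
  also have "\<dots> = (\<integral>r. exp (- (a \<bullet> mmul r r)) \<partial>wishart_sq d \<mu> covariance)"
    by (rule integral_wishart_sq_exp[OF a covariance_PiQ, symmetric])
  finally show ?thesis using laplace_limit unfolding k(2) by simp
qed

lemma Tmeas_convpow_scaled_law:
  assumes "1 \<le> n"
  shows "Tmeas d ((1 / sqrt (real n)) *\<^sub>R mid) (convpow d \<mu> \<nu> n) =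
      convpow d \<mu> (scaled_law (1 / sqrt (real n))) n"
  using Tmeas_convpow[OF cone_law, of "1 / sqrt (real n)" n]
    Tmeas_scale[OF cone_law, of "1 / sqrt (real n)"] assms
  by simp

lemma second_moment_convpow_scaled_law:
  assumes n: "1 \<le> n"
  shows "(\<integral>\<^sup>+r. ennreal ((norm r)\<^sup>2) \<partial>convpow d \<mu> (scaled_law (1 / sqrt (real n))) n) =
      ennreal (\<integral>r. (norm r)\<^sup>2 \<partial>\<nu>)"
proof -
  let ?c = "1 / sqrt (real n)"
  have "(\<integral>\<^sup>+r. ennreal ((norm r)\<^sup>2) \<partial>scaled_law ?c) = (\<integral>\<^sup>+r. ennreal ((norm (?c *\<^sub>R r))\<^sup>2) \<partial>\<nu>)"
    using norm_sq_measurable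
    by (intro nn_integral_distr measurable_cone_law[OF cone_law scale_measurable]) simp_all
  also have "\<dots> = (\<integral>\<^sup>+r. ennreal (1 / real n) * ennreal ((norm r)\<^sup>2) \<partial>\<nu>)"
    by (intro nn_integral_cong) (simp add: ennreal_mult'[symmetric] power_divide)
  also have "\<dots> = ennreal (1 / real n) * (\<integral>\<^sup>+r. ennreal ((norm r)\<^sup>2) \<partial>\<nu>)"
    by (rule nn_integral_cmult) (rule measurable_cone_law[OF cone_law norm_sq_measurable])
  also have "(\<integral>\<^sup>+r. ennreal ((norm r)\<^sup>2) \<partial>\<nu>) = ennreal (\<integral>r. (norm r)\<^sup>2 \<partial>\<nu>)"
    by (rule nn_integral_eq_integral[OF integrable_norm_sq]) simp
  finally have "(\<integral>\<^sup>+r. ennreal ((norm r)\<^sup>2) \<partial>convpow d \<mu> (scaled_law ?c) n) =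
      ennreal (real n) * (ennreal (1 / real n) * ennreal (\<integral>r. (norm r)\<^sup>2 \<partial>\<nu>))"
    by (simp add: convpow_second_moment cone_law_scaled_law ennreal_of_nat_eq_real_of_nat)
  then show ?thesis using n by (simp add: mult.assoc[symmetric] ennreal_mult'[symmetric])
qed

lemma central_limit:
  "weak_conv_Pi d (\<lambda>n. Tmeas d ((1 / sqrt (real n)) *\<^sub>R mid)
      (convpow d \<mu> \<nu> n)) (wishart_sq d \<mu> covariance)"
proof (rule weak_conv_PiI_laplace)
  let ?P = "\<lambda>n. Tmeas d ((1 / sqrt (real n)) *\<^sub>R mid) (convpow d \<mu> \<nu> n)"
  show "cone_law (wishart_sq d \<mu> covariance)" by (rule cone_law_wishart_sq[OF covariance_PiQ])
  show "cone_law (?P n)" for n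
    using cone_law_scale[OF cone_law_convpow[OF cone_law], of "1 / sqrt (real n)" n]
    by (simp add: Tmeas_scale[OF cone_law_convpow[OF cone_law]])
  show "(\<lambda>n. \<integral>r. exp (- (a \<bullet> mmul r r)) \<partial>?P n) \<longlonglongrightarrow> (\<integral>r. exp (- (a \<bullet> mmul r r))
      \<partial>wishart_sq d \<mu> covariance)"
    if "a \<in> PiQ d" for a
    by (rule Lim_transform_eventually[OF laplace_convergence[OF that] eventually_sequentiallyI[of 1]])
      (simp only: Tmeas_convpow_scaled_law)
  show "(\<integral>\<^sup>+r. ennreal ((norm r)\<^sup>2) \<partial>?P n) \<le> ennreal (\<integral>r. (norm r)\<^sup>2 \<partial>\<nu>)" if "1 \<le> n" for n
    unfolding Tmeas_convpow_scaled_law[OF that] second_moment_convpow_scaled_law[OF that] ..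
qed simp

end

theorem mainTheorem19:
  fixes d :: nat and \<mu> :: real and \<nu> :: "'q::finite mat measure"
  assumes "d \<in> {1, 2, 4}"
    and "\<mu> > rho d TYPE('q) - 1"
    and "prob_space \<nu>" and "sets \<nu> = sets (PiS d)"
    and "(\<integral>\<^sup>+ r. ennreal ((norm r)\<^sup>2) \<partial>\<nu>) < \<infinity>"
  shows "integrable \<nu> (\<lambda>r. mmul r r)
     \<and> (1 / (2 * \<mu>)) *\<^sub>R (\<integral> r. mmul r r \<partial>\<nu>) \<in> PiQ d
     \<and> (\<forall>n\<ge>1. Tmeas d ((1 / sqrt (real n)) *\<^sub>R mid) (convpow d \<mu> \<nu> n)
              = convpow d \<mu> (Tmeas d ((1 / sqrt (real n)) *\<^sub>R mid) \<nu>) n)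
     \<and> weak_conv_Pi d
         (\<lambda>n. Tmeas d ((1 / sqrt (real n)) *\<^sub>R mid) (convpow d \<mu> \<nu> n))
         (wishart_sq d \<mu> ((1 / (2 * \<mu>)) *\<^sub>R (\<integral> r. mmul r r \<partial>\<nu>)))"
proof -
  interpret wishart_setting d \<mu> "TYPE('q)"
    by unfold_locales (use assms in auto)
  have law: "cone_law \<nu>" using assms by (simp add: space_prob_algebra)
  interpret clt_setting d \<mu> "TYPE('q)" \<nu>
  proof
    have "(\<lambda>r. (norm r)\<^sup>2) \<in> borel_measurable \<nu>"
      by (intro measurable_cone_law[OF law] measurable_PiS) measurable
    then show "integrable \<nu> (\<lambda>r. (norm r)\<^sup>2)" using assms by (intro integrableI_nonneg) auto
  qed (rule law)
  have "Tmeas d ((1 / sqrt (real n)) *\<^sub>R mid) (convpow d \<mu> \<nu> n)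
      = convpow d \<mu> (Tmeas d ((1 / sqrt (real n)) *\<^sub>R mid) \<nu>) n" if "n \<ge> 1" for n
    using that by (intro Tmeas_convpow law) simp
  then show ?thesis
    using integrable_square covariance_PiQ central_limit unfolding covariance_def second_moment_def
    by blast
qed

end
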